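(* The CM point of discriminant $-11$ on $\mathcal{X}(1)$ has $t$-coordinate equal to $$\frac{7^3\, 43^2\, 127^2\, 139^2\, 307^2\, 659^2\, 11}{3^3\, 13^7\, 83^7},$$ and lies under the two points of $\mathcal{X}_0(3)$ with $$(x,y) = \left(-\frac{10099}{64},\ -\frac12 \pm \frac{109809\sqrt{-11}}{512}\right)$$ in the model $y^2 + y = x^3 + x^2 - 44704 x - 3655907$ of $\mathcal{X}_0(3)$.
   Context: Let $K=\mathbf{Q}(\cos 2\pi/7)$, with ring of integers $O_K=\mathbf{Z}[2\cos 2\pi/7]$. Let $A$ be the quaternion algebra over $K$ ramified at exactly two of the three real places of $K$ and at no other place, $\mathcal{O}\subset A$ a maximal order, and $\Gamma(1)$ the group of elements of $\mathcal{O}$ of reduced norm $1$, embedded in $\mathrm{SL}_2(\mathbf{R})$ via the unramified real place. Then $\Gamma(1)/\{\pm1\}$ is the $(2,3,7)$ triangle group, and the Shimura curve $\mathcal{X}(1)$ (the quotient of the upper half-plane $\mathcal{H}$ by $\Gamma(1)$) has genus $0$ with elliptic points of orders $2,3,7$. Let $t:\mathcal{X}(1)\to\mathbf{P}^1$ be the isomorphism taking the values $0,1,\infty$ at the elliptic points of orders $2,3,7$ respectively. The rational prime $3$ is inert in $K$, with residue field $\mathbf{F}_{27}$. Fix an isomorphism $\iota:\mathcal{O}/3\mathcal{O}\to M_2(\mathbf{F}_{27})$, let $\Gamma_0(3)$ be the group of $g\in\Gamma(1)$ with $\iota(g)$ upper triangular, and let $\mathcal{X}_0(3)=\mathcal{H}/\Gamma_0(3)$,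 with its natural degree-$28$ map to $\mathcal{X}(1)$. The curve $\mathcal{X}_0(3)$ and the pulled-back function $t$ on it are defined over $\mathbf{Q}$. The function $t-1$ on $\mathcal{X}_0(3)$ has a unique simple zero $P_0$. With origin $P_0$, $\mathcal{X}_0(3)$ is the elliptic curve $y^2+y=x^3+x^2-44704x-3655907$, on which $t=1-\frac{343F_9^3}{64F_4^7}$ with $$F_4 = x^2 - 1208 x - 227671 + 91 y,$$ $$F_9 = (8 x^3 - 384 x^2 - 13656232 x - 678909344) y - (1015 x^4 + 770584 x^3 + 163098512 x^2 + 29785004488 x + 2319185361392).$$ The CM point of discriminant $-11$ on $\mathcal{X}(1)$ is the point with complex multiplication by the order $O_K[(1+\sqrt{-11})/2]$ of $K(\sqrt{-11})$: it is the image in $\mathcal{X}(1)$ of the fixed point in $\mathcal{H}$ of $q(K(\sqrt{-11})^* )$ for a $K$-algebra embedding $q:K(\sqrt{-11})\to A$ with $q^{-1}(\mathcal{O})=O_K[(1+\sqrt{-11})/2]$. There is a unique such point on $\mathcal{X}(1)$, and so its $t$-coordinate is rational. *)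

theory Defs
  imports
    "HOL-Complex_Analysis.Complex_Analysis"
    "HOL-Algebra.Algebra"
    "HOL-Algebra.Algebraic_Closure_Type"
begin

section \<open>Generalities on rings\<close>

abbreviation real_ring :: "real ring" where
  "real_ring \<equiv> ring_of_type_algebra"

abbreviation complex_ring :: "complex ring" where
  "complex_ring \<equiv> ring_of_type_algebra"

text \<open>The quaternion algebra \<open>(a,b/R)\<close>: the quadruple \<open>(x0,x1,x2,x3)\<close> stands for
  \<open>x0 + x1 i + x2 j + x3 ij\<close>, where \<open>i^2 = a\<close>, \<open>j^2 = b\<close>, \<open>ji = -ij\<close>.\<close>

definition quat_mult :: "'a ring \<Rightarrow> 'a \<Rightarrow> 'a \<Rightarrow> 'a \<times> 'a \<times> 'a \<times> 'a \<Rightarrow> 'a \<times> 'a \<times> 'a \<times> 'a \<Rightarrow> 'a \<times> 'a \<times> 'a \<times> 'a"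
  where "quat_mult R a b = (\<lambda>(x0, x1, x2, x3) (y0, y1, y2, y3).
    ((x0 \<otimes>\<^bsub>R\<^esub> y0) \<oplus>\<^bsub>R\<^esub> (a \<otimes>\<^bsub>R\<^esub> (x1 \<otimes>\<^bsub>R\<^esub> y1)) \<oplus>\<^bsub>R\<^esub> (b \<otimes>\<^bsub>R\<^esub> (x2 \<otimes>\<^bsub>R\<^esub> y2))
       \<ominus>\<^bsub>R\<^esub> ((a \<otimes>\<^bsub>R\<^esub> b) \<otimes>\<^bsub>R\<^esub> (x3 \<otimes>\<^bsub>R\<^esub> y3)),
     (x0 \<otimes>\<^bsub>R\<^esub> y1) \<oplus>\<^bsub>R\<^esub> (x1 \<otimes>\<^bsub>R\<^esub> y0) \<oplus>\<^bsub>R\<^esub> (b \<otimes>\<^bsub>R\<^esub> ((x3 \<otimes>\<^bsub>R\<^esub> y2) \<ominus>\<^bsub>R\<^esub> (x2 \<otimes>\<^bsub>R\<^esub> y3))),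
     (x0 \<otimes>\<^bsub>R\<^esub> y2) \<oplus>\<^bsub>R\<^esub> (x2 \<otimes>\<^bsub>R\<^esub> y0) \<oplus>\<^bsub>R\<^esub> (a \<otimes>\<^bsub>R\<^esub> ((x1 \<otimes>\<^bsub>R\<^esub> y3) \<ominus>\<^bsub>R\<^esub> (x3 \<otimes>\<^bsub>R\<^esub> y1))),
     (x0 \<otimes>\<^bsub>R\<^esub> y3) \<oplus>\<^bsub>R\<^esub> (x3 \<otimes>\<^bsub>R\<^esub> y0) \<oplus>\<^bsub>R\<^esub> (x1 \<otimes>\<^bsub>R\<^esub> y2) \<ominus>\<^bsub>R\<^esub> (x2 \<otimes>\<^bsub>R\<^esub> y1)))"

definition quat_algebra :: "'a ring \<Rightarrow> 'a \<Rightarrow> 'a \<Rightarrow> ('a \<times> 'a \<times> 'a \<times> 'a) ring" where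
  "quat_algebra R a b =
    \<lparr>carrier = carrier R \<times> carrier R \<times> carrier R \<times> carrier R,
     monoid.mult = quat_mult R a b,
     one = (\<one>\<^bsub>R\<^esub>, \<zero>\<^bsub>R\<^esub>, \<zero>\<^bsub>R\<^esub>, \<zero>\<^bsub>R\<^esub>),
     ring.zero = (\<zero>\<^bsub>R\<^esub>, \<zero>\<^bsub>R\<^esub>, \<zero>\<^bsub>R\<^esub>, \<zero>\<^bsub>R\<^esub>),
     add = (\<lambda>(x0, x1, x2, x3) (y0, y1, y2, y3).
       (x0 \<oplus>\<^bsub>R\<^esub> y0, x1 \<oplus>\<^bsub>R\<^esub> y1, x2 \<oplus>\<^bsub>R\<^esub> y2, x3 \<oplus>\<^bsub>R\<^esub> y3))\<rparr>"

definition is_division_ring :: "'a ring \<Rightarrow> bool" where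
  "is_division_ring R \<longleftrightarrow> \<one>\<^bsub>R\<^esub> \<noteq> \<zero>\<^bsub>R\<^esub> \<and> carrier R - {\<zero>\<^bsub>R\<^esub>} \<subseteq> Units R"

text \<open>\<open>M_2(R)\<close>; the quadruple \<open>(p,q,r,s)\<close> is the matrix with rows \<open>(p,q)\<close> and \<open>(r,s)\<close>.\<close>

definition mat2_ring :: "'a ring \<Rightarrow> ('a \<times> 'a \<times> 'a \<times> 'a) ring" where
  "mat2_ring R =
    \<lparr>carrier = carrier R \<times> carrier R \<times> carrier R \<times> carrier R,
     monoid.mult = (\<lambda>(p, q, r, s) (p', q', r', s').
       ((p \<otimes>\<^bsub>R\<^esub> p') \<oplus>\<^bsub>R\<^esub> (q \<otimes>\<^bsub>R\<^esub> r'), (p \<otimes>\<^bsub>R\<^esub> q') \<oplus>\<^bsub>R\<^esub> (q \<otimes>\<^bsub>R\<^esub> s'),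
        (r \<otimes>\<^bsub>R\<^esub> p') \<oplus>\<^bsub>R\<^esub> (s \<otimes>\<^bsub>R\<^esub> r'), (r \<otimes>\<^bsub>R\<^esub> q') \<oplus>\<^bsub>R\<^esub> (s \<otimes>\<^bsub>R\<^esub> s'))),
     one = (\<one>\<^bsub>R\<^esub>, \<zero>\<^bsub>R\<^esub>, \<zero>\<^bsub>R\<^esub>, \<one>\<^bsub>R\<^esub>),
     ring.zero = (\<zero>\<^bsub>R\<^esub>, \<zero>\<^bsub>R\<^esub>, \<zero>\<^bsub>R\<^esub>, \<zero>\<^bsub>R\<^esub>),
     add = (\<lambda>(p, q, r, s) (p', q', r', s').
       (p \<oplus>\<^bsub>R\<^esub> p', q \<oplus>\<^bsub>R\<^esub> q', r \<oplus>\<^bsub>R\<^esub> r', s \<oplus>\<^bsub>R\<^esub> s'))\<rparr>"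

definition upper_triangular2 :: "'a ring \<Rightarrow> 'a \<times> 'a \<times> 'a \<times> 'a \<Rightarrow> bool" where
  "upper_triangular2 R = (\<lambda>(p, q, r, s). r = \<zero>\<^bsub>R\<^esub>)"


section \<open>The cubic field and its places\<close>

definition K7 :: "real set" where
  "K7 = generate_field real_ring {cos (2 * pi / 7)}"

definition OK7 :: "real set" where
  "OK7 = {x \<in> K7. algebraic_int x}"

abbreviation K7_ring :: "real ring" where
  "K7_ring \<equiv> real_ring\<lparr>carrier := K7\<rparr>"

abbreviation OK7_ring :: "real ring" where
  "OK7_ring \<equiv> real_ring\<lparr>carrier := OK7\<rparr>"

text \<open>The finite places of \<open>K\<close> are represented by the nontrivial non-archimedean absolute
  values; the values of \<open>v\<close> outside \<open>K\<close> are irrelevant.\<close>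

definition nonarch_abs_value :: "(real \<Rightarrow> real) \<Rightarrow> bool" where
  "nonarch_abs_value v \<longleftrightarrow>
     (\<forall>x\<in>K7. 0 \<le> v x \<and> (v x = 0 \<longleftrightarrow> x = 0)) \<and>
     (\<forall>x\<in>K7. \<forall>y\<in>K7. v (x * y) = v x * v y) \<and>
     (\<forall>x\<in>K7. \<forall>y\<in>K7. v (x + y) \<le> max (v x) (v y)) \<and>
     (\<exists>x\<in>K7. x \<noteq> 0 \<and> v x \<noteq> 1)"

definition v_Cauchy_ring :: "(real \<Rightarrow> real) \<Rightarrow> (nat \<Rightarrow> real) ring" where
  "v_Cauchy_ring v =
    \<lparr>carrier = {s. range s \<subseteq> K7 \<and> (\<forall>e>0. \<exists>N. \<forall>m\<ge>N. \<forall>n\<ge>N. v (s m - s n) < e)},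
     monoid.mult = (\<lambda>s s' n. s n * s' n),
     one = (\<lambda>n. 1),
     ring.zero = (\<lambda>n. 0),
     add = (\<lambda>s s' n. s n + s' n)\<rparr>"

definition v_null_seqs :: "(real \<Rightarrow> real) \<Rightarrow> (nat \<Rightarrow> real) set" where
  "v_null_seqs v = {s \<in> carrier (v_Cauchy_ring v). (\<lambda>n. v (s n)) \<longlonglongrightarrow> 0}"

definition K7_completion :: "(real \<Rightarrow> real) \<Rightarrow> (nat \<Rightarrow> real) set ring" where
  "K7_completion v = v_Cauchy_ring v Quot v_null_seqs v"

definition to_completion :: "(real \<Rightarrow> real) \<Rightarrow> real \<Rightarrow> (nat \<Rightarrow> real) set" where
  "to_completion v k = v_null_seqs v +>\<^bsub>v_Cauchy_ring v\<^esub> (\<lambda>n. k)"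

text \<open>\<open>(a,b/K)\<close> is ramified at a place if its base change \<open>(a,b/K_v)\<close> to the completion is
  a division algebra.\<close>

definition ramified_finite :: "real \<Rightarrow> real \<Rightarrow> (real \<Rightarrow> real) \<Rightarrow> bool" where
  "ramified_finite a b v \<longleftrightarrow>
     is_division_ring (quat_algebra (K7_completion v) (to_completion v a) (to_completion v b))"

definition ramified_real :: "real \<Rightarrow> real \<Rightarrow> (real \<Rightarrow> real) \<Rightarrow> bool" where
  "ramified_real a b \<tau> \<longleftrightarrow> is_division_ring (quat_algebra real_ring (\<tau> a) (\<tau> b))"

text \<open>\<open>(a,b/K)\<close> is unramified at the real place \<open>\<sigma>\<close> and at all finite places, and ramified at
  the other two real places. Real places are compared on \<open>K\<close> only.\<close>

definition ramified_exactly_off :: "real \<Rightarrow> real \<Rightarrow> (real \<Rightarrow> real) \<Rightarrow> bool" where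
  "ramified_exactly_off a b \<sigma> \<longleftrightarrow>
     \<sigma> \<in> ring_hom K7_ring real_ring \<and>
     (\<forall>\<tau> \<in> ring_hom K7_ring real_ring. ramified_real a b \<tau> \<longleftrightarrow> (\<exists>k\<in>K7. \<tau> k \<noteq> \<sigma> k)) \<and>
     (\<forall>v. nonarch_abs_value v \<longrightarrow> \<not> ramified_finite a b v)"


section \<open>Orders and arithmetic groups\<close>

abbreviation quat_alg_K7 :: "real \<Rightarrow> real \<Rightarrow> (real \<times> real \<times> real \<times> real) ring" where
  "quat_alg_K7 a b \<equiv> quat_algebra K7_ring a b"

definition quat_scalar :: "real \<Rightarrow> real \<times> real \<times> real \<times> real" where
  "quat_scalar k = (k, 0, 0, 0)"

definition reduced_norm :: "real \<Rightarrow> real \<Rightarrow> real \<times> real \<times> real \<times> real \<Rightarrow> real" where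
  "reduced_norm a b = (\<lambda>(x0, x1, x2, x3). x0^2 - a * x1^2 - b * x2^2 + a * b * x3^2)"

definition quat_span ::
  "real \<Rightarrow> real \<Rightarrow> real set \<Rightarrow> (real \<times> real \<times> real \<times> real) set \<Rightarrow> (real \<times> real \<times> real \<times> real) set" where
  "quat_span a b R S =
     {(\<Oplus>\<^bsub>quat_alg_K7 a b\<^esub>s\<in>S. quat_scalar (c s) \<otimes>\<^bsub>quat_alg_K7 a b\<^esub> s) |c. c \<in> S \<rightarrow> R}"

text \<open>An order is a subring that is a finitely generated \<open>O_K\<close>-module spanning the algebra over \<open>K\<close>.\<close>

definition is_order :: "real \<Rightarrow> real \<Rightarrow> (real \<times> real \<times> real \<times> real) set \<Rightarrow> bool" where
  "is_order a b \<O> \<longleftrightarrow> subring \<O> (quat_alg_K7 a b) \<and>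
     (\<exists>S. finite S \<and> S \<subseteq> carrier (quat_alg_K7 a b) \<and> \<O> = quat_span a b OK7 S \<and>
        carrier (quat_alg_K7 a b) = quat_span a b K7 S)"

definition is_maximal_order :: "real \<Rightarrow> real \<Rightarrow> (real \<times> real \<times> real \<times> real) set \<Rightarrow> bool" where
  "is_maximal_order a b \<O> \<longleftrightarrow> is_order a b \<O> \<and> (\<forall>\<O>'. is_order a b \<O>' \<and> \<O> \<subseteq> \<O>' \<longrightarrow> \<O>' = \<O>)"

definition Gamma1 ::
  "real \<Rightarrow> real \<Rightarrow> (real \<times> real \<times> real \<times> real) set \<Rightarrow> (real \<times> real \<times> real \<times> real) set" where
  "Gamma1 a b \<O> = {g \<in> \<O>. reduced_norm a b g = 1}"

definition F27 :: "real set ring" where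
  "F27 = OK7_ring Quot {3 * x |x. x \<in> OK7}"

definition three_ideal ::
  "(real \<times> real \<times> real \<times> real) set \<Rightarrow> (real \<times> real \<times> real \<times> real) set" where
  "three_ideal \<O> = {(3 * x0, 3 * x1, 3 * x2, 3 * x3) |x0 x1 x2 x3. (x0, x1, x2, x3) \<in> \<O>}"

abbreviation order_ring ::
  "real \<Rightarrow> real \<Rightarrow> (real \<times> real \<times> real \<times> real) set \<Rightarrow> (real \<times> real \<times> real \<times> real) ring" where
  "order_ring a b \<O> \<equiv> (quat_alg_K7 a b)\<lparr>carrier := \<O>\<rparr>"

definition Gamma0_3 ::
  "real \<Rightarrow> real \<Rightarrow> (real \<times> real \<times> real \<times> real) set \<Rightarrow>
   ((real \<times> real \<times> real \<times> real) set \<Rightarrow> real set \<times> real set \<times> real set \<times> real set) \<Rightarrow>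
   (real \<times> real \<times> real \<times> real) set" where
  "Gamma0_3 a b \<O> \<iota> =
     {g \<in> Gamma1 a b \<O>. upper_triangular2 F27 (\<iota> (three_ideal \<O> +>\<^bsub>order_ring a b \<O>\<^esub> g))}"

text \<open>A \<open>K\<close>-algebra homomorphism to \<open>M_2(\<real>)\<close>, where \<open>\<real>\<close> is a \<open>K\<close>-algebra by the real place \<open>\<sigma>\<close>.\<close>

definition real_splitting ::
  "real \<Rightarrow> real \<Rightarrow> (real \<Rightarrow> real) \<Rightarrow> (real \<times> real \<times> real \<times> real \<Rightarrow> real \<times> real \<times> real \<times> real) \<Rightarrow> bool" where
  "real_splitting a b \<sigma> \<rho> \<longleftrightarrow>
     \<rho> \<in> ring_hom (quat_alg_K7 a b) (mat2_ring real_ring) \<and>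
     (\<forall>k\<in>K7. \<rho> (quat_scalar k) = (\<sigma> k, 0, 0, \<sigma> k))"


section \<open>Quotients of the upper half-plane\<close>

definition upper_half_plane :: "complex set" where
  "upper_half_plane = {z. Im z > 0}"

definition moebius :: "real \<times> real \<times> real \<times> real \<Rightarrow> complex \<Rightarrow> complex" where
  "moebius = (\<lambda>(p, q, r, s) z. (of_real p * z + of_real q) / (of_real r * z + of_real s))"

definition orbit_of :: "(real \<times> real \<times> real \<times> real) set \<Rightarrow> complex \<Rightarrow> complex set" where
  "orbit_of G z = {moebius g z |g. g \<in> G}"

definition quotient_curve :: "(real \<times> real \<times> real \<times> real) set \<Rightarrow> complex set set" where
  "quotient_curve G = orbit_of G ` upper_half_plane"

text \<open>The natural projection from the quotient by a subgroup of \<open>G\<close> to the quotient by \<open>G\<close>.\<close>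

definition curve_proj :: "(real \<times> real \<times> real \<times> real) set \<Rightarrow> complex set \<Rightarrow> complex set" where
  "curve_proj G p = (\<Union>z\<in>p. orbit_of G z)"

text \<open>Order of the stabilizer of \<open>z\<close> in the image of \<open>G\<close> in \<open>PSL_2(\<real>)\<close>. Elements of \<open>G\<close> with the
  same image induce the same function \<^const>\<open>moebius\<close>.\<close>

definition stabilizer_order :: "(real \<times> real \<times> real \<times> real) set \<Rightarrow> complex \<Rightarrow> nat" where
  "stabilizer_order G z = card {moebius g |g. g \<in> G \<and> moebius g z = z}"

datatype P1 = P1_fin complex | P1_inf

fun P1_value :: "P1 \<Rightarrow> complex" where
  "P1_value (P1_fin w) = w"
| "P1_value P1_inf = 0"

text \<open>Holomorphic maps from the upper half-plane to \<open>P^1\<close>, other than the constant \<open>\<infinity>\<close>.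
  The value 0 at poles is the normalization built into \<^const>\<open>nicely_meromorphic_on\<close>.\<close>

definition P1_holomorphic :: "(complex \<Rightarrow> P1) \<Rightarrow> bool" where
  "P1_holomorphic F \<longleftrightarrow>
     (\<lambda>z. P1_value (F z)) nicely_meromorphic_on upper_half_plane \<and>
     (\<forall>z\<in>upper_half_plane. F z = P1_inf \<longleftrightarrow> is_pole (\<lambda>w. P1_value (F w)) z)"

text \<open>A bijection from the quotient to \<open>P^1\<close> whose pullback to the upper half-plane is holomorphic
  (the complex structure of the quotient is the quotient structure, and a bijective holomorphic map
  of Riemann surfaces is an isomorphism).\<close>

definition iso_to_P1 :: "(real \<times> real \<times> real \<times> real) set \<Rightarrow> (complex set \<Rightarrow> P1) \<Rightarrow> bool" where
  "iso_to_P1 G t \<longleftrightarrow> bij_betw t (quotient_curve G) UNIV \<and> P1_holomorphic (\<lambda>z. t (orbit_of G z))"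

definition elliptic_normalized :: "(real \<times> real \<times> real \<times> real) set \<Rightarrow> (complex set \<Rightarrow> P1) \<Rightarrow> bool" where
  "elliptic_normalized G t \<longleftrightarrow> (\<forall>z\<in>upper_half_plane.
     (stabilizer_order G z = 2 \<longrightarrow> t (orbit_of G z) = P1_fin 0) \<and>
     (stabilizer_order G z = 3 \<longrightarrow> t (orbit_of G z) = P1_fin 1) \<and>
     (stabilizer_order G z = 7 \<longrightarrow> t (orbit_of G z) = P1_inf))"

text \<open>For a \<open>G\<close>-invariant function \<open>f\<close> and a point \<open>z\<close> with stabilizer of order \<open>e\<close>, a local
  coordinate of the quotient pulls back to a function with a zero of order \<open>e\<close> at \<open>z\<close>, so the order
  of \<open>f\<close> on the quotient is \<open>zorder f z / e\<close>.\<close>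

definition simple_zero_on_quotient ::
  "(real \<times> real \<times> real \<times> real) set \<Rightarrow> (complex \<Rightarrow> complex) \<Rightarrow> complex \<Rightarrow> bool" where
  "simple_zero_on_quotient G f z \<longleftrightarrow> zorder f z = int (stabilizer_order G z)"


section \<open>The elliptic curve\<close>

datatype E_point = E_origin | E_affine complex complex

definition E_curve :: "E_point set" where
  "E_curve = insert E_origin
     {E_affine x y |x y. y^2 + y = x^3 + x^2 - 44704 * x - 3655907}"

fun E_x :: "E_point \<Rightarrow> P1" where
  "E_x E_origin = P1_inf"
| "E_x (E_affine x y) = P1_fin x"

fun E_y :: "E_point \<Rightarrow> P1" where
  "E_y E_origin = P1_inf"
| "E_y (E_affine x y) = P1_fin y"

text \<open>A map to the (smooth) curve is holomorphic iff its two coordinate functions are.\<close>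

definition iso_to_E :: "(real \<times> real \<times> real \<times> real) set \<Rightarrow> (complex set \<Rightarrow> E_point) \<Rightarrow> bool" where
  "iso_to_E G \<phi> \<longleftrightarrow> bij_betw \<phi> (quotient_curve G) E_curve \<and>
     P1_holomorphic (\<lambda>z. E_x (\<phi> (orbit_of G z))) \<and>
     P1_holomorphic (\<lambda>z. E_y (\<phi> (orbit_of G z)))"

definition F4 :: "complex \<Rightarrow> complex \<Rightarrow> complex" where
  "F4 x y = x^2 - 1208 * x - 227671 + 91 * y"

definition F9 :: "complex \<Rightarrow> complex \<Rightarrow> complex" where
  "F9 x y = (8 * x^3 - 384 * x^2 - 13656232 * x - 678909344) * y
     - (1015 * x^4 + 770584 * x^3 + 163098512 * x^2 + 29785004488 * x + 2319185361392)"

text \<open>The isomorphism of \<open>X_0(3)\<close> (the quotient by \<open>G0\<close>) with the elliptic curve: the origin is the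
  simple zero of \<open>t - 1\<close>, and \<open>t\<close> is the given rational function of \<open>x, y\<close>. That
  equality is required where the denominator does not vanish, which determines \<open>t\<close> everywhere.\<close>

definition X0_3_model ::
  "(real \<times> real \<times> real \<times> real) set \<Rightarrow> (real \<times> real \<times> real \<times> real) set \<Rightarrow>
   (complex set \<Rightarrow> P1) \<Rightarrow> (complex set \<Rightarrow> E_point) \<Rightarrow> bool" where
  "X0_3_model G1 G0 t \<phi> \<longleftrightarrow> iso_to_E G0 \<phi> \<and>
     (\<forall>z\<in>upper_half_plane. \<phi> (orbit_of G0 z) = E_origin \<longleftrightarrow>
        simple_zero_on_quotient G0 (\<lambda>w. P1_value (t (curve_proj G1 (orbit_of G0 w))) - 1) z) \<and>
     (\<forall>p\<in>quotient_curve G0. \<forall>x y. \<phi> p = E_affine x y \<and> F4 x y \<noteq> 0 \<longrightarrow>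
        t (curve_proj G1 p) = P1_fin (1 - 343 * F9 x y ^ 3 / (64 * F4 x y ^ 7)))"


section \<open>The CM point of discriminant \<open>-11\<close>\<close>

definition sqrt_m11 :: complex where
  "sqrt_m11 = \<i> * of_real (sqrt 11)"

definition K7_sqrt_m11 :: "complex set" where
  "K7_sqrt_m11 = generate_field complex_ring (of_real ` K7 \<union> {sqrt_m11})"

definition OK7_m11 :: "complex set" where
  "OK7_m11 = generate_ring complex_ring (of_real ` OK7 \<union> {(1 + sqrt_m11) / 2})"

definition CM_embedding_m11 ::
  "real \<Rightarrow> real \<Rightarrow> (real \<times> real \<times> real \<times> real) set \<Rightarrow>
   (complex \<Rightarrow> real \<times> real \<times> real \<times> real) \<Rightarrow> bool" where
  "CM_embedding_m11 a b \<O> q \<longleftrightarrow>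
     q \<in> ring_hom (complex_ring\<lparr>carrier := K7_sqrt_m11\<rparr>) (quat_alg_K7 a b) \<and>
     (\<forall>k\<in>K7. q (of_real k) = quat_scalar k) \<and>
     {u \<in> K7_sqrt_m11. q u \<in> \<O>} = OK7_m11"

definition is_CM_point_m11 ::
  "real \<Rightarrow> real \<Rightarrow> (real \<times> real \<times> real \<times> real) set \<Rightarrow>
   (real \<times> real \<times> real \<times> real \<Rightarrow> real \<times> real \<times> real \<times> real) \<Rightarrow> complex set \<Rightarrow> bool" where
  "is_CM_point_m11 a b \<O> \<rho> P \<longleftrightarrow> (\<exists>q. \<exists>z\<in>upper_half_plane. CM_embedding_m11 a b \<O> q \<and>
     (\<forall>u\<in>K7_sqrt_m11 - {0}. moebius (\<rho> (q u)) z = z) \<and>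
     P = orbit_of (\<rho> ` Gamma1 a b \<O>) z)"

end

(*
  Proof idea.  At a zero of F9 the function t - 1 is a cube times a unit, so the stabilizer of the
  origin in Gamma_0(3) has order divisible by 3.  An element h of order 3 gives beta = 2h + 1 with
  beta^2 = -3, which normalizes Gamma_0(3) and hence acts on the elliptic curve by an automorphism
  fixing the origin; by Liouville's theorem, applied to functions with bounded pole order, it is
  +1 or -1.

  Let alpha of norm 3 generate the CM order and fix z.  The nine zeros of F9, translated by the
  powers of h, meet all cosets of Gamma_0(3) but one, so beta g = d alpha for some g, d in Gamma(1).
  Hence t(alpha w) = t(beta g w) for all w, and at w = z the point Q = [g z] satisfies t(Q) = t(wQ),
  where w is the automorphism.  As z has trivial stabilizer, t is unramified there (a deck
  transformation would agree with an element of the countable group Gamma(1)); this excludes w = 1.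
  So t(Q) = t(-Q), and comparing derivatives at z gives a second equation, with the multiplier
  3/lambda^2 of alpha at its fixed point, lambda^2 - lambda + 3 = 0.  The two equations determine Q.
*)

theory Submission
  imports Defs "HOL-Number_Theory.Cong" "Jordan_Normal_Form.Char_Poly"
begin

section \<open>Algebraic integers\<close>

text \<open>Strong approximation, fundamental domains and discreteness are avoided: the cosets of
  \<open>\<Gamma>0\<close> are exhibited on the curve itself (28 = 1 + 3 * 9), and countability of
  the groups takes the place of discreteness.

  That two equations determine Q reflects 1 - 1/2 - 1/3 - 1/7 = 1/42. Let a, b, c be the ratios of
  the values at -Q and at Q of \<open>F4\<close>, \<open>F9\<close> and \<open>G14\<close>, where
  \<open>G14\<close> is a square root of 64 F4^7 - 343 F9^3 on the curve. Then t(Q) = t(-Q) means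
  b^3 = a^7, and c^2 = a^7 follows; this curve is parametrized by (s^6, s^14, s^21). The invariant
  derivation sends t to a constant times F9^2 G14 / F4^8, and the ratio of this expression at -Q and
  Q is s^(28 + 21 - 48) = s. So s is, up to sign, the multiplier of \<alpha> at z, a known number of
  Q(sqrt(-11)). The relations for \<open>F4\<close> and \<open>F9\<close> then become linear in 2y +
  1 with explicit coefficients, and eliminating 2y + 1 leaves two polynomials in x whose gcd is
  linear.\<close>

text \<open>The determinant trick: an eigenvalue of an integer matrix is a root of its characteristic
  polynomial.\<close>

lemma int_matrix_eigenvalue_algebraic_int:
  fixes w :: "'i \<Rightarrow> complex" and A :: "'i \<Rightarrow> 'i \<Rightarrow> int"
  assumes "finite I" "i0 \<in> I" "w i0 \<noteq> 0"
    and ev: "\<And>i. i \<in> I \<Longrightarrow> x * w i = (\<Sum>j\<in>I. of_int (A i j) * w j)"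
  shows "algebraic_int x"
proof -
  define n where "n = card I"
  obtain e where e: "bij_betw e {0..<n} I"
    using ex_bij_betw_nat_finite[OF \<open>finite I\<close>] n_def by blast
  define B where "B = Matrix.mat n n (\<lambda>(i, j). A (e i) (e j))"
  define v where "v = Matrix.vec n (\<lambda>i. w (e i))"
  define C where "C = map_mat (of_int :: int \<Rightarrow> complex) B"
  have B: "B \<in> carrier_mat n n" and C: "C \<in> carrier_mat n n"
    by (simp_all add: B_def C_def)
  have "C *\<^sub>v v = x \<cdot>\<^sub>v v"
  proof (rule Matrix.eq_vecI)
    fix i assume "i < dim_vec (x \<cdot>\<^sub>v v)"
    hence i: "i < n" by (simp add: v_def)
    hence "e i \<in> I" using e by (auto simp: bij_betw_def)
    have "Matrix.vec_index (C *\<^sub>v v) i = (\<Sum>j = 0..<n. of_int (A (e i) (e j)) * w (e j))"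
      using i by (simp add: C_def B_def v_def scalar_prod_def)
    also have "\<dots> = (\<Sum>j\<in>I. of_int (A (e i) j) * w j)"
      using sum.reindex_bij_betw[OF e, of "\<lambda>j. of_int (A (e i) j) * w j"] by simp
    also have "\<dots> = x * w (e i)" using ev[OF \<open>e i \<in> I\<close>] by simp
    finally show "Matrix.vec_index (C *\<^sub>v v) i = Matrix.vec_index (x \<cdot>\<^sub>v v) i" using i by (simp add: v_def)
  qed (simp_all add: C_def B_def v_def)
  moreover have "v \<noteq> 0\<^sub>v n"
  proof
    assume v0: "v = 0\<^sub>v n"
    obtain i where "i < n" "e i = i0"
      using e \<open>i0 \<in> I\<close> unfolding bij_betw_def by (metis atLeastLessThan_iff imageE)
    thus False using v0 \<open>w i0 \<noteq> 0\<close> by (metis v_def index_vec index_zero_vec(1))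
  qed
  ultimately have "eigenvalue C x"
    unfolding eigenvalue_def eigenvector_def using C
    by (intro exI[of _ v]) (auto simp: v_def)
  hence "poly (char_poly C) x = 0"
    using eigenvalue_root_char_poly[OF C] by simp
  moreover have "char_poly C = of_int_poly (char_poly B)"
    unfolding C_def by (rule of_int_hom.char_poly_hom[OF B])
  ultimately have "poly (of_int_poly (char_poly B)) x = 0" by simp
  moreover have "Polynomial.lead_coeff (char_poly B) = 1"
    using degree_monic_char_poly[OF B] by simp
  ultimately show ?thesis
    unfolding algebraic_int_altdef_ipoly by blast
qed

definition int_span :: "'i set \<Rightarrow> ('i \<Rightarrow> complex) \<Rightarrow> complex set" where
  "int_span I w = range (\<lambda>c. \<Sum>i\<in>I. of_int (c i :: int) * w i)"

lemma int_spanI: "x = (\<Sum>i\<in>I. of_int (c i) * w i) \<Longrightarrow> x \<in> int_span I w"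
  by (auto simp: int_span_def)

lemma int_span_add: "x \<in> int_span I w \<Longrightarrow> y \<in> int_span I w \<Longrightarrow> x + y \<in> int_span I w"
  unfolding int_span_def
  by (auto simp: sum.distrib[symmetric] ring_distribs(2)[symmetric] simp flip: of_int_add)

lemma int_span_mult: "x \<in> int_span I w \<Longrightarrow> of_int k * x \<in> int_span I w"
  unfolding int_span_def
  by (auto simp: sum_distrib_left mult.assoc[symmetric] simp flip: of_int_mult)

lemma int_span_0: "0 \<in> int_span I w"
  by (rule int_spanI[where c = "\<lambda>_. 0"]) simp

lemma int_span_sum: "(\<And>j. j \<in> J \<Longrightarrow> f j \<in> int_span I w) \<Longrightarrow> sum f J \<in> int_span I w"
  by (induction J rule: infinite_finite_induct) (auto simp: int_span_0 int_span_add)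

lemma int_span_base:
  assumes "finite I" "i \<in> I" shows "w i \<in> int_span I w"
proof (rule int_spanI[where c = "\<lambda>j. if j = i then 1 else 0"])
  have "(\<Sum>j\<in>I. of_int (if j = i then 1 else 0) * w j) = (\<Sum>j\<in>I. if j = i then w j else 0)"
    by (intro sum.cong) auto
  thus "w i = (\<Sum>j\<in>I. of_int (if j = i then 1 else 0) * w j)"
    using assms by simp
qed

lemma int_span_mono:
  assumes "\<And>i. i \<in> I \<Longrightarrow> x * w i \<in> int_span I w" "y \<in> int_span I w"
  shows "x * y \<in> int_span I w"
proof -
  obtain c where y: "y = (\<Sum>i\<in>I. of_int (c i) * w i)" using assms(2) by (auto simp: int_span_def)
  have "x * y = (\<Sum>i\<in>I. of_int (c i) * (x * w i))" by (simp add: y sum_distrib_left mult_ac)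
  thus ?thesis using assms(1) by (auto intro!: int_span_sum int_span_mult)
qed

lemma int_span_stable_algebraic_int:
  assumes "finite I" "i0 \<in> I" "w i0 \<noteq> 0" "\<And>i. i \<in> I \<Longrightarrow> x * w i \<in> int_span I w"
  shows "algebraic_int x"
proof -
  have "\<exists>c. x * w i = (\<Sum>j\<in>I. of_int (c j :: int) * w j)" if "i \<in> I" for i
    using assms(4)[OF that] by (auto simp: int_span_def)
  then obtain A where "\<And>i. i \<in> I \<Longrightarrow> x * w i = (\<Sum>j\<in>I. of_int (A i j :: int) * w j)" by metis
  thus ?thesis
    using int_matrix_eigenvalue_algebraic_int[where I = I and w = w and A = A] assms(1-3) by blast
qed

lemma algebraic_int_power_relation:
  assumes "algebraic_int (x :: complex)"
  obtains n c where "n > 0" "x ^ n = (\<Sum>k<n. of_int (c k :: int) * x ^ k)"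
proof -
  obtain p :: "int poly" where p: "poly (of_int_poly p) x = 0" "Polynomial.lead_coeff p = 1"
    using assms unfolding algebraic_int_altdef_ipoly by blast
  define n where "n = Polynomial.degree p"
  have deg: "Polynomial.degree (of_int_poly p :: complex poly) = n"
    by (simp add: n_def)
  have "n > 0"
  proof (rule ccontr)
    assume "\<not> n > 0"
    hence "p = [:1:]" using p(2) unfolding n_def
      by (metis degree_eq_zeroE gr0I lead_coeff_pCons(2) pCons_0_0 one_neq_zero Polynomial.leading_coeff_0_iff Polynomial.coeff_pCons_0)
    thus False using p(1) by simp
  qed
  have "0 = (\<Sum>k\<le>n. of_int (Polynomial.coeff p k) * x ^ k)"
    using p(1) unfolding poly_altdef deg by simp
  also have "\<dots> = (\<Sum>k<n. of_int (Polynomial.coeff p k) * x ^ k) + x ^ n"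
    using p(2) by (simp add: n_def lessThan_Suc_atMost[symmetric])
  finally have "- (\<Sum>k<n. of_int (Polynomial.coeff p k) * x ^ k) = x ^ n"
    by (intro minus_unique) simp
  hence "x ^ n = (\<Sum>k<n. of_int (- Polynomial.coeff p k) * x ^ k)"
    by (simp only: of_int_minus mult_minus_left sum_negf)
  thus ?thesis by (rule that[OF \<open>n > 0\<close>])
qed

text \<open>The monomials x^i y^j with i < m and j < n span a finitely generated group that contains
  1 and is stable under multiplication by x and by y, hence also by x + y and by x y.\<close>

lemma complex_algebraic_int_add_mult:
  assumes "algebraic_int (x :: complex)" "algebraic_int y"
  shows "algebraic_int (x + y)" "algebraic_int (x * y)"
proof -
  obtain m c where m: "m > 0" "x ^ m = (\<Sum>k<m. of_int (c k :: int) * x ^ k)"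
    using algebraic_int_power_relation[OF assms(1)] .
  obtain n d where n: "n > 0" "y ^ n = (\<Sum>k<n. of_int (d k :: int) * y ^ k)"
    using algebraic_int_power_relation[OF assms(2)] .
  define I where "I = {..<m} \<times> {..<n}"
  define w where "w = (\<lambda>(i, j). x ^ i * y ^ j)"
  have fin: "finite I" by (simp add: I_def)
  have base: "x ^ i * y ^ j \<in> int_span I w" if "i < m" "j < n" for i j
    using int_span_base[OF fin, of "(i, j)" w] that by (simp add: I_def w_def)
  have X: "x * w ij \<in> int_span I w" if ij_in: "ij \<in> I" for ij
  proof -
    obtain i j where ij: "ij = (i, j)" "i < m" "j < n" using ij_in by (auto simp: I_def)
    show ?thesis
    proof (cases "Suc i < m")
      case True
      thus ?thesis using base[of "Suc i" j] ij by (simp add: w_def mult.assoc)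
    next
      case False
      hence "Suc i = m" using ij by simp
      have "x * w ij = x ^ Suc i * y ^ j" using ij by (simp add: w_def mult.assoc)
      also have "\<dots> = (\<Sum>k<m. of_int (c k) * (x ^ k * y ^ j))"
        unfolding \<open>Suc i = m\<close> m(2) by (simp add: sum_distrib_right mult.assoc)
      finally show ?thesis using ij base by (auto intro!: int_span_sum int_span_mult)
    qed
  qed
  have Y: "y * w ij \<in> int_span I w" if ij_in: "ij \<in> I" for ij
  proof -
    obtain i j where ij: "ij = (i, j)" "i < m" "j < n" using ij_in by (auto simp: I_def)
    show ?thesis
    proof (cases "Suc j < n")
      case True
      thus ?thesis using base[of i "Suc j"] ij by (simp add: w_def mult_ac)
    next
      case False
      hence "Suc j = n" using ij by simp
      have "y * w ij = x ^ i * y ^ Suc j" using ij by (simp add: w_def mult_ac)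
      also have "\<dots> = (\<Sum>k<n. of_int (d k) * (x ^ i * y ^ k))"
        unfolding \<open>Suc j = n\<close> n(2) by (simp add: sum_distrib_left mult_ac)
      finally show ?thesis using ij base by (auto intro!: int_span_sum int_span_mult)
    qed
  qed
  have I0: "(0, 0) \<in> I" "w (0, 0) \<noteq> 0" using m n by (simp_all add: I_def w_def)
  show "algebraic_int (x + y)"
    by (rule int_span_stable_algebraic_int[where I = I and w = w, OF fin I0])
       (use X Y in \<open>auto simp: ring_distribs intro!: int_span_add\<close>)
  show "algebraic_int (x * y)"
    by (rule int_span_stable_algebraic_int[where I = I and w = w, OF fin I0])
       (use int_span_mono[OF X Y] in \<open>auto simp: mult.assoc\<close>)
qed

lemma real_algebraic_int_add_mult:
  assumes "algebraic_int (x :: real)" "algebraic_int y"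
  shows "algebraic_int (x + y)" "algebraic_int (x * y)"
  using complex_algebraic_int_add_mult[of "of_real x" "of_real y"] assms
  by (simp_all flip: of_real_add of_real_mult)


section \<open>The cubic field\<close>

definition eta :: real where "eta = 2 * cos (2 * pi / 7)"

text \<open>With \<theta> = 2\<pi>/7 the identity cos 4\<theta> = cos 3\<theta> is a quartic
  equation in c = cos \<theta>. Its factor c - 1 belongs to \<theta> = 0 and is cancelled.\<close>

lemma eta_cubic: "eta^3 = 1 + 2 * eta - eta^2"
proof -
  define c where "c = cos (2 * pi / 7)"
  define th where "th = 2 * pi / 7"
  have "cos (2 * (2 * th)) = cos (2 * pi - 3 * th)"
    by (rule arg_cong[of _ _ cos]) (simp add: th_def field_simps)
  also have "\<dots> = cos (3 * th)" by (rule cos_2pi_minus)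
  finally have "2 * (2 * c^2 - 1)^2 - 1 = 4 * c^3 - 3 * c"
    unfolding cos_double_cos cos_treble_cos c_def th_def .
  hence "(c - 1) * (8 * c^3 + 4 * c^2 - 4 * c - 1) = 0" by Groebner_Basis.algebra
  moreover have "c < 1"
    using cos_monotone_0_pi[of 0 "2 * pi / 7"] by (simp add: c_def)
  ultimately have "8 * c^3 + 4 * c^2 - 4 * c - 1 = 0" by simp
  thus ?thesis unfolding eta_def c_def[symmetric] by (simp add: power_mult_distrib)
qed

text \<open>The norm form of \<open>\<int>[eta]\<close> and the cofactor giving the inverse.\<close>

definition cubic_norm :: "'a::comm_ring_1 \<Rightarrow> 'a \<Rightarrow> 'a \<Rightarrow> 'a" where
  "cubic_norm p q r = p * ((p + 2 * r) * (p - q + 3 * r) - (q - r) * (2 * q - r))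
     - r * (q * (p - q + 3 * r) - r * (2 * q - r)) + (q - r) * (q * (q - r) - r * (p + 2 * r))"

lemma cubic_norm_cofactor:
  fixes p q r x :: real
  assumes "x^3 = 1 + 2 * x - x^2"
  shows "(p + q * x + r * x^2) * (((p + 2 * r) * (p - q + 3 * r) - (q - r) * (2 * q - r))
     + (r * (2 * q - r) - q * (p - q + 3 * r)) * x + (q * (q - r) - r * (p + 2 * r)) * x^2)
     = cubic_norm p q r"
  using assms unfolding cubic_norm_def by Groebner_Basis.algebra

text \<open>This is the inertness of 3: the minimal polynomial of \<open>eta\<close> has no root
  modulo 3. The 27 residue triples are simply enumerated.\<close>

lemma cubic_norm_mod3:
  fixes a b c :: int
  assumes "3 dvd cubic_norm a b c" shows "3 dvd a" "3 dvd b" "3 dvd c"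
proof -
  have "[cubic_norm a b c = cubic_norm (a mod 3) (b mod 3) (c mod 3)] (mod 3)"
    unfolding cubic_norm_def
    by (intro cong_add cong_mult cong_diff cong_refl) (auto simp: cong_def)
  hence *: "cubic_norm a b c mod 3 = cubic_norm (a mod 3) (b mod 3) (c mod 3) mod 3"
    by (simp add: cong_def)
  have "a mod 3 \<in> {0, 1, 2}" "b mod 3 \<in> {0, 1, 2}" "c mod 3 \<in> {0, 1, 2}" by auto
  moreover have "\<forall>x\<in>{0, 1, 2}. \<forall>y\<in>{0, 1, 2}. \<forall>z\<in>{0, 1, 2::int}.
      cubic_norm x y z mod 3 = 0 \<longrightarrow> x = 0 \<and> y = 0 \<and> z = 0"
    by (simp add: cubic_norm_def)
  ultimately have "a mod 3 = 0 \<and> b mod 3 = 0 \<and> c mod 3 = 0"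
    using assms * unfolding dvd_eq_mod_eq_0 by metis
  thus "3 dvd a" "3 dvd b" "3 dvd c" by auto
qed

lemma cubic_norm_scale: "cubic_norm (k * p) (k * q) (k * r) = k^3 * cubic_norm p q r"
  for k p q r :: "'a::comm_ring_1"
  by (simp add: cubic_norm_def algebra_simps power3_eq_cube)

text \<open>Infinite descent at the inert prime 3. Linear independence of 1, \<open>eta\<close>,
  \<open>eta^2\<close> over the rationals will be a consequence.\<close>

lemma cubic_norm_int_eq_0:
  fixes a b c :: int
  assumes "cubic_norm a b c = 0" shows "a = 0 \<and> b = 0 \<and> c = 0"
  using assms
proof (induction "nat (\<bar>a\<bar> + \<bar>b\<bar> + \<bar>c\<bar>)" arbitrary: a b c rule: less_induct)
  case less
  have "3 dvd a" "3 dvd b" "3 dvd c" using cubic_norm_mod3[of a b c] less.prems by auto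
  then obtain a' b' c' where abc: "a = 3 * a'" "b = 3 * b'" "c = 3 * c'" by (auto elim!: dvdE)
  show ?case
  proof (rule ccontr)
    assume "\<not> (a = 0 \<and> b = 0 \<and> c = 0)"
    hence "nat (\<bar>a'\<bar> + \<bar>b'\<bar> + \<bar>c'\<bar>) < nat (\<bar>a\<bar> + \<bar>b\<bar> + \<bar>c\<bar>)" using abc by auto
    moreover have "cubic_norm a' b' c' = 0"
      using less.prems unfolding abc cubic_norm_scale by simp
    ultimately have "a' = 0 \<and> b' = 0 \<and> c' = 0" using less.hyps by blast
    thus False using abc \<open>\<not> _\<close> by simp
  qed
qed

lemma common_denominator3:
  assumes "p \<in> \<rat>" "q \<in> \<rat>" "r \<in> (\<rat> :: real set)"
  obtains d a b c :: int where "d > 0" "p = of_int a / of_int d" "q = of_int b / of_int d" "r = of_int c / of_int d"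
proof -
  obtain a1 d1 where 1: "d1 > 0" "p = of_int a1 / of_int d1" using assms(1) by (meson Rats_cases')
  obtain a2 d2 where 2: "d2 > 0" "q = of_int a2 / of_int d2" using assms(2) by (meson Rats_cases')
  obtain a3 d3 where 3: "d3 > 0" "r = of_int a3 / of_int d3" using assms(3) by (meson Rats_cases')
  show ?thesis
    by (rule that[of "d1 * d2 * d3" "a1 * d2 * d3" "a2 * d1 * d3" "a3 * d1 * d2"])
       (use 1 2 3 in \<open>auto simp: field_simps\<close>)
qed

lemma cubic_norm_rat_eq_0:
  assumes "p \<in> \<rat>" "q \<in> \<rat>" "r \<in> (\<rat> :: real set)" "cubic_norm p q r = 0"
  shows "p = 0 \<and> q = 0 \<and> r = 0"
proof -
  obtain d a b c :: int where d: "d > 0" "p = of_int a / of_int d" "q = of_int b / of_int d" "r = of_int c / of_int d"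
    using common_denominator3[OF assms(1-3)] .
  have "of_int d ^ 3 * cubic_norm p q r = cubic_norm (of_int d * p) (of_int d * q) (of_int d * r)"
    by (simp add: cubic_norm_scale)
  also have "\<dots> = cubic_norm (of_int a) (of_int b) (of_int c)" using d by simp
  also have "\<dots> = of_int (cubic_norm a b c)" by (simp add: cubic_norm_def)
  finally have "cubic_norm a b c = 0" using assms(4) by simp
  hence "a = 0 \<and> b = 0 \<and> c = 0" by (rule cubic_norm_int_eq_0)
  thus ?thesis using d by simp
qed


section \<open>Elements of the cubic field in the basis 1, \<open>eta\<close>,
  \<open>eta^2\<close>\<close>

lemma ring_of_type_algebra_simps [simp]:
  "carrier ring_of_type_algebra = UNIV" "x \<otimes>\<^bsub>ring_of_type_algebra\<^esub> y = x * y"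
  "\<one>\<^bsub>ring_of_type_algebra\<^esub> = 1" "\<zero>\<^bsub>ring_of_type_algebra\<^esub> = 0"
  "x \<oplus>\<^bsub>ring_of_type_algebra\<^esub> y = x + y"
  by (simp_all add: ring_of_type_algebra_def)

lemma a_inv_ring_of_type_algebra [simp]:
  "a_inv ring_of_type_algebra (x :: 'a::comm_ring_1) = - x"
proof -
  interpret ring "ring_of_type_algebra :: 'a ring" by (rule ring_from_type_algebra)
  show ?thesis by (rule minus_equality) simp_all
qed

lemma m_inv_ring_of_type_algebra [simp]:
  assumes "(x :: 'a::Fields.field) \<noteq> 0"
  shows "m_inv ring_of_type_algebra x = inverse x"
proof -
  interpret cring "ring_of_type_algebra :: 'a ring" by (rule cring_from_type_algebra)
  show ?thesis by (rule comm_inv_char) (use assms in simp_all)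
qed

text \<open>The argument \<open>x\<close> stays free so that the same coordinates can be evaluated
  at every conjugate of \<open>eta\<close>.\<close>

definition trip :: "real \<Rightarrow> real \<Rightarrow> real \<Rightarrow> real \<Rightarrow> real" where
  "trip p q r x = p + q * x + r * x^2"

lemma K7_1: "1 \<in> K7"
  using generate_field.one[of real_ring] by (simp add: K7_def)

lemma K7_add: "x \<in> K7 \<Longrightarrow> y \<in> K7 \<Longrightarrow> x + y \<in> K7"
  using generate_field.eng_add[of x real_ring _ y] by (simp add: K7_def)

lemma K7_mult: "x \<in> K7 \<Longrightarrow> y \<in> K7 \<Longrightarrow> x * y \<in> K7"
  using generate_field.eng_mult[of x real_ring _ y] by (simp add: K7_def)

lemma K7_uminus: "x \<in> K7 \<Longrightarrow> - x \<in> K7"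
  using generate_field.a_inv[of x real_ring] by (simp add: K7_def)

lemma K7_diff: "x \<in> K7 \<Longrightarrow> y \<in> K7 \<Longrightarrow> x - y \<in> K7"
  using K7_add[of x "- y"] K7_uminus by simp

lemma K7_0: "0 \<in> K7"
  using K7_diff[OF K7_1 K7_1] by simp

lemma K7_inverse: "x \<in> K7 \<Longrightarrow> inverse x \<in> K7"
  using generate_field.m_inv[of x real_ring] K7_0 by (cases "x = 0") (simp_all add: K7_def)

lemma K7_divide: "x \<in> K7 \<Longrightarrow> y \<in> K7 \<Longrightarrow> x / y \<in> K7"
  by (simp add: divide_inverse K7_mult K7_inverse)

lemma K7_of_nat: "of_nat n \<in> K7"
  by (induction n) (auto simp: K7_0 K7_1 K7_add)

lemma K7_of_int: "of_int n \<in> K7"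
  by (cases n) (auto simp: K7_of_nat K7_uminus simp del: of_nat_Suc)

lemma K7_numeral: "numeral n \<in> K7"
  using K7_of_int[of "numeral n"] by simp

lemma K7_Rats: "x \<in> \<rat> \<Longrightarrow> x \<in> K7"
  by (metis K7_divide K7_of_int Rats_cases')

lemma K7_eta: "eta \<in> K7"
proof -
  have "cos (2 * pi / 7) \<in> K7"
    unfolding K7_def by (rule generate_field.incl) simp
  thus ?thesis using K7_mult[OF K7_numeral[of "num.Bit0 num.One"]] by (simp add: eta_def)
qed

lemma K7_power: "x \<in> K7 \<Longrightarrow> x ^ n \<in> K7"
  by (induction n) (auto simp: K7_1 K7_mult)

lemmas K7_closed = K7_0 K7_1 K7_add K7_mult K7_uminus K7_diff K7_inverse K7_divide K7_of_int
  K7_numeral K7_eta K7_power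

definition is_root7 :: "real \<Rightarrow> bool" where
  "is_root7 x \<longleftrightarrow> x^3 = 1 + 2 * x - x^2"

lemma trip_mult:
  assumes "is_root7 x"
  shows "trip p q r x * trip p' q' r' x =
    trip (p * p' + q * r' + r * q' - r * r') (p * q' + q * p' + 2 * (q * r' + r * q') - r * r')
      (p * r' + q * q' + r * p' - (q * r' + r * q') + 3 * r * r') x"
  using assms unfolding trip_def is_root7_def by Groebner_Basis.algebra

lemma is_root7_eta: "is_root7 eta"
  using eta_cubic by (simp add: is_root7_def)

text \<open>The other two roots: 2 cos 2\<theta> = (2 cos \<theta>)^2 - 2 gives one, and the sum -1
  of all three roots gives the last.\<close>

definition eta2 :: real where "eta2 = eta^2 - 2"
definition eta3 :: real where "eta3 = 1 - eta - eta^2"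

lemma is_root7_eta23: "is_root7 eta2" "is_root7 eta3"
  using eta_cubic unfolding is_root7_def eta2_def eta3_def by Groebner_Basis.algebra+

lemma trip_norm:
  "trip p q r eta * trip p q r eta2 * trip p q r eta3 = cubic_norm p q r"
  using eta_cubic unfolding trip_def eta2_def eta3_def cubic_norm_def by Groebner_Basis.algebra

lemma trip_trace: "trip p q r eta + trip p q r eta2 + trip p q r eta3 = 3 * p - q + 5 * r"
  using eta_cubic unfolding trip_def eta2_def eta3_def by Groebner_Basis.algebra

lemma K7_imp_trip:
  assumes "x \<in> K7"
  obtains p q r where "p \<in> \<rat>" "q \<in> \<rat>" "r \<in> \<rat>" "x = trip p q r eta"
proof -
  have "\<exists>p q r. p \<in> \<rat> \<and> q \<in> \<rat> \<and> r \<in> \<rat> \<and> x = trip p q r eta"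
    using assms unfolding K7_def
  proof (induction rule: generate_field.induct)
    case one
    show ?case by (intro exI[of _ 1] exI[of _ 0]) (simp add: trip_def)
  next
    case (incl h)
    thus ?case by (intro exI[of _ 0] exI[of _ "1/2"]) (simp add: trip_def eta_def)
  next
    case (a_inv h)
    then obtain p q r where "p \<in> \<rat>" "q \<in> \<rat>" "r \<in> \<rat>" "h = trip p q r eta" by blast
    thus ?case by (intro exI[of _ "- p"] exI[of _ "- q"] exI[of _ "- r"]) (simp add: trip_def)
  next
    case (m_inv h)
    then obtain p q r where h: "p \<in> \<rat>" "q \<in> \<rat>" "r \<in> \<rat>" "h = trip p q r eta" by blast
    define N where "N = cubic_norm p q r"
    have "N \<noteq> 0"
    proof
      assume "N = 0"
      hence "p = 0 \<and> q = 0 \<and> r = 0" using cubic_norm_rat_eq_0[OF h(1-3)] by (simp add: N_def)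
      thus False using m_inv(2) h by (simp add: trip_def)
    qed
    \<comment> \<open>The coordinates of the product of the other two conjugates of h; multiplied by
      h they give the norm.\<close>
    define p' q' r' where "p' = (p + 2 * r) * (p - q + 3 * r) - (q - r) * (2 * q - r)"
      and "q' = r * (2 * q - r) - q * (p - q + 3 * r)" and "r' = q * (q - r) - r * (p + 2 * r)"
    have "N \<in> \<rat>" "p' \<in> \<rat>" "q' \<in> \<rat>" "r' \<in> \<rat>"
      using h(1-3) by (simp_all add: N_def cubic_norm_def p'_def q'_def r'_def)
    have "h * trip p' q' r' eta = N"
      using cubic_norm_cofactor[OF eta_cubic, of p q r]
      by (simp add: h(4) trip_def p'_def q'_def r'_def N_def)
    hence "inverse h = trip p' q' r' eta / N"
      using \<open>N \<noteq> 0\<close> m_inv(2) by (simp add: field_simps)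
    also have "\<dots> = trip (p' / N) (q' / N) (r' / N) eta"
      by (simp add: trip_def add_divide_distrib)
    finally show ?case
      using m_inv(2) \<open>N \<in> \<rat>\<close> \<open>p' \<in> \<rat>\<close> \<open>q' \<in> \<rat>\<close> \<open>r' \<in> \<rat>\<close>
      by (intro exI[of _ "p' / N"] exI[of _ "q' / N"] exI[of _ "r' / N"]) simp
  next
    case (eng_add h1 h2)
    then obtain p q r p' q' r' where "p \<in> \<rat>" "q \<in> \<rat>" "r \<in> \<rat>" "h1 = trip p q r eta"
      "p' \<in> \<rat>" "q' \<in> \<rat>" "r' \<in> \<rat>" "h2 = trip p' q' r' eta" by metis
    thus ?case
      by (intro exI[of _ "p + p'"] exI[of _ "q + q'"] exI[of _ "r + r'"]) (simp add: trip_def algebra_simps)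
  next
    case (eng_mult h1 h2)
    then obtain p q r p' q' r' where h: "p \<in> \<rat>" "q \<in> \<rat>" "r \<in> \<rat>" "h1 = trip p q r eta"
      "p' \<in> \<rat>" "q' \<in> \<rat>" "r' \<in> \<rat>" "h2 = trip p' q' r' eta" by metis
    show ?case
      by (rule exI[of _ "p * p' + q * r' + r * q' - r * r'"],
          rule exI[of _ "p * q' + q * p' + 2 * (q * r' + r * q') - r * r'"],
          rule exI[of _ "p * r' + q * q' + r * p' - (q * r' + r * q') + 3 * r * r'"])
         (use h in \<open>simp add: trip_mult[OF is_root7_eta]\<close>)
  qed
  thus ?thesis using that by blast
qed

lemma trip_in_K7: "p \<in> \<rat> \<Longrightarrow> q \<in> \<rat> \<Longrightarrow> r \<in> \<rat> \<Longrightarrow> trip p q r eta \<in> K7"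
  by (simp add: trip_def K7_closed K7_Rats)

lemma trip_eq_0:
  assumes "p \<in> \<rat>" "q \<in> \<rat>" "r \<in> \<rat>" "trip p q r eta = 0"
  shows "p = 0 \<and> q = 0 \<and> r = 0"
  using cubic_norm_cofactor[OF eta_cubic, of p q r] assms
  by (intro cubic_norm_rat_eq_0) (simp_all add: trip_def)

lemma trip_inj:
  assumes "p \<in> \<rat>" "q \<in> \<rat>" "r \<in> \<rat>" "p' \<in> \<rat>" "q' \<in> \<rat>" "r' \<in> \<rat>" "trip p q r eta = trip p' q' r' eta"
  shows "p = p' \<and> q = q' \<and> r = r'"
  using trip_eq_0[of "p - p'" "q - q'" "r - r'"] assms by (simp add: trip_def algebra_simps)

text \<open>For a conjugate \<open>x\<close> of \<open>eta\<close>, the embedding of \<open>K\<close> that sends \<open>eta\<close> to \<open>x\<close>.\<close>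

definition conj7 :: "real \<Rightarrow> real \<Rightarrow> real" where
  "conj7 x u = (THE v. \<exists>p\<in>\<rat>. \<exists>q\<in>\<rat>. \<exists>r\<in>\<rat>. u = trip p q r eta \<and> v = trip p q r x)"

lemma conj7_trip:
  assumes "p \<in> \<rat>" "q \<in> \<rat>" "r \<in> \<rat>" shows "conj7 x (trip p q r eta) = trip p q r x"
  unfolding conj7_def by (rule the_equality) (use assms trip_inj[OF assms] in blast)+

lemma conj7_add: "u \<in> K7 \<Longrightarrow> v \<in> K7 \<Longrightarrow> conj7 x (u + v) = conj7 x u + conj7 x v"
proof -
  assume "u \<in> K7" "v \<in> K7"
  then obtain p q r p' q' r' where u: "p \<in> \<rat>" "q \<in> \<rat>" "r \<in> \<rat>" "u = trip p q r eta"
    and v: "p' \<in> \<rat>" "q' \<in> \<rat>" "r' \<in> \<rat>" "v = trip p' q' r' eta" by (metis K7_imp_trip)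
  have "u + v = trip (p + p') (q + q') (r + r') eta" by (simp add: u v trip_def algebra_simps)
  hence "conj7 x (u + v) = trip (p + p') (q + q') (r + r') x" using u v conj7_trip by simp
  thus ?thesis by (simp add: u v conj7_trip) (simp add: trip_def algebra_simps)
qed

lemma conj7_mult:
  assumes "u \<in> K7" "v \<in> K7" "is_root7 x"
  shows "conj7 x (u * v) = conj7 x u * conj7 x v"
proof -
  obtain p q r p' q' r' where u: "p \<in> \<rat>" "q \<in> \<rat>" "r \<in> \<rat>" "u = trip p q r eta"
    and v: "p' \<in> \<rat>" "q' \<in> \<rat>" "r' \<in> \<rat>" "v = trip p' q' r' eta" using assms by (metis K7_imp_trip)
  show ?thesis
    using u v by (simp add: trip_mult[OF is_root7_eta] trip_mult[OF assms(3)] conj7_trip)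
qed

lemma conj7_Rats: "u \<in> \<rat> \<Longrightarrow> conj7 x u = u"
  using conj7_trip[of u 0 0 x] by (simp add: trip_def)

lemma conj7_ipoly:
  assumes "u \<in> K7" "is_root7 x"
  shows "conj7 x (poly (of_int_poly p) u) = poly (of_int_poly p) (conj7 x u)"
proof -
  have "poly (of_int_poly p) u \<in> K7 \<and> ?thesis"
  proof (induction p)
    case 0
    show ?case by (simp add: K7_0 conj7_Rats)
  next
    case (pCons a p)
    thus ?case using assms
      by (auto simp: map_poly_pCons K7_closed conj7_add conj7_mult conj7_Rats)
  qed
  thus ?thesis ..
qed

lemma conj7_algebraic_int:
  assumes "u \<in> K7" "is_root7 x" "algebraic_int u"
  shows "algebraic_int (conj7 x u)"
  using assms conj7_ipoly[OF assms(1,2)] unfolding algebraic_int_altdef_ipoly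
  by (metis conj7_Rats Rats_0)

section \<open>The ring of integers is Z[\<open>eta\<close>]\<close>

lemma algebraic_int_eta: "algebraic_int eta"
proof -
  have "poly (of_int_poly [:- 1, - 2, 1, 1:]) eta = 0"
    using eta_cubic by (simp add: algebra_simps power2_eq_square power3_eq_cube)
  thus ?thesis unfolding algebraic_int_altdef_ipoly
    by (intro exI[of _ "[:- 1, - 2, 1, 1:]"]) auto
qed

lemma algebraic_int_trip:
  "algebraic_int (trip (of_int a) (of_int b) (of_int c) eta)"
  unfolding trip_def power2_eq_square
  by (intro real_algebraic_int_add_mult algebraic_int_eta int_imp_algebraic_int) auto

text \<open>Norm and trace are built from the three conjugates, which are again algebraic integers,
  and a rational algebraic integer is an integer.\<close>

lemma cubic_norm_Ints_of_algebraic_int: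
  assumes "p \<in> \<rat>" "q \<in> \<rat>" "r \<in> \<rat>" "algebraic_int (trip p q r eta)"
  shows "cubic_norm p q r \<in> \<int>" "3 * p - q + 5 * r \<in> \<int>"
proof -
  have "algebraic_int (trip p q r eta2)" "algebraic_int (trip p q r eta3)"
    using conj7_algebraic_int[OF trip_in_K7 is_root7_eta23(1)] conj7_algebraic_int[OF trip_in_K7 is_root7_eta23(2)]
      assms conj7_trip[OF assms(1-3)] by metis+
  hence "algebraic_int (cubic_norm p q r)" "algebraic_int (3 * p - q + 5 * r)"
    unfolding trip_norm[symmetric] trip_trace[symmetric] using assms(4)
    by (auto intro!: real_algebraic_int_add_mult)
  moreover have "cubic_norm p q r \<in> \<rat>" "3 * p - q + 5 * r \<in> \<rat>"
    using assms by (simp_all add: cubic_norm_def)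
  ultimately show "cubic_norm p q r \<in> \<int>" "3 * p - q + 5 * r \<in> \<int>"
    using rational_algebraic_int_is_int by blast+
qed

text \<open>Modulo 7 the minimal polynomial of \<open>eta\<close> is \<open>(x - 2)\<^sup>3\<close>, so divisibility by 7 is tested in the
  basis \<open>1, eta - 2, (eta - 2)\<^sup>2\<close>.\<close>

lemma cubic_norm_343_dvd:
  fixes a b c :: int
  assumes "343 dvd cubic_norm a b c" shows "7 dvd a" "7 dvd b" "7 dvd c"
proof -
  have p7: "Factorial_Ring.prime (7 :: int)" by simp
  define u v where "u = a + 2 * b + 4 * c" and "v = b + 4 * c"
  have ab: "a = u - 2 * v + 4 * c" "b = v - 4 * c" by (simp_all add: u_def v_def)
  obtain k where "cubic_norm a b c = 343 * k" using assms by (auto elim: dvdE)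
  hence k: "u^3 - 7 * u^2 * v + 21 * u^2 * c + 14 * u * v^2 - 77 * u * v * c + 98 * u * c^2
      - 7 * v^3 + 49 * v^2 * c - 98 * v * c^2 + 49 * c^3 = 343 * k"
    unfolding ab(1,2) cubic_norm_def by Groebner_Basis.algebra
  have "u^3 = 7 * (49 * k + u^2 * v - 3 * u^2 * c - 2 * u * v^2 + 11 * u * v * c - 14 * u * c^2
      + v^3 - 7 * v^2 * c + 14 * v * c^2 - 7 * c^3)"
    using k by Groebner_Basis.algebra
  hence "7 dvd u" using Factorial_Ring.prime_dvd_power[OF p7] by (metis dvd_triv_left)
  then obtain u' where u: "u = 7 * u'" by (auto elim: dvdE)
  have "v^3 = 7 * (7 * u'^3 - 7 * u'^2 * v + 21 * u'^2 * c + 2 * u' * v^2 - 11 * u' * v * c + 14 * u' * c^2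
      + v^2 * c - 2 * v * c^2 + c^3 - 7 * k)"
    using k unfolding u by Groebner_Basis.algebra
  hence "7 dvd v" using Factorial_Ring.prime_dvd_power[OF p7] by (metis dvd_triv_left)
  then obtain v' where v: "v = 7 * v'" by (auto elim: dvdE)
  have "c^3 = 7 * (k - u'^3 + 7 * u'^2 * v' - 3 * u'^2 * c - 14 * u' * v'^2 + 11 * u' * v' * c - 2 * u' * c^2
      + 7 * v'^3 - 7 * v'^2 * c + 2 * v' * c^2)"
    using k unfolding u v by Groebner_Basis.algebra
  hence "7 dvd c" using Factorial_Ring.prime_dvd_power[OF p7] by (metis dvd_triv_left)
  with \<open>7 dvd u\<close> \<open>7 dvd v\<close> show "7 dvd a" "7 dvd b" "7 dvd c" unfolding ab by auto
qed

lemma OK7_trip: "trip (of_int a) (of_int b) (of_int c) eta \<in> OK7"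
  unfolding OK7_def using algebraic_int_trip trip_in_K7 by auto

text \<open>The traces of x, x \<open>eta\<close> and x \<open>eta^2\<close> are integers, and the
  trace form has determinant 49 with an inverse whose entries have denominator 7; so 7x has integral
  coordinates. The norm of 7x is 343 times an integer, which forces each of these coordinates to be
  divisible by 7.\<close>

lemma OK7_imp_trip:
  assumes "x \<in> OK7"
  obtains a b c :: int where "x = trip (of_int a) (of_int b) (of_int c) eta"
proof -
  obtain p q r where x: "p \<in> \<rat>" "q \<in> \<rat>" "r \<in> \<rat>" "x = trip p q r eta"
    using assms K7_imp_trip unfolding OK7_def by blast
  have alg: "algebraic_int (trip p q r eta)" using assms x(4) by (simp add: OK7_def)
  define t0 t1 t2 where "t0 = 3 * p - q + 5 * r" and "t1 = - p + 5 * q - 4 * r" and "t2 = 5 * p - 4 * q + 13 * r"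
  have t0: "t0 \<in> \<int>" using cubic_norm_Ints_of_algebraic_int(2)[OF x(1-3) alg] by (simp add: t0_def)
  have e1: "trip p q r eta * eta = trip r (p + 2 * r) (q - r) eta"
    using eta_cubic unfolding trip_def by Groebner_Basis.algebra
  have "algebraic_int (trip r (p + 2 * r) (q - r) eta)"
    unfolding e1[symmetric] using alg algebraic_int_eta by (rule real_algebraic_int_add_mult)
  hence "3 * r - (p + 2 * r) + 5 * (q - r) \<in> \<int>"
    by (rule cubic_norm_Ints_of_algebraic_int(2)[rotated 3]) (use x in auto)
  hence t1: "t1 \<in> \<int>" by (simp add: t1_def algebra_simps)
  have e2: "trip p q r eta * eta * eta = trip (q - r) (2 * q - r) (p - q + 3 * r) eta"
    using eta_cubic unfolding trip_def by Groebner_Basis.algebra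
  have "algebraic_int (trip (q - r) (2 * q - r) (p - q + 3 * r) eta)"
    unfolding e2[symmetric] by (intro real_algebraic_int_add_mult alg algebraic_int_eta)
  hence "3 * (q - r) - (2 * q - r) + 5 * (p - q + 3 * r) \<in> \<int>"
    by (rule cubic_norm_Ints_of_algebraic_int(2)[rotated 3]) (use x in auto)
  hence t2: "t2 \<in> \<int>" by (simp add: t2_def algebra_simps)
  have "7 * p = 7 * t0 - t1 - 3 * t2" "7 * q = - t0 + 2 * t1 + t2" "7 * r = - 3 * t0 + t1 + 2 * t2"
    by (simp_all add: t0_def t1_def t2_def algebra_simps)
  hence "7 * p \<in> \<int>" "7 * q \<in> \<int>" "7 * r \<in> \<int>" using t0 t1 t2 by simp_all
  then obtain a b c :: int where abc: "7 * p = of_int a" "7 * q = of_int b" "7 * r = of_int c"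
    by (metis Ints_cases)
  obtain n :: int where n: "cubic_norm p q r = of_int n"
    using cubic_norm_Ints_of_algebraic_int(1)[OF x(1-3) alg] by (metis Ints_cases)
  have "real_of_int (cubic_norm a b c) = cubic_norm (of_int a) (of_int b) (of_int c)"
    by (simp add: cubic_norm_def)
  also have "\<dots> = cubic_norm (7 * p) (7 * q) (7 * r)" by (simp add: abc)
  also have "\<dots> = of_int (343 * n)" by (simp add: cubic_norm_scale n)
  finally have "cubic_norm a b c = 343 * n" by (simp only: of_int_eq_iff)
  hence "7 dvd a" "7 dvd b" "7 dvd c" using cubic_norm_343_dvd by (metis dvd_triv_left)+
  then obtain a' b' c' where "a = 7 * a'" "b = 7 * b'" "c = 7 * c'" by (auto elim!: dvdE)
  hence "x = trip (of_int a') (of_int b') (of_int c') eta"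
    using abc by (simp add: x(4))
  thus ?thesis by (rule that)
qed

lemma OK7_subset_K7: "x \<in> OK7 \<Longrightarrow> x \<in> K7"
  by (simp add: OK7_def)

lemma OK7_add: "x \<in> OK7 \<Longrightarrow> y \<in> OK7 \<Longrightarrow> x + y \<in> OK7"
  and OK7_mult: "x \<in> OK7 \<Longrightarrow> y \<in> OK7 \<Longrightarrow> x * y \<in> OK7"
  and OK7_uminus: "x \<in> OK7 \<Longrightarrow> - x \<in> OK7"
  and OK7_of_int: "of_int n \<in> OK7"
  by (auto simp: OK7_def K7_closed real_algebraic_int_add_mult)

lemma OK7_0: "0 \<in> OK7" and OK7_1: "1 \<in> OK7" and OK7_numeral: "numeral k \<in> OK7"
  using OK7_of_int[of 0] OK7_of_int[of 1] OK7_of_int[of "numeral k"] by simp_all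

lemma OK7_diff: "x \<in> OK7 \<Longrightarrow> y \<in> OK7 \<Longrightarrow> x - y \<in> OK7"
  using OK7_add[of x "- y"] OK7_uminus by simp

lemmas OK7_closed = OK7_0 OK7_1 OK7_add OK7_mult OK7_uminus OK7_diff OK7_of_int OK7_numeral

lemma countable_K7: "countable K7"
proof -
  have "K7 \<subseteq> (\<lambda>(p, q, r). trip (of_rat p) (of_rat q) (of_rat r) eta) ` UNIV"
  proof
    fix x assume "x \<in> K7"
    then obtain p q r where x: "p \<in> \<rat>" "q \<in> \<rat>" "r \<in> \<rat>" "x = trip p q r eta" by (rule K7_imp_trip)
    then obtain p' q' r' where "p = of_rat p'" "q = of_rat q'" "r = of_rat r'" by (auto elim!: Rats_cases)
    thus "x \<in> (\<lambda>(p, q, r). trip (of_rat p) (of_rat q) (of_rat r) eta) ` UNIV"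
      using x by (intro image_eqI[of _ _ "(p', q', r')"]) auto
  qed
  thus ?thesis by (rule countable_subset) (rule countable_image, simp)
qed

text \<open>A product of three conjugates that is less than 1 in absolute value is a vanishing norm.\<close>

lemma OK7_conj_bound_imp_0:
  assumes "y \<in> OK7" "11 * y^2 \<le> 4" "11 * (conj7 eta2 y)^2 \<le> 4" "11 * (conj7 eta3 y)^2 \<le> 4"
  shows "y = 0"
proof -
  obtain a b c :: int where y: "y = trip (of_int a) (of_int b) (of_int c) eta"
    using OK7_imp_trip[OF assms(1)] .
  have small: "\<bar>u\<bar> < 1" if "11 * u^2 \<le> 4" for u :: real
    using that by (simp add: abs_square_less_1[symmetric])
  let ?u = "conj7 eta2 y" and ?v = "conj7 eta3 y"
  have "\<bar>y * ?u * ?v\<bar> = \<bar>y\<bar> * \<bar>?u\<bar> * \<bar>?v\<bar>" by (simp add: abs_mult)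
  also have "\<dots> < 1 * 1 * 1"
    using small assms by (intro mult_strict_mono') auto
  finally have "\<bar>y * ?u * ?v\<bar> < 1" by simp
  moreover have "y * ?u * ?v = of_int (cubic_norm a b c)"
    using trip_norm[of "of_int a" "of_int b" "of_int c"]
    by (simp add: y conj7_trip) (simp add: cubic_norm_def)
  ultimately have "cubic_norm a b c = 0" by (simp flip: of_int_abs)
  hence "a = 0 \<and> b = 0 \<and> c = 0" by (rule cubic_norm_int_eq_0)
  thus ?thesis by (simp add: y trip_def)
qed

section \<open>Integer polynomials as coefficient lists\<close>

text \<open>Lists make identities between polynomials with large coefficients decidable by \<open>code_simp\<close>.\<close>

primrec lev :: "int list \<Rightarrow> complex \<Rightarrow> complex" where
  "lev [] x = 0"
| "lev (a # p) x = of_int a + x * lev p x"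

fun ladd :: "int list \<Rightarrow> int list \<Rightarrow> int list" where
  "ladd [] q = q"
| "ladd p [] = p"
| "ladd (a # p) (b # q) = (a + b) # ladd p q"

definition lscale :: "int \<Rightarrow> int list \<Rightarrow> int list" where
  "lscale c p = map (\<lambda>a. c * a) p"

primrec lmul :: "int list \<Rightarrow> int list \<Rightarrow> int list" where
  "lmul [] q = []"
| "lmul (a # p) q = ladd (lscale a q) (0 # lmul p q)"

definition lzero :: "int list \<Rightarrow> bool" where
  "lzero p \<longleftrightarrow> list_all (\<lambda>a. a = 0) p"

lemma lev_ladd: "lev (ladd p q) x = lev p x + lev q x"
  by (induction p q rule: ladd.induct) (auto simp: algebra_simps)

lemma lev_lscale: "lev (lscale c p) x = of_int c * lev p x"
  by (induction p) (auto simp: lscale_def algebra_simps)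

lemma lev_lmul: "lev (lmul p q) x = lev p x * lev q x"
  by (induction p) (auto simp: lev_ladd lev_lscale algebra_simps)

lemma lev_lzero: "lzero p \<Longrightarrow> lev p x = 0"
  by (induction p) (auto simp: lzero_def)

lemmas lev_hom = lev_ladd lev_lscale lev_lmul

lemma lev_eq_poly: "lev p x = poly (Poly (map of_int p)) x"
  by (induction p) auto

primrec lderiv_aux :: "int \<Rightarrow> int list \<Rightarrow> int list" where
  "lderiv_aux n [] = []"
| "lderiv_aux n (a # p) = n * a # lderiv_aux (n + 1) p"

definition lderiv :: "int list \<Rightarrow> int list" where
  "lderiv p = lderiv_aux 1 (tl p)"

lemma lev_lderiv_aux: "lev (lderiv_aux (n + 1) p) x = lev (lderiv_aux n p) x + lev p x"
proof (induction p arbitrary: n)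
  case (Cons a p)
  show ?case using Cons[of "n + 1"] by (simp add: algebra_simps)
qed simp

lemma lev_lderiv: "lev (lderiv p) x = poly (pderiv (Poly (map of_int p))) x"
proof (induction p)
  case (Cons a p)
  have "lev (lderiv (a # p)) x = lev (lderiv_aux 0 p) x + lev p x"
    using lev_lderiv_aux[of 0 p x] by (simp add: lderiv_def)
  moreover have "lev (lderiv_aux 0 p) x = x * lev (lderiv p) x"
    by (cases p) (auto simp: lderiv_def)
  ultimately show ?case
    using Cons by (simp add: pderiv_pCons lev_eq_poly)
qed (simp add: lderiv_def)

text \<open>The pair \<open>(p, q)\<close> stands for \<open>p(x) + q(x) Y\<close>, where \<open>Y\<^sup>2\<close> is the polynomial \<open>d\<close>.\<close>

definition pmul :: "int list \<Rightarrow> int list \<times> int list \<Rightarrow> int list \<times> int list \<Rightarrow> int list \<times> int list" where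
  "pmul d u v = (ladd (lmul (fst u) (fst v)) (lmul d (lmul (snd u) (snd v))),
                 ladd (lmul (fst u) (snd v)) (lmul (snd u) (fst v)))"

definition padd :: "int list \<times> int list \<Rightarrow> int list \<times> int list \<Rightarrow> int list \<times> int list" where
  "padd u v = (ladd (fst u) (fst v), ladd (snd u) (snd v))"

definition pscale :: "int \<Rightarrow> int list \<times> int list \<Rightarrow> int list \<times> int list" where
  "pscale c u = (lscale c (fst u), lscale c (snd u))"

definition pev :: "int list \<times> int list \<Rightarrow> complex \<Rightarrow> complex \<Rightarrow> complex" where
  "pev u x Y = lev (fst u) x + lev (snd u) x * Y"

lemma pev_padd: "pev (padd u v) x Y = pev u x Y + pev v x Y"
  by (simp add: pev_def padd_def lev_hom algebra_simps)

lemma pev_pscale: "pev (pscale c u) x Y = of_int c * pev u x Y"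
  by (simp add: pev_def pscale_def lev_hom algebra_simps)

lemma pev_pmul:
  assumes "Y^2 = lev d x"
  shows "pev (pmul d u v) x Y = pev u x Y * pev v x Y"
proof -
  have "Y * Y = lev d x" using assms by (simp add: power2_eq_square)
  hence "pev (pmul d u v) x Y = lev (fst u) x * lev (fst v) x + (Y * Y) * (lev (snd u) x * lev (snd v) x)
     + (lev (fst u) x * lev (snd v) x + lev (snd u) x * lev (fst v) x) * Y"
    by (simp add: pev_def pmul_def lev_hom)
  also have "\<dots> = pev u x Y * pev v x Y"
    by (simp add: pev_def algebra_simps)
  finally show ?thesis .
qed


section \<open>The functions on the elliptic curve\<close>

text \<open>The right-hand side after completing the square: (2y + 1)^2 equals this polynomial in
  x.\<close>

definition cubic :: "int list" where
  "cubic = [- 14623627, - 178816, 4, 4]"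

lemma lev_cubic: "lev cubic x = 4 * x^3 + 4 * x^2 - 178816 * x - 14623627"
  by (simp add: cubic_def algebra_simps power2_eq_square power3_eq_cube)

definition on_E :: "complex \<Rightarrow> complex \<Rightarrow> bool" where
  "on_E x y \<longleftrightarrow> y^2 + y = x^3 + x^2 - 44704 * x - 3655907"

lemma on_E_iff: "on_E x y \<longleftrightarrow> (2 * y + 1)^2 = lev cubic x"
proof -
  have "(2 * y + 1)^2 - lev cubic x = 4 * (y^2 + y - (x^3 + x^2 - 44704 * x - 3655907))"
    by (simp add: lev_cubic algebra_simps power2_eq_square)
  thus ?thesis unfolding on_E_def by (smt (verit) eq_iff_diff_eq_0 mult_eq_0_iff zero_neq_numeral)
qed

lemma on_E_neg: "on_E x y \<Longrightarrow> on_E x (- 1 - y)"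
  by (simp add: on_E_def algebra_simps power2_eq_square)

lemma on_E_same_x:
  assumes "on_E x y" "on_E x y'" shows "y' = y \<or> y' = - 1 - y"
proof -
  have "(y' - y) * (y' - (- 1 - y)) = (y'^2 + y') - (y^2 + y)" by (simp add: algebra_simps power2_eq_square)
  also have "\<dots> = 0" using assms by (simp add: on_E_def)
  finally show ?thesis by (metis eq_iff_diff_eq_0 mult_eq_0_iff)
qed

text \<open>Coordinates of twice \<open>F4\<close>, since y = (Y - 1)/2 would bring in denominators;
  \<open>F9_pair\<close> is doubled for the same reason.\<close>

definition F4_pair :: "int list \<times> int list" where
  "F4_pair = ([- 455433, - 2416, 2], [91])"

definition F9_pair :: "int list \<times> int list" where
  "F9_pair = ([- 4637691813440, - 59556352744, - 326196640, - 1541176, - 2030], [- 678909344, - 13656232, - 384, 8])"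

text \<open>A square root of 64 F4^7 - 343 F9^3 on the curve, stored without doubling. The numbers
  4, 9 and 14 in the names are pole orders at the origin.\<close>

definition G14_pair :: "int list \<times> int list" where
  "G14_pair = ([- 53562735485857676636, 95148742768473520, 15702047860023280, 116002182257290, 237993866012, 343448854, - 400071, - 8],
    [8840865623343180, 167984826791152, 2064039854464, 9440384002, 9987180, 4214])"

lemma F4_pev: "2 * F4 x y = pev F4_pair x (2 * y + 1)"
  by (simp add: F4_def F4_pair_def pev_def algebra_simps power2_eq_square)

lemma F9_pev: "2 * F9 x y = pev F9_pair x (2 * y + 1)"
  by (simp add: F9_def F9_pair_def pev_def algebra_simps power2_eq_square power3_eq_cube power4_eq_xxxx)

definition G14 :: "complex \<Rightarrow> complex \<Rightarrow> complex" where
  "G14 x y = pev G14_pair x (2 * y + 1)"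

text \<open>The double zeros of \<open>t\<close>: \<open>t = G14\<^sup>2 / (64 F4\<^sup>7)\<close>.\<close>

lemma G14_identity:
  "(let m = pmul cubic; u = m F4_pair F4_pair; v = m u F4_pair;
        z = padd (padd (pscale 4 (m (m v u) u)) (pscale (- 343) (m F9_pair (m F9_pair F9_pair))))
              (pscale (- 8) (m G14_pair G14_pair))
    in lzero (fst z) \<and> lzero (snd z))"
  by code_simp

lemma F4_F9_G14:
  assumes "on_E x y"
  shows "64 * F4 x y ^ 7 - 343 * F9 x y ^ 3 = G14 x y ^ 2"
proof -
  let ?Y = "2 * y + 1"
  let ?m = "pmul cubic"
  let ?u = "?m F4_pair F4_pair"
  let ?v = "?m ?u F4_pair"
  note hom = pev_pmul[OF assms[unfolded on_E_iff]] pev_padd pev_pscale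
  let ?z = "padd (padd (pscale 4 (?m (?m ?v ?u) ?u)) (pscale (- 343) (?m F9_pair (?m F9_pair F9_pair))))
              (pscale (- 8) (?m G14_pair G14_pair))"
  have "lzero (fst ?z) \<and> lzero (snd ?z)"
    using G14_identity unfolding Let_def .
  hence "pev ?z x ?Y = 0"
    by (simp only: pev_def lev_lzero mult_zero_left add_0)
  moreover have "pev ?z x ?Y = 4 * (2 * F4 x y) ^ 7 - 343 * (2 * F9 x y) ^ 3 - 8 * G14 x y ^ 2"
    by (simp only: hom F4_pev F9_pev G14_def of_int_numeral of_int_minus)
      (simp add: eval_nat_numeral algebra_simps)
  ultimately have "8 * (64 * F4 x y ^ 7 - 343 * F9 x y ^ 3) = 8 * G14 x y ^ 2"
    by (simp only:) (simp add: power_mult_distrib)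
  thus ?thesis unfolding mult_cancel_left by simp
qed

section \<open>The algebra that determines the CM point\<close>

lemma CM_gcd_identity:
  "(let A = fst F4_pair; B = fst F9_pair; C = snd F9_pair;
        P = ladd (lscale 207025 cubic) (lscale 704 (lmul A A));
        Q = ladd (lscale 4024 (lmul C A)) (lscale 98189 B);
        U = [7529895749544690127, - 4930992433725056, - 10779064021324, 2238428468];
        V = [- 195276069142408, 253132629136, - 97903432]
    in lzero (ladd (ladd (lmul U P) (lmul V Q))
         (lscale (- 91365549054751689706928920617) [10099, 64])))"
  by code_simp

text \<open>The hypotheses are what is left after 2y + 1 has been eliminated, and 64x + 10099 is
  their greatest common divisor. The Bezout cofactors are hidden behind an existential quantifier so
  that their coefficients do not enter the terms being simplified.\<close>

lemma CM_gcd: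
  assumes "207025 * lev cubic x + 704 * lev (fst F4_pair) x ^ 2 = 0"
    and "4024 * lev (snd F9_pair) x * lev (fst F4_pair) x + 98189 * lev (fst F9_pair) x = 0"
  shows "x = - 10099 / 64"
proof -
  have "\<exists>U V. lzero (ladd (ladd (lmul U (ladd (lscale 207025 cubic) (lscale 704 (lmul (fst F4_pair) (fst F4_pair)))))
           (lmul V (ladd (lscale 4024 (lmul (snd F9_pair) (fst F4_pair))) (lscale 98189 (fst F9_pair)))))
         (lscale (- 91365549054751689706928920617) [10099, 64]))"
    using CM_gcd_identity unfolding Let_def by blast
  then obtain U V where "lzero (ladd (ladd (lmul U (ladd (lscale 207025 cubic) (lscale 704 (lmul (fst F4_pair) (fst F4_pair)))))
           (lmul V (ladd (lscale 4024 (lmul (snd F9_pair) (fst F4_pair))) (lscale 98189 (fst F9_pair)))))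
         (lscale (- 91365549054751689706928920617) [10099, 64]))" by blast
  from lev_lzero[OF this, of x] have "lev U x * (207025 * lev cubic x + 704 * lev (fst F4_pair) x ^ 2) +
      lev V x * (4024 * lev (snd F9_pair) x * lev (fst F4_pair) x + 98189 * lev (fst F9_pair) x) -
      91365549054751689706928920617 * (10099 + 64 * x) = 0"
    by (simp add: lev_hom power2_eq_square algebra_simps)
  hence "64 * x = - 10099" by (simp add: assms add_eq_0_iff)
  thus ?thesis by (simp add: field_simps)
qed

text \<open>The solutions of b^3 = a^7 = c^2 are (s^6, s^14, s^21), and b^2 c / a^8 = s identifies s
  with -r. The exponents 6 and 14 are even, so the sign disappears.\<close>

lemma CM_ratios:
  fixes a b c r :: complex
  assumes "a \<noteq> 0" "b \<noteq> 0" "b^3 = a^7" "c^2 = a^7" "b^2 * c = - r * a^8"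
  shows "a = r^6" "b = r^14"
proof -
  have "b^4 * a^7 = (b^2 * c)^2" using assms(4) by (simp add: power_mult_distrib flip: power_mult)
  also have "\<dots> = r^2 * a^9 * a^7" using assms(5) by (simp add: power_mult_distrib flip: power_mult power_add)
  finally have b4: "b^4 = r^2 * a^9" using assms(1) by simp
  have "a^27 * a = (b^3)^4" using assms(3) by (simp flip: power_mult power_Suc2)
  also have "\<dots> = (b^4)^3" by (simp flip: power_mult)
  also have "\<dots> = a^27 * r^6" by (simp add: b4 power_mult_distrib flip: power_mult)
  finally show a: "a = r^6" using assms(1) by simp
  have "b^3 * b = b^4" by (simp flip: power_Suc2)
  also have "\<dots> = (r^6)^7 * r^14" unfolding b4 a by (simp flip: power_mult power_add)
  also have "\<dots> = b^3 * r^14" using assms(3) a by simp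
  finally show "b = r^14" using assms(2) by simp
qed

text \<open>The value is rational because (2515 + 1079 s)^3 = 8 (5 - 8 s)^7: at this point
  \<open>F9\<close> and \<open>F4\<close> are rational multiples of 2515 + 1079 s and 5 - 8 s, so s
  cancels from F9^3 / F4^7.\<close>

lemma CM_value:
  fixes s :: complex
  assumes s: "s^2 = - 11" and x: "x = - 10099 / 64"
    and Y: "455 * (2 * y + 1) = - 8 * s * lev (fst F4_pair) x"
  shows "F4 x y \<noteq> 0"
    and "1 - 343 * F9 x y ^ 3 / (64 * F4 x y ^ 7) =
      (7^3 * 43^2 * 127^2 * 139^2 * 307^2 * 659^2 * 11) / (3^3 * 13^7 * 83^7)"
proof -
  have A: "lev (fst F4_pair) x = (- (49963095 / 2048))" unfolding x F4_pair_def by simp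
  have "2 * y + 1 = 455 * (2 * y + 1) / 455" by simp
  also have "455 * (2 * y + 1) = - 8 * s * ((- (49963095 / 2048)))" using Y unfolding A .
  finally have Y': "2 * y + 1 = - (8 / 455) * s * ((- (49963095 / 2048)))" by simp
  have ss: "s * s = - 11" using s by (simp add: power2_eq_square)
  have sst: "s * (s * c) = - 11 * c" for c
    using ss by (simp only: mult.assoc[symmetric])
  have F4: "F4 x y = (- (49963095 / 2048)) / 10 * (5 - 8 * s)"
  proof -
    have "2 * F4 x y = lev (fst F4_pair) x + 91 * (2 * y + 1)"
      by (simp add: F4_pev pev_def F4_pair_def)
    thus ?thesis unfolding A Y' by (simp add: field_simps)
  qed
  have F9: "F9 x y = (12035341103063985945 / 8388608) / 5030 * (2515 + 1079 * s)"
  proof -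
    have "2 * F9 x y = lev (fst F9_pair) x + lev (snd F9_pair) x * (2 * y + 1)"
      by (simp add: F9_pev pev_def)
    moreover have "lev (fst F9_pair) x = (12035341103063985945 / 8388608)" "lev (snd F9_pair) x = (47022305874453 / 32768)"
      unfolding x F9_pair_def by simp_all
    ultimately show ?thesis unfolding Y' by (simp add: field_simps)
  qed
  have 3: "(2515 + 1079 * s) ^ 3 = (- (80718240920)) + (6656376896) * s"
    by (simp add: power3_eq_cube algebra_simps ss sst)
  have 2: "(5 - 8 * s) ^ 2 = - 679 - 80 * s"
    by (simp add: power2_eq_square algebra_simps ss sst)
  have 4: "(5 - 8 * s) ^ 4 = (390641) + (108640) * s"
  proof -
    have "(5 - 8 * s) ^ 4 = ((5 - 8 * s) ^ 2) ^ 2" by (simp flip: power_mult)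
    thus ?thesis unfolding 2 by (simp add: power2_eq_square algebra_simps ss sst)
  qed
  have 7: "(5 - 8 * s) ^ 7 = (- (10089780115)) + (832047112) * s"
  proof -
    have "(5 - 8 * s) ^ 7 = (5 - 8 * s) ^ 4 * (5 - 8 * s) ^ 2 * (5 - 8 * s)"
      by (simp flip: power_add power_Suc2)
    thus ?thesis unfolding 2 4 by (simp add: algebra_simps ss sst)
  qed
  have nz: "5 - 8 * s \<noteq> 0"
  proof
    assume "5 - 8 * s = 0"
    hence "8 * s = 5" by simp
    hence "(8 * s) * (8 * s) = 25" by simp
    moreover have "(8 * s) * (8 * s) = 64 * (s * s)" by (simp only: mult_ac) simp
    ultimately show False by (simp add: ss)
  qed
  thus "F4 x y \<noteq> 0" unfolding F4 by simp
  have "F9 x y ^ 3 = ((12035341103063985945 / 8388608) / 5030)^3 * ((8) * (5 - 8 * s) ^ 7)"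
    unfolding F9 power_mult_distrib 3 7 by (simp add: algebra_simps)
  moreover have "F4 x y ^ 7 = ((- (49963095 / 2048)) / 10)^7 * (5 - 8 * s) ^ 7"
    unfolding F4 power_mult_distrib ..
  ultimately have "343 * F9 x y ^ 3 / (64 * F4 x y ^ 7) =
     343 * (((12035341103063985945 / 8388608) / 5030)^3 * (8)) / (64 * ((- (49963095 / 2048)) / 10)^7)"
    using nz by simp
  thus "1 - 343 * F9 x y ^ 3 / (64 * F4 x y ^ 7) =
      (7^3 * 43^2 * 127^2 * 139^2 * 307^2 * 659^2 * 11) / (3^3 * 13^7 * 83^7)"
    by (simp only:) (simp add: power_divide)
qed

lemma CM_algebra:
  fixes x y r :: complex
  assumes E: "on_E x y" and r: "3 * r^2 + 5 * r + 3 = 0"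
    and nz: "F4 x y \<noteq> 0" "F4 x (- 1 - y) \<noteq> 0" "F9 x y \<noteq> 0" "F9 x (- 1 - y) \<noteq> 0" "G14 x y \<noteq> 0"
    and t: "F9 x y ^ 3 * F4 x (- 1 - y) ^ 7 = F9 x (- 1 - y) ^ 3 * F4 x y ^ 7"
    and D: "- (F9 x (- 1 - y) ^ 2 / F4 x (- 1 - y) ^ 8 * G14 x (- 1 - y)) =
       r * (F9 x y ^ 2 / F4 x y ^ 8 * G14 x y)"
  shows "1 - 343 * F9 x y ^ 3 / (64 * F4 x y ^ 7) =
      (7^3 * 43^2 * 127^2 * 139^2 * 307^2 * 659^2 * 11) / (3^3 * 13^7 * 83^7)"
proof -
  define a b c where "a = F4 x (- 1 - y) / F4 x y" and "b = F9 x (- 1 - y) / F9 x y"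
    and "c = G14 x (- 1 - y) / G14 x y"
  have F4': "F4 x (- 1 - y) = a * F4 x y" and F9': "F9 x (- 1 - y) = b * F9 x y"
    and G': "G14 x (- 1 - y) = c * G14 x y"
    using nz by (simp_all add: a_def b_def c_def)
  have ab0: "a \<noteq> 0" "b \<noteq> 0" using nz by (simp_all add: a_def b_def)
  have "(F9 x y ^ 3 * F4 x y ^ 7) * a ^ 7 = (F9 x y ^ 3 * F4 x y ^ 7) * b ^ 3"
    using t unfolding F4' F9' by (simp add: power_mult_distrib ac_simps)
  hence b3: "b ^ 3 = a ^ 7" using nz by simp
  have "c^2 * G14 x y ^ 2 = a^7 * (64 * F4 x y ^ 7) - b^3 * (343 * F9 x y ^ 3)"
    using F4_F9_G14[OF on_E_neg[OF E]] unfolding F4' F9' G' by (simp add: power_mult_distrib ac_simps)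
  also have "\<dots> = a^7 * G14 x y ^ 2"
    unfolding b3 F4_F9_G14[OF E, symmetric] by (simp add: algebra_simps)
  finally have c2: "c^2 = a^7" using nz by simp
  have "- (b^2 * c / a^8) * (F9 x y ^ 2 / F4 x y ^ 8 * G14 x y) = r * (F9 x y ^ 2 / F4 x y ^ 8 * G14 x y)"
    using D unfolding F4' F9' G' by (simp add: power_mult_distrib ac_simps)
  moreover have "F9 x y ^ 2 / F4 x y ^ 8 * G14 x y \<noteq> 0" using nz by simp
  ultimately have "- (b^2 * c / a^8) = r" by (rule mult_right_cancel[THEN iffD1, rotated])
  hence "b^2 * c / a^8 = - r" by (metis minus_minus)
  hence bc: "b^2 * c = - r * a^8" using ab0 by (simp add: divide_eq_eq)
  note ab = CM_ratios[OF ab0 b3 c2 bc]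
  \<comment> \<open>The equation for r has discriminant 25 - 36 = -11, so s is one of the two square
    roots of -11.\<close>
  define s where "s = 6 * r + 5"
  have s: "s^2 = - 11" using r unfolding s_def by Groebner_Basis.algebra
  hence ss: "s * s = - 11" by (simp add: power2_eq_square)
  have r2: "18 * r^2 = 7 - 5 * s" unfolding s_def using r by Groebner_Basis.algebra
  hence "162 * r^4 = - 113 - 35 * s"
    using ss by Groebner_Basis.algebra
  hence "729 * r^6 = - 679 + 80 * s"
    using ss r2 by Groebner_Basis.algebra
  moreover from this have "9565938 * r^14 = - 3240713 - 2713685 * s"
    using ss r2 by Groebner_Basis.algebra
  ultimately have r6: "r^6 = (- 679 + 80 * s) / 729"
    and r14: "r^14 = (- 3240713 - 2713685 * s) / 9565938"
    by (simp_all add: eq_divide_eq mult.commute)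
  define A B C Y where "A = lev (fst F4_pair) x" and "B = lev (fst F9_pair) x"
    and "C = lev (snd F9_pair) x" and "Y = 2 * y + 1"
  have Y2: "Y^2 = lev cubic x" using E by (simp add: on_E_iff Y_def)
  have neg: "2 * (- 1 - y) + 1 = - Y" by (simp add: Y_def)
  have f4: "2 * F4 x y = A + 91 * Y" "2 * F4 x (- 1 - y) = A - 91 * Y"
    unfolding F4_pev neg Y_def[symmetric] by (simp_all add: pev_def A_def F4_pair_def)
  have f9: "2 * F9 x y = B + C * Y" "2 * F9 x (- 1 - y) = B - C * Y"
    unfolding F9_pev neg Y_def[symmetric] by (simp_all add: pev_def B_def C_def)
  have "A - 91 * Y = a * (A + 91 * Y)" unfolding f4[symmetric] F4' by simp
  hence 1: "729 * (A - 91 * Y) = (- 679 + 80 * s) * (A + 91 * Y)"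
    unfolding ab(1) r6 by (simp add: field_simps)
  have "B - C * Y = b * (B + C * Y)" unfolding f9[symmetric] F9' by simp
  hence 2: "9565938 * (B - C * Y) = (- 3240713 - 2713685 * s) * (B + C * Y)"
    unfolding ab(2) r14 by (simp add: field_simps)
  \<comment> \<open>Collecting terms in the first relation gives 91 (50 + 80 s) Y = (1408 - 80 s) A,
    and 5 (1408 - 80 s) = -8 s (50 + 80 s). The second relation is treated in the same way
    below.\<close>
  have "(50 + 80 * s) * (455 * Y + 8 * s * A) = 0" using 1 ss by Groebner_Basis.algebra
  moreover have "50 + 80 * s \<noteq> 0"
  proof
    assume "50 + 80 * s = 0"
    hence "(50 - 80 * s) * (50 + 80 * s) = 0" by simp
    moreover have "(50 - 80 * s) * (50 + 80 * s) = 2500 - 6400 * (s * s)" by Groebner_Basis.algebra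
    ultimately show False unfolding ss by simp
  qed
  ultimately have YA: "455 * Y = - 8 * s * A" by (simp add: eq_neg_iff_add_eq_0)
  have "(6325225 - 2713685 * s) * (2515 * (C * Y) - 1079 * s * B) = 0" using 2 ss by Groebner_Basis.algebra
  moreover have "6325225 - 2713685 * s \<noteq> 0"
  proof
    assume "6325225 - 2713685 * s = 0"
    hence "(6325225 + 2713685 * s) * (6325225 - 2713685 * s) = 0" by simp
    moreover have "(6325225 + 2713685 * s) * (6325225 - 2713685 * s) = 6325225^2 - 2713685^2 * (s * s)" by Groebner_Basis.algebra
    ultimately show False unfolding ss by simp
  qed
  ultimately have YB: "2515 * (C * Y) = 1079 * s * B" by simp
  \<comment> \<open>Squaring removes the choice of s: 207025 = 455^2 and 704 = 64 * 11.\<close>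
  have "(455 * Y)^2 = (8 * s * A)^2" unfolding YA by simp
  hence "207025 * Y^2 = 64 * s^2 * A^2" by (simp add: power_mult_distrib)
  hence P4: "207025 * lev cubic x + 704 * A^2 = 0" unfolding Y2 s by simp
  \<comment> \<open>Substituting one relation into the other removes Y. With 455 = 5 * 91 and 2515 =
    5 * 503 the coefficients are 4024 = 8 * 503 and 98189 = 91 * 1079.\<close>
  have "s * (4024 * C * A + 98189 * B) = 0" using YA YB by Groebner_Basis.algebra
  hence P5: "4024 * C * A + 98189 * B = 0" using s by auto
  have x: "x = - 10099 / 64"
    by (rule CM_gcd) (use P4 P5 in \<open>simp_all add: A_def B_def C_def\<close>)
  show ?thesis
    by (rule CM_value(2)[OF s x]) (use YA in \<open>simp add: A_def Y_def\<close>)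
qed

section \<open>Zeros of \<open>F9\<close> and \<open>F4\<close> through their norms to the
  x-line\<close>

definition F9_norm :: "int list" where
  "F9_norm = [7062119191304754929485568, 226497213093199554364032, 3155316912471704771520, 21166737984507752448, 57657008868076800, 115015533065496, 925447687584, 1785513096, 1036305, - 64]"

definition F4_norm :: "int list" where
  "F4_norm = [82129368169, 920356888, 995550, - 10697, 1]"

text \<open>\<open>F9_norm\<close> has leading coefficient -64. Substituting X/64 for x and
  multiplying by -(64^8) makes it monic with integer coefficients.\<close>

lemma algebraic_int_scaled_F9_root:
  assumes "lev F9_norm a = 0" shows "algebraic_int (64 * a)"
proof -
  let ?Q = "[- 1987809834900382678478703864314863812608, - 996145277819325528059178515146211328,
    - 216831727161306664304728835358720, - 22727611851615437855655985152, - 967324091693639978188800,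
    - 30150631899921383424, - 3790633728344064, - 114272838144, - 1036305, 1 :: int]"
  have "lev ?Q (64 * a) = - (64 ^ 8) * lev F9_norm a"
    by (simp add: F9_norm_def algebra_simps)
  hence "poly (of_int_poly (Poly ?Q)) (64 * a) = 0"
    using assms by (simp add: lev_eq_poly)
  moreover have "Polynomial.lead_coeff (Poly ?Q) = 1" by simp
  ultimately show ?thesis unfolding algebraic_int_altdef_ipoly by blast
qed

lemma algebraic_int_scaled_lev:
  assumes "algebraic_int (of_int c * a :: complex)" "length p \<le> Suc n"
  shows "algebraic_int (of_int c ^ n * lev p a)"
  using assms(2)
proof (induction p arbitrary: n)
  case (Cons b p)
  show ?case
  proof (cases n)
    case 0
    thus ?thesis using Cons by (auto simp: int_imp_algebraic_int)
  next
    case (Suc m)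
    have "of_int c ^ n * lev (b # p) a = of_int (c ^ n * b) + (of_int c * a) * (of_int c ^ m * lev p a)"
      by (simp add: Suc algebra_simps)
    moreover have "algebraic_int (of_int (c ^ n * b) :: complex)"
      by (rule int_imp_algebraic_int) simp
    moreover have "algebraic_int ((of_int c * a) * (of_int c ^ m * lev p a))"
      by (rule complex_algebraic_int_add_mult(2)) (use assms(1) Cons Suc in simp_all)
    ultimately show ?thesis using complex_algebraic_int_add_mult(1) by metis
  qed
qed simp

text \<open>A Bezout identity for the polynomial and its derivative modulo 5.\<close>

definition F9_bezout_quotient :: "int list" where
  "F9_bezout_quotient = [- 1321824953023671164151501, - 1455199027349613532952704, 1275919847108118321627328,
    - 48458900627494328271936, - 2781471068785294102122128, - 1501781867274624628187704,
    1275276002709806597869096, - 2737412528976115040751728, - 179334236710084287306429,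
    - 3769550732094723920677, - 33809377168199536579, - 115178405973009656, - 274747009548498,
    - 2588400227693, - 5711776315, - 3730826, 256]"

lemma F9_norm_squarefree_identity:
  "lzero (ladd (ladd (lmul [- 1, - 1, 1, 0, - 2, - 1, 1, - 2] F9_norm)
     (lmul [2, 0, - 2, - 2, 1, 0, - 2, 1, - 2] (lderiv F9_norm)))
     (lscale (- 1) (ladd [1] (lscale 5 F9_bezout_quotient))))"
  by code_simp

text \<open>At a double root a the Bezout identity modulo 5 reads 5 W(a) = -1 with W of degree 16.
  As 64 a is an algebraic integer, so is 64^16 W(a), and 64^16 / 5 would be an integer. Working
  modulo 5 keeps the cofactors small.\<close>

lemma F9_norm_simple_roots:
  assumes "lev F9_norm a = 0" shows "lev (lderiv F9_norm) a \<noteq> 0"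
proof
  assume "lev (lderiv F9_norm) a = 0"
  hence "- 1 = 5 * lev F9_bezout_quotient a"
    using lev_lzero[OF F9_norm_squarefree_identity, of a] assms by (simp add: lev_hom)
  moreover have "lev F9_bezout_quotient a = (5 * lev F9_bezout_quotient a) / 5" by simp
  ultimately have W: "lev F9_bezout_quotient a = - 1 / 5" by (simp only:)
  have "algebraic_int (of_int 64 ^ 16 * lev F9_bezout_quotient a)"
    by (rule algebraic_int_scaled_lev)
       (use algebraic_int_scaled_F9_root[OF assms] in \<open>simp_all add: F9_bezout_quotient_def\<close>)
  hence "algebraic_int (- (64 ^ 16 / 5) :: complex)" by (simp add: W)
  hence "(- (64 ^ 16 / 5) :: complex) \<in> \<int>"
    by (rule rational_algebraic_int_is_int) simp
  then obtain k :: int where k: "(- (64 ^ 16 / 5) :: complex) = of_int k" by (auto elim: Ints_cases)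
  have "(of_int (5 * k) :: complex) = 5 * of_int k" by simp
  also have "\<dots> = of_int (- (64 ^ 16))" unfolding k[symmetric] by simp
  finally have "(of_int (- (64 ^ 16)) :: complex) = of_int (5 * k)" ..
  hence "- (64 ^ 16) = 5 * k" by (simp only: of_int_eq_iff)
  hence "- 79228162514264337593543950336 = 5 * k" by simp
  thus False by presburger
qed

lemma F9_norm_identity:
  "lzero (ladd (ladd (lscale 4 F9_norm) (lscale (- 1) (lmul (fst F9_pair) (fst F9_pair))))
     (lmul cubic (lmul (snd F9_pair) (snd F9_pair))))"
  by code_simp

lemma F4_norm_identity:
  "lzero (ladd (ladd (lscale 4 F4_norm) (lscale (- 1) (lmul (fst F4_pair) (fst F4_pair))))
     (lmul cubic (lmul (snd F4_pair) (snd F4_pair))))"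
  by code_simp

text \<open>A Bezout identity with a nonzero constant: the two norms share no root, so the formula
  for t is valid at the zeros of \<open>F9\<close> and gives the value 1 there.\<close>

lemma F4_F9_norm_coprime_identity:
  "lzero (ladd (ladd (lmul [- 8143934574832866631242148445548552200593736894428750796228349399, - 218515851151717254647579290946320137841307284256913149952697496, - 2352754972048518371962170606673264652185040718883667910130654, - 10238332773498862763238991975958369446331274750260785534487, - 2127415054994897319673504345603562792713316749853705293, - 124924435341084959184113284496410480155882256703522804, - 299487924800270910002339337188311192367012952554923, - 192485736915064870758014445711397933353073602110, 11777561733678627274818284875469021105342336] F4_norm)
     (lmul [97209448535268463550316297036252040596156089660747, 484872288196655789350313843865651974715041900349, - 1996326668338520398398720261152743998757599363, 184024402088728551169035701179203454770974] F9_norm)) [- 17648511036374330210508240056352834099572728603906006639159901830711718865])"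
  by code_simp

lemma F4_cubic_coprime_identity:
  "lzero (ladd (ladd (lmul [3760071, - 2738] cubic)
     (lmul [- 92130556, - 899658, 5476] (fst F4_pair))) [13026580286769])"
  by code_simp

lemma F9_norm_eq:
  assumes "on_E x y" shows "F9 x y * F9 x (- 1 - y) = lev F9_norm x"
proof -
  let ?B = "lev (fst F9_pair) x" and ?C = "lev (snd F9_pair) x" and ?Y = "2 * y + 1"
  have "4 * (F9 x y * F9 x (- 1 - y)) = (2 * F9 x y) * (2 * F9 x (- 1 - y))" by simp
  also have "\<dots> = (?B + ?C * ?Y) * (?B - ?C * ?Y)"
    unfolding F9_pev by (simp add: pev_def algebra_simps)
  also have "\<dots> = ?B * ?B - ?Y^2 * (?C * ?C)" by (simp add: algebra_simps power2_eq_square)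
  also have "\<dots> = 4 * lev F9_norm x"
  proof -
    have "4 * lev F9_norm x - ?B * ?B + lev cubic x * (?C * ?C) = 0"
      using lev_lzero[OF F9_norm_identity, of x] by (simp add: lev_hom)
    hence "4 * lev F9_norm x = ?B * ?B - lev cubic x * (?C * ?C)"
      by (simp add: algebra_simps)
    thus ?thesis using assms unfolding on_E_iff by simp
  qed
  finally show ?thesis by simp
qed

lemma F4_norm_eq:
  assumes "on_E x y" shows "F4 x y * F4 x (- 1 - y) = lev F4_norm x"
proof -
  let ?B = "lev (fst F4_pair) x" and ?C = "lev (snd F4_pair) x" and ?Y = "2 * y + 1"
  have "4 * (F4 x y * F4 x (- 1 - y)) = (2 * F4 x y) * (2 * F4 x (- 1 - y))" by simp
  also have "\<dots> = (?B + ?C * ?Y) * (?B - ?C * ?Y)"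
    unfolding F4_pev by (simp add: pev_def algebra_simps)
  also have "\<dots> = ?B * ?B - ?Y^2 * (?C * ?C)" by (simp add: algebra_simps power2_eq_square)
  also have "\<dots> = 4 * lev F4_norm x"
  proof -
    have "4 * lev F4_norm x - ?B * ?B + lev cubic x * (?C * ?C) = 0"
      using lev_lzero[OF F4_norm_identity, of x] by (simp add: lev_hom)
    hence "4 * lev F4_norm x = ?B * ?B - lev cubic x * (?C * ?C)"
      by (simp add: algebra_simps)
    thus ?thesis using assms unfolding on_E_iff by simp
  qed
  finally show ?thesis by simp
qed

lemma F4_F9_no_common_zero:
  assumes "on_E x y" "F9 x y = 0" shows "F4 x y \<noteq> 0"
proof
  assume "F4 x y = 0"
  hence "lev F4_norm x = 0" "lev F9_norm x = 0"
    using F9_norm_eq[OF assms(1)] F4_norm_eq[OF assms(1)] assms(2) by auto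
  thus False using lev_lzero[OF F4_F9_norm_coprime_identity, of x] by (simp add: lev_hom)
qed

text \<open>If \<open>F4\<close> vanished at both points, its part free of 2y + 1 and 2y + 1 itself
  would vanish, contradicting the coprimality above. This is how t = \<infinity> is excluded at a
  point with t(Q) = t(-Q).\<close>

lemma F4_zero_neg:
  assumes "on_E x y" "F4 x y = 0" shows "F4 x (- 1 - y) \<noteq> 0"
proof
  assume F: "F4 x (- 1 - y) = 0"
  have *: "lev (fst F4_pair) x + 91 * (2 * y + 1) = 0" "lev (fst F4_pair) x - 91 * (2 * y + 1) = 0"
    using F4_pev[of x y] F4_pev[of x "- 1 - y"] assms(2) F
    by (simp_all add: pev_def F4_pair_def algebra_simps)
  have "2 * lev (fst F4_pair) x = 0" "182 * (2 * y + 1) = 0" using * by Groebner_Basis.algebra+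
  hence 0: "lev (fst F4_pair) x = 0" "2 * y + 1 = 0" by (simp_all only: mult_eq_0_iff) simp_all
  hence "lev cubic x = 0" using assms(1) unfolding on_E_iff by simp
  thus False using lev_lzero[OF F4_cubic_coprime_identity, of x] 0 by (simp add: lev_hom)
qed

text \<open>The zeros of \<open>F9\<close> are counted by their x-coordinates, which makes the nine
  points over t = 1 visibly distinct.\<close>

lemma card_F9_norm_roots: "card {x. lev F9_norm x = 0} = 9"
proof -
  let ?p = "Poly (map of_int F9_norm) :: complex poly"
  have deg: "Polynomial.degree ?p = 9"
    by (simp add: F9_norm_def)
  have "rsquarefree ?p"
    unfolding rsquarefree_roots
  proof (intro allI notI)
    fix a assume "poly ?p a = 0 \<and> poly (pderiv ?p) a = 0"
    hence "lev F9_norm a = 0" "lev (lderiv F9_norm) a = 0"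
      by (simp_all add: lev_eq_poly[symmetric] lev_lderiv[symmetric])
    thus False using F9_norm_simple_roots by simp
  qed
  hence "Polynomial.smult (Polynomial.lead_coeff ?p) (\<Prod>z|poly ?p z = 0. [:- z, 1:]) = ?p"
    by (rule complex_poly_decompose_rsquarefree)
  moreover have "?p \<noteq> 0" using deg by auto
  ultimately have "Polynomial.degree ?p = Polynomial.degree (\<Prod>z|poly ?p z = 0. [:- z, 1:])"
    by (metis Polynomial.degree_smult_eq Polynomial.leading_coeff_0_iff)
  also have "\<dots> = card {z. poly ?p z = 0}"
    by (subst Polynomial.degree_prod_sum_eq) auto
  finally have "card {x. poly ?p x = 0} = Polynomial.degree ?p" ..
  thus ?thesis by (simp add: deg lev_eq_poly)
qed

section \<open>The quaternion algebra and its real matrix representation\<close>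

type_synonym quat = "real \<times> real \<times> real \<times> real"

text \<open>The total version of \<open>quat_mult\<close> over the reals, for which ring identities
  hold without carrier conditions.\<close>

definition qmul :: "real \<Rightarrow> real \<Rightarrow> quat \<Rightarrow> quat \<Rightarrow> quat" where
  "qmul a b = (\<lambda>(x0, x1, x2, x3) (y0, y1, y2, y3).
    (x0 * y0 + a * (x1 * y1) + b * (x2 * y2) - a * b * (x3 * y3),
     x0 * y1 + x1 * y0 + b * (x3 * y2 - x2 * y3),
     x0 * y2 + x2 * y0 + a * (x1 * y3 - x3 * y1),
     x0 * y3 + x3 * y0 + x1 * y2 - x2 * y1))"

definition qconj :: "quat \<Rightarrow> quat" where
  "qconj = (\<lambda>(x0, x1, x2, x3). (x0, - x1, - x2, - x3))"

definition K7_quats :: "quat set" where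
  "K7_quats = K7 \<times> K7 \<times> K7 \<times> K7"

lemma a_inv_K7_ring [simp]: "x \<in> K7 \<Longrightarrow> a_inv K7_ring x = - x"
proof -
  assume x: "x \<in> K7"
  have "subring K7 real_ring"
    by (rule ring.subringI[OF ring_from_type_algebra]) (auto simp: K7_closed)
  then interpret ring K7_ring
    by (rule ring.subring_is_ring[OF ring_from_type_algebra])
  show ?thesis by (rule minus_equality) (use x in \<open>simp_all add: K7_closed\<close>)
qed

lemma quat_algebra_K7_simps:
  "carrier (quat_alg_K7 a b) = K7_quats" "\<one>\<^bsub>quat_alg_K7 a b\<^esub> = (1, 0, 0, 0)"
  "\<zero>\<^bsub>quat_alg_K7 a b\<^esub> = 0" "x \<oplus>\<^bsub>quat_alg_K7 a b\<^esub> y = x + y"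
  by (auto simp: quat_algebra_def K7_quats_def zero_prod_def plus_prod_def split: prod.splits)

lemma quat_algebra_K7_mult:
  assumes "a \<in> K7" "b \<in> K7" "x \<in> K7_quats" "y \<in> K7_quats"
  shows "x \<otimes>\<^bsub>quat_alg_K7 a b\<^esub> y = qmul a b x y"
  using assms
  by (auto simp: quat_algebra_def quat_mult_def qmul_def K7_quats_def a_minus_def K7_closed split: prod.splits)

lemma qmul_K7:
  assumes "a \<in> K7" "b \<in> K7" "x \<in> K7_quats" "y \<in> K7_quats"
  shows "qmul a b x y \<in> K7_quats"
  using assms by (auto simp: qmul_def K7_quats_def K7_closed split: prod.splits)

lemma K7_quats_closed:
  "x \<in> K7_quats \<Longrightarrow> y \<in> K7_quats \<Longrightarrow> x + y \<in> K7_quats"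
  "x \<in> K7_quats \<Longrightarrow> y \<in> K7_quats \<Longrightarrow> x - y \<in> K7_quats"
  "x \<in> K7_quats \<Longrightarrow> - x \<in> K7_quats" "0 \<in> K7_quats"
  "k \<in> K7 \<Longrightarrow> x \<in> K7_quats \<Longrightarrow> k *\<^sub>R x \<in> K7_quats"
  "x \<in> K7_quats \<Longrightarrow> qconj x \<in> K7_quats"
  "k \<in> K7 \<Longrightarrow> (k, 0, 0, 0) \<in> K7_quats"
  by (auto simp: K7_quats_def plus_prod_def K7_closed zero_prod_def uminus_prod_def minus_prod_def
      qconj_def split: prod.splits)

lemma qmul_assoc: "qmul a b (qmul a b x y) z = qmul a b x (qmul a b y z)"
  by (cases x; cases y; cases z) (simp add: qmul_def algebra_simps)

lemma qmul_distrib: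
  "qmul a b (x + y) z = qmul a b x z + qmul a b y z"
  "qmul a b x (y + z) = qmul a b x y + qmul a b x z"
  "qmul a b (x - y) z = qmul a b x z - qmul a b y z"
  "qmul a b x (y - z) = qmul a b x y - qmul a b x z"
  "qmul a b (- x) z = - qmul a b x z"
  "qmul a b x (- z) = - qmul a b x z"
  by (cases x; cases y; cases z; simp add: qmul_def algebra_simps)+

lemma qmul_scaleR:
  "qmul a b (k *\<^sub>R x) y = k *\<^sub>R qmul a b x y" "qmul a b x (k *\<^sub>R y) = k *\<^sub>R qmul a b x y"
  by (cases x; cases y; simp add: qmul_def algebra_simps)+

lemma qmul_one: "qmul a b (1, 0, 0, 0) x = x" "qmul a b x (1, 0, 0, 0) = x"
  by (cases x; simp add: qmul_def)+

lemma qmul_scalar: "qmul a b (k, 0, 0, 0) x = k *\<^sub>R x"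
  by (cases x; simp add: qmul_def)

lemma qmul_qconj:
  "qmul a b x (qconj x) = (reduced_norm a b x, 0, 0, 0)"
  "qmul a b (qconj x) x = (reduced_norm a b x, 0, 0, 0)"
  by (cases x; simp add: qmul_def qconj_def reduced_norm_def algebra_simps power2_eq_square)+

lemma reduced_norm_qmul: "reduced_norm a b (qmul a b x y) = reduced_norm a b x * reduced_norm a b y"
  by (cases x; cases y) (simp add: qmul_def reduced_norm_def algebra_simps power2_eq_square)

lemma reduced_norm_qconj [simp]: "reduced_norm a b (qconj x) = reduced_norm a b x"
  by (cases x) (simp add: qconj_def reduced_norm_def)

lemma reduced_norm_scaleR: "reduced_norm a b (k *\<^sub>R x) = k^2 * reduced_norm a b x"
  by (cases x) (simp add: reduced_norm_def algebra_simps power2_eq_square)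

lemma reduced_norm_minus [simp]: "reduced_norm a b (- x) = reduced_norm a b x"
  by (cases x) (simp add: reduced_norm_def)

lemma qconj_eq: "qconj x = (2 * fst x, 0, 0, 0) - x"
  by (cases x) (simp add: qconj_def)

lemma ring_quat_algebra_K7:
  assumes "a \<in> K7" "b \<in> K7" shows "ring (quat_alg_K7 a b)"
proof (rule ringI)
  show "abelian_group (quat_alg_K7 a b)"
  proof (rule abelian_groupI)
    fix x assume "x \<in> carrier (quat_alg_K7 a b)"
    thus "\<exists>y\<in>carrier (quat_alg_K7 a b). y \<oplus>\<^bsub>quat_alg_K7 a b\<^esub> x = \<zero>\<^bsub>quat_alg_K7 a b\<^esub>"
      by (intro bexI[of _ "- x"]) (simp_all only: quat_algebra_K7_simps K7_quats_closed ab_left_minus)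
  qed (simp_all add: quat_algebra_K7_simps K7_quats_closed add_ac)
  show "monoid (quat_alg_K7 a b)"
    by (rule monoidI)
       (auto simp: quat_algebra_K7_simps quat_algebra_K7_mult[OF assms] qmul_K7[OF assms] qmul_assoc qmul_one
         K7_quats_closed K7_1)
qed (auto simp: quat_algebra_K7_simps quat_algebra_K7_mult[OF assms] qmul_K7[OF assms] K7_quats_closed qmul_distrib)

definition mmul :: "quat \<Rightarrow> quat \<Rightarrow> quat" where
  "mmul = (\<lambda>(p, q, r, s) (p', q', r', s').
    (p * p' + q * r', p * q' + q * s', r * p' + s * r', r * q' + s * s'))"

definition mtrace :: "quat \<Rightarrow> real" where "mtrace = (\<lambda>(p, q, r, s). p + s)"
definition mdet :: "quat \<Rightarrow> real" where "mdet = (\<lambda>(p, q, r, s). p * s - q * r)"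

lemma mat2_real_ring_simps:
  "x \<otimes>\<^bsub>mat2_ring real_ring\<^esub> y = mmul x y" "x \<oplus>\<^bsub>mat2_ring real_ring\<^esub> y = x + y"
  "\<one>\<^bsub>mat2_ring real_ring\<^esub> = (1, 0, 0, 1)"
  by (auto simp: mat2_ring_def mmul_def plus_prod_def split: prod.splits)

lemma mmul_assoc: "mmul (mmul x y) z = mmul x (mmul y z)"
  by (cases x; cases y; cases z) (simp add: mmul_def algebra_simps)

lemma mmul_scaleR: "mmul (k *\<^sub>R x) y = k *\<^sub>R mmul x y" "mmul x (k *\<^sub>R y) = k *\<^sub>R mmul x y"
  by (cases x; cases y; simp add: mmul_def algebra_simps)+

lemma mmul_scalar: "mmul (k, 0, 0, k) x = k *\<^sub>R x"
  by (cases x) (simp add: mmul_def)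

lemma mtrace_linear: "mtrace (x + y) = mtrace x + mtrace y" "mtrace (k *\<^sub>R x) = k * mtrace x"
  by (cases x; cases y; simp add: mtrace_def algebra_simps)+

lemma mtrace_commute: "mtrace (mmul x y) = mtrace (mmul y x)"
  by (cases x; cases y) (simp add: mtrace_def mmul_def algebra_simps)

section \<open>An order with a splitting at a real place\<close>

locale quat_order =
  fixes a b :: real and \<sigma> :: "real \<Rightarrow> real" and \<O> :: "quat set" and \<rho> :: "quat \<Rightarrow> quat"
  assumes ab: "a \<in> K7" "a \<noteq> 0" "b \<in> K7" "b \<noteq> 0"
    and sigma_hom: "\<sigma> \<in> Ring.ring_hom K7_ring real_ring"
    and order: "is_order a b \<O>"
    and splitting: "real_splitting a b \<sigma> \<rho>"
begin

abbreviation qm (infixl "\<star>" 70) where "x \<star> y \<equiv> qmul a b x y"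
abbreviation nrd where "nrd \<equiv> reduced_norm a b"

lemma sigma_add: "x \<in> K7 \<Longrightarrow> y \<in> K7 \<Longrightarrow> \<sigma> (x + y) = \<sigma> x + \<sigma> y"
  using Ring.ring_hom_add[OF sigma_hom] by simp

lemma sigma_mult: "x \<in> K7 \<Longrightarrow> y \<in> K7 \<Longrightarrow> \<sigma> (x * y) = \<sigma> x * \<sigma> y"
  using Ring.ring_hom_mult[OF sigma_hom] by simp

lemma sigma_1 [simp]: "\<sigma> 1 = 1"
  using Ring.ring_hom_one[OF sigma_hom] by simp

lemma sigma_0 [simp]: "\<sigma> 0 = 0"
  using sigma_add[of 0 0] by (simp add: K7_0)

lemma sigma_uminus: "x \<in> K7 \<Longrightarrow> \<sigma> (- x) = - \<sigma> x"
  using sigma_add[of x "- x"] by (simp add: K7_closed)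

lemma sigma_of_int [simp]: "\<sigma> (of_int n) = of_int n"
proof -
  have nat: "\<sigma> (of_nat n) = of_nat n" for n
    by (induction n) (simp_all add: sigma_add K7_1 K7_of_nat)
  show ?thesis
  proof (cases n)
    case (neg m)
    hence "\<sigma> (of_int n) = \<sigma> (- of_nat (Suc m))" by simp
    also have "\<dots> = - of_nat (Suc m)" by (subst sigma_uminus) (simp_all only: K7_of_nat nat)
    finally show ?thesis by (simp add: neg)
  qed (simp add: nat)
qed

lemma sigma_numeral [simp]: "\<sigma> (numeral k) = numeral k"
  using sigma_of_int[of "numeral k"] by simp

lemma sigma_eq_0: "x \<in> K7 \<Longrightarrow> \<sigma> x = 0 \<Longrightarrow> x = 0"
  using sigma_mult[of x "inverse x"] by (cases "x = 0") (simp_all add: K7_closed)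

lemma sigma_ipoly:
  assumes "u \<in> K7" shows "\<sigma> (poly (of_int_poly p) u) = poly (of_int_poly p) (\<sigma> u)"
proof -
  have "poly (of_int_poly p) u \<in> K7 \<and> ?thesis"
    by (induction p) (use assms in \<open>auto simp: map_poly_pCons K7_closed sigma_add sigma_mult\<close>)
  thus ?thesis ..
qed

text \<open>\<open>\<sigma>\<close> fixes integers and is injective on the field, so a monic
  integral equation for \<open>\<sigma> u\<close> pulls back to one for u.\<close>

lemma algebraic_int_sigma:
  assumes "u \<in> K7" "algebraic_int (\<sigma> u)" shows "algebraic_int u"
proof -
  obtain p where p: "poly (of_int_poly p) (\<sigma> u) = 0" "Polynomial.lead_coeff p = 1"
    using assms(2) unfolding algebraic_int_altdef_ipoly by blast
  have "poly (of_int_poly p) u \<in> K7"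
    by (induction p) (use assms in \<open>auto simp: map_poly_pCons K7_closed\<close>)
  hence "poly (of_int_poly p) u = 0"
    using p(1) sigma_ipoly[OF assms(1)] sigma_eq_0 by simp
  thus ?thesis using p(2) unfolding algebraic_int_altdef_ipoly by blast
qed

lemma rho_add: "x \<in> K7_quats \<Longrightarrow> y \<in> K7_quats \<Longrightarrow> \<rho> (x + y) = \<rho> x + \<rho> y"
  using splitting Ring.ring_hom_add[of \<rho> "quat_alg_K7 a b" "mat2_ring real_ring" x y]
  by (simp add: real_splitting_def quat_algebra_K7_simps mat2_real_ring_simps)

lemma rho_mult: "x \<in> K7_quats \<Longrightarrow> y \<in> K7_quats \<Longrightarrow> \<rho> (x \<star> y) = mmul (\<rho> x) (\<rho> y)"
  using splitting Ring.ring_hom_mult[of \<rho> "quat_alg_K7 a b" "mat2_ring real_ring" x y]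
  by (simp add: real_splitting_def quat_algebra_K7_simps mat2_real_ring_simps quat_algebra_K7_mult ab)

lemma rho_scalar: "k \<in> K7 \<Longrightarrow> \<rho> (k, 0, 0, 0) = (\<sigma> k, 0, 0, \<sigma> k)"
  using splitting by (simp add: real_splitting_def quat_scalar_def)

lemma rho_scaleR: "k \<in> K7 \<Longrightarrow> x \<in> K7_quats \<Longrightarrow> \<rho> (k *\<^sub>R x) = \<sigma> k *\<^sub>R \<rho> x"
  using rho_mult[of "(k, 0, 0, 0)" x] by (simp add: qmul_scalar rho_scalar K7_quats_closed mmul_scalar)

lemma rho_0: "\<rho> 0 = 0"
  using rho_add[of 0 0] by (simp add: K7_quats_closed)

lemma rho_uminus: "x \<in> K7_quats \<Longrightarrow> \<rho> (- x) = - \<rho> x"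
  using rho_scaleR[of "- 1" x] sigma_uminus[OF K7_1] by (simp add: K7_closed)

text \<open>The images of i and j are traceless because each anticommutes with the other, whose
  square is a nonzero scalar; the image of k is traceless because ij = -ji. So the matrix trace is
  the reduced trace.\<close>

lemma mtrace_rho:
  assumes "x \<in> K7_quats" shows "mtrace (\<rho> x) = 2 * \<sigma> (fst x)"
proof -
  define i j k :: quat where "i = (0, 1, 0, 0)" and "j = (0, 0, 1, 0)" and "k = (0, 0, 0, 1)"
  have K: "i \<in> K7_quats" "j \<in> K7_quats" "k \<in> K7_quats" "(1, 0, 0, 0) \<in> K7_quats"
    by (simp_all add: i_def j_def k_def K7_quats_def K7_closed)
  have mul: "i \<star> j = k" "j \<star> i = - k" "i \<star> i = (a, 0, 0, 0)" "j \<star> j = (b, 0, 0, 0)"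
    by (simp_all add: i_def j_def k_def qmul_def)
  have ij: "mmul (\<rho> j) (\<rho> i) = - mmul (\<rho> i) (\<rho> j)"
    using rho_mult[OF K(2,1)] rho_mult[OF K(1,2)] rho_uminus[OF K(3)] by (simp add: mul)
  have neg: "mtrace (- u) = - mtrace u" for u using mtrace_linear(2)[of "- 1" u] by simp
  have sq0: "mtrace U = 0" if "mmul V U = - mmul U V" "mmul V V = (c, 0, 0, c)" "c \<noteq> 0" for U V c
  proof -
    have "mtrace (mmul (mmul V V) U) = c * mtrace U"
      by (simp add: that(2) mmul_scalar mtrace_linear)
    moreover have "mtrace (mmul (mmul V V) U) = mtrace (mmul V (- mmul U V))"
      by (simp add: mmul_assoc that(1))
    moreover have "\<dots> = - mtrace (mmul V (mmul U V))"
      using mmul_scaleR(2)[of V "- 1" "mmul U V"] by (simp add: neg)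
    moreover have "mtrace (mmul V (mmul U V)) = mtrace (mmul (mmul V V) U)"
      by (subst mtrace_commute, subst mmul_assoc, subst mtrace_commute) (rule refl)
    ultimately have "c * mtrace U = 0" by linarith
    thus ?thesis using that(3) by simp
  qed
  have "mtrace (\<rho> i) = 0"
    by (rule sq0[of "\<rho> j" _ "\<sigma> b"]) (use ij rho_mult[OF K(2,2)] rho_scalar ab sigma_eq_0 in \<open>auto simp: mul\<close>)
  moreover have "mtrace (\<rho> j) = 0"
    by (rule sq0[of "\<rho> i" _ "\<sigma> a"]) (use ij rho_mult[OF K(1,1)] rho_scalar ab sigma_eq_0 in \<open>auto simp: mul\<close>)
  moreover have "mtrace (\<rho> k) = 0"
  proof -
    have "mtrace (\<rho> k) = mtrace (mmul (\<rho> i) (\<rho> j))" using rho_mult[OF K(1,2)] by (simp add: mul)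
    also have "\<dots> = mtrace (- mmul (\<rho> i) (\<rho> j))" using mtrace_commute[of "\<rho> i" "\<rho> j"] by (simp add: ij)
    also have "\<dots> = - mtrace (\<rho> k)" using rho_mult[OF K(1,2)] by (simp add: mul neg)
    finally show ?thesis by simp
  qed
  moreover obtain x0 x1 x2 x3 where x: "x = (x0, x1, x2, x3)" by (cases x) auto
  have xK: "x0 \<in> K7" "x1 \<in> K7" "x2 \<in> K7" "x3 \<in> K7" using assms by (simp_all add: x K7_quats_def)
  have "x = (x0, 0, 0, 0) + (x1 *\<^sub>R i + (x2 *\<^sub>R j + x3 *\<^sub>R k))"
    by (simp add: x i_def j_def k_def)
  hence "\<rho> x = \<rho> (x0, 0, 0, 0) + (\<sigma> x1 *\<^sub>R \<rho> i + (\<sigma> x2 *\<^sub>R \<rho> j + \<sigma> x3 *\<^sub>R \<rho> k))"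
    using xK K by (simp add: rho_add rho_scaleR K7_quats_closed)
  ultimately show ?thesis
    using xK by (simp add: mtrace_linear rho_scalar) (simp add: mtrace_def x)
qed

lemma rho_qconj:
  assumes "x \<in> K7_quats" "\<rho> x = (p, q, r, s)" shows "\<rho> (qconj x) = (s, - q, - r, p)"
proof -
  have f: "fst x \<in> K7" using assms(1) by (auto simp: K7_quats_def)
  have "\<rho> (qconj x) = \<rho> ((2 * fst x, 0, 0, 0) + - x)" by (simp add: qconj_eq)
  also have "\<dots> = (2 * \<sigma> (fst x), 0, 0, 2 * \<sigma> (fst x)) + - \<rho> x"
    using f assms(1) by (simp only: rho_add rho_scalar rho_uminus K7_quats_closed K7_closed sigma_mult sigma_numeral)
  also have "2 * \<sigma> (fst x) = p + s" using mtrace_rho[OF assms(1)] by (simp add: assms(2) mtrace_def)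
  finally show ?thesis by (simp add: assms(2))
qed

lemma nrd_K7: "x \<in> K7_quats \<Longrightarrow> nrd x \<in> K7"
  using ab by (auto simp: K7_quats_def reduced_norm_def K7_closed)

lemma mdet_rho:
  assumes "x \<in> K7_quats" shows "mdet (\<rho> x) = \<sigma> (nrd x)"
proof -
  obtain p q r s where x: "\<rho> x = (p, q, r, s)" by (cases "\<rho> x") auto
  have "\<rho> (x \<star> qconj x) = mmul (\<rho> x) (\<rho> (qconj x))"
    by (rule rho_mult) (use assms in \<open>auto simp: K7_quats_closed\<close>)
  thus ?thesis using nrd_K7[OF assms]
    by (simp add: qmul_qconj rho_scalar rho_qconj[OF assms x] x mmul_def mdet_def mult.commute)
qed

text \<open>Nondegeneracy of the trace form: if x maps to 0, then the reduced trace of x y vanishes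
  for all y, and y = 1, i, j, k read off the coordinates of x.\<close>

lemma rho_eq_0:
  assumes "x \<in> K7_quats" "\<rho> x = 0" shows "x = 0"
proof -
  have *: "fst (x \<star> y) = 0" if "y \<in> K7_quats" for y
  proof -
    have "\<rho> (x \<star> y) = 0"
      using rho_mult[OF assms(1) that] assms(2) by (cases "\<rho> y") (simp add: mmul_def zero_prod_def)
    hence "\<sigma> (fst (x \<star> y)) = 0"
      using mtrace_rho[OF qmul_K7[OF ab(1,3) assms(1) that]] by (simp add: mtrace_def zero_prod_def)
    moreover have "fst (x \<star> y) \<in> K7" using qmul_K7[OF ab(1,3) assms(1) that] by (auto simp: K7_quats_def)
    ultimately show ?thesis by (rule sigma_eq_0[rotated])
  qed
  obtain x0 x1 x2 x3 where x: "x = (x0, x1, x2, x3)" by (cases x) auto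
  have "x0 = 0" "x1 = 0" "x2 = 0" "x3 = 0"
    using *[of "(1, 0, 0, 0)"] *[of "(0, 1, 0, 0)"] *[of "(0, 0, 1, 0)"] *[of "(0, 0, 0, 1)"] ab
    by (simp_all add: x qmul_def K7_quats_def K7_closed)
  thus ?thesis by (simp add: x zero_prod_def)
qed

lemma rho_inj: "x \<in> K7_quats \<Longrightarrow> y \<in> K7_quats \<Longrightarrow> \<rho> x = \<rho> y \<Longrightarrow> x = y"
  using rho_eq_0[of "x - y"] rho_add[of x "- y"] by (simp add: K7_quats_closed rho_uminus)

text \<open>With \<open>\<ell>\<close> a left eigenvector of \<open>\<rho> g\<close>, the entries of the rows \<open>\<ell> \<rho>(x)\<close>, \<open>x \<in> \<O>\<close>, lie in a
  finitely generated module stable under the eigenvalue.\<close>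

lemma quat_span_eq:
  assumes "finite S" "S \<subseteq> K7_quats" "R \<subseteq> K7"
  shows "quat_span a b R S = {(\<Sum>s\<in>S. c s *\<^sub>R s) |c. c \<in> S \<rightarrow> R}"
proof -
  interpret A: ring "quat_alg_K7 a b" by (rule ring_quat_algebra_K7) (use ab in auto)
  have "(\<Oplus>\<^bsub>quat_alg_K7 a b\<^esub>s\<in>S. quat_scalar (c s) \<otimes>\<^bsub>quat_alg_K7 a b\<^esub> s) = (\<Sum>s\<in>S. c s *\<^sub>R s)"
    if "c \<in> S \<rightarrow> R" for c
    using assms(1) assms(2) that
  proof (induction S)
    case (insert s S)
    have c: "c s' \<in> K7" "s' \<in> K7_quats" if "s' \<in> insert s S" for s'
      using insert.prems assms(3) that by auto
    have e: "quat_scalar (c s') \<otimes>\<^bsub>quat_alg_K7 a b\<^esub> s' = c s' *\<^sub>R s'" if "s' \<in> insert s S" for s'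
      using c[OF that] by (simp add: quat_scalar_def quat_algebra_K7_mult ab K7_quats_closed qmul_scalar)
    let ?f = "\<lambda>s'. quat_scalar (c s') \<otimes>\<^bsub>quat_alg_K7 a b\<^esub> s'"
    have f: "?f s' \<in> carrier (quat_alg_K7 a b)" if "s' \<in> insert s S" for s'
      unfolding e[OF that] quat_algebra_K7_simps using c[OF that] by (rule K7_quats_closed)
    have "finsum (quat_alg_K7 a b) ?f (insert s S) = ?f s \<oplus>\<^bsub>quat_alg_K7 a b\<^esub> finsum (quat_alg_K7 a b) ?f S"
      by (rule A.finsum_insert) (use insert.hyps f in auto)
    also have "finsum (quat_alg_K7 a b) ?f S = (\<Sum>s\<in>S. c s *\<^sub>R s)"
      by (rule insert.IH) (use insert.prems in auto)
    also have "?f s \<oplus>\<^bsub>quat_alg_K7 a b\<^esub> (\<Sum>s\<in>S. c s *\<^sub>R s) = (\<Sum>s\<in>insert s S. c s *\<^sub>R s)"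
      using e[of s] insert.hyps by (simp add: quat_algebra_K7_simps)
    finally show ?case .
  qed (simp add: quat_algebra_K7_simps)
  thus ?thesis unfolding quat_span_def Setcompr_eq_image by (rule image_cong[OF refl])
qed

lemma order_generators:
  obtains S where "finite S" "S \<subseteq> \<O>" "\<O> \<subseteq> K7_quats"
    "\<O> = {(\<Sum>s\<in>S. c s *\<^sub>R s) |c. c \<in> S \<rightarrow> OK7}"
proof -
  obtain S where S: "finite S" "S \<subseteq> K7_quats" "\<O> = quat_span a b OK7 S"
    using order by (auto simp: is_order_def quat_algebra_K7_simps)
  hence O: "\<O> = {(\<Sum>s\<in>S. c s *\<^sub>R s) |c. c \<in> S \<rightarrow> OK7}"
    using quat_span_eq[of S OK7] OK7_subset_K7 by auto
  have "S \<subseteq> \<O>"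
  proof
    fix s assume s: "s \<in> S"
    have "(\<Sum>s'\<in>S. (if s' = s then 1 else 0) *\<^sub>R s') = (\<Sum>s'\<in>S. if s' = s then s' else 0)"
      by (intro sum.cong) auto
    also have "\<dots> = s" using S(1) s by simp
    finally show "s \<in> \<O>" unfolding O
      by (intro CollectI exI[of _ "\<lambda>s'. if s' = s then 1 else 0"]) (auto simp: OK7_closed)
  qed
  moreover have "\<O> \<subseteq> K7_quats"
  proof -
    have "\<O> \<subseteq> carrier (quat_alg_K7 a b)"
      using order unfolding is_order_def by (meson subringE(1))
    thus ?thesis by (simp add: quat_algebra_K7_simps)
  qed
  ultimately show ?thesis using that S(1) O by blast
qed

lemma O_K7: "x \<in> \<O> \<Longrightarrow> x \<in> K7_quats"
  by (rule order_generators) blast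

lemma subring_O: "subring \<O> (quat_alg_K7 a b)"
  using order by (simp add: is_order_def)

lemma O_add: "x \<in> \<O> \<Longrightarrow> y \<in> \<O> \<Longrightarrow> x + y \<in> \<O>"
  using subringE(7)[OF subring_O] by (simp add: quat_algebra_K7_simps)

lemma O_mult: "x \<in> \<O> \<Longrightarrow> y \<in> \<O> \<Longrightarrow> x \<star> y \<in> \<O>"
  using subringE(6)[OF subring_O, of x y] by (simp add: quat_algebra_K7_mult ab O_K7)

lemma O_1: "(1, 0, 0, 0) \<in> \<O>"
  using subringE(3)[OF subring_O] by (simp add: quat_algebra_K7_simps)

lemma O_scaleR: "k \<in> OK7 \<Longrightarrow> x \<in> \<O> \<Longrightarrow> k *\<^sub>R x \<in> \<O>"
proof -
  assume k: "k \<in> OK7" and x: "x \<in> \<O>"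
  obtain S where S: "\<O> = {(\<Sum>s\<in>S. c s *\<^sub>R s) |c. c \<in> S \<rightarrow> OK7}"
    by (rule order_generators)
  then obtain c where c: "c \<in> S \<rightarrow> OK7" "x = (\<Sum>s\<in>S. c s *\<^sub>R s)" using x by blast
  have "k *\<^sub>R x = (\<Sum>s\<in>S. (k * c s) *\<^sub>R s)" by (simp add: c scaleR_sum_right)
  moreover have "(\<lambda>s. k * c s) \<in> S \<rightarrow> OK7" using c k by (intro Pi_I OK7_mult) blast+
  ultimately show ?thesis by (subst S, intro CollectI exI[of _ "\<lambda>s. k * c s"] conjI)
qed

lemma O_uminus: "x \<in> \<O> \<Longrightarrow> - x \<in> \<O>"
  using O_scaleR[of "- 1" x] OK7_uminus[OF OK7_1] by simp

lemma O_diff: "x \<in> \<O> \<Longrightarrow> y \<in> \<O> \<Longrightarrow> x - y \<in> \<O>"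
  using O_add[of x "- y"] O_uminus by simp

lemma O_0: "0 \<in> \<O>"
  using O_diff[OF O_1 O_1] by simp

lemma O_scalar: "k \<in> OK7 \<Longrightarrow> (k, 0, 0, 0) \<in> \<O>"
  using O_scaleR[OF _ O_1] by simp

lemma rho_sum:
  assumes "finite S" "S \<subseteq> K7_quats" "c \<in> S \<rightarrow> K7"
  shows "\<rho> (\<Sum>s\<in>S. c s *\<^sub>R s) = (\<Sum>s\<in>S. \<sigma> (c s) *\<^sub>R \<rho> s) \<and> (\<Sum>s\<in>S. c s *\<^sub>R s) \<in> K7_quats"
  using assms
  by (induction S) (auto simp: rho_0 K7_quats_closed rho_add rho_scaleR)

lemma sigma_trip:
  "\<sigma> (trip (of_int i) (of_int j) (of_int k) eta) = trip (of_int i) (of_int j) (of_int k) (\<sigma> eta)"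
  by (simp add: trip_def sigma_add sigma_mult K7_closed power2_eq_square)

lemma eigenvalue_algebraic_int:
  fixes lam l1 l2 :: complex
  assumes g: "g \<in> \<O>" "\<rho> g = (p, q, r, s)" and l: "l1 \<noteq> 0 \<or> l2 \<noteq> 0"
    and ev: "l1 * of_real p + l2 * of_real r = lam * l1" "l1 * of_real q + l2 * of_real s = lam * l2"
  shows "algebraic_int lam"
proof -
  obtain S where S: "finite S" "S \<subseteq> \<O>" "\<O> \<subseteq> K7_quats"
    "\<O> = {(\<Sum>s\<in>S. c s *\<^sub>R s) |c. c \<in> S \<rightarrow> OK7}"
    by (rule order_generators)
  define row1 row2 :: "quat \<Rightarrow> complex" where
    "row1 = (\<lambda>(p, q, r, s). l1 * of_real p + l2 * of_real r)" and
    "row2 = (\<lambda>(p, q, r, s). l1 * of_real q + l2 * of_real s)"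
  have lin: "row1 (x + y) = row1 x + row1 y" "row1 (k *\<^sub>R x) = of_real k * row1 x" "row1 0 = 0"
    "row2 (x + y) = row2 x + row2 y" "row2 (k *\<^sub>R x) = of_real k * row2 x" "row2 0 = 0" for x y k
    by (cases x; cases y; simp add: row1_def row2_def algebra_simps zero_prod_def)+
  have mul: "row1 (mmul (\<rho> g) x) = lam * row1 x" "row2 (mmul (\<rho> g) x) = lam * row2 x" for x
  proof -
    obtain p' q' r' s' where x: "x = (p', q', r', s')" by (cases x) auto
    have "row1 (mmul (\<rho> g) x) = (l1 * of_real p + l2 * of_real r) * of_real p' + (l1 * of_real q + l2 * of_real s) * of_real r'"
      by (simp add: row1_def x g mmul_def algebra_simps)
    also have "\<dots> = lam * row1 x" unfolding ev by (simp add: row1_def x algebra_simps)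
    finally show "row1 (mmul (\<rho> g) x) = lam * row1 x" .
    have "row2 (mmul (\<rho> g) x) = (l1 * of_real p + l2 * of_real r) * of_real q' + (l1 * of_real q + l2 * of_real s) * of_real s'"
      by (simp add: row2_def x g mmul_def algebra_simps)
    also have "\<dots> = lam * row2 x" unfolding ev by (simp add: row2_def x algebra_simps)
    finally show "row2 (mmul (\<rho> g) x) = lam * row2 x" .
  qed
  have main: "algebraic_int lam"
    if row: "\<And>x y. row (x + y) = row x + row y" "\<And>k x. row (k *\<^sub>R x) = of_real k * row x" "row 0 = 0"
      "\<And>x. row (mmul (\<rho> g) x) = lam * row x" and nz: "row (1, 0, 0, 1) \<noteq> 0" for row :: "quat \<Rightarrow> complex"
  proof -
    have row_sum: "row (\<Sum>s\<in>S. c s *\<^sub>R f s) = (\<Sum>s\<in>S. of_real (c s) * row (f s))" for c f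
      using S(1) by (induction S) (simp_all add: row)
    define I where "I = {..<3::nat} \<times> S"
    define w where "w = (\<lambda>(k, s). of_real (\<sigma> eta) ^ k * row (\<rho> s))"
    have fin: "finite I" using S(1) by (simp add: I_def)
    have expand: "row (\<rho> x) = (\<Sum>s\<in>S. of_real (\<sigma> (c s)) * row (\<rho> s))"
      if "x = (\<Sum>s\<in>S. c s *\<^sub>R s)" "c \<in> S \<rightarrow> OK7" for x c
    proof -
      have "\<rho> x = (\<Sum>s\<in>S. \<sigma> (c s) *\<^sub>R \<rho> s)"
        unfolding that(1) using rho_sum[of S c] S that(2) OK7_subset_K7 by blast
      thus ?thesis by (simp add: row_sum)
    qed
    have base: "of_real (\<sigma> k) * row (\<rho> s) \<in> int_span I w" if "k \<in> OK7" "s \<in> S" for k s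
    proof -
      obtain i j l where k: "k = trip (of_int i) (of_int j) (of_int l) eta"
        using OK7_imp_trip[OF \<open>k \<in> OK7\<close>] .
      have "of_real (\<sigma> k) * row (\<rho> s) = of_int i * w (0, s) + of_int j * w (1, s) + of_int l * w (2, s)"
        unfolding k sigma_trip by (simp add: trip_def w_def algebra_simps)
      moreover have "w (n, s) \<in> int_span I w" if "n < 3" for n
        by (rule int_span_base[OF fin]) (use that \<open>s \<in> S\<close> in \<open>simp add: I_def\<close>)
      ultimately show ?thesis by (simp only: int_span_add int_span_mult)
    qed
    have span: "of_real (\<sigma> k) * row (\<rho> x) \<in> int_span I w" if kx: "k \<in> OK7" "x \<in> \<O>" for k x
    proof -
      obtain c where c: "x = (\<Sum>s\<in>S. c s *\<^sub>R s)" "c \<in> S \<rightarrow> OK7" using kx(2) S(4) by blast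
      have "of_real (\<sigma> k) * row (\<rho> x) = (\<Sum>s\<in>S. of_real (\<sigma> (k * c s)) * row (\<rho> s))"
        unfolding expand[OF c] sum_distrib_left
      proof (intro sum.cong refl)
        fix s assume "s \<in> S"
        thus "of_real (\<sigma> k) * (of_real (\<sigma> (c s)) * row (\<rho> s)) = of_real (\<sigma> (k * c s)) * row (\<rho> s)"
          using c(2) kx(1) by (subst sigma_mult) (auto intro!: OK7_subset_K7)
      qed
      thus ?thesis using c(2) kx(1) by (auto intro!: int_span_sum base OK7_mult)
    qed
    \<comment> \<open>The generated module is nonzero because 1 lies in the order and the functional
      does not vanish at the identity matrix.\<close>
    have "\<exists>s\<in>S. row (\<rho> s) \<noteq> 0"
    proof (rule ccontr)
      assume z: "\<not> (\<exists>s\<in>S. row (\<rho> s) \<noteq> 0)"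
      obtain c where c: "(1, 0, 0, 0) = (\<Sum>s\<in>S. c s *\<^sub>R s)" "c \<in> S \<rightarrow> OK7" using O_1 S(4) by blast
      have "row (\<rho> (1, 0, 0, 0)) = 0" unfolding expand[OF c] using z by (intro sum.neutral) auto
      thus False using nz by (simp add: rho_scalar K7_closed)
    qed
    then obtain s0 where s0: "s0 \<in> S" "row (\<rho> s0) \<noteq> 0" by blast
    show ?thesis
    proof (rule int_span_stable_algebraic_int[of I "(0, s0)" w])
      fix ks assume "ks \<in> I"
      then obtain k s where ks: "ks = (k, s)" "s \<in> S" by (auto simp: I_def)
      have "\<sigma> eta ^ k = \<sigma> (eta ^ k)" by (induction k) (simp_all add: sigma_mult K7_closed)
      have "s \<in> \<O>" using ks(2) S(2) by blast
      hence "row (\<rho> (g \<star> s)) = lam * row (\<rho> s)"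
        using rho_mult[OF O_K7[OF g(1)] O_K7[of s]] by (simp add: row(4))
      hence "lam * w ks = of_real (\<sigma> (eta ^ k)) * row (\<rho> (g \<star> s))"
        using \<open>\<sigma> eta ^ k = \<sigma> (eta ^ k)\<close> by (simp add: w_def ks(1) flip: of_real_power)
      moreover have "eta ^ k \<in> OK7" by (induction k) (use OK7_trip[of 0 1 0] in \<open>auto simp: OK7_closed trip_def\<close>)
      ultimately show "lam * w ks \<in> int_span I w"
        using span[OF _ O_mult[OF g(1) \<open>s \<in> \<O>\<close>]] by simp
    qed (use s0 fin in \<open>auto simp: I_def w_def\<close>)
  qed
  \<comment> \<open>The two columns give two functionals, with values l1 and l2 at the identity
    matrix; one of them is usable.\<close>
  show ?thesis
  proof (cases "l1 = 0")
    case False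
    show ?thesis by (rule main[of row1, OF lin(1-3) mul(1)]) (use False in \<open>simp add: row1_def\<close>)
  next
    case True
    show ?thesis by (rule main[of row2, OF lin(4-6) mul(2)]) (use True l in \<open>simp add: row2_def\<close>)
  qed
qed

text \<open>Both roots of the characteristic polynomial of \<open>\<rho> g\<close> are eigenvalues
  and hence algebraic integers. Their sum and product are the images under \<open>\<sigma>\<close>
  of the reduced trace and norm.\<close>

lemma order_integral:
  assumes "g \<in> \<O>" shows "2 * fst g \<in> OK7" "nrd g \<in> OK7"
proof -
  obtain p q r s where g: "\<rho> g = (p, q, r, s)" by (cases "\<rho> g") auto
  have gK: "g \<in> K7_quats" by (rule O_K7[OF assms])
  hence K: "2 * fst g \<in> K7" "nrd g \<in> K7" by (auto simp: K7_quats_def nrd_K7 K7_closed)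
  define T D where "T = complex_of_real (p + s)" and "D = complex_of_real (p * s - q * r)"
  have T: "p + s = \<sigma> (2 * fst g)" and D: "p * s - q * r = \<sigma> (nrd g)"
    using mtrace_rho[OF gK] mdet_rho[OF gK] gK
    by (auto simp: g mtrace_def mdet_def K7_quats_def sigma_mult K7_closed)
  have ev: "algebraic_int x" if "x^2 - T * x + D = 0" for x
  proof -
    have ch: "x * x - of_real p * x - of_real s * x + of_real p * of_real s - of_real q * of_real r = 0"
      using that by (simp add: T_def D_def power2_eq_square algebra_simps)
    \<comment> \<open>Each of (r, x - p) and (x - s, q) is a left eigenvector unless it is zero; if
      both are zero, the matrix is scalar and any row vector serves.\<close>
    show ?thesis
    proof (cases "r \<noteq> 0 \<or> x \<noteq> of_real p")
      case True
      show ?thesis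
        by (rule eigenvalue_algebraic_int[OF assms g, of "of_real r" "x - of_real p"])
           (use True ch in \<open>auto simp: algebra_simps add_eq_0_iff diff_eq_eq eq_diff_eq\<close>)
    next
      case False
      show ?thesis
      proof (cases "q \<noteq> 0 \<or> x \<noteq> of_real s")
        case True
        show ?thesis
          by (rule eigenvalue_algebraic_int[OF assms g, of "x - of_real s" "of_real q"])
             (use True ch in \<open>auto simp: algebra_simps add_eq_0_iff diff_eq_eq eq_diff_eq\<close>)
      next
        case False
        show ?thesis
          by (rule eigenvalue_algebraic_int[OF assms g, of 1 0])
             (use False \<open>\<not> (r \<noteq> 0 \<or> x \<noteq> of_real p)\<close> in auto)
      qed
    qed
  qed
  define w where "w = csqrt (T^2 - 4 * D)"
  have w: "w^2 = T^2 - 4 * D" by (simp add: w_def)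
  define x1 x2 where "x1 = (T + w) / 2" and "x2 = (T - w) / 2"
  have D4: "D = (T^2 - w^2) / 4" using w by simp
  have "x1^2 - T * x1 + D = 0" "x2^2 - T * x2 + D = 0"
    unfolding D4 by (simp_all add: x1_def x2_def field_simps power2_eq_square)
  hence "algebraic_int x1" "algebraic_int x2" using ev by blast+
  hence "algebraic_int (x1 + x2)" "algebraic_int (x1 * x2)" by (auto intro: complex_algebraic_int_add_mult)
  moreover have "x1 + x2 = T" "x1 * x2 = D"
    unfolding D4 by (simp_all add: x1_def x2_def field_simps power2_eq_square)
  ultimately have "algebraic_int (\<sigma> (2 * fst g))" "algebraic_int (\<sigma> (nrd g))"
    unfolding T_def D_def T D algebraic_int_of_real_iff by simp_all
  thus "2 * fst g \<in> OK7" "nrd g \<in> OK7"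
    using algebraic_int_sigma K by (simp_all add: OK7_def)
qed

lemma O_qconj: "g \<in> \<O> \<Longrightarrow> qconj g \<in> \<O>"
  unfolding qconj_eq by (intro O_diff O_scalar order_integral)

abbreviation "\<Gamma> \<equiv> Gamma1 a b \<O>"

lemma Gamma_1: "(1, 0, 0, 0) \<in> \<Gamma>"
  by (simp add: Gamma1_def O_1 reduced_norm_def)

lemma Gamma_mult: "g \<in> \<Gamma> \<Longrightarrow> h \<in> \<Gamma> \<Longrightarrow> g \<star> h \<in> \<Gamma>"
  by (simp add: Gamma1_def O_mult reduced_norm_qmul)

lemma Gamma_qconj: "g \<in> \<Gamma> \<Longrightarrow> qconj g \<in> \<Gamma>"
  by (simp add: Gamma1_def O_qconj)

lemma Gamma_O: "g \<in> \<Gamma> \<Longrightarrow> g \<in> \<O>"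
  by (simp add: Gamma1_def)

lemma Gamma_inverse:
  assumes "g \<in> \<Gamma>" shows "g \<star> qconj g = (1, 0, 0, 0)" "qconj g \<star> g = (1, 0, 0, 0)"
  using assms by (simp_all add: qmul_qconj Gamma1_def)

end

section \<open>The residue field and reduction modulo 3\<close>

lemma domain_OK7_ring: "domain OK7_ring"
proof -
  interpret R: field real_ring by (rule field_from_type_algebra)
  have "subring OK7 real_ring"
    by (rule R.subringI) (auto simp: OK7_closed)
  thus ?thesis by (rule R.subring_is_domain)
qed

lemma a_inv_OK7_ring [simp]: "x \<in> OK7 \<Longrightarrow> a_inv OK7_ring x = - x"
proof -
  assume x: "x \<in> OK7"
  interpret domain OK7_ring by (rule domain_OK7_ring)
  show ?thesis by (rule minus_equality) (use x in \<open>simp_all add: OK7_closed\<close>)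
qed

definition three_OK7 :: "real set" where "three_OK7 = {3 * x |x. x \<in> OK7}"

lemma ideal_three_OK7: "ideal three_OK7 OK7_ring"
proof -
  interpret domain OK7_ring by (rule domain_OK7_ring)
  have add: "u + v \<in> three_OK7" if uv: "u \<in> three_OK7" "v \<in> three_OK7" for u v
  proof -
    obtain x y where "u = 3 * x" "v = 3 * y" "x \<in> OK7" "y \<in> OK7" using uv by (auto simp: three_OK7_def)
    hence "u + v = 3 * (x + y)" "x + y \<in> OK7" by (simp_all add: OK7_closed)
    thus ?thesis unfolding three_OK7_def by blast
  qed
  have mul: "u * v \<in> three_OK7" if uv: "u \<in> three_OK7" "v \<in> OK7" for u v
  proof -
    obtain x where "u = 3 * x" "x \<in> OK7" using uv by (auto simp: three_OK7_def)
    hence "u * v = 3 * (x * v)" "x * v \<in> OK7" using uv by (simp_all add: OK7_closed)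
    thus ?thesis unfolding three_OK7_def by blast
  qed
  have sub: "three_OK7 \<subseteq> OK7" by (auto simp: three_OK7_def OK7_closed)
  show ?thesis
  proof (rule idealI[OF ring_axioms])
    have "inv\<^bsub>add_monoid OK7_ring\<^esub> u \<in> three_OK7" if u: "u \<in> three_OK7" for u
    proof -
      have "inv\<^bsub>add_monoid OK7_ring\<^esub> u = - u"
        using a_inv_OK7_ring[of u] u sub unfolding a_inv_def by auto
      also have "\<dots> = u * (- 1)" by simp
      finally show ?thesis using mul[OF u, of "- 1"] by (simp add: OK7_closed)
    qed
    moreover have "0 \<in> three_OK7" unfolding three_OK7_def using OK7_0 by force
    ultimately show "subgroup three_OK7 (add_monoid OK7_ring)"
      by (intro subgroup.intro) (use sub add in auto)
  qed (use mul in \<open>auto simp: mult.commute\<close>)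
qed

definition residue :: "real \<Rightarrow> real set" where
  "residue x = three_OK7 +>\<^bsub>OK7_ring\<^esub> x"

lemma F27_eq: "F27 = OK7_ring Quot three_OK7"
  by (simp add: F27_def three_OK7_def)

lemma residue_hom: "residue \<in> Ring.ring_hom OK7_ring F27"
  using ideal.rcos_ring_hom[OF ideal_three_OK7] by (simp add: F27_eq residue_def[abs_def])

lemma cring_F27: "cring F27"
proof -
  interpret domain OK7_ring by (rule domain_OK7_ring)
  show ?thesis unfolding F27_eq by (rule ideal.quotient_is_cring[OF ideal_three_OK7 cring_axioms])
qed

lemma residue_eq_zero_iff:
  assumes "x \<in> OK7" shows "residue x = \<zero>\<^bsub>F27\<^esub> \<longleftrightarrow> x \<in> three_OK7"
proof -
  interpret ideal three_OK7 OK7_ring by (rule ideal_three_OK7)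
  have "\<zero>\<^bsub>F27\<^esub> = three_OK7" by (simp add: F27_eq FactRing_def)
  moreover have "x \<in> three_OK7 +>\<^bsub>OK7_ring\<^esub> x" using assms by (intro a_rcos_self) simp
  moreover have "three_OK7 +>\<^bsub>OK7_ring\<^esub> x = three_OK7" if "x \<in> three_OK7"
    using that by (rule a_rcos_const)
  ultimately show ?thesis unfolding residue_def by auto
qed

lemma residue_eq_iff:
  assumes "x \<in> OK7" "y \<in> OK7" "x - y \<in> three_OK7" shows "residue x = residue y"
proof -
  interpret F: cring F27 by (rule cring_F27)
  have c: "residue z \<in> carrier F27" if "z \<in> OK7" for z
    using ring_hom_closed[OF residue_hom] that by simp
  have "residue x = residue (x - y) \<oplus>\<^bsub>F27\<^esub> residue y"
    using Ring.ring_hom_add[OF residue_hom, of "x - y" y] assms by (simp add: OK7_closed)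
  thus ?thesis using residue_eq_zero_iff[of "x - y"] assms c by (simp add: OK7_closed)
qed

lemma F27_carrierE:
  assumes "w \<in> carrier F27" obtains x where "x \<in> OK7" "w = residue x"
  using assms unfolding F27_eq residue_def by (auto simp: FactRing_def A_RCOSETS_def RCOSETS_def a_r_coset_def)

lemma one_notin_three_OK7: "1 \<notin> three_OK7"
proof
  assume "1 \<in> three_OK7"
  then obtain x where "x \<in> OK7" "1 = 3 * x" by (auto simp: three_OK7_def)
  hence "x = 1 / 3" "algebraic_int x" by (simp_all add: OK7_def)
  hence "algebraic_int (1 / 3 :: real)" by (simp only:)
  hence "(1 / 3 :: real) \<in> \<int>" by (rule rational_algebraic_int_is_int) auto
  then obtain k :: int where "(1 / 3 :: real) = of_int k" by (auto elim: Ints_cases)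
  hence "real_of_int 1 = of_int (3 * k)" by simp
  hence "1 = 3 * k" by (simp only: of_int_eq_iff)
  thus False by presburger
qed

text \<open>Multiplying x by its cofactor gives its norm N, which is prime to 3 by inertness. As N^2
  = 1 modulo 3, the cofactor times N inverts x.\<close>

lemma field_F27: "field F27"
proof -
  interpret F: cring F27 by (rule cring_F27)
  have one: "residue 1 = \<one>\<^bsub>F27\<^esub>" using Ring.ring_hom_one[OF residue_hom] by simp
  have nz: "\<one>\<^bsub>F27\<^esub> \<noteq> \<zero>\<^bsub>F27\<^esub>"
    using residue_eq_zero_iff[OF OK7_1] one_notin_three_OK7 one by simp
  have "w \<in> Units F27" if w: "w \<in> carrier F27" "w \<noteq> \<zero>\<^bsub>F27\<^esub>" for w
  proof -
    obtain x where x: "x \<in> OK7" "w = residue x" using F27_carrierE[OF w(1)] .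
    obtain p q r :: int where pqr: "x = trip (of_int p) (of_int q) (of_int r) eta"
      using OK7_imp_trip[OF x(1)] .
    define N where "N = cubic_norm p q r"
    have "\<not> 3 dvd N"
    proof
      assume "3 dvd N"
      then obtain p' q' r' where "p = 3 * p'" "q = 3 * q'" "r = 3 * r'"
        using cubic_norm_mod3[of p q r] by (auto simp: N_def elim!: dvdE)
      hence "x = 3 * trip (of_int p') (of_int q') (of_int r') eta" by (simp add: pqr trip_def algebra_simps)
      hence "x \<in> three_OK7" using OK7_trip by (auto simp: three_OK7_def)
      thus False using w(2) residue_eq_zero_iff[OF x(1)] x(2) by simp
    qed
    hence "N mod 3 = 1 \<or> N mod 3 = 2" by presburger
    hence "(N * N) mod 3 = 1" by (auto simp: mod_mult_eq[of N 3 N, symmetric])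
    define k where "k = (N * N) div 3"
    have k: "N * N = 3 * k + 1" using \<open>(N * N) mod 3 = 1\<close> unfolding k_def by presburger
    define y where "y = trip (of_int ((p + 2 * r) * (p - q + 3 * r) - (q - r) * (2 * q - r)))
      (of_int (r * (2 * q - r) - q * (p - q + 3 * r))) (of_int (q * (q - r) - r * (p + 2 * r))) eta"
    have "x * y = of_int N"
      using cubic_norm_cofactor[OF eta_cubic, of "of_int p" "of_int q" "of_int r"]
      by (simp add: pqr y_def trip_def N_def cubic_norm_def)
    hence xy: "x * (y * of_int N) = 1 + 3 * of_int k"
      using arg_cong[OF k, of real_of_int] by (simp add: mult.assoc[symmetric])
    have y: "y * of_int N \<in> OK7" unfolding y_def by (intro OK7_mult OK7_trip OK7_of_int)
    have "residue x \<otimes>\<^bsub>F27\<^esub> residue (y * of_int N) = residue (1 + 3 * of_int k)"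
      using Ring.ring_hom_mult[OF residue_hom, of x "y * of_int N"] x y xy by simp
    also have "\<dots> = residue 1"
      by (rule residue_eq_iff) (auto simp: OK7_closed three_OK7_def)
    finally have "w \<otimes>\<^bsub>F27\<^esub> residue (y * of_int N) = \<one>\<^bsub>F27\<^esub>" by (simp add: x one)
    moreover have "residue (y * of_int N) \<in> carrier F27"
      using ring_hom_closed[OF residue_hom] y by simp
    ultimately show ?thesis using w(1) F.m_comm unfolding Units_def by fastforce
  qed
  moreover have "\<zero>\<^bsub>F27\<^esub> \<notin> Units F27"
    using nz F.Units_r_inv_ex[of "\<zero>\<^bsub>F27\<^esub>"] F.l_null by auto
  ultimately have "Units F27 = carrier F27 - {\<zero>\<^bsub>F27\<^esub>}"
    using F.Units_closed by blast
  thus ?thesis by (rule F.cring_fieldI)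
qed

text \<open>An upper bound is enough: 27 different elements will be produced as slopes of bottom
  rows.\<close>

lemma card_F27: "finite (carrier F27) \<and> card (carrier F27) \<le> 27"
proof -
  let ?A = "{0, 1, 2 :: int} \<times> {0, 1, 2 :: int} \<times> {0, 1, 2 :: int}"
  let ?f = "\<lambda>(p, q, r). residue (trip (of_int p) (of_int q) (of_int r) eta)"
  have "carrier F27 \<subseteq> ?f ` ?A"
  proof
    fix w assume "w \<in> carrier F27"
    then obtain x where x: "x \<in> OK7" "w = residue x" by (rule F27_carrierE)
    obtain p q r :: int where pqr: "x = trip (of_int p) (of_int q) (of_int r) eta"
      using OK7_imp_trip[OF x(1)] .
    have e: "of_int z = real_of_int (z mod 3) + 3 * real_of_int (z div 3)" for z :: int
    proof -
      have "real_of_int z = of_int (z mod 3 + 3 * (z div 3))" by (simp only: mod_mult_div_eq)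
      thus ?thesis by (simp only: of_int_add of_int_mult of_int_numeral)
    qed
    have "x - trip (of_int (p mod 3)) (of_int (q mod 3)) (of_int (r mod 3)) eta =
      3 * trip (of_int (p div 3)) (of_int (q div 3)) (of_int (r div 3)) eta"
      unfolding pqr trip_def e[of p] e[of q] e[of r] by (simp add: algebra_simps)
    hence "x - trip (of_int (p mod 3)) (of_int (q mod 3)) (of_int (r mod 3)) eta \<in> three_OK7"
      unfolding three_OK7_def using OK7_trip by blast
    hence "w = ?f (p mod 3, q mod 3, r mod 3)"
      unfolding x(2) using residue_eq_iff[OF x(1) OK7_trip] by simp
    moreover have "z mod 3 \<in> {0, 1, 2}" for z :: int by auto
    hence "(p mod 3, q mod 3, r mod 3) \<in> ?A" by (intro SigmaI)
    ultimately show "w \<in> ?f ` ?A" by (rule image_eqI)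
  qed
  moreover have "finite (?f ` ?A)" by (intro finite_imageI) simp
  moreover have "card (?f ` ?A) \<le> card ?A" by (rule card_image_le) simp
  moreover have "card ?A = 27" by simp
  ultimately show ?thesis
    using finite_subset[of "carrier F27" "?f ` ?A"] card_mono[of "?f ` ?A" "carrier F27"] by linarith
qed

lemma three_F27:
  assumes "w \<in> carrier F27" shows "w \<oplus>\<^bsub>F27\<^esub> w \<oplus>\<^bsub>F27\<^esub> w = \<zero>\<^bsub>F27\<^esub>"
proof -
  obtain x where x: "x \<in> OK7" "w = residue x" using F27_carrierE[OF assms] .
  have "w \<oplus>\<^bsub>F27\<^esub> w \<oplus>\<^bsub>F27\<^esub> w = residue (x + x + x)"
    using x Ring.ring_hom_add[OF residue_hom, of x x] Ring.ring_hom_add[OF residue_hom, of "x + x" x]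
    by (simp add: OK7_closed)
  also have "\<dots> = \<zero>\<^bsub>F27\<^esub>"
    using residue_eq_zero_iff[of "x + x + x"] x by (auto simp: OK7_closed three_OK7_def)
  finally show ?thesis .
qed

lemma qmul_zero [simp]: "qmul a b x 0 = 0" "qmul a b 0 x = 0"
  by (cases x; simp add: qmul_def zero_prod_def)+

section \<open>The order and its unit group modulo 3\<close>

locale quat_order_mod3 = quat_order +
  fixes \<iota> :: "quat set \<Rightarrow> real set \<times> real set \<times> real set \<times> real set"
  assumes iota: "\<iota> \<in> ring_iso (order_ring a b \<O> Quot three_ideal \<O>) (mat2_ring F27)"
begin

sublocale F: field F27 by (rule field_F27)

lemma three_ideal_eq: "three_ideal \<O> = {3 *\<^sub>R x |x. x \<in> \<O>}"
  by (auto simp: three_ideal_def)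

lemma order_ring_simps:
  "carrier (order_ring a b \<O>) = \<O>" "x \<oplus>\<^bsub>order_ring a b \<O>\<^esub> y = x + y"
  "\<one>\<^bsub>order_ring a b \<O>\<^esub> = (1, 0, 0, 0)" "\<zero>\<^bsub>order_ring a b \<O>\<^esub> = 0"
  "x \<in> \<O> \<Longrightarrow> y \<in> \<O> \<Longrightarrow> x \<otimes>\<^bsub>order_ring a b \<O>\<^esub> y = x \<star> y"
  using quat_algebra_K7_simps[of a b] quat_algebra_K7_mult[of a b x y] ab O_K7 by auto

lemma ring_order_ring: "ring (order_ring a b \<O>)"
  using ring.subring_is_ring[OF ring_quat_algebra_K7 subring_O] ab by simp

lemma ideal_three_ideal: "ideal (three_ideal \<O>) (order_ring a b \<O>)"
proof -
  interpret R: ring "order_ring a b \<O>" by (rule ring_order_ring)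
  have add: "u + v \<in> three_ideal \<O>" if uv: "u \<in> three_ideal \<O>" "v \<in> three_ideal \<O>" for u v
  proof -
    obtain x y where "u = 3 *\<^sub>R x" "v = 3 *\<^sub>R y" "x \<in> \<O>" "y \<in> \<O>" using uv unfolding three_ideal_eq by blast
    hence "u + v = 3 *\<^sub>R (x + y)" "x + y \<in> \<O>" by (simp_all add: O_add scaleR_add_right)
    thus ?thesis unfolding three_ideal_eq by blast
  qed
  have mul: "u \<star> v \<in> three_ideal \<O> \<and> v \<star> u \<in> three_ideal \<O>" if uv: "u \<in> three_ideal \<O>" "v \<in> \<O>" for u v
  proof -
    obtain x where "u = 3 *\<^sub>R x" "x \<in> \<O>" using uv unfolding three_ideal_eq by blast
    hence "u \<star> v = 3 *\<^sub>R (x \<star> v)" "v \<star> u = 3 *\<^sub>R (v \<star> x)" "x \<star> v \<in> \<O>" "v \<star> x \<in> \<O>"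
      using uv by (simp_all add: qmul_scaleR O_mult)
    thus ?thesis unfolding three_ideal_eq by blast
  qed
  have sub: "three_ideal \<O> \<subseteq> \<O>" unfolding three_ideal_eq using O_scaleR OK7_numeral by blast
  have neg: "- u \<in> three_ideal \<O>" if u: "u \<in> three_ideal \<O>" for u
  proof -
    obtain x where "u = 3 *\<^sub>R x" "x \<in> \<O>" using u unfolding three_ideal_eq by blast
    hence "- u = 3 *\<^sub>R (- x)" "- x \<in> \<O>" by (simp_all add: O_uminus)
    thus ?thesis unfolding three_ideal_eq by blast
  qed
  show ?thesis
  proof (rule idealI[OF R.ring_axioms])
    have "inv\<^bsub>add_monoid (order_ring a b \<O>)\<^esub> u \<in> three_ideal \<O>" if u: "u \<in> three_ideal \<O>" for u
    proof -
      have "u \<in> \<O>" "- u \<in> \<O>" using u sub neg[OF u] by blast+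
      hence "\<ominus>\<^bsub>order_ring a b \<O>\<^esub> u = - u"
        by (intro R.minus_equality) (simp_all add: quat_algebra_K7_simps)
      thus ?thesis using neg[OF u] unfolding a_inv_def by simp
    qed
    moreover have "0 \<in> three_ideal \<O>" unfolding three_ideal_eq using O_0 by force
    ultimately show "subgroup (three_ideal \<O>) (add_monoid (order_ring a b \<O>))"
      by (intro subgroup.intro) (use sub add in \<open>auto simp: quat_algebra_K7_simps\<close>)
  next
    fix u v assume u: "u \<in> three_ideal \<O>" and v: "v \<in> carrier (order_ring a b \<O>)"
    have "u \<in> \<O>" "v \<in> \<O>" using u v sub by (simp_all only: order_ring_simps) blast
    thus "v \<otimes>\<^bsub>order_ring a b \<O>\<^esub> u \<in> three_ideal \<O>" "u \<otimes>\<^bsub>order_ring a b \<O>\<^esub> v \<in> three_ideal \<O>"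
      using mul[OF u] by (simp_all add: quat_algebra_K7_mult ab O_K7)
  qed
qed

definition th :: "quat \<Rightarrow> real set \<times> real set \<times> real set \<times> real set" where
  "th g = \<iota> (three_ideal \<O> +>\<^bsub>order_ring a b \<O>\<^esub> g)"

lemma th_hom: "th \<in> Ring.ring_hom (order_ring a b \<O>) (mat2_ring F27)"
proof -
  have "\<iota> \<in> Ring.ring_hom (order_ring a b \<O> Quot three_ideal \<O>) (mat2_ring F27)"
    using iota by (simp add: ring_iso_def)
  from ring_hom_trans[OF ideal.rcos_ring_hom[OF ideal_three_ideal] this]
  show ?thesis by (simp add: th_def[abs_def] comp_def)
qed

lemma th_carrier:
  assumes "g \<in> \<O>" "th g = (p, q, r, s)"
  shows "p \<in> carrier F27" "q \<in> carrier F27" "r \<in> carrier F27" "s \<in> carrier F27"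
  using ring_hom_closed[OF th_hom, of g] assms by (auto simp: order_ring_simps mat2_ring_def)

lemma th_mult:
  assumes "g \<in> \<O>" "h \<in> \<O>" "th g = (p, q, r, s)" "th h = (p', q', r', s')"
  shows "th (g \<star> h) =
    ((p \<otimes>\<^bsub>F27\<^esub> p') \<oplus>\<^bsub>F27\<^esub> (q \<otimes>\<^bsub>F27\<^esub> r'), (p \<otimes>\<^bsub>F27\<^esub> q') \<oplus>\<^bsub>F27\<^esub> (q \<otimes>\<^bsub>F27\<^esub> s'),
     (r \<otimes>\<^bsub>F27\<^esub> p') \<oplus>\<^bsub>F27\<^esub> (s \<otimes>\<^bsub>F27\<^esub> r'), (r \<otimes>\<^bsub>F27\<^esub> q') \<oplus>\<^bsub>F27\<^esub> (s \<otimes>\<^bsub>F27\<^esub> s'))"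
  using Ring.ring_hom_mult[OF th_hom, of g h] assms
  by (simp add: quat_algebra_K7_mult ab O_K7) (simp add: mat2_ring_def)

lemma th_add:
  assumes "g \<in> \<O>" "h \<in> \<O>" "th g = (p, q, r, s)" "th h = (p', q', r', s')"
  shows "th (g + h) = (p \<oplus>\<^bsub>F27\<^esub> p', q \<oplus>\<^bsub>F27\<^esub> q', r \<oplus>\<^bsub>F27\<^esub> r', s \<oplus>\<^bsub>F27\<^esub> s')"
  using Ring.ring_hom_add[OF th_hom, of g h] assms
  by (simp add: quat_algebra_K7_simps) (simp add: mat2_ring_def)

lemma th_one: "th (1, 0, 0, 0) = (\<one>\<^bsub>F27\<^esub>, \<zero>\<^bsub>F27\<^esub>, \<zero>\<^bsub>F27\<^esub>, \<one>\<^bsub>F27\<^esub>)"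
  using Ring.ring_hom_one[OF th_hom] by (simp add: quat_algebra_K7_simps) (simp add: mat2_ring_def)

lemma th_zero_iff:
  assumes "g \<in> \<O>"
  shows "th g = (\<zero>\<^bsub>F27\<^esub>, \<zero>\<^bsub>F27\<^esub>, \<zero>\<^bsub>F27\<^esub>, \<zero>\<^bsub>F27\<^esub>) \<longleftrightarrow> g \<in> three_ideal \<O>"
proof -
  interpret I: ideal "three_ideal \<O>" "order_ring a b \<O>" by (rule ideal_three_ideal)
  let ?Q = "order_ring a b \<O> Quot three_ideal \<O>"
  let ?c = "\<lambda>g. three_ideal \<O> +>\<^bsub>order_ring a b \<O>\<^esub> g"
  have c: "?c x \<in> carrier ?Q" if "x \<in> \<O>" for x
    using ring_hom_closed[OF I.rcos_ring_hom, of x] that by (simp add: order_ring_simps)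
  have z: "?c x = three_ideal \<O>" if "x \<in> three_ideal \<O>" for x
    using that by (rule I.a_rcos_const)
  have 0: "0 \<in> three_ideal \<O>" unfolding three_ideal_eq using O_0 by force
  have "th 0 \<oplus>\<^bsub>mat2_ring F27\<^esub> th 0 = th 0"
    using Ring.ring_hom_add[OF th_hom, of 0 0] O_0 by (simp add: quat_algebra_K7_simps)
  hence th0: "th 0 = (\<zero>\<^bsub>F27\<^esub>, \<zero>\<^bsub>F27\<^esub>, \<zero>\<^bsub>F27\<^esub>, \<zero>\<^bsub>F27\<^esub>)"
    using th_carrier[OF O_0] by (cases "th 0") (auto simp: mat2_ring_def)
  have "inj_on \<iota> (carrier ?Q)" using iota by (simp add: ring_iso_def bij_betw_def)
  hence "th g = th 0 \<longleftrightarrow> ?c g = ?c 0"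
    unfolding th_def using c[OF assms] c[OF O_0] by (auto dest: inj_onD)
  also have "?c 0 = three_ideal \<O>" by (rule z[OF 0])
  also have "?c g = three_ideal \<O> \<longleftrightarrow> g \<in> three_ideal \<O>"
  proof
    have "g \<in> ?c g" by (rule I.a_rcos_self) (use assms in \<open>simp only: order_ring_simps\<close>)
    thus "?c g = three_ideal \<O> \<Longrightarrow> g \<in> three_ideal \<O>" by simp
  qed (rule z)
  finally show ?thesis by (simp add: th0)
qed

abbreviation "\<Gamma>0 \<equiv> Gamma0_3 a b \<O> \<iota>"

lemma Gamma0_iff: "g \<in> \<Gamma>0 \<longleftrightarrow> g \<in> \<Gamma> \<and> fst (snd (snd (th g))) = \<zero>\<^bsub>F27\<^esub>"
  by (auto simp: Gamma0_3_def th_def upper_triangular2_def split: prod.splits)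

lemma Gamma0E:
  assumes "g \<in> \<Gamma>0"
  obtains p q s where "g \<in> \<Gamma>" "th g = (p, q, \<zero>\<^bsub>F27\<^esub>, s)" "p \<in> carrier F27" "q \<in> carrier F27" "s \<in> carrier F27"
  using assms th_carrier[OF Gamma_O[of g]] unfolding Gamma0_iff
  by (metis fst_conv snd_conv surj_pair)

lemma Gamma0_I: "g \<in> \<Gamma> \<Longrightarrow> th g = (p, q, \<zero>\<^bsub>F27\<^esub>, s) \<Longrightarrow> g \<in> \<Gamma>0"
  by (simp add: Gamma0_iff)

lemma Gamma0_Gamma: "g \<in> \<Gamma>0 \<Longrightarrow> g \<in> \<Gamma>"
  by (simp add: Gamma0_iff)

lemma Gamma0_1: "(1, 0, 0, 0) \<in> \<Gamma>0"
  using Gamma_1 by (simp add: Gamma0_iff th_one)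

lemma Gamma0_mult:
  assumes "g \<in> \<Gamma>0" "h \<in> \<Gamma>0" shows "g \<star> h \<in> \<Gamma>0"
proof -
  obtain p q s where g: "g \<in> \<Gamma>" "th g = (p, q, \<zero>\<^bsub>F27\<^esub>, s)" "p \<in> carrier F27" "q \<in> carrier F27" "s \<in> carrier F27"
    using Gamma0E[OF assms(1)] .
  obtain p' q' s' where h: "h \<in> \<Gamma>" "th h = (p', q', \<zero>\<^bsub>F27\<^esub>, s')" "p' \<in> carrier F27" "q' \<in> carrier F27" "s' \<in> carrier F27"
    using Gamma0E[OF assms(2)] .
  show ?thesis
    using th_mult[OF Gamma_O[OF g(1)] Gamma_O[OF h(1)] g(2) h(2)] g h
    by (intro Gamma0_I[OF Gamma_mult[OF g(1) h(1)]]) simp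
qed

text \<open>Two elements of \<open>\<Gamma>\<close> with proportional bottom rows modulo 3 lie in the same coset of \<open>\<Gamma>0\<close>.\<close>

lemma Gamma0_coset:
  assumes x: "x \<in> \<Gamma>" "th x = (p, q, r, s)" and y: "y \<in> \<Gamma>" "th y = (p', q', r', s')"
    and c: "c \<in> carrier F27" "r' = c \<otimes>\<^bsub>F27\<^esub> r" "s' = c \<otimes>\<^bsub>F27\<^esub> s"
  shows "y \<star> qconj x \<in> \<Gamma>0"
proof -
  obtain t u v w where t: "th (qconj x) = (t, u, v, w)" by (cases "th (qconj x)") auto
  note xc = th_carrier[OF Gamma_O[OF x(1)] x(2)]
  note yc = th_carrier[OF Gamma_O[OF y(1)] y(2)]
  note tc = th_carrier[OF Gamma_O[OF Gamma_qconj[OF x(1)]] t]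
  have "(r \<otimes>\<^bsub>F27\<^esub> t) \<oplus>\<^bsub>F27\<^esub> (s \<otimes>\<^bsub>F27\<^esub> v) = \<zero>\<^bsub>F27\<^esub>"
    using trans[OF sym[OF th_mult[OF Gamma_O[OF x(1)] Gamma_O[OF Gamma_qconj[OF x(1)]] x(2) t]]
      th_one[folded Gamma_inverse(1)[OF x(1)]]]
    by (simp only: prod.inject)
  moreover have "(r' \<otimes>\<^bsub>F27\<^esub> t) \<oplus>\<^bsub>F27\<^esub> (s' \<otimes>\<^bsub>F27\<^esub> v) = c \<otimes>\<^bsub>F27\<^esub> ((r \<otimes>\<^bsub>F27\<^esub> t) \<oplus>\<^bsub>F27\<^esub> (s \<otimes>\<^bsub>F27\<^esub> v))"
    unfolding c(2,3) using c(1) xc tc by (simp add: F.m_assoc F.r_distr)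
  ultimately have "(r' \<otimes>\<^bsub>F27\<^esub> t) \<oplus>\<^bsub>F27\<^esub> (s' \<otimes>\<^bsub>F27\<^esub> v) = \<zero>\<^bsub>F27\<^esub>"
    using c(1) by simp
  thus ?thesis
    using th_mult[OF Gamma_O[OF y(1)] Gamma_O[OF Gamma_qconj[OF x(1)]] y(2) t]
    by (intro Gamma0_I[OF Gamma_mult[OF y(1) Gamma_qconj[OF x(1)]]]) simp
qed

text \<open>The bottom row (0, s) is proportional to the bottom row (0, 1) of the identity, so the
  coset criterion applies to g and 1.\<close>

lemma Gamma0_qconj: "g \<in> \<Gamma>0 \<Longrightarrow> qconj g \<in> \<Gamma>0"
proof -
  assume "g \<in> \<Gamma>0"
  then obtain p q s where g: "g \<in> \<Gamma>" "th g = (p, q, \<zero>\<^bsub>F27\<^esub>, s)" "p \<in> carrier F27" "q \<in> carrier F27" "s \<in> carrier F27"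
    using Gamma0E by blast
  have "s \<noteq> \<zero>\<^bsub>F27\<^esub>"
  proof
    assume s: "s = \<zero>\<^bsub>F27\<^esub>"
    obtain t u v w where t: "th (qconj g) = (t, u, v, w)" by (cases "th (qconj g)") auto
    note tc = th_carrier[OF Gamma_O[OF Gamma_qconj[OF g(1)]] t]
    show False
      using th_mult[OF Gamma_O[OF g(1)] Gamma_O[OF Gamma_qconj[OF g(1)]] g(2) t] tc
      by (simp add: Gamma_inverse[OF g(1)] th_one s)
  qed
  hence inv: "inv\<^bsub>F27\<^esub> s \<in> carrier F27" "inv\<^bsub>F27\<^esub> s \<otimes>\<^bsub>F27\<^esub> s = \<one>\<^bsub>F27\<^esub>"
    using g(5) F.field_Units by (auto intro!: F.Units_inv_closed F.Units_l_inv)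
  have "(1, 0, 0, 0) \<star> qconj g \<in> \<Gamma>0"
    by (rule Gamma0_coset[OF g(1,2) Gamma_1 th_one inv(1)]) (use inv in simp_all)
  thus ?thesis by (simp add: qmul_one)
qed

lemma F27_no_nilpotents: "u \<in> carrier F27 \<Longrightarrow> u \<otimes>\<^bsub>F27\<^esub> u = \<zero>\<^bsub>F27\<^esub> \<Longrightarrow> u = \<zero>\<^bsub>F27\<^esub>"
  using F.integral by blast

lemma th_3_multiple: "x \<in> \<O> \<Longrightarrow> th (3 *\<^sub>R x) = (\<zero>\<^bsub>F27\<^esub>, \<zero>\<^bsub>F27\<^esub>, \<zero>\<^bsub>F27\<^esub>, \<zero>\<^bsub>F27\<^esub>)"
  using th_zero_iff[of "3 *\<^sub>R x"] O_scaleR[OF OK7_numeral] unfolding three_ideal_eq by blast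

lemma third_of_th_zero:
  assumes "x \<in> \<O>" "th x = (\<zero>\<^bsub>F27\<^esub>, \<zero>\<^bsub>F27\<^esub>, \<zero>\<^bsub>F27\<^esub>, \<zero>\<^bsub>F27\<^esub>)"
  obtains y where "y \<in> \<O>" "x = 3 *\<^sub>R y"
  using th_zero_iff[OF assms(1)] assms(2) unfolding three_ideal_eq by blast

text \<open>Used to see that elements of norm 3 have nonzero reduction modulo 3.\<close>

lemma nrd_3_not_three_multiple:
  assumes "y \<in> \<O>" shows "nrd (3 *\<^sub>R y) \<noteq> 3"
proof
  assume "nrd (3 *\<^sub>R y) = 3"
  hence "3 * nrd y = 1" by (simp add: reduced_norm_scaleR)
  hence "1 \<in> three_OK7" using order_integral(2)[OF assms] unfolding three_OK7_def by force
  thus False using one_notin_three_OK7 by simp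
qed

text \<open>An element of order 3 in \<open>\<Gamma>0\<close> is unipotent modulo 3, which makes \<open>2h + 1\<close>, a square root
  of \<open>-3\<close>, strictly upper triangular modulo 3: it plays the role of the Fricke involution.\<close>

definition beta :: "quat \<Rightarrow> quat" where "beta h = 2 *\<^sub>R h + (1, 0, 0, 0)"

section \<open>Consequences of an element of order 3 in \<open>\<Gamma>0\<close>\<close>

context
  fixes h :: quat
  assumes h: "h \<in> \<Gamma>0" "h \<star> h + h + (1, 0, 0, 0) = 0"
begin

lemma h_O: "h \<in> \<O>" using h(1) Gamma0_Gamma Gamma_O by blast

lemma beta_O: "beta h \<in> \<O>"
  unfolding beta_def by (intro O_add O_1 O_scaleR OK7_numeral h_O)

lemma beta_sq: "beta h \<star> beta h = (- 3, 0, 0, 0)"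
proof -
  have "beta h \<star> beta h = 4 *\<^sub>R (h \<star> h + h + (1, 0, 0, 0)) + (- 3, 0, 0, 0)"
    by (cases h) (simp add: beta_def qmul_def algebra_simps)
  thus ?thesis unfolding h(2) by simp
qed

text \<open>The square of the norm is the norm 9 of -3. Norm -3 would make \<open>beta h\<close>
  equal to its conjugate, hence a real scalar with square -3.\<close>

lemma nrd_beta: "nrd (beta h) = 3"
proof -
  have "nrd (beta h) ^ 2 = nrd (beta h \<star> beta h)" by (simp add: reduced_norm_qmul power2_eq_square)
  also have "\<dots> = 3^2" by (simp add: beta_sq reduced_norm_def)
  finally have "nrd (beta h) = 3 \<or> nrd (beta h) = - 3" by (simp only: power2_eq_iff)
  moreover have "nrd (beta h) \<noteq> - 3"
  proof
    assume *: "nrd (beta h) = - 3"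
    have "beta h \<star> qconj (beta h) = beta h \<star> beta h"
      by (simp add: qmul_qconj * beta_sq)
    hence "beta h \<star> (beta h \<star> (qconj (beta h) - beta h)) = 0" by (simp add: qmul_distrib)
    hence "- 3 *\<^sub>R (qconj (beta h) - beta h) = 0"
      by (simp only: qmul_assoc[symmetric] beta_sq qmul_scalar)
    hence "qconj (beta h) = beta h" by simp
    then obtain k where k: "beta h = (k, 0, 0, 0)"
      by (cases "beta h") (simp add: qconj_def)
    hence "k * k = - 3" using beta_sq by (simp add: qmul_def)
    moreover have "k * k \<ge> 0" by simp
    ultimately show False by linarith
  qed
  ultimately show ?thesis by blast
qed

text \<open>Modulo 3 the element \<open>beta h\<close> is upper triangular with square 0, so its
  diagonal entries are nilpotent and vanish; in characteristic 3 this makes the diagonal entries of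
  h equal to 1. The corner u is nonzero because norm 3 forbids divisibility by 3.\<close>

lemma th_beta:
  obtains u where "u \<in> carrier F27" "u \<noteq> \<zero>\<^bsub>F27\<^esub>" "th (beta h) = (\<zero>\<^bsub>F27\<^esub>, u, \<zero>\<^bsub>F27\<^esub>, \<zero>\<^bsub>F27\<^esub>)"
    "th h = (\<one>\<^bsub>F27\<^esub>, \<ominus>\<^bsub>F27\<^esub> u, \<zero>\<^bsub>F27\<^esub>, \<one>\<^bsub>F27\<^esub>)"
proof -
  obtain p q s where g: "h \<in> \<Gamma>" "th h = (p, q, \<zero>\<^bsub>F27\<^esub>, s)" "p \<in> carrier F27" "q \<in> carrier F27" "s \<in> carrier F27"
    using Gamma0E[OF h(1)] .
  have "beta h = (h + h) + (1, 0, 0, 0)" unfolding beta_def by (simp add: scaleR_2)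
  hence b: "th (beta h) = (p \<oplus>\<^bsub>F27\<^esub> p \<oplus>\<^bsub>F27\<^esub> \<one>\<^bsub>F27\<^esub>, q \<oplus>\<^bsub>F27\<^esub> q, \<zero>\<^bsub>F27\<^esub>, s \<oplus>\<^bsub>F27\<^esub> s \<oplus>\<^bsub>F27\<^esub> \<one>\<^bsub>F27\<^esub>)"
    using th_add[OF O_add[OF h_O h_O] O_1 th_add[OF h_O h_O g(2) g(2)] th_one] g by simp
  define p' q' s' where "p' = p \<oplus>\<^bsub>F27\<^esub> p \<oplus>\<^bsub>F27\<^esub> \<one>\<^bsub>F27\<^esub>" and "q' = q \<oplus>\<^bsub>F27\<^esub> q" and "s' = s \<oplus>\<^bsub>F27\<^esub> s \<oplus>\<^bsub>F27\<^esub> \<one>\<^bsub>F27\<^esub>"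
  have c: "p' \<in> carrier F27" "q' \<in> carrier F27" "s' \<in> carrier F27" using g by (simp_all add: p'_def q'_def s'_def)
  have b: "th (beta h) = (p', q', \<zero>\<^bsub>F27\<^esub>, s')" using b by (simp add: p'_def q'_def s'_def)
  have "beta h \<star> beta h = 3 *\<^sub>R (- 1, 0, 0, 0)" by (simp add: beta_sq)
  hence "th (beta h \<star> beta h) = (\<zero>\<^bsub>F27\<^esub>, \<zero>\<^bsub>F27\<^esub>, \<zero>\<^bsub>F27\<^esub>, \<zero>\<^bsub>F27\<^esub>)"
    using th_3_multiple[OF O_scalar[OF OK7_uminus[OF OK7_1]]] by simp
  hence "p' \<otimes>\<^bsub>F27\<^esub> p' = \<zero>\<^bsub>F27\<^esub>" "s' \<otimes>\<^bsub>F27\<^esub> s' = \<zero>\<^bsub>F27\<^esub>"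
    using th_mult[OF beta_O beta_O b b] c by simp_all
  hence 0: "p' = \<zero>\<^bsub>F27\<^esub>" "s' = \<zero>\<^bsub>F27\<^esub>" using F27_no_nilpotents c by blast+
  have e: "v = \<one>\<^bsub>F27\<^esub>" if v: "v \<in> carrier F27" "v \<oplus>\<^bsub>F27\<^esub> v \<oplus>\<^bsub>F27\<^esub> \<one>\<^bsub>F27\<^esub> = \<zero>\<^bsub>F27\<^esub>" for v
  proof -
    have "(v \<oplus>\<^bsub>F27\<^esub> v) \<oplus>\<^bsub>F27\<^esub> \<one>\<^bsub>F27\<^esub> = (v \<oplus>\<^bsub>F27\<^esub> v) \<oplus>\<^bsub>F27\<^esub> v" using three_F27[OF v(1)] v(2) by simp
    thus ?thesis using v(1) F.add.l_cancel[of "v \<oplus>\<^bsub>F27\<^esub> v" "\<one>\<^bsub>F27\<^esub>" v] by simp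
  qed
  have ps: "p = \<one>\<^bsub>F27\<^esub>" "s = \<one>\<^bsub>F27\<^esub>" using e[OF g(3)] e[OF g(5)] 0 by (simp_all add: p'_def s'_def)
  have "q = \<ominus>\<^bsub>F27\<^esub> q'"
    using F.minus_equality[of q q'] three_F27[OF g(4)] g(4) unfolding q'_def by (simp add: F.a_ac)
  moreover have "q' \<noteq> \<zero>\<^bsub>F27\<^esub>"
  proof
    assume "q' = \<zero>\<^bsub>F27\<^esub>"
    then obtain y where "y \<in> \<O>" "beta h = 3 *\<^sub>R y"
      using third_of_th_zero[OF beta_O] b 0 by metis
    thus False using nrd_3_not_three_multiple nrd_beta by metis
  qed
  ultimately show ?thesis using that[of q'] c b 0 g(2) ps by simp
qed

text \<open>A product of strictly upper triangular, upper triangular and strictly upper triangular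
  matrices is 0, so \<beta> g \<beta> is divisible by 3. As the inverse of \<beta> is -\<beta>/3,
  the conjugate of g by \<beta> is integral. Since \<beta>^2 is central, the same element serves on
  both sides.\<close>

lemma beta_normalizes:
  assumes g: "g \<in> \<Gamma>0"
  obtains g' where "g' \<in> \<Gamma>0" "beta h \<star> g = g' \<star> beta h" "g \<star> beta h = beta h \<star> g'"
proof -
  obtain u where u: "u \<in> carrier F27" "u \<noteq> \<zero>\<^bsub>F27\<^esub>" "th (beta h) = (\<zero>\<^bsub>F27\<^esub>, u, \<zero>\<^bsub>F27\<^esub>, \<zero>\<^bsub>F27\<^esub>)"
    using th_beta by metis
  obtain p q s where g': "g \<in> \<Gamma>" "th g = (p, q, \<zero>\<^bsub>F27\<^esub>, s)" "p \<in> carrier F27" "q \<in> carrier F27" "s \<in> carrier F27"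
    using Gamma0E[OF g] .
  have gO: "g \<in> \<O>" by (rule Gamma_O[OF g'(1)])
  have bg: "th (beta h \<star> g) = (\<zero>\<^bsub>F27\<^esub>, u \<otimes>\<^bsub>F27\<^esub> s, \<zero>\<^bsub>F27\<^esub>, \<zero>\<^bsub>F27\<^esub>)"
    using th_mult[OF beta_O gO u(3) g'(2)] u g' by simp
  have "th (beta h \<star> g \<star> beta h) = (\<zero>\<^bsub>F27\<^esub>, \<zero>\<^bsub>F27\<^esub>, \<zero>\<^bsub>F27\<^esub>, \<zero>\<^bsub>F27\<^esub>)"
    using th_mult[OF O_mult[OF beta_O gO] beta_O bg u(3)] u g' by simp
  then obtain y where y: "y \<in> \<O>" "beta h \<star> g \<star> beta h = 3 *\<^sub>R y"
    using third_of_th_zero[OF O_mult[OF O_mult[OF beta_O gO] beta_O]] by metis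
  define k where "k = - y"
  have kO: "k \<in> \<O>" using y by (simp add: k_def O_uminus)
  have "3 *\<^sub>R (k \<star> beta h) = - ((beta h \<star> g \<star> beta h) \<star> beta h)"
    unfolding y(2) by (simp add: k_def qmul_scaleR qmul_distrib)
  also have "\<dots> = 3 *\<^sub>R (beta h \<star> g)"
  proof -
    have "(beta h \<star> g \<star> beta h) \<star> beta h = (beta h \<star> g) \<star> (- 3, 0, 0, 0)"
      by (simp only: qmul_assoc beta_sq)
    also have "(- 3, 0, 0, 0) = (- 3) *\<^sub>R ((1, 0, 0, 0) :: quat)" by simp
    finally show ?thesis by (simp only: qmul_scaleR qmul_one) simp
  qed
  finally have k1: "beta h \<star> g = k \<star> beta h" by simp
  have "3 *\<^sub>R (beta h \<star> k) = - (beta h \<star> (beta h \<star> g \<star> beta h))"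
    unfolding y(2) by (simp add: k_def qmul_scaleR qmul_distrib)
  also have "\<dots> = 3 *\<^sub>R (g \<star> beta h)"
  proof -
    have "beta h \<star> (beta h \<star> g \<star> beta h) = (beta h \<star> beta h) \<star> (g \<star> beta h)"
      by (simp only: qmul_assoc)
    thus ?thesis by (simp add: beta_sq qmul_scalar)
  qed
  finally have k2: "g \<star> beta h = beta h \<star> k" by simp
  have "nrd (beta h) * nrd g = nrd k * nrd (beta h)"
    using arg_cong[OF k1, of nrd] by (simp add: reduced_norm_qmul)
  hence "nrd k = 1" using g'(1) by (simp add: nrd_beta Gamma1_def)
  hence kG: "k \<in> \<Gamma>" using kO by (simp add: Gamma1_def)
  obtain t1 t2 t3 t4 where t: "th k = (t1, t2, t3, t4)" by (cases "th k") auto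
  note tc = th_carrier[OF kO t]
  have "t3 \<otimes>\<^bsub>F27\<^esub> u = \<zero>\<^bsub>F27\<^esub>"
    using th_mult[OF kO beta_O t u(3)] bg tc u(1) by (simp add: k1)
  hence "t3 = \<zero>\<^bsub>F27\<^esub>" using u tc F.integral by blast
  hence "k \<in> \<Gamma>0" using Gamma0_I[OF kG] t by simp
  thus ?thesis using that k1 k2 by blast
qed

text \<open>On the slope s/r of the bottom row, right multiplication by h is translation by
  -u.\<close>

lemma bottom_row_mult_h:
  assumes x: "x \<in> \<Gamma>" "th x = (p, q, r, s)"
    and u: "u \<in> carrier F27" "th h = (\<one>\<^bsub>F27\<^esub>, \<ominus>\<^bsub>F27\<^esub> u, \<zero>\<^bsub>F27\<^esub>, \<one>\<^bsub>F27\<^esub>)"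
  obtains p' q' where "th (x \<star> h) = (p', q', r, s \<ominus>\<^bsub>F27\<^esub> r \<otimes>\<^bsub>F27\<^esub> u)"
proof -
  note c = th_carrier[OF Gamma_O[OF x(1)] x(2)]
  have "r \<otimes>\<^bsub>F27\<^esub> (\<ominus>\<^bsub>F27\<^esub> u) \<oplus>\<^bsub>F27\<^esub> s = s \<ominus>\<^bsub>F27\<^esub> r \<otimes>\<^bsub>F27\<^esub> u"
    using c u(1) by (simp add: a_minus_def F.r_minus F.a_comm)
  thus ?thesis
    using th_mult[OF Gamma_O[OF x(1)] h_O x(2) u(2)] c u(1) that by simp
qed

text \<open>Nine distinct \<open>\<langle>h\<rangle>\<close>-orbits of cosets other than \<open>\<Gamma>0\<close> itself account for all 27 finite slopes
  of bottom rows.\<close>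

lemma all_slopes:
  fixes f :: "quat \<Rightarrow> 'c" and gs :: "nat \<Rightarrow> quat"
  assumes f0: "\<And>g x. g \<in> \<Gamma>0 \<Longrightarrow> x \<in> \<Gamma> \<Longrightarrow> f (g \<star> x) = f x"
    and fh: "\<And>x. x \<in> \<Gamma> \<Longrightarrow> f (x \<star> h) = f x"
    and gs: "\<And>i. i < 9 \<Longrightarrow> gs i \<in> \<Gamma>" "\<And>i. i < 9 \<Longrightarrow> f (gs i) \<noteq> f (1, 0, 0, 0)"
    and inj: "inj_on (\<lambda>i. f (gs i)) {..<9}"
    and v: "v \<in> carrier F27"
  obtains x p q r where "x \<in> \<Gamma>" "th x = (p, q, r, r \<otimes>\<^bsub>F27\<^esub> v)" "r \<noteq> \<zero>\<^bsub>F27\<^esub>"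
proof -
  obtain u where u: "u \<in> carrier F27" "u \<noteq> \<zero>\<^bsub>F27\<^esub>"
    "th h = (\<one>\<^bsub>F27\<^esub>, \<ominus>\<^bsub>F27\<^esub> u, \<zero>\<^bsub>F27\<^esub>, \<one>\<^bsub>F27\<^esub>)" using th_beta by metis
  have hG: "h \<in> \<Gamma>" by (rule Gamma0_Gamma[OF h(1)])
  \<comment> \<open>\<open>has c w\<close> says that the value c of f occurs at some bottom row of
    slope w. Recording values of f instead of cosets allows f to be a point of the curve, where
    distinctness can be seen.\<close>
  define has where "has = (\<lambda>c w. \<exists>x p q r. x \<in> \<Gamma> \<and> f x = c \<and> th x = (p, q, r, r \<otimes>\<^bsub>F27\<^esub> w) \<and> r \<noteq> \<zero>\<^bsub>F27\<^esub>)"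
  have has_step: "has c (w \<ominus>\<^bsub>F27\<^esub> u)" if hw: "has c w" "w \<in> carrier F27" for c w
  proof -
    obtain x p q r where x: "x \<in> \<Gamma>" "f x = c" "th x = (p, q, r, r \<otimes>\<^bsub>F27\<^esub> w)" "r \<noteq> \<zero>\<^bsub>F27\<^esub>"
      using hw(1) unfolding has_def by blast
    note c = th_carrier[OF Gamma_O[OF x(1)] x(3)]
    obtain p' q' where "th (x \<star> h) = (p', q', r, r \<otimes>\<^bsub>F27\<^esub> w \<ominus>\<^bsub>F27\<^esub> r \<otimes>\<^bsub>F27\<^esub> u)"
      using bottom_row_mult_h[OF x(1,3) u(1,3)] .
    moreover have "r \<otimes>\<^bsub>F27\<^esub> w \<ominus>\<^bsub>F27\<^esub> r \<otimes>\<^bsub>F27\<^esub> u = r \<otimes>\<^bsub>F27\<^esub> (w \<ominus>\<^bsub>F27\<^esub> u)"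
      using c u(1) hw(2) by (simp add: a_minus_def F.r_distr F.r_minus)
    ultimately have "th (x \<star> h) = (p', q', r, r \<otimes>\<^bsub>F27\<^esub> (w \<ominus>\<^bsub>F27\<^esub> u))" by simp
    thus ?thesis unfolding has_def
      using x Gamma_mult[OF x(1) hG] fh[OF x(1)] by blast
  qed
  \<comment> \<open>A slope determines the coset of \<open>\<Gamma>0\<close>, and f is constant on
    cosets.\<close>
  have has_unique: "c = c'" if hc: "has c w" "has c' w" and w: "w \<in> carrier F27" for c c' w
  proof -
    obtain x p q r where x: "x \<in> \<Gamma>" "f x = c" "th x = (p, q, r, r \<otimes>\<^bsub>F27\<^esub> w)" "r \<noteq> \<zero>\<^bsub>F27\<^esub>"
      using hc(1) unfolding has_def by blast
    obtain y p' q' r' where y: "y \<in> \<Gamma>" "f y = c'" "th y = (p', q', r', r' \<otimes>\<^bsub>F27\<^esub> w)" "r' \<noteq> \<zero>\<^bsub>F27\<^esub>"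
      using hc(2) unfolding has_def by blast
    have r: "r \<in> carrier F27" "r' \<in> carrier F27"
      using th_carrier[OF Gamma_O[OF x(1)] x(3)] th_carrier[OF Gamma_O[OF y(1)] y(3)] by blast+
    hence inv: "inv\<^bsub>F27\<^esub> r \<in> carrier F27" "inv\<^bsub>F27\<^esub> r \<otimes>\<^bsub>F27\<^esub> r = \<one>\<^bsub>F27\<^esub>"
      using x(4) F.field_Units by (auto intro!: F.Units_inv_closed F.Units_l_inv)
    have "y \<star> qconj x \<in> \<Gamma>0"
    proof (rule Gamma0_coset[OF x(1,3) y(1,3)])
      show "r' \<otimes>\<^bsub>F27\<^esub> inv\<^bsub>F27\<^esub> r \<in> carrier F27" using r inv by simp
      show "r' = r' \<otimes>\<^bsub>F27\<^esub> inv\<^bsub>F27\<^esub> r \<otimes>\<^bsub>F27\<^esub> r" using r inv by (simp add: F.m_assoc)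
      thus "r' \<otimes>\<^bsub>F27\<^esub> w = r' \<otimes>\<^bsub>F27\<^esub> inv\<^bsub>F27\<^esub> r \<otimes>\<^bsub>F27\<^esub> (r \<otimes>\<^bsub>F27\<^esub> w)"
        using r inv w by (simp add: F.m_assoc[symmetric])
    qed
    hence "f ((y \<star> qconj x) \<star> x) = f x" using f0 x(1) by blast
    moreover have "(y \<star> qconj x) \<star> x = y"
      using Gamma_inverse[OF x(1)] by (simp add: qmul_assoc qmul_one)
    ultimately show ?thesis using x y by simp
  qed
  have has_gs: "\<exists>w\<in>carrier F27. has (f (gs i)) w" if i: "i < 9" for i
  proof -
    obtain p q r s where g: "th (gs i) = (p, q, r, s)" by (cases "th (gs i)") auto
    note c = th_carrier[OF Gamma_O[OF gs(1)[OF i]] g]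
    have "r \<noteq> \<zero>\<^bsub>F27\<^esub>"
    proof
      assume "r = \<zero>\<^bsub>F27\<^esub>"
      hence "gs i \<in> \<Gamma>0" using Gamma0_I[OF gs(1)[OF i]] g by simp
      hence "f (gs i \<star> (1, 0, 0, 0)) = f (1, 0, 0, 0)" by (rule f0[OF _ Gamma_1])
      thus False using gs(2)[OF i] by (simp add: qmul_one)
    qed
    hence inv: "inv\<^bsub>F27\<^esub> r \<in> carrier F27" "r \<otimes>\<^bsub>F27\<^esub> inv\<^bsub>F27\<^esub> r = \<one>\<^bsub>F27\<^esub>"
      using c F.field_Units by (auto intro!: F.Units_inv_closed F.Units_r_inv)
    have "r \<otimes>\<^bsub>F27\<^esub> (inv\<^bsub>F27\<^esub> r \<otimes>\<^bsub>F27\<^esub> s) = s" using inv c by (simp add: F.m_assoc[symmetric])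
    hence "th (gs i) = (p, q, r, r \<otimes>\<^bsub>F27\<^esub> (inv\<^bsub>F27\<^esub> r \<otimes>\<^bsub>F27\<^esub> s))" using g by simp
    hence "has (f (gs i)) (inv\<^bsub>F27\<^esub> r \<otimes>\<^bsub>F27\<^esub> s)"
      unfolding has_def using gs(1)[OF i] \<open>r \<noteq> \<zero>\<^bsub>F27\<^esub>\<close> by metis
    moreover have "inv\<^bsub>F27\<^esub> r \<otimes>\<^bsub>F27\<^esub> s \<in> carrier F27" using c inv by simp
    ultimately show ?thesis by blast
  qed
  then obtain sl where sl: "\<And>i. i < 9 \<Longrightarrow> sl i \<in> carrier F27" "\<And>i. i < 9 \<Longrightarrow> has (f (gs i)) (sl i)"
    by metis
  \<comment> \<open>The subgroup 0, u, 2u: translation by u has order 3 in characteristic 3.\<close>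
  define sh :: "nat \<Rightarrow> real set" where
    "sh = (\<lambda>j. if j = 0 then \<zero>\<^bsub>F27\<^esub> else if j = 1 then u else u \<oplus>\<^bsub>F27\<^esub> u)"
  have shc: "sh j \<in> carrier F27" for j using u by (simp add: sh_def)
  have sh_has: "has (f (gs i)) (sl i \<ominus>\<^bsub>F27\<^esub> sh j)" if ij: "i < 9" "j < 3" for i j
  proof -
    note s = sl[OF ij(1)]
    have 1: "has (f (gs i)) (sl i \<ominus>\<^bsub>F27\<^esub> u)" by (rule has_step[OF s(2,1)])
    have "has (f (gs i)) (sl i \<ominus>\<^bsub>F27\<^esub> u \<ominus>\<^bsub>F27\<^esub> u)" by (rule has_step[OF 1]) (use s u in simp)
    moreover have "sl i \<ominus>\<^bsub>F27\<^esub> u \<ominus>\<^bsub>F27\<^esub> u = sl i \<ominus>\<^bsub>F27\<^esub> (u \<oplus>\<^bsub>F27\<^esub> u)"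
      using s u by (simp add: a_minus_def F.minus_add F.a_assoc)
    moreover have "sl i \<ominus>\<^bsub>F27\<^esub> \<zero>\<^bsub>F27\<^esub> = sl i" using s by (simp add: a_minus_def)
    moreover have "j = 0 \<or> j = 1 \<or> j = 2" using ij(2) by auto
    ultimately show ?thesis using 1 s by (auto simp: sh_def)
  qed
  have sh_inj: "inj_on sh {..<3}"
  proof -
    have "u \<oplus>\<^bsub>F27\<^esub> u \<noteq> \<zero>\<^bsub>F27\<^esub>"
      using three_F27[OF u(1)] u by auto
    moreover have "u \<oplus>\<^bsub>F27\<^esub> u \<noteq> u"
      using u F.add.l_cancel[of u u "\<zero>\<^bsub>F27\<^esub>"] by auto
    ultimately have "sh 0 \<noteq> sh 1" "sh 0 \<noteq> sh 2" "sh 1 \<noteq> sh 2" using u by (auto simp: sh_def)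
    moreover have "{..<3} = {0, 1, 2 :: nat}" by auto
    ultimately show ?thesis by (auto simp: inj_on_def)
  qed
  let ?F = "\<lambda>(i, j). sl i \<ominus>\<^bsub>F27\<^esub> sh j"
  have "inj_on ?F ({..<9} \<times> {..<3})"
  proof (rule inj_onI, clarsimp)
    fix i j i' j' assume ij: "i < 9" "j < 3" "i' < (9::nat)" "j' < (3::nat)"
      and eq: "sl i \<ominus>\<^bsub>F27\<^esub> sh j = sl i' \<ominus>\<^bsub>F27\<^esub> sh j'"
    have "f (gs i) = f (gs i')"
      by (rule has_unique[OF sh_has[OF ij(1,2)]])
         (use sh_has[OF ij(3,4)] eq sl ij shc in \<open>simp_all\<close>)
    hence "i = i'" using inj ij by (auto dest: inj_onD)
    moreover have "sh j = sh j'"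
    proof -
      have "\<ominus>\<^bsub>F27\<^esub> sh j = \<ominus>\<^bsub>F27\<^esub> sh j'"
        using eq sl[OF ij(3)] shc[of j] shc[of j'] F.add.l_cancel[of "sl i'" "\<ominus>\<^bsub>F27\<^esub> sh j" "\<ominus>\<^bsub>F27\<^esub> sh j'"]
        by (simp add: a_minus_def \<open>i = i'\<close>)
      thus ?thesis using shc by (metis F.minus_minus)
    qed
    hence "j = j'" using sh_inj ij by (auto dest: inj_onD)
    ultimately show "i = i' \<and> j = j'" by simp
  qed
  \<comment> \<open>The 9 * 3 slopes are pairwise different and the field has at most 27 elements,
    so every slope occurs.\<close>
  hence "card (?F ` ({..<9} \<times> {..<3})) = 27" by (subst card_image) simp_all
  moreover have "?F ` ({..<9} \<times> {..<3}) \<subseteq> carrier F27" using sl shc by auto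
  ultimately have im: "?F ` ({..<9} \<times> {..<3}) = carrier F27"
    using card_F27 card_subset_eq[of "carrier F27" "?F ` ({..<9} \<times> {..<3})"]
      card_mono[of "carrier F27" "?F ` ({..<9} \<times> {..<3})"] by linarith
  obtain i j where "i < 9" "j < 3" "v = sl i \<ominus>\<^bsub>F27\<^esub> sh j"
    using v unfolding im[symmetric] by auto
  hence "has (f (gs i)) v" using sh_has by simp
  thus ?thesis unfolding has_def using that by blast
qed

text \<open>The aim is d = \<beta> x \<alpha>^(-1), which is \<beta> x times the conjugate of
  \<alpha>, divided by 3. Modulo 3 left multiplication by \<beta> retains only the bottom row, so it
  suffices that the bottom row of x is killed by the conjugate of \<alpha> modulo 3. Then d is
  integral, and its norm is 3 * 1 * 3 / 9 = 1.\<close>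

lemma exists_translate:
  fixes f :: "quat \<Rightarrow> 'c" and gs :: "nat \<Rightarrow> quat"
  assumes f0: "\<And>g x. g \<in> \<Gamma>0 \<Longrightarrow> x \<in> \<Gamma> \<Longrightarrow> f (g \<star> x) = f x"
    and fh: "\<And>x. x \<in> \<Gamma> \<Longrightarrow> f (x \<star> h) = f x"
    and gs: "\<And>i. i < 9 \<Longrightarrow> gs i \<in> \<Gamma>" "\<And>i. i < 9 \<Longrightarrow> f (gs i) \<noteq> f (1, 0, 0, 0)"
    and inj: "inj_on (\<lambda>i. f (gs i)) {..<9}"
    and al: "al \<in> \<O>" "nrd al = 3"
  obtains x d where "x \<in> \<Gamma>" "d \<in> \<Gamma>" "beta h \<star> x = d \<star> al"
proof -
  obtain u where u: "u \<in> carrier F27" "u \<noteq> \<zero>\<^bsub>F27\<^esub>" "th (beta h) = (\<zero>\<^bsub>F27\<^esub>, u, \<zero>\<^bsub>F27\<^esub>, \<zero>\<^bsub>F27\<^esub>)"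
    using th_beta by metis
  obtain a1 a2 a3 a4 where A: "th al = (a1, a2, a3, a4)" by (cases "th al") auto
  note Ac = th_carrier[OF al(1) A]
  have cO: "qconj al \<in> \<O>" by (rule O_qconj[OF al(1)])
  obtain b1 b2 b3 b4 where B: "th (qconj al) = (b1, b2, b3, b4)" by (cases "th (qconj al)") auto
  note Bc = th_carrier[OF cO B]
  have "al \<star> qconj al = 3 *\<^sub>R (1, 0, 0, 0)" by (simp add: qmul_qconj al)
  hence "th (al \<star> qconj al) = (\<zero>\<^bsub>F27\<^esub>, \<zero>\<^bsub>F27\<^esub>, \<zero>\<^bsub>F27\<^esub>, \<zero>\<^bsub>F27\<^esub>)"
    using th_3_multiple[OF O_1] by simp
  hence AB: "a1 \<otimes>\<^bsub>F27\<^esub> b1 \<oplus>\<^bsub>F27\<^esub> a2 \<otimes>\<^bsub>F27\<^esub> b3 = \<zero>\<^bsub>F27\<^esub>" "a1 \<otimes>\<^bsub>F27\<^esub> b2 \<oplus>\<^bsub>F27\<^esub> a2 \<otimes>\<^bsub>F27\<^esub> b4 = \<zero>\<^bsub>F27\<^esub>"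
    "a3 \<otimes>\<^bsub>F27\<^esub> b1 \<oplus>\<^bsub>F27\<^esub> a4 \<otimes>\<^bsub>F27\<^esub> b3 = \<zero>\<^bsub>F27\<^esub>" "a3 \<otimes>\<^bsub>F27\<^esub> b2 \<oplus>\<^bsub>F27\<^esub> a4 \<otimes>\<^bsub>F27\<^esub> b4 = \<zero>\<^bsub>F27\<^esub>"
    using th_mult[OF al(1) cO A B] by simp_all
  have "\<not> (a1 = \<zero>\<^bsub>F27\<^esub> \<and> a2 = \<zero>\<^bsub>F27\<^esub> \<and> a3 = \<zero>\<^bsub>F27\<^esub> \<and> a4 = \<zero>\<^bsub>F27\<^esub>)"
  proof
    assume "a1 = \<zero>\<^bsub>F27\<^esub> \<and> a2 = \<zero>\<^bsub>F27\<^esub> \<and> a3 = \<zero>\<^bsub>F27\<^esub> \<and> a4 = \<zero>\<^bsub>F27\<^esub>"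
    then obtain y where "y \<in> \<O>" "al = 3 *\<^sub>R y" using third_of_th_zero[OF al(1)] A by metis
    thus False using nrd_3_not_three_multiple al(2) by metis
  qed
  \<comment> \<open>Any nonzero row of \<alpha> modulo 3 is killed from the right by the conjugate
    of \<alpha>, because their product is 3.\<close>
  then obtain r0 s0 where r0: "r0 \<in> carrier F27" "s0 \<in> carrier F27" "r0 \<noteq> \<zero>\<^bsub>F27\<^esub> \<or> s0 \<noteq> \<zero>\<^bsub>F27\<^esub>"
    "r0 \<otimes>\<^bsub>F27\<^esub> b1 \<oplus>\<^bsub>F27\<^esub> s0 \<otimes>\<^bsub>F27\<^esub> b3 = \<zero>\<^bsub>F27\<^esub>" "r0 \<otimes>\<^bsub>F27\<^esub> b2 \<oplus>\<^bsub>F27\<^esub> s0 \<otimes>\<^bsub>F27\<^esub> b4 = \<zero>\<^bsub>F27\<^esub>"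
    using AB Ac by metis
  \<comment> \<open>The row direction with r0 = 0 is realized by the identity, every other direction
    by \<open>all_slopes\<close>.\<close>
  have "\<exists>x p q c. x \<in> \<Gamma> \<and> c \<in> carrier F27 \<and> th x = (p, q, c \<otimes>\<^bsub>F27\<^esub> r0, c \<otimes>\<^bsub>F27\<^esub> s0)"
  proof (cases "r0 = \<zero>\<^bsub>F27\<^esub>")
    case True
    hence "inv\<^bsub>F27\<^esub> s0 \<in> carrier F27" "inv\<^bsub>F27\<^esub> s0 \<otimes>\<^bsub>F27\<^esub> s0 = \<one>\<^bsub>F27\<^esub>"
      using r0 F.field_Units by (auto intro!: F.Units_inv_closed F.Units_l_inv)
    thus ?thesis using Gamma_1 th_one True
      by (intro exI[of _ "(1, 0, 0, 0)"] exI[of _ "\<one>\<^bsub>F27\<^esub>"] exI[of _ "\<zero>\<^bsub>F27\<^esub>"] exI[of _ "inv\<^bsub>F27\<^esub> s0"]) simp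
  next
    case False
    hence inv: "inv\<^bsub>F27\<^esub> r0 \<in> carrier F27" "inv\<^bsub>F27\<^esub> r0 \<otimes>\<^bsub>F27\<^esub> r0 = \<one>\<^bsub>F27\<^esub>"
      using r0 F.field_Units by (auto intro!: F.Units_inv_closed F.Units_l_inv)
    have "inv\<^bsub>F27\<^esub> r0 \<otimes>\<^bsub>F27\<^esub> s0 \<in> carrier F27" using inv r0 by simp
    then obtain x p q r where x: "x \<in> \<Gamma>" "th x = (p, q, r, r \<otimes>\<^bsub>F27\<^esub> (inv\<^bsub>F27\<^esub> r0 \<otimes>\<^bsub>F27\<^esub> s0))"
      using all_slopes[OF f0 fh gs inj] by metis
    have r: "r \<in> carrier F27" using th_carrier[OF Gamma_O[OF x(1)] x(2)] by blast
    have "r = (r \<otimes>\<^bsub>F27\<^esub> inv\<^bsub>F27\<^esub> r0) \<otimes>\<^bsub>F27\<^esub> r0" using r inv r0 by (simp add: F.m_assoc)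
    moreover have "r \<otimes>\<^bsub>F27\<^esub> (inv\<^bsub>F27\<^esub> r0 \<otimes>\<^bsub>F27\<^esub> s0) = (r \<otimes>\<^bsub>F27\<^esub> inv\<^bsub>F27\<^esub> r0) \<otimes>\<^bsub>F27\<^esub> s0"
      using r inv r0 by (simp add: F.m_assoc)
    ultimately have "th x = (p, q, (r \<otimes>\<^bsub>F27\<^esub> inv\<^bsub>F27\<^esub> r0) \<otimes>\<^bsub>F27\<^esub> r0, (r \<otimes>\<^bsub>F27\<^esub> inv\<^bsub>F27\<^esub> r0) \<otimes>\<^bsub>F27\<^esub> s0)"
      using x(2) by simp
    moreover have "r \<otimes>\<^bsub>F27\<^esub> inv\<^bsub>F27\<^esub> r0 \<in> carrier F27" using r inv by simp
    ultimately show ?thesis using x(1) by blast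
  qed
  then obtain x p q c where x: "x \<in> \<Gamma>" "c \<in> carrier F27" "th x = (p, q, c \<otimes>\<^bsub>F27\<^esub> r0, c \<otimes>\<^bsub>F27\<^esub> s0)" by blast
  have xO: "x \<in> \<O>" by (rule Gamma_O[OF x(1)])
  note xc = th_carrier[OF xO x(3)]
  obtain t1 t2 where t: "th (x \<star> qconj al) = (t1, t2, \<zero>\<^bsub>F27\<^esub>, \<zero>\<^bsub>F27\<^esub>)"
  proof -
    have "c \<otimes>\<^bsub>F27\<^esub> r0 \<otimes>\<^bsub>F27\<^esub> b1 \<oplus>\<^bsub>F27\<^esub> c \<otimes>\<^bsub>F27\<^esub> s0 \<otimes>\<^bsub>F27\<^esub> b3 = c \<otimes>\<^bsub>F27\<^esub> (r0 \<otimes>\<^bsub>F27\<^esub> b1 \<oplus>\<^bsub>F27\<^esub> s0 \<otimes>\<^bsub>F27\<^esub> b3)"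
      "c \<otimes>\<^bsub>F27\<^esub> r0 \<otimes>\<^bsub>F27\<^esub> b2 \<oplus>\<^bsub>F27\<^esub> c \<otimes>\<^bsub>F27\<^esub> s0 \<otimes>\<^bsub>F27\<^esub> b4 = c \<otimes>\<^bsub>F27\<^esub> (r0 \<otimes>\<^bsub>F27\<^esub> b2 \<oplus>\<^bsub>F27\<^esub> s0 \<otimes>\<^bsub>F27\<^esub> b4)"
      using x(2) r0(1,2) Bc by (simp_all add: F.m_assoc F.r_distr)
    thus ?thesis using th_mult[OF xO cO x(3) B] that x(2) by (simp add: r0(4,5))
  qed
  have xcO: "x \<star> qconj al \<in> \<O>" by (rule O_mult[OF xO cO])
  have "th (beta h \<star> (x \<star> qconj al)) = (\<zero>\<^bsub>F27\<^esub>, \<zero>\<^bsub>F27\<^esub>, \<zero>\<^bsub>F27\<^esub>, \<zero>\<^bsub>F27\<^esub>)"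
    using th_mult[OF beta_O xcO u(3) t] th_carrier[OF xcO t] u(1) by simp
  then obtain d where d: "d \<in> \<O>" "beta h \<star> (x \<star> qconj al) = 3 *\<^sub>R d"
    using third_of_th_zero[OF O_mult[OF beta_O xcO]] by metis
  have "nrd (3 *\<^sub>R d) = 3 * (1 * 3)"
    using x(1) unfolding d(2)[symmetric] by (simp add: reduced_norm_qmul nrd_beta al Gamma1_def)
  hence "d \<in> \<Gamma>" using d(1) by (simp add: Gamma1_def reduced_norm_scaleR)
  moreover have "beta h \<star> x = d \<star> al"
  proof -
    have "3 *\<^sub>R (d \<star> al) = (beta h \<star> (x \<star> qconj al)) \<star> al" by (simp add: d(2) qmul_scaleR)
    also have "\<dots> = (beta h \<star> x) \<star> (qconj al \<star> al)" by (simp only: qmul_assoc)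
    also have "qconj al \<star> al = 3 *\<^sub>R (1, 0, 0, 0)" by (simp add: qmul_qconj al)
    also have "(beta h \<star> x) \<star> (3 *\<^sub>R (1, 0, 0, 0)) = 3 *\<^sub>R (beta h \<star> x)" by (simp only: qmul_scaleR qmul_one)
    finally show ?thesis by simp
  qed
  ultimately show ?thesis using that x(1) by blast
qed

end

end

lemma cubic_simple_roots_identity:
  "lzero (ladd (ladd (lmul [- 10289799, 84456] cubic) (lmul [840154239, 3420549, - 28152] (lderiv cubic))) [- 241162079949])"
  by code_simp

text \<open>Smoothness of the curve at the points with 2y + 1 = 0.\<close>

lemma cubic_simple_roots: "lev cubic x = 0 \<Longrightarrow> lev (lderiv cubic) x \<noteq> 0"
  using lev_lzero[OF cubic_simple_roots_identity, of x] by (auto simp: lev_hom)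

section \<open>Moebius transformations\<close>

definition madj :: "quat \<Rightarrow> quat" where "madj = (\<lambda>(p, q, r, s). (s, - q, - r, p))"

lemma mdet_mmul: "mdet (mmul x y) = mdet x * mdet y"
  by (cases x; cases y) (simp add: mdet_def mmul_def algebra_simps)

lemma mdet_madj [simp]: "mdet (madj x) = mdet x"
  by (cases x) (simp add: mdet_def madj_def)

lemma mmul_madj: "mmul x (madj x) = mdet x *\<^sub>R (1, 0, 0, 1)" "mmul (madj x) x = mdet x *\<^sub>R (1, 0, 0, 1)"
  by (cases x; simp add: mdet_def madj_def mmul_def algebra_simps)+

lemma upper_half_plane_open [simp]: "open upper_half_plane"
  and upper_half_plane_connected [simp]: "connected upper_half_plane"
  unfolding upper_half_plane_def
  by (auto simp: open_halfspace_Im_gt convex_halfspace_Im_gt convex_connected)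

text \<open>The automorphy factor of the matrix.\<close>

definition mdenom :: "quat \<Rightarrow> complex \<Rightarrow> complex" where
  "mdenom = (\<lambda>(p, q, r, s) z. of_real r * z + of_real s)"

lemma mdenom_nonzero:
  assumes "mdet m > 0" "z \<in> upper_half_plane" shows "mdenom m z \<noteq> 0"
proof
  obtain p q r s where m: "m = (p, q, r, s)" by (cases m) auto
  assume "mdenom m z = 0"
  hence "r * Im z = 0" "r * Re z + s = 0" by (simp_all add: m mdenom_def complex_eq_iff)
  hence "r = 0" "s = 0" using assms(2) by (auto simp: upper_half_plane_def)
  thus False using assms(1) by (simp add: m mdet_def)
qed

lemma Im_moebius:
  assumes "mdet m > 0" "z \<in> upper_half_plane"
  shows "Im (moebius m z) = mdet m * Im z / (cmod (mdenom m z))^2"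
proof -
  obtain p q r s where m: "m = (p, q, r, s)" by (cases m) auto
  show ?thesis
    unfolding m moebius_def mdenom_def mdet_def case_prod_conv cmod_power2 Im_divide
    by (simp add: algebra_simps)
qed

lemma moebius_in_H:
  assumes "mdet m > 0" "z \<in> upper_half_plane" shows "moebius m z \<in> upper_half_plane"
  using Im_moebius[OF assms] mdenom_nonzero[OF assms] assms by (simp add: upper_half_plane_def)

lemma moebius_mmul:
  assumes "mdet n > 0" "z \<in> upper_half_plane"
  shows "moebius (mmul m n) z = moebius m (moebius n z)"
proof -
  obtain p q r s where m: "m = (p, q, r, s)" by (cases m) auto
  obtain p' q' r' s' where n: "n = (p', q', r', s')" by (cases n) auto
  define d where "d = of_real r' * z + of_real s'"
  have d: "d \<noteq> 0" using mdenom_nonzero[OF assms] by (simp add: n mdenom_def d_def)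
  define u where "u = of_real p' * z + of_real q'"
  have frac: "(v / d) / (w / d) = v / w" for v w using d by simp
  have "moebius m (moebius n z) =
      (of_real p * (u / d) + of_real q) / (of_real r * (u / d) + of_real s)"
    by (simp add: m n moebius_def d_def u_def)
  also have "of_real p * (u / d) + of_real q = (of_real p * u + of_real q * d) / d"
    using d by (simp add: add_divide_distrib)
  also have "of_real r * (u / d) + of_real s = (of_real r * u + of_real s * d) / d"
    using d by (simp add: add_divide_distrib)
  also note frac
  also have "of_real p * u + of_real q * d = of_real (p * p' + q * r') * z + of_real (p * q' + q * s')"
    by (simp add: u_def d_def algebra_simps)
  also have "of_real r * u + of_real s * d = of_real (r * p' + s * r') * z + of_real (r * q' + s * s')"
    by (simp add: u_def d_def algebra_simps)
  also have "(of_real (p * p' + q * r') * z + of_real (p * q' + q * s')) /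
      (of_real (r * p' + s * r') * z + of_real (r * q' + s * s')) = moebius (mmul m n) z"
    by (simp add: m n moebius_def mmul_def)
  finally show ?thesis ..
qed

lemma moebius_one [simp]: "moebius (1, 0, 0, 1) z = z"
  by (simp add: moebius_def)

lemma moebius_scaleR:
  assumes "k \<noteq> 0" shows "moebius (k *\<^sub>R m) z = moebius m z"
proof -
  obtain p q r s where m: "m = (p, q, r, s)" by (cases m) auto
  have "moebius (k *\<^sub>R m) z = (of_real k * (of_real p * z + of_real q)) / (of_real k * (of_real r * z + of_real s))"
    by (simp add: m moebius_def algebra_simps)
  also have "\<dots> = moebius m z" using assms by (simp add: m moebius_def)
  finally show ?thesis .
qed

lemma moebius_madj:
  assumes "mdet m > 0" "z \<in> upper_half_plane"
  shows "moebius (madj m) (moebius m z) = z" "moebius m (moebius (madj m) z) = z"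
proof -
  have "moebius (madj m) (moebius m z) = moebius (mdet m *\<^sub>R (1, 0, 0, 1)) z"
    by (simp only: moebius_mmul[OF assms, symmetric] mmul_madj)
  thus "moebius (madj m) (moebius m z) = z" using assms by (simp only: moebius_scaleR moebius_one)
  have "moebius m (moebius (madj m) z) = moebius (mdet m *\<^sub>R (1, 0, 0, 1)) z"
    using assms by (simp only: moebius_mmul[symmetric] mmul_madj mdet_madj)
  thus "moebius m (moebius (madj m) z) = z" using assms by (simp only: moebius_scaleR moebius_one)
qed

lemma moebius_has_field_derivative:
  assumes "mdet m > 0" "z \<in> upper_half_plane"
  shows "(moebius m has_field_derivative (of_real (mdet m) / mdenom m z ^ 2)) (at z)"
proof -
  obtain p q r s where m: "m = (p, q, r, s)" by (cases m) auto
  have d: "of_real r * z + of_real s \<noteq> 0" using mdenom_nonzero[OF assms] by (simp add: m mdenom_def)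
  have "((\<lambda>z. (of_real p * z + of_real q) / (of_real r * z + of_real s)) has_field_derivative
     (of_real p * (of_real r * z + of_real s) - (of_real p * z + of_real q) * of_real r) /
       ((of_real r * z + of_real s) * (of_real r * z + of_real s))) (at z)"
    by (rule derivative_eq_intros refl d | use d in simp)+
  moreover have "of_real p * (of_real r * z + of_real s) - (of_real p * z + of_real q) * of_real r =
      (of_real (mdet m) :: complex)"
    by (simp add: m mdet_def algebra_simps)
  ultimately show ?thesis
    by (simp add: m moebius_def mdenom_def power2_eq_square)
qed

lemma moebius_holomorphic: "mdet m > 0 \<Longrightarrow> moebius m holomorphic_on upper_half_plane"
  by (subst holomorphic_on_open[OF upper_half_plane_open]) (intro ballI exI, rule moebius_has_field_derivative)

lemma moebius_analytic: "mdet m > 0 \<Longrightarrow> z \<in> upper_half_plane \<Longrightarrow> moebius m analytic_on {z}"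
  by (rule holomorphic_on_imp_analytic_at[OF moebius_holomorphic upper_half_plane_open])

lemma moebius_isCont: "mdet m > 0 \<Longrightarrow> z \<in> upper_half_plane \<Longrightarrow> isCont (moebius m) z"
  by (rule analytic_at_imp_isCont[OF moebius_analytic])

section \<open>Countable matrix groups and their orbits\<close>

definition matrix_group :: "quat set \<Rightarrow> bool" where
  "matrix_group G \<longleftrightarrow> (1, 0, 0, 1) \<in> G \<and> (\<forall>g\<in>G. \<forall>h\<in>G. mmul g h \<in> G) \<and> (\<forall>g\<in>G. madj g \<in> G) \<and>
     (\<forall>g\<in>G. mdet g = 1) \<and> countable G"

locale matrix_grp =
  fixes G :: "quat set"
  assumes grp: "matrix_group G"
begin

lemma one_in: "(1, 0, 0, 1) \<in> G" and mul_in: "g \<in> G \<Longrightarrow> h \<in> G \<Longrightarrow> mmul g h \<in> G"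
  and adj_in: "g \<in> G \<Longrightarrow> madj g \<in> G" and det_1: "g \<in> G \<Longrightarrow> mdet g = 1" and count: "countable G"
  using grp by (auto simp: matrix_group_def)

lemma det_pos: "g \<in> G \<Longrightarrow> mdet g > 0" by (simp add: det_1)

lemma orbit_of_iff: "w \<in> orbit_of G z \<longleftrightarrow> (\<exists>g\<in>G. w = moebius g z)"
  unfolding orbit_of_def by blast

lemma orbit_self: "z \<in> orbit_of G z"
  unfolding orbit_of_iff using one_in moebius_one by metis

lemma orbit_moebius:
  assumes "g \<in> G" "z \<in> upper_half_plane" shows "orbit_of G (moebius g z) = orbit_of G z"
proof (intro equalityI subsetI)
  fix w assume "w \<in> orbit_of G (moebius g z)"
  then obtain h where "h \<in> G" "w = moebius h (moebius g z)" unfolding orbit_of_iff by blast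
  hence "w = moebius (mmul h g) z" "mmul h g \<in> G"
    using assms by (simp_all add: moebius_mmul det_pos mul_in)
  thus "w \<in> orbit_of G z" unfolding orbit_of_iff by blast
next
  fix w assume "w \<in> orbit_of G z"
  then obtain h where h: "h \<in> G" "w = moebius h z" unfolding orbit_of_iff by blast
  hence "w = moebius h (moebius (madj g) (moebius g z))" using assms by (simp add: moebius_madj det_pos)
  also have "\<dots> = moebius (mmul h (madj g)) (moebius g z)"
    using assms by (simp add: moebius_mmul det_pos adj_in moebius_in_H)
  finally show "w \<in> orbit_of G (moebius g z)" using h assms mul_in adj_in unfolding orbit_of_iff by blast
qed

lemma orbit_eq_iff:
  assumes "z \<in> upper_half_plane" "w \<in> upper_half_plane"
  shows "orbit_of G z = orbit_of G w \<longleftrightarrow> (\<exists>g\<in>G. w = moebius g z)"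
proof
  assume "orbit_of G z = orbit_of G w"
  thus "\<exists>g\<in>G. w = moebius g z" using orbit_self[of w] unfolding orbit_of_iff[symmetric] by simp
next
  assume "\<exists>g\<in>G. w = moebius g z"
  thus "orbit_of G z = orbit_of G w" using orbit_moebius[OF _ assms(1)] by auto
qed

lemma countable_orbit: "countable (orbit_of G z)"
proof -
  have "orbit_of G z = (\<lambda>g. moebius g z) ` G" by (auto simp: orbit_of_def)
  thus ?thesis using count by simp
qed

end

section \<open>Holomorphic maps to the projective line\<close>

lemma P1_holomorphic_analytic:
  assumes "P1_holomorphic F" "z \<in> upper_half_plane" "F z \<noteq> P1_inf"
  shows "(\<lambda>w. P1_value (F w)) analytic_on {z}"
  using assms nicely_meromorphic_on_imp_analytic_at unfolding P1_holomorphic_def by blast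

lemma P1_holomorphic_pole:
  assumes "P1_holomorphic F" "z \<in> upper_half_plane" "F z = P1_inf"
  shows "is_pole (\<lambda>w. P1_value (F w)) z"
  using assms unfolding P1_holomorphic_def by blast

lemma P1_holomorphic_finite_near:
  assumes "P1_holomorphic F" "z \<in> upper_half_plane"
  shows "eventually (\<lambda>w. F w \<noteq> P1_inf \<and> w \<in> upper_half_plane) (at z)"
proof -
  have "(\<lambda>w. P1_value (F w)) meromorphic_on {z}"
    using assms unfolding P1_holomorphic_def nicely_meromorphic_on_def
    by (meson meromorphic_on_subset empty_subsetI insert_subset)
  hence "isolated_singularity_at (\<lambda>w. P1_value (F w)) z"
    by (rule meromorphic_on_isolated_singularity)
  hence "eventually (\<lambda>w. \<not> is_pole (\<lambda>w. P1_value (F w)) w) (at z)"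
    by (rule eventually_not_pole)
  moreover have "eventually (\<lambda>w. w \<in> upper_half_plane) (at z)"
    using assms(2) by (intro eventually_at_in_open') auto
  ultimately show ?thesis
    by eventually_elim (use assms(1) in \<open>auto simp: P1_holomorphic_def\<close>)
qed

lemma P1_value_finite: "F \<noteq> P1_inf \<Longrightarrow> F = P1_fin (P1_value F)"
  by (cases F) auto

section \<open>The two quotients, their coordinates and the map between them\<close>

locale shimura =
  G1: matrix_grp G1 + G0: matrix_grp G0 for G1 G0 :: "quat set" +
  fixes t :: "complex set \<Rightarrow> P1" and \<phi> :: "complex set \<Rightarrow> E_point"
  assumes sub: "G0 \<subseteq> G1"
    and t_iso: "iso_to_P1 G1 t"
    and model: "X0_3_model G1 G0 t \<phi>"
begin

abbreviation "H \<equiv> upper_half_plane"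

text \<open>Everything is pulled back to the half-plane, where holomorphy is that of ordinary
  functions. By the convention of \<open>P1_value\<close>, the functions \<open>xf\<close>,
  \<open>yf\<close> and \<open>tf\<close> are 0 at their poles.\<close>

definition pt :: "complex \<Rightarrow> E_point" where "pt z = \<phi> (orbit_of G0 z)"
definition tt :: "complex \<Rightarrow> P1" where "tt z = t (orbit_of G1 z)"
definition xf :: "complex \<Rightarrow> complex" where "xf z = P1_value (E_x (pt z))"
definition yf :: "complex \<Rightarrow> complex" where "yf z = P1_value (E_y (pt z))"
definition tf :: "complex \<Rightarrow> complex" where "tf z = P1_value (tt z)"

lemma pt_eq_iff: "z \<in> H \<Longrightarrow> w \<in> H \<Longrightarrow> pt z = pt w \<longleftrightarrow> (\<exists>g\<in>G0. w = moebius g z)"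
proof -
  assume zw: "z \<in> H" "w \<in> H"
  have "inj_on \<phi> (quotient_curve G0)"
    using model by (auto simp: X0_3_model_def iso_to_E_def bij_betw_def)
  hence "pt z = pt w \<longleftrightarrow> orbit_of G0 z = orbit_of G0 w"
    using zw unfolding pt_def by (auto simp: quotient_curve_def dest: inj_onD)
  thus ?thesis using G0.orbit_eq_iff[OF zw] by simp
qed

lemma tt_eq_iff: "z \<in> H \<Longrightarrow> w \<in> H \<Longrightarrow> tt z = tt w \<longleftrightarrow> (\<exists>g\<in>G1. w = moebius g z)"
proof -
  assume zw: "z \<in> H" "w \<in> H"
  have "inj_on t (quotient_curve G1)"
    using t_iso by (auto simp: iso_to_P1_def bij_betw_def)
  hence "tt z = tt w \<longleftrightarrow> orbit_of G1 z = orbit_of G1 w"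
    using zw unfolding tt_def by (auto simp: quotient_curve_def dest: inj_onD)
  thus ?thesis using G1.orbit_eq_iff[OF zw] by simp
qed

lemma pt_eq_orbit: "z \<in> H \<Longrightarrow> w \<in> H \<Longrightarrow> pt z = pt w \<Longrightarrow> w \<in> orbit_of G0 z"
  unfolding pt_eq_iff orbit_of_def by blast

lemma tt_eq_orbit: "z \<in> H \<Longrightarrow> w \<in> H \<Longrightarrow> tt z = tt w \<Longrightarrow> w \<in> orbit_of G1 z"
  unfolding tt_eq_iff orbit_of_def by blast

lemma pt_surj: "Q \<in> E_curve \<Longrightarrow> \<exists>z\<in>H. pt z = Q"
proof -
  assume "Q \<in> E_curve"
  hence "Q \<in> \<phi> ` quotient_curve G0"
    using model by (simp add: X0_3_model_def iso_to_E_def bij_betw_def)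
  thus ?thesis unfolding quotient_curve_def pt_def by blast
qed

lemma pt_E: "z \<in> H \<Longrightarrow> pt z \<in> E_curve"
proof -
  assume "z \<in> H"
  hence "\<phi> (orbit_of G0 z) \<in> \<phi> ` quotient_curve G0" unfolding quotient_curve_def by blast
  thus ?thesis using model by (simp add: X0_3_model_def iso_to_E_def bij_betw_def pt_def)
qed

lemma on_E_E_curve: "E_affine x y \<in> E_curve \<longleftrightarrow> on_E x y"
  by (auto simp: E_curve_def on_E_def)

lemma pt_affine:
  assumes "z \<in> H" "pt z \<noteq> E_origin"
  shows "pt z = E_affine (xf z) (yf z)" "on_E (xf z) (yf z)"
proof -
  show *: "pt z = E_affine (xf z) (yf z)"
    using assms(2) by (cases "pt z") (simp_all add: xf_def yf_def)
  show "on_E (xf z) (yf z)" using pt_E[OF assms(1)] unfolding * on_E_E_curve .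
qed

lemma pt_affine_iff: "z \<in> H \<Longrightarrow> pt z = E_affine x y \<longleftrightarrow> pt z \<noteq> E_origin \<and> xf z = x \<and> yf z = y"
  using pt_affine(1) by fastforce

lemma x_holo: "P1_holomorphic (\<lambda>z. E_x (pt z))" and y_holo: "P1_holomorphic (\<lambda>z. E_y (pt z))"
  using model by (auto simp: X0_3_model_def iso_to_E_def pt_def)

lemma t_holo: "P1_holomorphic tt"
  using t_iso by (auto simp: iso_to_P1_def tt_def[abs_def])

lemma E_x_inf_iff: "E_x Q = P1_inf \<longleftrightarrow> Q = E_origin" and E_y_inf_iff: "E_y Q = P1_inf \<longleftrightarrow> Q = E_origin"
  by (cases Q; simp)+

lemma xf_analytic: "z \<in> H \<Longrightarrow> pt z \<noteq> E_origin \<Longrightarrow> xf analytic_on {z}"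
  and yf_analytic: "z \<in> H \<Longrightarrow> pt z \<noteq> E_origin \<Longrightarrow> yf analytic_on {z}"
  using P1_holomorphic_analytic[OF x_holo] P1_holomorphic_analytic[OF y_holo]
  by (simp_all add: xf_def[abs_def] yf_def[abs_def] E_x_inf_iff E_y_inf_iff)

lemma xf_pole: "z \<in> H \<Longrightarrow> pt z = E_origin \<Longrightarrow> is_pole xf z"
  using P1_holomorphic_pole[OF x_holo] by (simp add: xf_def[abs_def])

lemma tf_analytic: "z \<in> H \<Longrightarrow> tt z \<noteq> P1_inf \<Longrightarrow> tf analytic_on {z}"
  using P1_holomorphic_analytic[OF t_holo] by (simp add: tf_def[abs_def])

lemma pt_affine_near: "z \<in> H \<Longrightarrow> eventually (\<lambda>w. pt w \<noteq> E_origin \<and> w \<in> H) (at z)"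
  using P1_holomorphic_finite_near[OF x_holo] by (simp add: E_x_inf_iff)

lemma tt_finite_near: "z \<in> H \<Longrightarrow> eventually (\<lambda>w. tt w \<noteq> P1_inf \<and> w \<in> H) (at z)"
  using P1_holomorphic_finite_near[OF t_holo] by simp

lemma pt_invariant: "g \<in> G0 \<Longrightarrow> z \<in> H \<Longrightarrow> pt (moebius g z) = pt z"
  by (simp add: pt_def G0.orbit_moebius)

lemma tt_invariant: "g \<in> G1 \<Longrightarrow> z \<in> H \<Longrightarrow> tt (moebius g z) = tt z"
  by (simp add: tt_def G1.orbit_moebius)

lemma curve_proj_orbit: "z \<in> H \<Longrightarrow> curve_proj G1 (orbit_of G0 z) = orbit_of G1 z"
proof -
  assume z: "z \<in> H"
  have "orbit_of G1 w = orbit_of G1 z" if "w \<in> orbit_of G0 z" for w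
    using that sub G1.orbit_moebius[OF _ z] unfolding G0.orbit_of_iff by blast
  moreover have "z \<in> orbit_of G0 z" by (rule G0.orbit_self)
  ultimately show ?thesis unfolding curve_proj_def by blast
qed

lemma tt_formula:
  assumes "z \<in> H" "pt z = E_affine x y" "F4 x y \<noteq> 0"
  shows "tt z = P1_fin (1 - 343 * F9 x y ^ 3 / (64 * F4 x y ^ 7))"
proof -
  have "orbit_of G0 z \<in> quotient_curve G0" using assms(1) by (simp add: quotient_curve_def)
  thus ?thesis using model assms unfolding X0_3_model_def tt_def pt_def
    by (metis curve_proj_orbit)
qed

lemma origin_iff:
  assumes "z \<in> H"
  shows "pt z = E_origin \<longleftrightarrow> zorder (\<lambda>w. tf w - 1) z = int (stabilizer_order G0 z)"
proof -
  have "eventually (\<lambda>w. w \<in> H) (at z)" using assms by (intro eventually_at_in_open') auto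
  hence "eventually (\<lambda>w. P1_value (t (curve_proj G1 (orbit_of G0 w))) - 1 = tf w - 1) (at z)"
    by eventually_elim (simp add: curve_proj_orbit tf_def tt_def)
  hence "zorder (\<lambda>w. P1_value (t (curve_proj G1 (orbit_of G0 w))) - 1) z = zorder (\<lambda>w. tf w - 1) z"
    by (rule zorder_cong) simp
  thus ?thesis using model assms
    unfolding X0_3_model_def simple_zero_on_quotient_def pt_def by simp
qed

text \<open>Orbits are countable, so the coordinates are nowhere locally constant.\<close>

lemma not_locally_one_point:
  assumes "open N" "z0 \<in> N" "N \<subseteq> H"
  shows "\<not> (\<forall>z\<in>N. pt z = Q)" "\<not> (\<forall>z\<in>N. tt z = v)"
proof -
  have unc: "uncountable N"
  proof -
    obtain e where e: "e > 0" "ball z0 e \<subseteq> N" using assms by (auto elim: openE)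
    thus ?thesis using uncountable_ball[OF e(1)] countable_subset by metis
  qed
  have H: "z \<in> H" if "z \<in> N" for z using that assms by blast
  show "\<not> (\<forall>z\<in>N. pt z = Q)"
  proof
    assume "\<forall>z\<in>N. pt z = Q"
    hence "N \<subseteq> orbit_of G0 z0"
      using pt_eq_orbit[OF H[OF assms(2)] H] assms(2) by auto
    thus False using unc G0.countable_orbit countable_subset by blast
  qed
  show "\<not> (\<forall>z\<in>N. tt z = v)"
  proof
    assume "\<forall>z\<in>N. tt z = v"
    hence "N \<subseteq> orbit_of G1 z0"
      using tt_eq_orbit[OF H[OF assms(2)] H] assms(2) by auto
    thus False using unc G1.countable_orbit countable_subset by blast
  qed
qed

lemma not_locally_finite_points:
  assumes "open N" "z0 \<in> N" "N \<subseteq> H" "finite A"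
  shows "\<not> pt ` N \<subseteq> A"
proof
  assume A: "pt ` N \<subseteq> A"
  have H: "z \<in> H" if "z \<in> N" for z using that assms by blast
  have "countable (N \<inter> {z. pt z = Q})" for Q
  proof (cases "N \<inter> {z. pt z = Q} = {}")
    case False
    then obtain z1 where z1: "z1 \<in> N" "pt z1 = Q" by blast
    have "N \<inter> {z. pt z = Q} \<subseteq> orbit_of G0 z1"
      using pt_eq_orbit[OF H[OF z1(1)] H] z1 by auto
    thus ?thesis using G0.countable_orbit countable_subset by blast
  qed (simp only: countable_empty)
  hence "countable (\<Union>Q\<in>A. N \<inter> {z. pt z = Q})" using assms(4) by (intro countable_UN) (auto intro: countable_finite)
  moreover have "N \<subseteq> (\<Union>Q\<in>A. N \<inter> {z. pt z = Q})" using A by auto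
  ultimately have "countable N" by (rule countable_subset[rotated])
  moreover obtain e where e: "e > 0" "ball z0 e \<subseteq> N" using assms by (auto elim: openE)
  ultimately have "countable (ball z0 e)" using countable_subset by blast
  thus False using uncountable_ball[OF e(1), of z0] by simp
qed

lemma finite_same_x: "finite {Q \<in> E_curve. \<exists>y. Q = E_affine x y}"
proof (cases "\<exists>y. on_E x y")
  case True
  then obtain y where y: "on_E x y" by blast
  have "{Q \<in> E_curve. \<exists>y. Q = E_affine x y} \<subseteq> {E_affine x y, E_affine x (- 1 - y)}"
    by (auto simp: on_E_E_curve dest: on_E_same_x[OF y])
  thus ?thesis by (rule finite_subset) simp
next
  case False
  hence "{Q \<in> E_curve. \<exists>y. Q = E_affine x y} = {}" by (auto simp: on_E_E_curve)
  thus ?thesis by (simp only: finite.emptyI)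
qed

lemma finite_same_y: "finite {Q \<in> E_curve. \<exists>x. Q = E_affine x y}"
proof -
  have "{x. on_E x y} \<subseteq> {x. poly [: - 3655907 - y^2 - y, - 44704, 1, 1:] x = 0}"
    by (auto simp: on_E_def algebra_simps power2_eq_square power3_eq_cube)
  moreover have "finite {x. poly [: - 3655907 - y^2 - y, - 44704, 1, 1:] x = 0}"
    by (rule poly_roots_finite) simp
  ultimately have "finite {x. on_E x y}" by (rule finite_subset)
  moreover have "{Q \<in> E_curve. \<exists>x. Q = E_affine x y} = (\<lambda>x. E_affine x y) ` {x. on_E x y}"
    by (auto simp: on_E_E_curve)
  ultimately show ?thesis by simp
qed

lemma good_ball:
  assumes "z1 \<in> H" "pt z1 \<noteq> E_origin" "open N" "z1 \<in> N"
  obtains r where "r > 0" "ball z1 r \<subseteq> N \<inter> H" "\<And>z. z \<in> ball z1 r \<Longrightarrow> pt z \<noteq> E_origin"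
    "xf holomorphic_on ball z1 r" "yf holomorphic_on ball z1 r"
proof -
  obtain r1 where r1: "r1 > 0" "\<And>z. z \<in> ball z1 r1 - {z1} \<Longrightarrow> pt z \<noteq> E_origin \<and> z \<in> H"
    using pt_affine_near[OF assms(1)] unfolding eventually_at by (auto simp: dist_commute)
  have r1': "pt z \<noteq> E_origin \<and> z \<in> H" if "z \<in> ball z1 r1" for z
    using r1(2)[of z] that assms(1,2) by (cases "z = z1") auto
  obtain r2 where r2: "r2 > 0" "ball z1 r2 \<subseteq> N" using assms(3,4) by (auto elim: openE)
  define r where "r = min r1 r2"
  have r: "r > 0" "ball z1 r \<subseteq> N \<inter> H" and aff: "\<And>z. z \<in> ball z1 r \<Longrightarrow> pt z \<noteq> E_origin"
    using r1' r1(1) r2 by (auto simp: r_def)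
  have H: "z \<in> H" if "z \<in> ball z1 r" for z using r(2) that by blast
  have "xf holomorphic_on ball z1 r" "yf holomorphic_on ball z1 r"
    using xf_analytic[OF H aff] yf_analytic[OF H aff]
    by (auto intro!: analytic_imp_holomorphic simp: analytic_on_analytic_at[of _ "ball z1 r"])
  thus ?thesis using that r aff by blast
qed

lemma xf_not_constant:
  assumes "open N" "z0 \<in> N" "N \<subseteq> H" "\<And>z. z \<in> N \<Longrightarrow> pt z \<noteq> E_origin"
  shows "\<not> xf constant_on N"
proof
  assume "xf constant_on N"
  then obtain c where "\<And>z. z \<in> N \<Longrightarrow> xf z = c" by (auto simp: constant_on_def)
  hence "pt ` N \<subseteq> {Q \<in> E_curve. \<exists>y. Q = E_affine c y}"
    using pt_affine(1)[of _] pt_E assms(3,4) by (fastforce simp: subset_iff)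
  thus False using not_locally_finite_points[OF assms(1-3) finite_same_x] by blast
qed

lemma yf_not_constant:
  assumes "open N" "z0 \<in> N" "N \<subseteq> H" "\<And>z. z \<in> N \<Longrightarrow> pt z \<noteq> E_origin"
  shows "\<not> yf constant_on N"
proof
  assume "yf constant_on N"
  then obtain c where "\<And>z. z \<in> N \<Longrightarrow> yf z = c" by (auto simp: constant_on_def)
  hence "pt ` N \<subseteq> {Q \<in> E_curve. \<exists>x. Q = E_affine x c}"
    using pt_affine(1)[of _] pt_E assms(3,4) by (fastforce simp: subset_iff)
  thus False using not_locally_finite_points[OF assms(1-3) finite_same_y] by blast
qed

text \<open>The map from the upper half-plane to the curve is open.  Near a point with \<open>2y + 1 \<noteq> 0\<close> the
  coordinate \<open>x\<close> is injective on the curve, near the others \<open>y\<close> is.\<close>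

lemma pt_open:
  assumes z1: "z1 \<in> H" "pt z1 = E_affine x1 y1" and N: "open N" "z1 \<in> N"
  obtains d where "d > 0" "\<And>x y. on_E x y \<Longrightarrow> dist x x1 < d \<Longrightarrow> dist y y1 < d \<Longrightarrow>
    \<exists>z\<in>N \<inter> H. pt z = E_affine x y"
proof -
  have aff: "pt z1 \<noteq> E_origin" using z1 by simp
  have v1: "xf z1 = x1" "yf z1 = y1" and E1: "on_E x1 y1"
    using pt_affine[OF z1(1) aff] z1(2) by auto
  obtain r where r: "r > 0" "ball z1 r \<subseteq> N \<inter> H" "\<And>z. z \<in> ball z1 r \<Longrightarrow> pt z \<noteq> E_origin"
    "xf holomorphic_on ball z1 r" "yf holomorphic_on ball z1 r"
    using good_ball[OF z1(1) aff N] by blast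
  have inj: "\<exists>e>0. (\<forall>x y x' y'. on_E x y \<longrightarrow> on_E x' y' \<longrightarrow> dist x x1 < e \<longrightarrow> dist y y1 < e \<longrightarrow>
      dist x' x1 < e \<longrightarrow> dist y' y1 < e \<longrightarrow> x = x' \<longrightarrow> y = y') \<or>
     (\<forall>x y x' y'. on_E x y \<longrightarrow> on_E x' y' \<longrightarrow> dist x x1 < e \<longrightarrow> dist y y1 < e \<longrightarrow>
      dist x' x1 < e \<longrightarrow> dist y' y1 < e \<longrightarrow> y = y' \<longrightarrow> x = x')"
  proof (cases "2 * y1 + 1 = 0")
    case False
    \<comment> \<open>Half the distance between the two ordinates y1 and -1 - y1 over x1, so that a
      ball of this radius sees only one sheet.\<close>
    define e where "e = norm (2 * y1 + 1) / 2"
    have "y = y'" if "on_E x y" "on_E x y'" "dist y y1 < e" "dist y' y1 < e" for x y y'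
    proof (rule ccontr)
      assume "y \<noteq> y'"
      hence "y' = - 1 - y" using on_E_same_x[OF that(1,2)] by simp
      hence "norm (2 * y1 + 1) = norm ((y1 - y) + (y1 - y'))" by (simp add: algebra_simps)
      also have "\<dots> \<le> norm (y1 - y) + norm (y1 - y')" by (rule norm_triangle_ineq)
      also have "\<dots> < e + e" using that(3,4) by (intro add_strict_mono) (simp_all add: dist_norm norm_minus_commute)
      finally show False by (simp add: e_def)
    qed
    moreover have "e > 0" using False by (simp add: e_def)
    ultimately show ?thesis by blast
  next
    case True
    \<comment> \<open>The difference quotient of the right-hand side of the curve equation. On the
      diagonal it is the derivative, nonzero at a simple root, so it stays nonzero nearby.\<close>
    define q where "q = (\<lambda>p :: complex \<times> complex. (fst p)^2 + fst p * snd p + (snd p)^2 + fst p + snd p - 44704)"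
    have "lev cubic x1 = 0" using E1 True by (simp add: on_E_iff)
    hence "lev (lderiv cubic) x1 \<noteq> 0" by (rule cubic_simple_roots)
    moreover have "lev (lderiv cubic) x1 = 4 * q (x1, x1)"
      by (simp add: cubic_def lderiv_def q_def algebra_simps power2_eq_square)
    ultimately have "q (x1, x1) \<noteq> 0" by simp
    moreover have "isCont q (x1, x1)" unfolding q_def by (intro continuous_intros)
    ultimately obtain e where e: "e > 0" "\<And>p. dist (x1, x1) p < e \<Longrightarrow> q p \<noteq> 0"
      using continuous_at_avoid[of "(x1, x1)" q 0] by blast
    have "x = x'" if "on_E x y" "on_E x' y" "dist x x1 < e / 2" "dist x' x1 < e / 2" for x x' y
    proof (rule ccontr)
      assume "x \<noteq> x'"
      have "dist (x1, x1) (x, x') \<le> dist x x1 + dist x' x1"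
        using sqrt_sum_squares_le_sum[of "dist x1 x" "dist x1 x'"] by (simp add: dist_Pair_Pair dist_commute)
      also have "\<dots> < e" using that(3,4) by simp
      finally have "q (x, x') \<noteq> 0" by (rule e(2))
      moreover have "(x - x') * q (x, x') = 0"
        using that(1,2) unfolding on_E_def q_def fst_conv snd_conv by Groebner_Basis.algebra
      ultimately show False using \<open>x \<noteq> x'\<close> by simp
    qed
    thus ?thesis using e(1) by (intro exI[of _ "e / 2"]) auto
  qed
  then obtain e where e: "e > 0" and inj':
    "(\<forall>x y x' y'. on_E x y \<longrightarrow> on_E x' y' \<longrightarrow> dist x x1 < e \<longrightarrow> dist y y1 < e \<longrightarrow>
      dist x' x1 < e \<longrightarrow> dist y' y1 < e \<longrightarrow> x = x' \<longrightarrow> y = y') \<or>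
     (\<forall>x y x' y'. on_E x y \<longrightarrow> on_E x' y' \<longrightarrow> dist x x1 < e \<longrightarrow> dist y y1 < e \<longrightarrow>
      dist x' x1 < e \<longrightarrow> dist y' y1 < e \<longrightarrow> y = y' \<longrightarrow> x = x')" by blast
  have "continuous_on (ball z1 r) xf" "continuous_on (ball z1 r) yf"
    using r by (auto intro: holomorphic_on_imp_continuous_on)
  hence c: "isCont xf z1" "isCont yf z1" using r(1) by (auto simp: continuous_on_eq_continuous_at)
  have c': "\<exists>d>0. \<forall>x'. dist x' z1 < d \<longrightarrow> dist (xf x') x1 < e"
    "\<exists>d>0. \<forall>x'. dist x' z1 < d \<longrightarrow> dist (yf x') y1 < e"
    using c e unfolding continuous_at_eps_delta v1 by blast+
  obtain r1 where r1: "r1 > 0" "\<And>z. dist z z1 < r1 \<Longrightarrow> dist (xf z) x1 < e" using c'(1) by blast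
  obtain r2 where r2: "r2 > 0" "\<And>z. dist z z1 < r2 \<Longrightarrow> dist (yf z) y1 < e" using c'(2) by blast
  define s where "s = min r (min r1 r2)"
  have s: "s > 0" using r r1 r2 by (simp add: s_def)
  have sub: "ball z1 s \<subseteq> ball z1 r" by (auto simp: s_def)
  have near: "dist (xf z) x1 < e" "dist (yf z) y1 < e" "z \<in> N" "z \<in> H" "pt z = E_affine (xf z) (yf z)"
    "on_E (xf z) (yf z)" if "z \<in> ball z1 s" for z
  proof -
    have z: "z \<in> ball z1 r" "dist z z1 < r1" "dist z z1 < r2" using that by (auto simp: s_def dist_commute)
    show "dist (xf z) x1 < e" "dist (yf z) y1 < e" using z r1 r2 by auto
    show "z \<in> N" "z \<in> H" using z(1) r(2) by auto
    thus "pt z = E_affine (xf z) (yf z)" "on_E (xf z) (yf z)" using pt_affine r(3)[OF z(1)] by auto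
  qed
  have sH: "ball z1 s \<subseteq> H" using near(4) by blast
  have aff_s: "pt z \<noteq> E_origin" if "z \<in> ball z1 s" for z using near(5)[OF that] by simp
  have z1s: "z1 \<in> ball z1 s" using s by simp
  have hol: "xf holomorphic_on ball z1 s" "yf holomorphic_on ball z1 s"
    using r(4,5) sub by (auto intro: holomorphic_on_subset)
  have "open (xf ` ball z1 s)"
    by (rule open_mapping_thm[OF hol(1) open_ball connected_ball open_ball subset_refl
          xf_not_constant[OF open_ball z1s sH aff_s]])
  moreover have "x1 \<in> xf ` ball z1 s" using s v1 by (intro image_eqI[of _ _ z1]) auto
  ultimately obtain d1 where d1: "d1 > 0" "ball x1 d1 \<subseteq> xf ` ball z1 s" by (auto elim: openE)
  have "open (yf ` ball z1 s)"
    by (rule open_mapping_thm[OF hol(2) open_ball connected_ball open_ball subset_refl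
          yf_not_constant[OF open_ball z1s sH aff_s]])
  moreover have "y1 \<in> yf ` ball z1 s" using s v1 by (intro image_eqI[of _ _ z1]) auto
  ultimately obtain d2 where d2: "d2 > 0" "ball y1 d2 \<subseteq> yf ` ball z1 s" by (auto elim: openE)
  define d where "d = min e (min d1 d2)"
  show ?thesis
  proof (rule that[of d])
    show "d > 0" using e d1 d2 by (simp add: d_def)
    fix x y assume xy: "on_E x y" "dist x x1 < d" "dist y y1 < d"
    hence dd: "dist x x1 < e" "dist y y1 < e" "x \<in> ball x1 d1" "y \<in> ball y1 d2"
      by (auto simp: d_def dist_commute)
    from inj' show "\<exists>z\<in>N \<inter> H. pt z = E_affine x y"
    proof
      assume I: "\<forall>x y x' y'. on_E x y \<longrightarrow> on_E x' y' \<longrightarrow> dist x x1 < e \<longrightarrow> dist y y1 < e \<longrightarrow>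
        dist x' x1 < e \<longrightarrow> dist y' y1 < e \<longrightarrow> x = x' \<longrightarrow> y = y'"
      obtain z where z: "z \<in> ball z1 s" "xf z = x" using d1(2) dd(3) by blast
      have "yf z = y" using I near[OF z(1)] xy(1) dd z(2) by blast
      thus ?thesis using near[OF z(1)] z(2) by (intro bexI[of _ z]) auto
    next
      assume I: "\<forall>x y x' y'. on_E x y \<longrightarrow> on_E x' y' \<longrightarrow> dist x x1 < e \<longrightarrow> dist y y1 < e \<longrightarrow>
        dist x' x1 < e \<longrightarrow> dist y' y1 < e \<longrightarrow> y = y' \<longrightarrow> x = x'"
      obtain z where z: "z \<in> ball z1 s" "yf z = y" using d2(2) dd(4) by blast
      have "xf z = x" using I near[OF z(1)] xy(1) dd z(2) by blast
      thus ?thesis using near[OF z(1)] z(2) by (intro bexI[of _ z]) auto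
    qed
  qed
qed

end

section \<open>Functions on the curve\<close>

lemma card_cubic_roots: "card {x. lev cubic x = 0} = 3"
proof -
  let ?p = "Poly (map of_int cubic) :: complex poly"
  have deg: "Polynomial.degree ?p = 3"
    by (simp add: cubic_def)
  have "rsquarefree ?p"
    unfolding rsquarefree_roots
  proof (intro allI notI)
    fix a assume "poly ?p a = 0 \<and> poly (pderiv ?p) a = 0"
    hence "lev cubic a = 0" "lev (lderiv cubic) a = 0"
      by (simp_all add: lev_eq_poly[symmetric] lev_lderiv[symmetric])
    thus False using cubic_simple_roots by simp
  qed
  hence "Polynomial.smult (Polynomial.lead_coeff ?p) (\<Prod>z|poly ?p z = 0. [:- z, 1:]) = ?p"
    by (rule complex_poly_decompose_rsquarefree)
  moreover have "?p \<noteq> 0" using deg by auto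
  ultimately have "Polynomial.degree ?p = Polynomial.degree (\<Prod>z|poly ?p z = 0. [:- z, 1:])"
    by (metis Polynomial.degree_smult_eq Polynomial.leading_coeff_0_iff)
  also have "\<dots> = card {z. poly ?p z = 0}"
    by (subst Polynomial.degree_prod_sum_eq) auto
  finally have "card {x. poly ?p x = 0} = Polynomial.degree ?p" ..
  thus ?thesis by (simp add: deg lev_eq_poly)
qed

lemma finite_cubic_roots: "finite {x. lev cubic x = 0}"
  using card_cubic_roots card.infinite by fastforce

text \<open>The bound is placed on the square of the norm because y grows like the power 3/2 of x;
  this keeps all exponents integral.\<close>

lemma entire_power_growth:
  assumes "f holomorphic_on UNIV" "\<And>x. R \<le> norm x \<Longrightarrow> norm (f x) ^ 2 \<le> C * norm x ^ (2 * n)"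
  shows "f x = (\<Sum>k\<le>n. (deriv ^^ k) f 0 / fact k * x ^ k)"
proof (rule Liouville_polynomial[OF assms(1), of R "sqrt \<bar>C\<bar>"])
  fix z :: complex assume z: "R \<le> norm z"
  have "norm (f z) ^ 2 \<le> \<bar>C\<bar> * norm z ^ (2 * n)"
    using order_trans[OF assms(2)[OF z] mult_right_mono[of C "\<bar>C\<bar>" "norm z ^ (2 * n)"]] by auto
  also have "\<dots> = (sqrt \<bar>C\<bar> * norm z ^ n) ^ 2"
    by (simp add: power_mult_distrib power_even_eq)
  finally show "norm (f z) \<le> sqrt \<bar>C\<bar> * norm z ^ n"
    by (rule power2_le_imp_le) simp
qed

text \<open>Liouville is applied twice: to f, which is then a polynomial of degree at most 2, and to
  its square, which has degree at most 3. The coefficient c^2 of x^4 in the square therefore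
  vanishes.\<close>

lemma entire_growth_3_halves:
  assumes "f holomorphic_on UNIV" "\<And>x. R \<le> norm x \<Longrightarrow> norm (f x) ^ 2 \<le> C * norm x ^ 3"
  obtains a b where "\<And>x. f x = a + b * x"
proof -
  define e' where "e' = (\<lambda>k. (deriv ^^ k) f 0 / fact k)"
  define a b c where "a = e' 0" and "b = e' 1" and "c = e' 2"
  have "norm (f x) ^ 2 \<le> \<bar>C\<bar> * norm x ^ (2 * 2)" if "max R 1 \<le> norm x" for x
  proof -
    have "norm (f x) ^ 2 \<le> C * norm x ^ 3" using assms(2) that by simp
    also have "\<dots> \<le> \<bar>C\<bar> * norm x ^ 3" by (intro mult_right_mono) auto
    also have "\<dots> \<le> \<bar>C\<bar> * norm x ^ 4" using that by (intro mult_left_mono power_increasing) auto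
    finally show ?thesis by simp
  qed
  hence "f x = (\<Sum>k\<le>2. e' k * x ^ k)" for x
    unfolding e'_def by (rule entire_power_growth[OF assms(1)])
  hence f: "f x = a + b * x + c * x^2" for x
    by (simp add: a_def b_def c_def atMost_Suc numeral_2_eq_2 algebra_simps)
  define e where "e = (\<lambda>k. (deriv ^^ k) (\<lambda>x. f x ^ 2) 0 / fact k)"
  have sq: "f x ^ 2 = (\<Sum>k\<le>3. e k * x ^ k)" for x
    unfolding e_def
  proof (rule Liouville_polynomial[of _ "max R 1" C])
    show "(\<lambda>x. f x ^ 2) holomorphic_on UNIV" by (intro holomorphic_intros assms(1))
    show "norm (f z ^ 2) \<le> C * norm z ^ 3" if "max R 1 \<le> norm z" for z
      using assms(2)[of z] that by (simp add: norm_power)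
  qed
  let ?p = "[:a, b, c:] ^ 2" and ?q = "[:e 0, e 1, e 2, e 3:]"
  have "poly ?p x = poly ?q x" for x
    using f[of x] sq[of x]
    by (simp add: algebra_simps power2_eq_square numeral_3_eq_3 atMost_Suc numeral_2_eq_2)
  hence "?p = ?q" by (simp add: poly_eq_poly_eq_iff[symmetric] fun_eq_iff)
  hence "Polynomial.coeff ?p 4 = Polynomial.coeff ?q 4" by simp
  hence "c = 0"
    by (simp add: power2_eq_square coeff_mult numeral_eq_Suc atMost_Suc)
  thus ?thesis using that f by simp
qed

text \<open>f is a polynomial of degree at most 3. Subtracting the multiple of the cubic with the
  same leading term leaves degree at most 2 and three distinct roots.\<close>

lemma entire_vanishing_on_cubic_roots:
  assumes "f holomorphic_on UNIV" "\<And>x. R \<le> norm x \<Longrightarrow> norm (f x) ^ 2 \<le> C * norm x ^ 6"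
    and zero: "\<And>x. lev cubic x = 0 \<Longrightarrow> f x = 0"
  obtains c where "\<And>x. f x = c * lev cubic x"
proof -
  define e where "e = (\<lambda>k. (deriv ^^ k) f 0 / fact k)"
  have "norm (f x) ^ 2 \<le> C * norm x ^ (2 * 3)" if "R \<le> norm x" for x using assms(2)[OF that] by simp
  hence f: "f x = (\<Sum>k\<le>3. e k * x ^ k)" for x
    unfolding e_def by (rule entire_power_growth[OF assms(1)])
  define c where "c = e 3 / 4"
  define p where "p = [:e 0 + 14623627 * c, e 1 + 178816 * c, e 2 - 4 * c:]"
  have p: "poly p x = f x - c * lev cubic x" for x
    by (simp add: p_def f lev_cubic c_def algebra_simps power2_eq_square power3_eq_cube
        numeral_3_eq_3 atMost_Suc numeral_2_eq_2)
  have "p = 0"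
  proof (rule ccontr)
    assume "p \<noteq> 0"
    have "{x. lev cubic x = 0} \<subseteq> {x. poly p x = 0}" using p zero by auto
    hence "3 \<le> card {x. poly p x = 0}"
      using card_mono[OF poly_roots_finite[OF \<open>p \<noteq> 0\<close>]] card_cubic_roots by metis
    also have "\<dots> \<le> Polynomial.degree p" by (rule poly_roots_degree[OF \<open>p \<noteq> 0\<close>])
    also have "\<dots> \<le> 2" by (simp add: p_def)
    finally show False by simp
  qed
  hence "f x = c * lev cubic x" for x using p[of x] by simp
  thus ?thesis by (rule that)
qed

lemma norm_lev_cubic:
  assumes "norm x \<ge> 10000"
  shows "norm x ^ 3 \<le> norm (lev cubic x)" "norm (lev cubic x) \<le> 8 * norm x ^ 3"
proof -
  let ?n = "norm x"
  have n2: "10000 * ?n \<le> ?n ^ 2"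
    using mult_right_mono[OF assms, of ?n] by (simp add: power2_eq_square)
  have n3: "10000 * ?n ^ 2 \<le> ?n ^ 3" using mult_right_mono[OF assms, of "?n ^ 2"] by (simp add: power2_eq_square power3_eq_cube)
  let ?l = "4 * x ^ 2 - 178816 * x - 14623627"
  have "norm ?l \<le> norm (4 * x ^ 2) + norm (178816 * x) + norm (14623627 :: complex)"
    by (meson norm_triangle_ineq4 norm_triangle_le_diff order_refl add_mono order_trans)
  also have "\<dots> = 4 * ?n ^ 2 + 178816 * ?n + 14623627" by (simp add: norm_mult norm_power)
  also have "\<dots> \<le> 3 * ?n ^ 3" using n2 n3 assms by linarith
  finally have l: "norm ?l \<le> 3 * ?n ^ 3" .
  have c: "lev cubic x = 4 * x ^ 3 + ?l" by (simp add: lev_cubic)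
  have m: "norm (4 * x ^ 3) = 4 * ?n ^ 3" by (simp add: norm_mult norm_power)
  show "norm x ^ 3 \<le> norm (lev cubic x)"
    using norm_diff_ineq[of "4 * x ^ 3" ?l] l unfolding c m by linarith
  have "0 \<le> ?n ^ 3" by simp
  thus "norm (lev cubic x) \<le> 8 * norm x ^ 3"
    using norm_triangle_ineq[of "4 * x ^ 3" ?l] l unfolding c m by linarith
qed

text \<open>x/(2y + 1) is a local parameter at the origin, and its square is x^2 divided by the
  cubic. After x - x' is split off, the term 4 (x x')^2 outweighs the rest when both numbers are
  large.\<close>

lemma local_parameter_inj:
  assumes "norm x \<ge> 10000" "norm x' \<ge> 10000" "x^2 * lev cubic x' = x'^2 * lev cubic x"
  shows "x = x'"
proof (rule ccontr)
  assume ne: "x \<noteq> x'"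
  have "(x - x') * (4 * (x * x')^2 - (- 178816 * (x * x') - 14623627 * (x + x'))) =
      - (x^2 * lev cubic x' - x'^2 * lev cubic x)"
    unfolding lev_cubic by Groebner_Basis.algebra
  hence "4 * (x * x')^2 = - 178816 * (x * x') - 14623627 * (x + x')" using ne assms(3) by simp
  hence "norm (4 * (x * x')^2) = norm (- 178816 * (x * x') - 14623627 * (x + x'))" by simp
  also have "\<dots> \<le> norm (178816 * (x * x')) + norm (14623627 * (x + x'))"
    using norm_triangle_ineq4[of "- 178816 * (x * x')" "14623627 * (x + x')"] by simp
  also have "\<dots> \<le> 178816 * norm (x * x') + 14623627 * (norm x + norm x')"
    unfolding norm_mult by (intro add_mono mult_mono norm_triangle_ineq) auto
  finally have *: "4 * norm (x * x') ^ 2 \<le> 178816 * norm (x * x') + 14623627 * (norm x + norm x')"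
    by (simp add: norm_mult norm_power)
  define m where "m = norm (x * x')"
  have m1: "10000 * norm x \<le> m" and m2: "10000 * norm x' \<le> m"
    using mult_left_mono[OF assms(2), of "norm x"] mult_right_mono[OF assms(1), of "norm x'"]
    by (simp_all add: m_def norm_mult mult.commute)
  have m3: "100000000 \<le> m" using m1 assms(1) by linarith
  have "100000000 * m \<le> m ^ 2"
    using mult_right_mono[OF m3, of m] m3 by (simp add: power2_eq_square)
  moreover have "14623627 * (norm x + norm x') \<le> 3000 * m"
    using m1 m2 m3 unfolding distrib_left by linarith
  moreover note *[folded m_def] m3
  ultimately have "100000000 * m \<le> 50000 * m" by linarith
  thus False using m3 by simp
qed

text \<open>One of the two ordinates over x, from a discontinuous branch of the root. Continuity
  will be claimed only for expressions symmetric in both ordinates.\<close>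

definition y_root :: "complex \<Rightarrow> complex" where
  "y_root x = (csqrt (lev cubic x) - 1) / 2"

lemma on_E_y_root: "on_E x (y_root x)"
  by (simp add: on_E_iff y_root_def)

text \<open>The distances of y1 from the two ordinates over x multiply to the change of the
  right-hand side of the curve equation, so one of the two is small.\<close>

lemma root_nearby:
  assumes "on_E x1 y1" "d > 0"
  obtains e where "e > 0" "\<And>x. dist x x1 < e \<Longrightarrow> \<exists>y. on_E x y \<and> dist y y1 < d"
proof -
  define c where "c = (\<lambda>x :: complex. x^3 + x^2 - 44704 * x - 3655907)"
  have "isCont c x1" unfolding c_def by (intro continuous_intros)
  then obtain e where e: "e > 0" "\<And>x. dist x x1 < e \<Longrightarrow> dist (c x) (c x1) < d^2"
    unfolding continuous_at_eps_delta using assms(2) by (metis zero_less_power)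
  have "\<exists>y. on_E x y \<and> dist y y1 < d" if "dist x x1 < e" for x
  proof -
    define y where "y = y_root x"
    have y: "on_E x y" "on_E x (- 1 - y)" using on_E_y_root on_E_neg by (simp_all add: y_def)
    have "(y - y1) * ((- 1 - y) - y1) = - (c x - c x1)"
      using y(1) assms(1) unfolding on_E_def c_def by Groebner_Basis.algebra
    hence "norm (y - y1) * norm ((- 1 - y) - y1) = dist (c x) (c x1)"
      by (metis dist_norm norm_minus_cancel norm_mult)
    also have "\<dots> < d * d" using e(2)[OF that] by (simp add: power2_eq_square)
    finally have "norm (y - y1) < d \<or> norm ((- 1 - y) - y1) < d"
      using mult_mono[of d "norm (y - y1)" d "norm ((- 1 - y) - y1)"] assms(2) by (meson less_imp_le not_less norm_ge_zero)
    thus ?thesis using y by (auto simp: dist_norm)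
  qed
  thus ?thesis using that e(1) by blast
qed

section \<open>Traces of functions from the curve to the x-line\<close>

context shimura
begin

definition pick :: "E_point \<Rightarrow> complex" where
  "pick Q = (SOME z. z \<in> H \<and> pt z = Q)"

lemma pick: "Q \<in> E_curve \<Longrightarrow> pick Q \<in> H \<and> pt (pick Q) = Q"
  unfolding pick_def using someI_ex[of "\<lambda>z. z \<in> H \<and> pt z = Q"] pt_surj by blast

definition curve_fun :: "(complex \<Rightarrow> complex) \<Rightarrow> complex \<Rightarrow> complex \<Rightarrow> complex" where
  "curve_fun g x y = g (pick (E_affine x y))"

text \<open>The trace to the x-line. At a branch point the single point is counted twice.\<close>

definition sheet_sum :: "(complex \<Rightarrow> complex) \<Rightarrow> complex \<Rightarrow> complex" where
  "sheet_sum g x = curve_fun g x (y_root x) + curve_fun g x (- 1 - y_root x)"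

definition curve_function :: "(complex \<Rightarrow> complex) \<Rightarrow> bool" where
  "curve_function g \<longleftrightarrow> (\<forall>z\<in>H. \<forall>w\<in>H. pt z = pt w \<longrightarrow> g z = g w) \<and>
     (\<forall>z\<in>H. pt z \<noteq> E_origin \<longrightarrow> g analytic_on {z})"

lemma curve_fun_pt:
  assumes "curve_function g" "z \<in> H" "pt z = E_affine x y"
  shows "curve_fun g x y = g z"
proof -
  have "E_affine x y \<in> E_curve" using pt_E[OF assms(2)] assms(3) by simp
  hence "pick (E_affine x y) \<in> H" "pt (pick (E_affine x y)) = pt z" using pick assms(3) by auto
  thus ?thesis using assms unfolding curve_function_def curve_fun_def by metis
qed

lemma sheet_sum_eq:
  assumes "on_E x y" shows "sheet_sum g x = curve_fun g x y + curve_fun g x (- 1 - y)"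
  using on_E_same_x[OF assms on_E_y_root[of x]] unfolding sheet_sum_def by (auto simp: add.commute)

text \<open>The preimages in the half-plane are picked arbitrarily, but by openness of the map to
  the curve nearby points of the curve have preimages near z1, and g has the same value at all
  preimages of a point.\<close>

lemma curve_fun_continuous:
  assumes g: "curve_function g" and E: "on_E x1 y1" and "e > 0"
  obtains d where "d > 0"
    "\<And>x y. on_E x y \<Longrightarrow> dist x x1 < d \<Longrightarrow> dist y y1 < d \<Longrightarrow> dist (curve_fun g x y) (curve_fun g x1 y1) < e"
proof -
  define z1 where "z1 = pick (E_affine x1 y1)"
  have z1: "z1 \<in> H" "pt z1 = E_affine x1 y1"
    using pick[of "E_affine x1 y1"] E by (simp_all add: z1_def on_E_E_curve)
  have "g analytic_on {z1}" using g z1 by (simp add: curve_function_def)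
  hence "isCont g z1" by (rule analytic_at_imp_isCont)
  then obtain r where r: "r > 0" "\<And>z. dist z z1 < r \<Longrightarrow> dist (g z) (g z1) < e"
    unfolding continuous_at_eps_delta using \<open>e > 0\<close> by blast
  obtain d where d: "d > 0" "\<And>x y. on_E x y \<Longrightarrow> dist x x1 < d \<Longrightarrow> dist y y1 < d \<Longrightarrow>
    \<exists>z\<in>ball z1 r \<inter> H. pt z = E_affine x y"
    using pt_open[OF z1 open_ball iffD2[OF centre_in_ball r(1)]] by blast
  show ?thesis
  proof (rule that[OF d(1)])
    fix x y assume "on_E x y" "dist x x1 < d" "dist y y1 < d"
    then obtain z where "z \<in> ball z1 r" "z \<in> H" "pt z = E_affine x y" using d(2) by blast
    thus "dist (curve_fun g x y) (curve_fun g x1 y1) < e"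
      using r(2)[of z] curve_fun_pt[OF g] z1 by (simp add: dist_commute)
  qed
qed

lemma sheet_sum_continuous:
  assumes g: "curve_function g" shows "isCont (sheet_sum g) x1"
  unfolding continuous_at_eps_delta
proof (intro allI impI)
  fix e :: real assume e: "e > 0"
  define y1 where "y1 = y_root x1"
  have E: "on_E x1 y1" "on_E x1 (- 1 - y1)" using on_E_y_root on_E_neg by (simp_all add: y1_def)
  have e2: "e / 2 > 0" using e by simp
  obtain d1 where d1: "d1 > 0" "\<And>x y. on_E x y \<Longrightarrow> dist x x1 < d1 \<Longrightarrow> dist y y1 < d1 \<Longrightarrow>
      dist (curve_fun g x y) (curve_fun g x1 y1) < e / 2"
    using curve_fun_continuous[OF g E(1) e2] by blast
  obtain d2 where d2: "d2 > 0" "\<And>x y. on_E x y \<Longrightarrow> dist x x1 < d2 \<Longrightarrow> dist y (- 1 - y1) < d2 \<Longrightarrow>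
      dist (curve_fun g x y) (curve_fun g x1 (- 1 - y1)) < e / 2"
    using curve_fun_continuous[OF g E(2) e2] by blast
  have "min d1 d2 > 0" using d1 d2 by simp
  from root_nearby[OF E(1) this] obtain d3 where
    d3: "d3 > 0" "\<And>x. dist x x1 < d3 \<Longrightarrow> \<exists>y. on_E x y \<and> dist y y1 < min d1 d2" by blast
  show "\<exists>d>0. \<forall>x'. dist x' x1 < d \<longrightarrow> dist (sheet_sum g x') (sheet_sum g x1) < e"
  proof (intro exI[of _ "min d3 (min d1 d2)"] conjI allI impI)
    show "min d3 (min d1 d2) > 0" using d1 d2 d3 by simp
    fix x assume x: "dist x x1 < min d3 (min d1 d2)"
    then obtain y where y: "on_E x y" "dist y y1 < min d1 d2" using d3 by auto
    have "dist (- 1 - y) (- 1 - y1) = dist y y1" by (simp add: dist_norm norm_minus_commute)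
    hence "dist (curve_fun g x y) (curve_fun g x1 y1) < e / 2"
      "dist (curve_fun g x (- 1 - y)) (curve_fun g x1 (- 1 - y1)) < e / 2"
      using d1(2)[OF y(1)] d2(2)[OF on_E_neg[OF y(1)]] x y(2) by auto
    hence "dist (curve_fun g x y + curve_fun g x (- 1 - y)) (curve_fun g x1 y1 + curve_fun g x1 (- 1 - y1)) < e"
      by (rule dist_triangle_add_half)
    thus "dist (sheet_sum g x) (sheet_sum g x1) < e"
      by (simp only: sheet_sum_eq[OF y(1)] sheet_sum_eq[OF E(1)])
  qed
qed

text \<open>A local inverse of x where x is unramified on the half-plane. The last clause keeps the
  section on the sheet of y1.\<close>

lemma local_section:
  assumes g: "curve_function g" and z1: "z1 \<in> H" "pt z1 = E_affine x1 y1" "deriv xf z1 \<noteq> 0" and "e > 0"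
  obtains h V where "open V" "x1 \<in> V" "(\<lambda>v. g (h v)) holomorphic_on V"
    "\<And>v. v \<in> V \<Longrightarrow> h v \<in> H \<and> pt (h v) = E_affine v (yf (h v)) \<and> dist (yf (h v)) y1 < e"
proof -
  have aff: "pt z1 \<noteq> E_origin" using z1 by simp
  obtain r where r: "r > 0" "ball z1 r \<subseteq> UNIV \<inter> H" "\<And>z. z \<in> ball z1 r \<Longrightarrow> pt z \<noteq> E_origin"
    "xf holomorphic_on ball z1 r" "yf holomorphic_on ball z1 r"
    by (rule good_ball[OF z1(1) aff open_UNIV UNIV_I]) (rule that; assumption)
  have "z1 \<in> ball z1 r" using r(1) by simp
  then obtain s where s: "s > 0" "ball z1 s \<subseteq> ball z1 r" "open (xf ` ball z1 s)" "inj_on xf (ball z1 s)"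
    using has_complex_derivative_locally_invertible[OF r(4) _ open_ball z1(3)] by blast
  have hol: "xf holomorphic_on ball z1 s" "yf holomorphic_on ball z1 s"
    using r(4,5) s(2) by (auto intro: holomorphic_on_subset)
  obtain h where h: "h holomorphic_on (xf ` ball z1 s)"
      "\<And>z. z \<in> ball z1 s \<Longrightarrow> deriv xf z * deriv h (xf z) = 1" "\<And>z. z \<in> ball z1 s \<Longrightarrow> h (xf z) = z"
    by (rule holomorphic_has_inverse[OF hol(1) open_ball s(4)]) (rule that; assumption)
  have hV: "h v \<in> ball z1 s \<and> xf (h v) = v" if "v \<in> xf ` ball z1 s" for v using h(3) that by auto
  have sH: "z \<in> H \<and> pt z \<noteq> E_origin" if "z \<in> ball z1 s" for z using that s(2) r(2,3) by blast
  have gh: "g holomorphic_on ball z1 s"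
    using g sH unfolding curve_function_def
    by (auto intro!: analytic_imp_holomorphic simp: analytic_on_analytic_at[of _ "ball z1 s"])
  have img: "h ` (xf ` ball z1 s) \<subseteq> ball z1 s" using hV by blast
  have gh': "(g \<circ> h) holomorphic_on (xf ` ball z1 s)" "(yf \<circ> h) holomorphic_on (xf ` ball z1 s)"
    by (rule holomorphic_on_compose_gen[OF h(1) _ img]; fact)+
  define V where "V = xf ` ball z1 s \<inter> (yf \<circ> h) -` ball y1 e"
  have "open V" unfolding V_def
    by (intro continuous_open_preimage holomorphic_on_imp_continuous_on gh' s(3)) auto
  have z1s: "z1 \<in> ball z1 s" using s(1) by simp
  have v1: "xf z1 = x1" "yf z1 = y1" using pt_affine[OF z1(1) aff] z1(2) by auto
  show ?thesis
  proof (rule that[of V h])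
    show "open V" by fact
    show "x1 \<in> V" unfolding V_def using z1s h(3)[OF z1s] v1 \<open>e > 0\<close> by (auto intro: image_eqI[of _ _ z1])
    show "(\<lambda>v. g (h v)) holomorphic_on V"
      using holomorphic_on_subset[OF gh'(1), of V] by (simp add: V_def comp_def)
    fix v assume "v \<in> V"
    hence v: "h v \<in> ball z1 s" "xf (h v) = v" "dist (yf (h v)) y1 < e"
      using hV by (auto simp: V_def dist_commute)
    thus "h v \<in> H \<and> pt (h v) = E_affine v (yf (h v)) \<and> dist (yf (h v)) y1 < e"
      using sH[OF v(1)] pt_affine(1)[of "h v"] by auto
  qed
qed

text \<open>Two sections whose ordinates stay within half the distance between y and -1 - y lie on
  different sheets, so the trace is the sum of g along both.\<close>

lemma sheet_sum_differentiable:
  assumes g: "curve_function g"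
    and zp: "zp \<in> H" "pt zp = E_affine x y" "deriv xf zp \<noteq> 0"
    and zm: "zm \<in> H" "pt zm = E_affine x (- 1 - y)" "deriv xf zm \<noteq> 0" and y: "2 * y + 1 \<noteq> 0"
  shows "sheet_sum g field_differentiable at x"
proof -
  define e where "e = norm (2 * y + 1) / 2"
  have e: "e > 0" using y by (simp add: e_def)
  obtain hp Vp where p: "open Vp" "x \<in> Vp" "(\<lambda>v. g (hp v)) holomorphic_on Vp"
    "\<And>v. v \<in> Vp \<Longrightarrow> hp v \<in> H \<and> pt (hp v) = E_affine v (yf (hp v)) \<and> dist (yf (hp v)) y < e"
    by (rule local_section[OF g zp e]) (rule that; assumption)
  obtain hm Vm where m: "open Vm" "x \<in> Vm" "(\<lambda>v. g (hm v)) holomorphic_on Vm"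
    "\<And>v. v \<in> Vm \<Longrightarrow> hm v \<in> H \<and> pt (hm v) = E_affine v (yf (hm v)) \<and> dist (yf (hm v)) (- 1 - y) < e"
    by (rule local_section[OF g zm e]) (rule that; assumption)
  have eq: "sheet_sum g v = g (hp v) + g (hm v)" if v: "v \<in> Vp \<inter> Vm" for v
  proof -
    have vp: "hp v \<in> H" "pt (hp v) = E_affine v (yf (hp v))" "dist (yf (hp v)) y < e"
      and vm: "hm v \<in> H" "pt (hm v) = E_affine v (yf (hm v))" "dist (yf (hm v)) (- 1 - y) < e"
      using p(4)[of v] m(4)[of v] v by blast+
    have E: "on_E v (yf (hp v))" "on_E v (yf (hm v))"
      using pt_E[OF vp(1)] pt_E[OF vm(1)] vp(2) vm(2) by (simp_all add: on_E_E_curve)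
    have "yf (hm v) \<noteq> yf (hp v)"
    proof
      assume eq: "yf (hm v) = yf (hp v)"
      have "dist y (- 1 - y) \<le> dist y (yf (hp v)) + dist (yf (hp v)) (- 1 - y)" by (rule dist_triangle)
      also have "\<dots> < e + e" using vp(3) vm(3) unfolding eq by (simp add: dist_commute)
      also have "\<dots> = norm (2 * y + 1)" by (simp add: e_def)
      also have "\<dots> = dist y (- 1 - y)" by (simp add: dist_norm algebra_simps)
      finally show False by simp
    qed
    hence "yf (hm v) = - 1 - yf (hp v)" using on_E_same_x[OF E] by blast
    thus ?thesis
      using sheet_sum_eq[OF E(1), of g] curve_fun_pt[OF g vp(1,2)] curve_fun_pt[OF g vm(1,2)] by simp
  qed
  have "(\<lambda>v. g (hp v) + g (hm v)) holomorphic_on (Vp \<inter> Vm)"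
    using p(3) m(3) by (intro holomorphic_on_add) (auto intro: holomorphic_on_subset)
  hence "sheet_sum g holomorphic_on (Vp \<inter> Vm)"
    by (rule holomorphic_transform) (simp add: eq)
  thus ?thesis using p m by (intro holomorphic_on_imp_differentiable_at[of _ "Vp \<inter> Vm"]) auto
qed

lemma deriv_xf_nonzero_near:
  assumes z1: "z1 \<in> H" "pt z1 \<noteq> E_origin"
  obtains r where "r > 0" "\<And>z. z \<in> ball z1 r - {z1} \<Longrightarrow> deriv xf z \<noteq> 0"
proof -
  obtain r where r: "r > 0" "ball z1 r \<subseteq> UNIV \<inter> H" "\<And>z. z \<in> ball z1 r \<Longrightarrow> pt z \<noteq> E_origin"
    "xf holomorphic_on ball z1 r" "yf holomorphic_on ball z1 r"
    by (rule good_ball[OF z1 open_UNIV UNIV_I]) (rule that; assumption)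
  have hd: "deriv xf holomorphic_on ball z1 r" by (rule holomorphic_deriv[OF r(4) open_ball])
  have "\<exists>b\<in>ball z1 r. deriv xf b \<noteq> 0"
  proof (rule ccontr)
    assume no: "\<not> (\<exists>b\<in>ball z1 r. deriv xf b \<noteq> 0)"
    have "(xf has_field_derivative 0) (at z)" if "z \<in> ball z1 r" for z
      using holomorphic_derivI[OF r(4) open_ball that] no that by simp
    hence "xf constant_on ball z1 r" by (intro has_field_derivative_0_imp_constant_on) auto
    moreover have "\<not> xf constant_on ball z1 r"
      by (rule xf_not_constant[of _ z1]) (use r in auto)
    ultimately show False by simp
  qed
  then obtain b where "b \<in> ball z1 r" "deriv xf b \<noteq> 0" by blast
  hence "\<forall>\<^sub>F w in at z1. deriv xf w \<noteq> 0 \<and> w \<in> ball z1 r"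
    using non_zero_neighbour_alt[OF hd open_ball connected_ball, of z1 b] r(1) by simp
  then obtain s where "s > 0" "\<And>z. z \<noteq> z1 \<Longrightarrow> dist z z1 < s \<Longrightarrow> deriv xf z \<noteq> 0"
    unfolding eventually_at by auto
  thus ?thesis using that[of s] by (auto simp: dist_commute)
qed

text \<open>What must be avoided are the branch points of the x-line and the ramification points of
  the map from the half-plane; both are isolated, and only x1 itself can remain.\<close>

lemma sheet_sum_differentiable_near:
  assumes g: "curve_function g"
  obtains r where "r > 0" "\<And>x. x \<in> ball x1 r - {x1} \<Longrightarrow> sheet_sum g field_differentiable at x"
proof -
  define y1 where "y1 = y_root x1"
  have E: "on_E x1 y1" "on_E x1 (- 1 - y1)" using on_E_y_root on_E_neg by (simp_all add: y1_def)
  have near: "\<exists>d>0. \<forall>x y. on_E x y \<longrightarrow> dist x x1 < d \<longrightarrow> dist y y2 < d \<longrightarrow> x \<noteq> x1 \<longrightarrow>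
      (\<exists>z\<in>H. pt z = E_affine x y \<and> deriv xf z \<noteq> 0)" if E2: "on_E x1 y2" for y2
  proof -
    define z1 where "z1 = pick (E_affine x1 y2)"
    have z1: "z1 \<in> H" "pt z1 = E_affine x1 y2"
      using pick[of "E_affine x1 y2"] E2 by (simp_all add: z1_def on_E_E_curve)
    have aff: "pt z1 \<noteq> E_origin" using z1 by simp
    obtain r where r: "r > 0" "\<And>z. z \<in> ball z1 r - {z1} \<Longrightarrow> deriv xf z \<noteq> 0"
      using deriv_xf_nonzero_near[OF z1(1) aff] by blast
    have z1r: "z1 \<in> ball z1 r" using r(1) by simp
    obtain d where d: "d > 0" "\<And>x y. on_E x y \<Longrightarrow> dist x x1 < d \<Longrightarrow> dist y y2 < d \<Longrightarrow>
      \<exists>z\<in>ball z1 r \<inter> H. pt z = E_affine x y"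
      using pt_open[OF z1 open_ball z1r] by blast
    have "\<exists>z\<in>H. pt z = E_affine x y \<and> deriv xf z \<noteq> 0"
      if xy: "on_E x y" "dist x x1 < d" "dist y y2 < d" "x \<noteq> x1" for x y
    proof -
      obtain z where z: "z \<in> ball z1 r" "z \<in> H" "pt z = E_affine x y" using d(2)[OF xy(1-3)] by blast
      hence "z \<noteq> z1" using z1 xy(4) by auto
      thus ?thesis using r(2) z by blast
    qed
    thus ?thesis using d(1) by blast
  qed
  obtain d1 where d1: "d1 > 0" "\<And>x y. on_E x y \<Longrightarrow> dist x x1 < d1 \<Longrightarrow> dist y y1 < d1 \<Longrightarrow> x \<noteq> x1 \<Longrightarrow>
      \<exists>z\<in>H. pt z = E_affine x y \<and> deriv xf z \<noteq> 0" using near[OF E(1)] by blast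
  obtain d2 where d2: "d2 > 0" "\<And>x y. on_E x y \<Longrightarrow> dist x x1 < d2 \<Longrightarrow> dist y (- 1 - y1) < d2 \<Longrightarrow> x \<noteq> x1 \<Longrightarrow>
      \<exists>z\<in>H. pt z = E_affine x y \<and> deriv xf z \<noteq> 0" using near[OF E(2)] by blast
  have "min d1 d2 > 0" using d1 d2 by simp
  from root_nearby[OF E(1) this] obtain d3 where
    d3: "d3 > 0" "\<And>x. dist x x1 < d3 \<Longrightarrow> \<exists>y. on_E x y \<and> dist y y1 < min d1 d2" by blast
  obtain d4 where d4: "d4 > 0" "\<And>x. lev cubic x = 0 \<Longrightarrow> x \<noteq> x1 \<Longrightarrow> d4 \<le> dist x1 x"
    using finite_set_avoid[OF finite_cubic_roots, of x1] by auto
  show ?thesis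
  proof (rule that[of "min (min d1 d2) (min d3 d4)"])
    show "min (min d1 d2) (min d3 d4) > 0" using d1 d2 d3 d4 by simp
    fix x assume "x \<in> ball x1 (min (min d1 d2) (min d3 d4)) - {x1}"
    hence x: "x \<noteq> x1" "dist x x1 < d1" "dist x x1 < d2" "dist x x1 < d3" "dist x1 x < d4"
      by (auto simp: dist_commute)
    obtain y where y: "on_E x y" "dist y y1 < min d1 d2" using d3(2)[OF x(4)] by blast
    have "dist (- 1 - y) (- 1 - y1) = dist y y1" by (simp add: dist_norm norm_minus_commute)
    hence y': "dist y y1 < d1" "dist (- 1 - y) (- 1 - y1) < d2" using y(2) by auto
    obtain zp where zp: "zp \<in> H" "pt zp = E_affine x y" "deriv xf zp \<noteq> 0"
      using d1(2)[OF y(1) x(2) y'(1) x(1)] by blast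
    obtain zm where zm: "zm \<in> H" "pt zm = E_affine x (- 1 - y)" "deriv xf zm \<noteq> 0"
      using d2(2)[OF on_E_neg[OF y(1)] x(3) y'(2) x(1)] by blast
    have "lev cubic x \<noteq> 0" using d4(2) x by fastforce
    hence "2 * y + 1 \<noteq> 0" using y(1) unfolding on_E_iff by auto
    thus "sheet_sum g field_differentiable at x" by (rule sheet_sum_differentiable[OF g zp zm])
  qed
qed

text \<open>Continuity everywhere makes the isolated exceptional points removable.\<close>

lemma sheet_sum_entire:
  assumes g: "curve_function g" shows "sheet_sum g holomorphic_on UNIV"
proof -
  have "sheet_sum g field_differentiable at x1" for x1
  proof -
    obtain r where r: "r > 0" "\<And>x. x \<in> ball x1 r - {x1} \<Longrightarrow> sheet_sum g field_differentiable at x"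
      using sheet_sum_differentiable_near[OF g] by blast
    have lim: "(sheet_sum g \<longlongrightarrow> sheet_sum g z) (at z within ball x1 r)" for z
      by (rule Lim_at_imp_Lim_at_within[OF isContD[OF sheet_sum_continuous[OF g]]])
    have hol: "sheet_sum g holomorphic_on (ball x1 r - {x1})"
      unfolding holomorphic_on_def by (rule ballI, rule field_differentiable_at_within, rule r(2))
    have "sheet_sum g holomorphic_on ball x1 r"
      by (rule no_isolated_singularity'[OF lim hol open_ball]) simp
    thus ?thesis
      by (rule holomorphic_on_imp_differentiable_at[OF _ open_ball iffD2[OF centre_in_ball r(1)]])
  qed
  thus ?thesis unfolding holomorphic_on_def by simp
qed

end

section \<open>Automorphisms of the curve\<close>

text \<open>The third difference isolates the leading coefficient, so an identity that is known only
  where the cubic of the curve is nonzero need only be tested at 0, 1, 2, 3.\<close>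

lemma third_difference_cubic:
  fixes f :: "complex \<Rightarrow> complex"
  assumes "\<And>x. f x = c3 * x^3 + c2 * x^2 + c1 * x + c0"
  shows "f 3 - 3 * f 2 + 3 * f 1 - f 0 = 6 * c3"
  by (simp add: assms algebra_simps)

text \<open>Inserting both v and -v separates the parts odd and even in v. The odd part forces c2 =
  0; the even part makes the substitution in x preserve the cubic up to the factor d2^2. The first
  alternative of the conclusion is a constant x-coordinate.\<close>

lemma linear_automorphism:
  assumes eq: "\<And>x v. v^2 = lev cubic x \<Longrightarrow> lev cubic (c0 + c1 * x + c2 * v) = (d0 + d1 * x + d2 * v)^2"
  shows "(c1 = 0 \<and> c2 = 0) \<or> (c0 = 0 \<and> c1 = 1 \<and> c2 = 0 \<and> d0 = 0 \<and> d1 = 0 \<and> d2^2 = 1)"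
proof -
  let ?f = "lev cubic"
  have nz: "?f 0 \<noteq> 0" "?f 1 \<noteq> 0" "?f 2 \<noteq> 0" "?f 3 \<noteq> 0" by (simp_all add: lev_cubic)
  have expand: "?f (u + w) = ?f u + (12 * u^2 + 8 * u - 178816) * w + (12 * u + 4) * w^2 + 4 * w^3" for u w
    unfolding lev_cubic by Groebner_Basis.algebra
  have odd: "c2 * (12 * (c0 + c1 * x)^2 + 8 * (c0 + c1 * x) - 178816 + 4 * c2^2 * ?f x) = 2 * d2 * (d0 + d1 * x)"
    if "?f x \<noteq> 0" for x
  proof -
    define v where "v = csqrt (?f x)"
    have v: "v^2 = ?f x" "(- v)^2 = ?f x" "v \<noteq> 0" using that by (simp_all add: v_def)
    have "?f ((c0 + c1 * x) + c2 * v) - ?f ((c0 + c1 * x) + c2 * (- v)) =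
       (d0 + d1 * x + d2 * v)^2 - (d0 + d1 * x + d2 * (- v))^2"
      using eq[OF v(1)] eq[OF v(2)] by simp
    hence "2 * v * (c2 * (12 * (c0 + c1 * x)^2 + 8 * (c0 + c1 * x) - 178816 + 4 * c2^2 * v^2)) =
       2 * v * (2 * d2 * (d0 + d1 * x))"
      unfolding expand by Groebner_Basis.algebra
    thus ?thesis using v by simp
  qed
  define p where "p = (\<lambda>x. c2 * (12 * (c0 + c1 * x)^2 + 8 * (c0 + c1 * x) - 178816 + 4 * c2^2 * ?f x) - 2 * d2 * (d0 + d1 * x))"
  \<comment> \<open>The leading coefficient 16 c2^3 comes from the term 4 c2^3 times the
    cubic.\<close>
  have "p 3 - 3 * p 2 + 3 * p 1 - p 0 = 6 * (16 * c2^3)"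
    by (rule third_difference_cubic[where ?c2.0 = "c2 * (12 * c1^2 + 16 * c2^2)"
          and ?c1.0 = "c2 * (24 * c0 * c1 + 8 * c1 - 4 * c2^2 * 178816) - 2 * d2 * d1"
          and ?c0.0 = "c2 * (12 * c0^2 + 8 * c0 - 178816 - 4 * c2^2 * 14623627) - 2 * d2 * d0"])
       (simp add: p_def lev_cubic algebra_simps power2_eq_square power3_eq_cube)
  moreover have "p 0 = 0" "p 1 = 0" "p 2 = 0" "p 3 = 0"
    unfolding p_def odd[OF nz(1)] odd[OF nz(2)] odd[OF nz(3)] odd[OF nz(4)] by (simp_all only: diff_self)
  ultimately have c2: "c2 = 0" by simp
  have even: "?f (c0 + c1 * x) = (d0 + d1 * x)^2 + d2^2 * ?f x" if "?f x \<noteq> 0" for x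
  proof -
    define v where "v = csqrt (?f x)"
    have v: "v^2 = ?f x" by (simp add: v_def)
    have "?f (c0 + c1 * x) = (d0 + d1 * x + d2 * v)^2" using eq[OF v] by (simp add: c2)
    also have "\<dots> = (d0 + d1 * x)^2 + d2^2 * v^2 + v * (2 * d2 * (d0 + d1 * x))"
      by (simp add: algebra_simps power2_eq_square)
    finally show ?thesis using odd[OF that] v by (simp add: c2)
  qed
  have "d2 = 0 \<or> (d0 = 0 \<and> d1 = 0)" using odd[OF nz(1)] odd[OF nz(2)] by (auto simp: c2)
  thus ?thesis
  proof
    assume d2: "d2 = 0"
    define q where "q = (\<lambda>x. ?f (c0 + c1 * x) - (d0 + d1 * x)^2)"
    have "q 3 - 3 * q 2 + 3 * q 1 - q 0 = 6 * (4 * c1^3)"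
      by (rule third_difference_cubic[where ?c2.0 = "12 * c0 * c1^2 + 4 * c1^2 - d1^2"
            and ?c1.0 = "12 * c0^2 * c1 + 8 * c0 * c1 - 178816 * c1 - 2 * d0 * d1"
            and ?c0.0 = "?f c0 - d0^2"])
         (simp add: q_def lev_cubic algebra_simps power2_eq_square power3_eq_cube)
    moreover have "q 0 = 0" "q 1 = 0" "q 2 = 0" "q 3 = 0"
      unfolding q_def even[OF nz(1)] even[OF nz(2)] even[OF nz(3)] even[OF nz(4)] by (simp_all add: d2)
    ultimately show ?thesis using c2 by simp
  next
    assume d: "d0 = 0 \<and> d1 = 0"
    define D where "D = d2^2"
    have e: "?f (c0 + c1 * x) = D * ?f x" if "?f x \<noteq> 0" for x using even[OF that] d by (simp add: D_def)
    note e' = e[OF nz(1)] e[OF nz(2)] e[OF nz(3)] e[OF nz(4)]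
    have v: "?f 0 = - 14623627" "?f 1 = - 14802435" "?f 2 = - 14981211" "?f 3 = - 15159931"
      by (simp_all add: lev_cubic)
    have F: "?f (c0 + c1 * x) = 4 * c1^3 * x^3 + (12 * c0 * c1^2 + 4 * c1^2) * x^2
        + (12 * c0^2 * c1 + 8 * c0 * c1 - 178816 * c1) * x + ?f c0" for x
      unfolding lev_cubic by Groebner_Basis.algebra
    define k where "k = 4 * c1^3"
    define l where "l = 12 * c0 * c1^2 + 4 * c1^2"
    define m where "m = 12 * c0^2 * c1 + 8 * c0 * c1 - 178816 * c1"
    have E: "?f c0 = - 14623627 * D" "k + l + m + ?f c0 = - 14802435 * D"
      "8 * k + 4 * l + 2 * m + ?f c0 = - 14981211 * D" "27 * k + 9 * l + 3 * m + ?f c0 = - 15159931 * D"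
      using e' unfolding F v k_def[symmetric] l_def[symmetric] m_def[symmetric] by (simp_all add: mult.commute)
    \<comment> \<open>Third and second differences of the four equations recover the equality of
      coefficients.\<close>
    have "6 * k = 6 * (4 * D)" "2 * l = 2 * (4 * D)" using E by Groebner_Basis.algebra+
    hence kl: "k = 4 * D" "l = 4 * D" by simp_all
    hence km: "m = - 178816 * D" using E by Groebner_Basis.algebra
    have k3: "c1^3 = D" using kl by (simp add: k_def)
    have "4 * (3 * c0 * c1^2 + c1^2) = 4 * D" using kl(2) unfolding l_def by Groebner_Basis.algebra
    hence k2: "3 * c0 * c1^2 + c1^2 = D" by (simp only: mult_cancel_left) simp
    note k1 = km[unfolded m_def]
    note k0 = E(1)
    show ?thesis
    proof (cases "c1 = 0")
      case False
      have "c1^2 * (3 * c0 + 1 - c1) = (3 * c0 * c1^2 + c1^2) - c1^3"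
        by (simp add: algebra_simps power2_eq_square power3_eq_cube)
      hence "c1^2 * (3 * c0 + 1 - c1) = 0" using k3 k2 by simp
      hence "3 * c0 + 1 - c1 = 0" using False by simp
      hence c0: "c1 = 3 * c0 + 1" by simp
      have "c1 * (12 * c0^2 + 8 * c0 - 178816 + 178816 * c1^2) =
          (12 * c0^2 * c1 + 8 * c0 * c1 - 178816 * c1) + 178816 * c1^3"
        by (simp add: algebra_simps power2_eq_square power3_eq_cube)
      hence "c1 * (12 * c0^2 + 8 * c0 - 178816 + 178816 * c1^2) = 0" using k1 k3 by simp
      hence "12 * c0^2 + 8 * c0 - 178816 + 178816 * c1^2 = 0" using False by simp
      hence "c0 * (3 * c0 + 2) = 0" unfolding c0 by Groebner_Basis.algebra
      hence "c0 = 0 \<or> 3 * c0 + 2 = 0" by simp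
      thus ?thesis
      proof
        assume "c0 = 0"
        thus ?thesis using c0 c2 d k3 by (simp add: D_def)
      next
        \<comment> \<open>This would be the substitution x = -2/3 - x', under which the cubic would
          have to be odd about -1/3, the extra symmetry of a curve with j = 1728. The constant term
          refutes it.\<close>
        assume *: "3 * c0 + 2 = 0"
        hence "c1 = - 1" using c0 by Groebner_Basis.algebra
        hence "D = - 1" using k3 by simp
        hence "27 * ?f c0 = 27 * 14623627" using k0 by simp
        moreover have "27 * ?f c0 = 4 * (3 * c0)^3 + 12 * (3 * c0)^2 - 178816 * 9 * (3 * c0) - 27 * 14623627"
          unfolding lev_cubic by Groebner_Basis.algebra
        moreover have "3 * c0 = - 2" using * by Groebner_Basis.algebra
        ultimately show ?thesis by simp
      qed
    qed (use c2 in simp)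
  qed
qed

section \<open>Behaviour at the origin and functions with a pole there\<close>

context shimura
begin

lemma pole_ball:
  assumes z0: "z0 \<in> H" "pt z0 = E_origin" and N: "open N" "z0 \<in> N"
  shows "\<exists>r>0. ball z0 r \<subseteq> N \<inter> H \<and> (\<forall>z\<in>ball z0 r - {z0}. pt z \<noteq> E_origin \<and> norm (xf z) \<ge> B)"
proof -
  have "max B 1 > 0" by simp
  hence "eventually (\<lambda>z. norm (xf z) \<ge> max B 1) (at z0)"
    using xf_pole[OF z0] unfolding is_pole_def filterlim_at_infinity[OF order_refl] by blast
  moreover have "eventually (\<lambda>z. z \<in> N) (at z0)" by (rule eventually_at_in_open'[OF N])
  ultimately have "eventually (\<lambda>z. norm (xf z) \<ge> max B 1 \<and> z \<in> N \<and> pt z \<noteq> E_origin \<and> z \<in> H) (at z0)"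
    using pt_affine_near[OF z0(1)] by eventually_elim auto
  then obtain r where r: "r > 0" "\<And>z. z \<noteq> z0 \<Longrightarrow> dist z z0 < r \<Longrightarrow>
      norm (xf z) \<ge> max B 1 \<and> z \<in> N \<and> pt z \<noteq> E_origin \<and> z \<in> H"
    unfolding eventually_at by auto
  have "z \<in> N \<inter> H" if "z \<in> ball z0 r" for z
    using r(2)[of z] that z0(1) N(2) by (cases "z = z0") (auto simp: dist_commute)
  moreover have "pt z \<noteq> E_origin \<and> norm (xf z) \<ge> B" if "z \<in> ball z0 r - {z0}" for z
    using r(2)[of z] that by (auto simp: dist_commute)
  ultimately show ?thesis using r(1) by blast
qed

text \<open>u = x/(2y + 1) extends holomorphically over the pole with value 0 and is not constant,
  so its image contains a disc. A curve point with large x has u in that disc, and u determines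
  first x and then y.\<close>

lemma pt_open_infinity:
  assumes z0: "z0 \<in> H" "pt z0 = E_origin" and N: "open N" "z0 \<in> N"
  obtains R where "R > 0" "\<And>x y. on_E x y \<Longrightarrow> norm x > R \<Longrightarrow> \<exists>z\<in>N \<inter> H. pt z = E_affine x y"
proof -
  obtain r where r: "r > 0" "ball z0 r \<subseteq> N \<inter> H"
    "\<And>z. z \<in> ball z0 r - {z0} \<Longrightarrow> pt z \<noteq> E_origin \<and> norm (xf z) \<ge> 10000"
    using pole_ball[OF z0 N, of 10000] by blast
  have zr: "z0 \<in> ball z0 r" using r(1) by simp
  define u where "u = (\<lambda>z. if z = z0 then 0 else xf z / (2 * yf z + 1))"
  have pnt: "z \<in> H" "pt z = E_affine (xf z) (yf z)" "(2 * yf z + 1)^2 = lev cubic (xf z)"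
    "norm (xf z) \<ge> 10000" "2 * yf z + 1 \<noteq> 0" if z: "z \<in> ball z0 r - {z0}" for z
  proof -
    show zH: "z \<in> H" using z r(2) by blast
    show *: "pt z = E_affine (xf z) (yf z)" "(2 * yf z + 1)^2 = lev cubic (xf z)"
      using pt_affine[OF zH] r(3)[OF z] by (simp_all add: on_E_iff)
    show **: "norm (xf z) \<ge> 10000" using r(3)[OF z] by blast
    have "norm (xf z) ^ 3 > 0" using ** by (intro zero_less_power) linarith
    hence "lev cubic (xf z) \<noteq> 0" using norm_lev_cubic(1)[OF **] by auto
    thus "2 * yf z + 1 \<noteq> 0" using *(2) by auto
  qed
  have usq: "u z ^ 2 * lev cubic (xf z) = xf z ^ 2" if z: "z \<in> ball z0 r - {z0}" for z
    using pnt(3,5)[OF z] z by (simp add: u_def power_divide flip: pnt(3)[OF z])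
  have bound: "norm x ^ 2 / norm (lev cubic x) \<le> 1 / norm x" if "norm x \<ge> 10000" for x
  proof -
    have "norm x ^ 2 / norm (lev cubic x) \<le> norm x ^ 2 / norm x ^ 3"
      using norm_lev_cubic(1)[OF that] that by (intro divide_left_mono mult_pos_pos zero_less_power) auto
    also have "\<dots> = 1 / norm x" using that by (simp add: power2_eq_square power3_eq_cube)
    finally show ?thesis .
  qed
  have unorm: "norm (u z) ^ 2 \<le> 1 / norm (xf z)" if z: "z \<in> ball z0 r - {z0}" for z
  proof -
    have "lev cubic (xf z) \<noteq> 0" using pnt(3,5)[OF z] by auto
    hence "norm (u z) ^ 2 = norm (xf z) ^ 2 / norm (lev cubic (xf z))"
      using arg_cong[OF usq[OF z], of norm] by (simp add: norm_mult norm_power field_simps)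
    thus ?thesis using bound[OF pnt(4)[OF z]] by simp
  qed
  \<comment> \<open>The estimate norm u^2 <= 1 / norm x makes u tend to 0 at the pole of x.\<close>
  have lim: "(u \<longlongrightarrow> 0) (at z0)"
  proof -
    have "((\<lambda>z. inverse (xf z)) \<longlongrightarrow> 0) (at z0)"
      using filterlim_compose[OF tendsto_inverse_0] xf_pole[OF z0] unfolding is_pole_def by blast
    hence "((\<lambda>z. norm (inverse (xf z))) \<longlongrightarrow> 0) (at z0)" by (rule tendsto_norm_zero)
    moreover have "eventually (\<lambda>z. norm (norm (u z) ^ 2) \<le> norm (inverse (xf z))) (at z0)"
      unfolding eventually_at using unorm r(1)
      by (intro exI[of _ r]) (auto simp: dist_commute norm_inverse inverse_eq_divide norm_divide)
    ultimately have "((\<lambda>z. norm (u z) ^ 2) \<longlongrightarrow> 0) (at z0)" by (rule Lim_null_comparison[rotated])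
    hence "((\<lambda>z. sqrt (norm (u z) ^ 2)) \<longlongrightarrow> sqrt 0) (at z0)" by (rule tendsto_real_sqrt)
    thus ?thesis by (simp add: tendsto_norm_zero_iff)
  qed
  have "(\<lambda>z. xf z / (2 * yf z + 1)) holomorphic_on (ball z0 r - {z0})"
  proof -
    have "xf holomorphic_on (ball z0 r - {z0})" "yf holomorphic_on (ball z0 r - {z0})"
      using xf_analytic[OF pnt(1)] yf_analytic[OF pnt(1)] r(3)
      by (auto intro!: analytic_imp_holomorphic simp: analytic_on_analytic_at[of _ "ball z0 r - {z0}"])
    thus ?thesis using pnt(5) by (intro holomorphic_intros) auto
  qed
  hence hol1: "u holomorphic_on (ball z0 r - {z0})"
    by (rule holomorphic_transform) (simp add: u_def)
  have cont: "(u \<longlongrightarrow> u z) (at z within ball z0 r)" if "z \<in> {z0}" for z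
  proof -
    have "z = z0" "u z0 = 0" using that by (simp_all add: u_def)
    thus ?thesis using Lim_at_imp_Lim_at_within[OF lim] by metis
  qed
  have hol: "u holomorphic_on ball z0 r"
    by (rule no_isolated_singularity'[OF cont hol1 open_ball]) simp_all
  have unz: "u z \<noteq> 0" if z: "z \<in> ball z0 r - {z0}" for z
    using pnt(4,5)[OF z] z by (auto simp: u_def)
  have "\<not> u constant_on ball z0 r"
  proof
    assume "u constant_on ball z0 r"
    then obtain c where c: "\<And>z. z \<in> ball z0 r \<Longrightarrow> u z = c" by (auto simp: constant_on_def)
    have "z0 + of_real (r / 2) \<in> ball z0 r - {z0}" using r(1) by (simp add: dist_norm)
    thus False using unz c[OF zr] c[of "z0 + of_real (r / 2)"] by (auto simp: u_def)
  qed
  hence "open (u ` ball z0 r)"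
    by (intro open_mapping_thm[OF hol open_ball connected_ball open_ball subset_refl])
  moreover have "0 \<in> u ` ball z0 r" using zr by (intro image_eqI[of _ _ z0]) (simp_all add: u_def)
  ultimately obtain e where e: "e > 0" "ball 0 e \<subseteq> u ` ball z0 r" by (auto elim: openE)
  show ?thesis
  proof (rule that[of "max 10000 (1 / e^2)"])
    show "max 10000 (1 / e^2) > 0" by (simp add: less_max_iff_disj)
    fix x y assume E: "on_E x y" and "norm x > max 10000 (1 / e^2)"
    hence x: "norm x \<ge> 10000" "1 / e^2 < norm x" by auto
    have "norm x ^ 3 > 0" using x by (intro zero_less_power) linarith
    hence cx: "lev cubic x \<noteq> 0" using norm_lev_cubic(1)[OF x(1)] by auto
    have y: "(2 * y + 1)^2 = lev cubic x" "2 * y + 1 \<noteq> 0" using E cx by (auto simp: on_E_iff)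
    define v where "v = x / (2 * y + 1)"
    have v0: "v \<noteq> 0" using x y by (auto simp: v_def)
    have "norm v ^ 2 = norm x ^ 2 / norm (lev cubic x)"
      by (simp add: v_def norm_divide power_divide norm_power flip: y(1))
    also have "\<dots> \<le> 1 / norm x" by (rule bound[OF x(1)])
    also have "\<dots> < e ^ 2"
    proof -
      have "1 < norm x * e ^ 2" using x(2) e(1) by (simp add: field_simps)
      moreover have "norm x > 0" using x(1) by linarith
      ultimately show ?thesis by (simp add: pos_divide_less_eq mult.commute)
    qed
    finally have "norm v < e" using e(1) by (metis less_imp_le norm_ge_zero power_less_imp_less_base)
    then obtain z where z: "z \<in> ball z0 r" "u z = v" using e(2) by (force simp: dist_norm)
    have zp: "z \<in> ball z0 r - {z0}" using z v0 by (auto simp: u_def)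
    have "xf z ^ 2 * lev cubic x = x ^ 2 * lev cubic (xf z)"
    proof -
      have "v^2 * lev cubic x = x^2" using y by (simp add: v_def power_divide flip: y(1))
      hence "v^2 * (xf z ^ 2 * lev cubic x - x^2 * lev cubic (xf z)) = 0"
        using usq[OF zp] unfolding z(2) by Groebner_Basis.algebra
      thus ?thesis using v0 by simp
    qed
    hence xz: "xf z = x" using local_parameter_inj[OF pnt(4)[OF zp] x(1)] by simp
    have "xf z / (2 * yf z + 1) = x / (2 * y + 1)" using z(2) zp by (simp add: u_def v_def)
    hence "2 * yf z + 1 = 2 * y + 1" using xz x y pnt(5)[OF zp] by (auto simp: field_simps)
    hence "pt z = E_affine x y" using pnt(2)[OF zp] xz by simp
    thus "\<exists>z\<in>N \<inter> H. pt z = E_affine x y" using r(2) z(1) by blast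
  qed
qed

lemma yf_curve_function: "curve_function (\<lambda>z. 2 * yf z + 1)"
  unfolding curve_function_def
  by (auto simp: yf_def[of _] intro!: analytic_intros) (auto simp flip: yf_def intro: yf_analytic)

lemma curve_function_mult:
  "curve_function g \<Longrightarrow> curve_function h \<Longrightarrow> curve_function (\<lambda>z. g z * h z)"
  unfolding curve_function_def by (metis analytic_on_mult)

lemma curve_fun_mult_y:
  assumes "on_E x y"
  shows "curve_fun (\<lambda>z. g z * (2 * yf z + 1)) x y = curve_fun g x y * (2 * y + 1)"
proof -
  have "pt (pick (E_affine x y)) = E_affine x y" using pick assms by (simp add: on_E_E_curve)
  thus ?thesis by (simp add: curve_fun_def yf_def)
qed

text \<open>The bound is given only near one preimage z0 of the origin; openness at infinity
  transports it to all points of the curve with large x.\<close>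

lemma curve_fun_growth:
  assumes g: "curve_function g" and z0: "z0 \<in> H" "pt z0 = E_origin"
    and gr: "eventually (\<lambda>z. norm (g z) ^ 2 \<le> C * norm (xf z) ^ 3) (at z0)"
  obtains R where "R > 0" "\<And>x y. on_E x y \<Longrightarrow> norm x > R \<Longrightarrow> norm (curve_fun g x y) ^ 2 \<le> C * norm x ^ 3"
proof -
  obtain r where r: "r > 0" "\<And>z. z \<noteq> z0 \<Longrightarrow> dist z z0 < r \<Longrightarrow> norm (g z) ^ 2 \<le> C * norm (xf z) ^ 3"
    using gr unfolding eventually_at by auto
  have "z0 \<in> ball z0 r" using r(1) by simp
  from pt_open_infinity[OF z0 open_ball this] obtain R where R: "R > 0"
    "\<And>x y. on_E x y \<Longrightarrow> norm x > R \<Longrightarrow> \<exists>z\<in>ball z0 r \<inter> H. pt z = E_affine x y" by blast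
  show ?thesis
  proof (rule that[OF R(1)])
    fix x y assume "on_E x y" "norm x > R"
    then obtain z where z: "z \<in> ball z0 r" "z \<in> H" "pt z = E_affine x y" using R(2) by blast
    have "z \<noteq> z0" using z(3) z0(2) by auto
    hence "norm (g z) ^ 2 \<le> C * norm (xf z) ^ 3" using r(2) z(1) by (simp add: dist_commute)
    moreover have "xf z = x" using z(3) by (simp add: xf_def)
    ultimately show "norm (curve_fun g x y) ^ 2 \<le> C * norm x ^ 3"
      using curve_fun_pt[OF g z(2,3)] by simp
  qed
qed

lemma norm_add_sq_le: "norm (a + b) ^ 2 \<le> 2 * (norm a ^ 2 + norm b ^ 2)" for a b :: complex
proof -
  have "norm (a + b) ^ 2 \<le> (norm a + norm b) ^ 2" by (intro power_mono norm_triangle_ineq) simp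
  also have "\<dots> \<le> 2 * (norm a ^ 2 + norm b ^ 2)"
    using zero_le_power2[of "norm a - norm b"] by (simp add: power2_eq_square algebra_simps)
  finally show ?thesis .
qed

text \<open>The Riemann-Roch space of functions with a pole of order at most 3 at the origin.\<close>

lemma curve_function_linear:
  assumes g: "curve_function g" and z0: "z0 \<in> H" "pt z0 = E_origin"
    and gr: "eventually (\<lambda>z. norm (g z) ^ 2 \<le> C * norm (xf z) ^ 3) (at z0)"
  obtains c0 c1 c2 where "\<And>z. z \<in> H \<Longrightarrow> pt z \<noteq> E_origin \<Longrightarrow> g z = c0 + c1 * xf z + c2 * (2 * yf z + 1)"
proof -
  \<comment> \<open>The traces of g and of g Y, where Y = 2y + 1, together recover g: they are the
    sum of the values on the two sheets and their difference times Y.\<close>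
  let ?h = "\<lambda>z. g z * (2 * yf z + 1)"
  have h: "curve_function ?h" by (rule curve_function_mult[OF g yf_curve_function])
  from curve_fun_growth[OF g z0 gr] obtain R where R: "R > 0"
    "\<And>x y. on_E x y \<Longrightarrow> norm x > R \<Longrightarrow> norm (curve_fun g x y) ^ 2 \<le> C * norm x ^ 3" by blast
  have "norm (sheet_sum g x) ^ 2 \<le> (4 * C) * norm x ^ 3" if "R + 1 \<le> norm x" for x
  proof -
    let ?y = "y_root x"
    have "norm (sheet_sum g x) ^ 2 \<le> 2 * (norm (curve_fun g x ?y) ^ 2 + norm (curve_fun g x (- 1 - ?y)) ^ 2)"
      unfolding sheet_sum_def by (rule norm_add_sq_le)
    thus ?thesis using R(2)[OF on_E_y_root[of x]] R(2)[OF on_E_neg[OF on_E_y_root[of x]]] that by simp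
  qed
  from entire_growth_3_halves[OF sheet_sum_entire[OF g] this]
  obtain a b where ab: "\<And>x. sheet_sum g x = a + b * x" by blast
  have hsum: "sheet_sum ?h x = (curve_fun g x y - curve_fun g x (- 1 - y)) * (2 * y + 1)" if "on_E x y" for x y
  proof -
    have "2 * (- 1 - y) + 1 = - (2 * y + 1)" by simp
    thus ?thesis unfolding sheet_sum_eq[OF that] curve_fun_mult_y[OF that] curve_fun_mult_y[OF on_E_neg[OF that]]
      by (simp add: algebra_simps)
  qed
  have sum6: "norm (sheet_sum ?h x) ^ 2 \<le> (32 * C) * norm x ^ 6" if "max (R + 1) 10000 \<le> norm x" for x
  proof -
    let ?y = "y_root x"
    have E: "on_E x ?y" by (rule on_E_y_root)
    have "norm (curve_fun g x ?y - curve_fun g x (- 1 - ?y)) ^ 2 \<le>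
        2 * (norm (curve_fun g x ?y) ^ 2 + norm (curve_fun g x (- 1 - ?y)) ^ 2)"
      using norm_add_sq_le[of "curve_fun g x ?y" "- curve_fun g x (- 1 - ?y)"] by simp
    also have "\<dots> \<le> (4 * C) * norm x ^ 3" using R(2)[OF E] R(2)[OF on_E_neg[OF E]] that by simp
    finally have 1: "norm (curve_fun g x ?y - curve_fun g x (- 1 - ?y)) ^ 2 \<le> (4 * C) * norm x ^ 3" .
    have 2: "norm (2 * ?y + 1) ^ 2 \<le> 8 * norm x ^ 3"
      using norm_lev_cubic(2)[of x] E that by (simp add: on_E_iff flip: norm_power)
    have "norm (sheet_sum ?h x) ^ 2 =
        norm (curve_fun g x ?y - curve_fun g x (- 1 - ?y)) ^ 2 * norm (2 * ?y + 1) ^ 2"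
      unfolding hsum[OF E] by (simp add: norm_mult power_mult_distrib)
    also have "\<dots> \<le> ((4 * C) * norm x ^ 3) * (8 * norm x ^ 3)"
      by (rule mult_mono[OF 1 2]) (use order_trans[OF zero_le_power2 1] in auto)
    finally show ?thesis by (simp flip: power_add)
  qed
  \<comment> \<open>Over a root of the cubic both sheets meet and Y = 0, so the trace of g Y
    vanishes there and is divisible by the cubic.\<close>
  have sum0: "sheet_sum ?h x = 0" if "lev cubic x = 0" for x
  proof -
    have "2 * y_root x + 1 = 0" using that by (simp add: y_root_def)
    thus ?thesis unfolding hsum[OF on_E_y_root] by simp
  qed
  from entire_vanishing_on_cubic_roots[OF sheet_sum_entire[OF h] sum6 sum0]
  obtain c where c: "\<And>x. sheet_sum ?h x = c * lev cubic x" by blast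
  show ?thesis
  proof (rule that[of "a / 2" "b / 2" "c / 2"])
    fix z assume z: "z \<in> H" "pt z \<noteq> E_origin"
    note E = pt_affine[OF z]
    define x y where "x = xf z" and "y = yf z"
    have E': "on_E x y" "pt z = E_affine x y" using E by (simp_all add: x_def y_def)
    define u v where "u = curve_fun g x y" and "v = curve_fun g x (- 1 - y)"
    have gz: "g z = u" using curve_fun_pt[OF g z(1) E'(2)] by (simp add: u_def)
    have uv: "u + v = a + b * x" using sheet_sum_eq[OF E'(1), of g] ab[of x] by (simp add: u_def v_def)
    have "(u - v) * (2 * y + 1) = c * (2 * y + 1)^2"
      using hsum[OF E'(1)] c[of x] E'(1) by (simp add: u_def v_def on_E_iff)
    hence uv': "u - v = c * (2 * y + 1)"
    proof (cases "2 * y + 1 = 0")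
      case True
      hence "- 1 - y = y" by Groebner_Basis.algebra
      thus ?thesis using True by (simp add: u_def v_def)
    qed (simp add: power2_eq_square)
    have "2 * u = a + b * x + c * (2 * y + 1)" using uv uv' by Groebner_Basis.algebra
    thus "g z = a / 2 + b / 2 * xf z + c / 2 * (2 * yf z + 1)"
      unfolding gz x_def[symmetric] y_def[symmetric] by (simp add: field_simps)
  qed
qed

end

lemma tendsto_eventually_norm_le:
  fixes f :: "'a \<Rightarrow> complex"
  assumes "(f \<longlongrightarrow> l) F" shows "eventually (\<lambda>z. norm (f z) \<le> norm l + 1) F"
proof -
  have "eventually (\<lambda>z. norm (f z) < norm l + 1) F"
    by (rule order_tendstoD(2)[OF tendsto_norm[OF assms]]) simp
  thus ?thesis by eventually_elim simp
qed

text \<open>If n is the pole order, the quotient of f(b z) and f(z) tends to the inverse of b'^n, so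
  it stays bounded.\<close>

lemma pole_growth_at_fixed_point:
  assumes pole: "is_pole f z0" and S: "open S" "z0 \<in> S" "f holomorphic_on S - {z0}"
    and b: "(b has_field_derivative b') (at z0)" "b' \<noteq> 0" "b z0 = z0"
    and inj: "eventually (\<lambda>z. b z \<noteq> z0) (at z0)"
  shows "\<exists>C. eventually (\<lambda>z. norm (f (b z)) \<le> C * norm (f z)) (at z0)"
proof -
  define n where "n = nat (- zorder f z0)"
  define g where "g = zor_poly f z0"
  obtain r where r: "g z0 \<noteq> 0" "r > 0" "g holomorphic_on cball z0 r"
    "\<And>w. w \<in> cball z0 r - {z0} \<Longrightarrow> f w = g w / (w - z0) ^ n \<and> g w \<noteq> 0"
    using zorder_exist_pole[OF S(3,1,2) pole] unfolding n_def g_def by metis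
  have cont: "isCont b z0" using b(1) DERIV_isCont by blast
  hence blim: "(b \<longlongrightarrow> z0) (at z0)" using b(3) by (simp add: isCont_def)
  have gc: "isCont g z0"
    using holomorphic_on_imp_continuous_on[OF r(3)] r(2) by (auto intro!: continuous_on_interior)
  have gb: "((\<lambda>z. g (b z)) \<longlongrightarrow> g z0) (at z0)" by (rule isCont_tendsto_compose[OF gc blim])
  have g0: "(g \<longlongrightarrow> g z0) (at z0)" using gc by (simp add: isCont_def)
  have q: "((\<lambda>z. (b z - z0) / (z - z0)) \<longlongrightarrow> b') (at z0)"
    using b(1) b(3) by (simp add: has_field_derivative_iff)
  have lim: "((\<lambda>z. g (b z) / g z * inverse ((b z - z0) / (z - z0)) ^ n) \<longlongrightarrow> g z0 / g z0 * inverse b' ^ n) (at z0)"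
    by (intro tendsto_intros gb g0 q r(1) b(2))
  have near: "eventually (\<lambda>z. z \<in> cball z0 r - {z0}) (at z0)"
    unfolding eventually_at using r(2) by (intro exI[of _ r]) (auto simp: dist_commute)
  have "eventually (\<lambda>z. b z \<in> ball z0 r) (at z0)"
    by (rule topological_tendstoD[OF blim]) (use r(2) in auto)
  from tendsto_eventually_norm_le[OF lim] near this inj
  have "eventually (\<lambda>z. norm (f (b z)) \<le> (norm (g z0 / g z0 * inverse b' ^ n) + 1) * norm (f z)) (at z0)"
  proof eventually_elim
    case (elim z)
    have bz: "b z \<in> cball z0 r - {z0}" using elim(3,4) by auto
    have ne: "g z \<noteq> 0" "z \<noteq> z0" using elim(2) r(4)[OF elim(2)] by auto
    have "f (b z) = (g (b z) / g z * inverse ((b z - z0) / (z - z0)) ^ n) * f z"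
      using r(4)[OF bz] r(4)[OF elim(2)] ne elim(4)
      by (simp add: field_simps power_divide)
    hence "norm (f (b z)) = norm (g (b z) / g z * inverse ((b z - z0) / (z - z0)) ^ n) * norm (f z)"
      by (simp only: norm_mult)
    thus ?case using elim(1) by (simp only: mult_right_mono norm_ge_zero)
  qed
  thus ?thesis by blast
qed

context shimura
begin

text \<open>\<open>n1\<close> lets B act on the curve, and \<open>n2\<close> makes the action
  injective, so the affine part is preserved. The functions x and 2y + 1 composed with B then have
  poles of bounded order at the origin only, and are linear in 1, x, 2y + 1.\<close>

lemma curve_automorphism:
  assumes z0: "z0 \<in> H" "pt z0 = E_origin" and B: "mdet B > 0" "moebius B z0 = z0"
    and n1: "\<And>g. g \<in> G0 \<Longrightarrow> \<exists>g'\<in>G0. mmul B g = mmul g' B"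
    and n2: "\<And>g. g \<in> G0 \<Longrightarrow> \<exists>g'\<in>G0. mmul g B = mmul B g'"
  shows "\<exists>\<epsilon>. \<epsilon>^2 = 1 \<and> (\<forall>z\<in>H. pt z \<noteq> E_origin \<longrightarrow> pt (moebius B z) \<noteq> E_origin \<and>
    xf (moebius B z) = xf z \<and> 2 * yf (moebius B z) + 1 = \<epsilon> * (2 * yf z + 1))"
proof -
  let ?b = "moebius B"
  have bH: "?b z \<in> H" if "z \<in> H" for z using moebius_in_H[OF B(1) that] .
  have fwd: "pt (?b z) = pt (?b w)" if zw: "z \<in> H" "w \<in> H" "pt z = pt w" for z w
  proof -
    obtain g where g: "g \<in> G0" "w = moebius g z" using pt_eq_iff[OF zw(1,2)] zw(3) by blast
    obtain g' where g': "g' \<in> G0" "mmul B g = mmul g' B" using n1[OF g(1)] by blast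
    have "?b w = moebius g' (?b z)"
      using moebius_mmul[OF G0.det_pos[OF g(1)] zw(1), of B] moebius_mmul[OF B(1) zw(1), of g'] g g' by simp
    thus ?thesis using pt_invariant[OF g'(1) bH[OF zw(1)]] by simp
  qed
  have bwd: "pt z = pt w" if zw: "z \<in> H" "w \<in> H" "pt (?b z) = pt (?b w)" for z w
  proof -
    obtain g where g: "g \<in> G0" "?b w = moebius g (?b z)" using pt_eq_iff[OF bH[OF zw(1)] bH[OF zw(2)]] zw(3) by blast
    obtain g' where g': "g' \<in> G0" "mmul g B = mmul B g'" using n2[OF g(1)] by blast
    have gz: "moebius g' z \<in> H" by (rule moebius_in_H[OF G0.det_pos[OF g'(1)] zw(1)])
    have "?b w = ?b (moebius g' z)"
      using moebius_mmul[OF G0.det_pos[OF g'(1)] zw(1), of B] moebius_mmul[OF B(1) zw(1), of g] g g' by simp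
    hence "w = moebius g' z" using moebius_madj(1)[OF B(1) zw(2)] moebius_madj(1)[OF B(1) gz] by metis
    thus ?thesis using pt_invariant[OF g'(1) zw(1)] by simp
  qed
  have origin: "pt (?b z) = E_origin \<longleftrightarrow> pt z = E_origin" if "z \<in> H" for z
    using fwd[OF that z0(1)] bwd[OF that z0(1)] z0(2) B(2) by auto
  have an: "moebius B analytic_on {z}" if "z \<in> H" for z by (rule moebius_analytic[OF B(1) that])
  have cf1: "curve_function (\<lambda>z. xf (?b z))" and cf2: "curve_function (\<lambda>z. 2 * yf (?b z) + 1)"
  proof -
    have inv: "xf (?b z) = xf (?b w)" "yf (?b z) = yf (?b w)" if "z \<in> H" "w \<in> H" "pt z = pt w" for z w
      using fwd[OF that] by (simp_all add: xf_def yf_def)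
    have an2: "(\<lambda>z. xf (?b z)) analytic_on {z}" "(\<lambda>z. yf (?b z)) analytic_on {z}"
      if z: "z \<in> H" "pt z \<noteq> E_origin" for z
      using analytic_on_compose[OF an[OF z(1)], of xf] analytic_on_compose[OF an[OF z(1)], of yf]
        xf_analytic[OF bH[OF z(1)]] yf_analytic[OF bH[OF z(1)]] origin[OF z(1)] z(2)
      by (simp_all add: o_def)
    show "curve_function (\<lambda>z. xf (?b z))" unfolding curve_function_def using inv an2 by blast
    have "(\<lambda>z. 2 * yf (?b z) + 1) analytic_on {z}" if z: "z \<in> H" "pt z \<noteq> E_origin" for z
      by (intro analytic_intros an2[OF z])
    moreover have "2 * yf (?b z) + 1 = 2 * yf (?b w) + 1" if "z \<in> H" "w \<in> H" "pt z = pt w" for z w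
      unfolding inv(2)[OF that] ..
    ultimately show "curve_function (\<lambda>z. 2 * yf (?b z) + 1)" unfolding curve_function_def by blast
  qed
  obtain r where r: "r > 0" "ball z0 r \<subseteq> H" "\<And>z. z \<in> ball z0 r - {z0} \<Longrightarrow> pt z \<noteq> E_origin \<and> norm (xf z) \<ge> 10000"
    using pole_ball[OF z0 upper_half_plane_open z0(1), of 10000] by blast
  have near: "eventually (\<lambda>z. z \<in> ball z0 r - {z0}) (at z0)"
    unfolding eventually_at using r(1) by (intro exI[of _ r]) (auto simp: dist_commute)
  have blim: "(?b \<longlongrightarrow> z0) (at z0)" using moebius_isCont[OF B(1) z0(1)] B(2) by (simp add: isCont_def)
  have bne: "?b z \<noteq> z0" if "z \<in> H" "z \<noteq> z0" for z
    using moebius_madj(1)[OF B(1) that(1)] moebius_madj(1)[OF B(1) z0(1)] B(2) that(2) by metis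
  have bnear: "eventually (\<lambda>z. ?b z \<in> ball z0 r) (at z0)"
    by (rule topological_tendstoD[OF blim]) (use r(1) in auto)
  from near have bne': "eventually (\<lambda>z. ?b z \<noteq> z0) (at z0)"
  proof eventually_elim
    case (elim z)
    thus ?case using r(2) bne[of z] by blast
  qed
  have xhol: "xf holomorphic_on ball z0 r - {z0}"
  proof (rule analytic_imp_holomorphic, subst analytic_on_analytic_at, rule ballI)
    fix z assume z: "z \<in> ball z0 r - {z0}"
    have "z \<in> H" using z r(2) by blast
    thus "xf analytic_on {z}" using xf_analytic[of z] r(3)[OF z] by blast
  qed
  have "of_real (mdet B) / mdenom B z0 ^ 2 \<noteq> 0" using B(1) mdenom_nonzero[OF B(1) z0(1)] by simp
  from pole_growth_at_fixed_point[OF xf_pole[OF z0] open_ball _ xhol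
      moebius_has_field_derivative[OF B(1) z0(1)] this B(2) bne'] r(1)
  obtain C where C: "eventually (\<lambda>z. norm (xf (?b z)) \<le> C * norm (xf z)) (at z0)" by auto
  from C near bnear bne' have both: "eventually (\<lambda>z. norm (xf (?b z)) ^ 2 \<le> C^2 * norm (xf z) ^ 3 \<and>
      norm (2 * yf (?b z) + 1) ^ 2 \<le> (8 * C^3) * norm (xf z) ^ 3) (at z0)"
  proof eventually_elim
    case (elim z)
    have bz: "?b z \<in> ball z0 r - {z0}" using elim by auto
    have n: "norm (xf z) \<ge> 10000" "norm (xf (?b z)) \<ge> 10000" using r(3)[OF elim(2)] r(3)[OF bz] by auto
    have "norm (xf (?b z)) ^ 2 \<le> C^2 * norm (xf z) ^ 2"
      using power_mono[OF elim(1), of 2] by (simp add: power_mult_distrib)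
    also have "\<dots> \<le> C^2 * norm (xf z) ^ 3" using n(1) by (intro mult_left_mono power_increasing) auto
    finally have 1: "norm (xf (?b z)) ^ 2 \<le> C^2 * norm (xf z) ^ 3" .
    have bH': "?b z \<in> H" using bz r(2) by auto
    \<comment> \<open>The growth of 2y + 1 needs no pole comparison of its own: the curve equation
      bounds it by that of x.\<close>
    have "on_E (xf (?b z)) (yf (?b z))" using pt_affine(2)[OF bH'] r(3)[OF bz] by blast
    hence "norm (2 * yf (?b z) + 1) ^ 2 = norm (lev cubic (xf (?b z)))"
      by (simp add: on_E_iff flip: norm_power)
    also have "\<dots> \<le> 8 * norm (xf (?b z)) ^ 3" by (rule norm_lev_cubic(2)[OF n(2)])
    also have "\<dots> \<le> 8 * (C * norm (xf z)) ^ 3" using power_mono[OF elim(1), of 3] by simp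
    also have "\<dots> = (8 * C^3) * norm (xf z) ^ 3" by (simp add: power_mult_distrib)
    finally show ?case using 1 by blast
  qed
  have gr1: "eventually (\<lambda>z. norm (xf (?b z)) ^ 2 \<le> C^2 * norm (xf z) ^ 3) (at z0)"
    using both by eventually_elim blast
  have gr2: "eventually (\<lambda>z. norm (2 * yf (?b z) + 1) ^ 2 \<le> (8 * C^3) * norm (xf z) ^ 3) (at z0)"
    using both by eventually_elim blast
  from curve_function_linear[OF cf1 z0 gr1] obtain c0 c1 c2
    where c: "\<And>z. z \<in> H \<Longrightarrow> pt z \<noteq> E_origin \<Longrightarrow> xf (?b z) = c0 + c1 * xf z + c2 * (2 * yf z + 1)" by blast
  from curve_function_linear[OF cf2 z0 gr2] obtain d0 d1 d2
    where d: "\<And>z. z \<in> H \<Longrightarrow> pt z \<noteq> E_origin \<Longrightarrow> 2 * yf (?b z) + 1 = d0 + d1 * xf z + d2 * (2 * yf z + 1)" by blast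
  have point: "\<exists>z\<in>H. pt z \<noteq> E_origin \<and> xf z = x \<and> yf z = y" if "on_E x y" for x y
    using pt_surj[of "E_affine x y"] that pt_affine_iff unfolding on_E_E_curve by blast
  have "lev cubic (c0 + c1 * x + c2 * v) = (d0 + d1 * x + d2 * v)^2" if v: "v^2 = lev cubic x" for x v
  proof -
    have "on_E x ((v - 1) / 2)" using v by (simp add: on_E_iff field_simps)
    then obtain z where z: "z \<in> H" "pt z \<noteq> E_origin" "xf z = x" "yf z = (v - 1) / 2" using point by blast
    have "2 * yf z + 1 = v" unfolding z(4) by simp
    moreover have "on_E (xf (?b z)) (yf (?b z))" using pt_affine(2)[OF bH[OF z(1)]] origin[OF z(1)] z(2) by blast
    ultimately show ?thesis using c[OF z(1,2)] d[OF z(1,2)] z(3) by (simp add: on_E_iff)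
  qed
  from linear_automorphism[OF this] show ?thesis
  proof
    \<comment> \<open>A constant x-coordinate contradicts the surjectivity of B on the
      half-plane.\<close>
    assume c12: "c1 = 0 \<and> c2 = 0"
    obtain w where w: "w \<in> H" "pt w \<noteq> E_origin" "xf w = c0 + 1" using point[OF on_E_y_root] by blast
    define z where "z = moebius (madj B) w"
    have z: "z \<in> H" "?b z = w"
      using moebius_in_H[of "madj B" w] moebius_madj(2)[OF B(1) w(1)] B(1) w(1) by (simp_all add: z_def)
    hence "xf w = c0" using c[OF z(1)] c12 origin[OF z(1)] w(2) by simp
    thus ?thesis using w(3) by simp
  next
    assume *: "c0 = 0 \<and> c1 = 1 \<and> c2 = 0 \<and> d0 = 0 \<and> d1 = 0 \<and> d2^2 = 1"
    show ?thesis
      by (rule exI[of _ d2]) (use c d origin * in auto)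
  qed
qed

end

section \<open>The value of t at the origin and its ramification elsewhere\<close>

context shimura
begin

text \<open>The formula for t is given at affine points, so the value at the origin is a limit. With
  w = 1/x and s = (2y + 1)/x^2, both tending to 0, F4 = x^2 f and F9 = x^5 K with f tending to 1 and
  K to 0. Hence F9^3 / F4^7 = x K^3 / f^7, and x K^2 stays bounded because x s^2 tends to 4.\<close>

lemma tt_at_origin:
  assumes z0: "z0 \<in> H" "pt z0 = E_origin"
  shows "tt z0 = P1_fin 1"
proof -
  define w where "w = (\<lambda>z. inverse (xf z))"
  define s where "s = (\<lambda>z. (2 * yf z + 1) / xf z ^ 2)"
  have w: "(w \<longlongrightarrow> 0) (at z0)"
    unfolding w_def using filterlim_compose[OF tendsto_inverse_0] xf_pole[OF z0] unfolding is_pole_def by blast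
  obtain r where r: "r > 0" "ball z0 r \<subseteq> H" "\<And>z. z \<in> ball z0 r - {z0} \<Longrightarrow> pt z \<noteq> E_origin \<and> norm (xf z) \<ge> 1"
    using pole_ball[OF z0 upper_half_plane_open z0(1), of 1] by blast
  have near: "eventually (\<lambda>z. z \<in> ball z0 r - {z0}) (at z0)"
    unfolding eventually_at using r(1) by (intro exI[of _ r]) (auto simp: dist_commute)
  have pnt: "z \<in> H" "pt z = E_affine (xf z) (yf z)" "xf z \<noteq> 0" "(2 * yf z + 1)^2 = lev cubic (xf z)"
    if z: "z \<in> ball z0 r - {z0}" for z
  proof -
    show zH: "z \<in> H" using z r(2) by blast
    show "pt z = E_affine (xf z) (yf z)" "(2 * yf z + 1)^2 = lev cubic (xf z)"
      using pt_affine[OF zH] r(3)[OF z] by (simp_all add: on_E_iff)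
    show "xf z \<noteq> 0" using r(3)[OF z] by auto
  qed
  let ?xs2 = "\<lambda>z. 4 + 4 * w z - 178816 * w z ^ 2 - 14623627 * w z ^ 3"
  have xs2: "xf z * s z ^ 2 = ?xs2 z" if z: "z \<in> ball z0 r - {z0}" for z
  proof -
    have e: "w z * xf z = 1" "xf z \<noteq> 0" using pnt(3)[OF z] by (simp_all add: w_def)
    have "s z * xf z ^ 2 = 2 * yf z + 1" using e(2) by (simp add: s_def)
    hence "(s z * xf z ^ 2) ^ 2 = lev cubic (xf z)" using pnt(4)[OF z] by simp
    moreover have "lev cubic (xf z) = ?xs2 z * xf z ^ 3"
      unfolding lev_cubic using e(1) by Groebner_Basis.algebra
    ultimately have "xf z ^ 3 * (xf z * s z ^ 2) = xf z ^ 3 * ?xs2 z"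
      by (simp add: power_mult_distrib eval_nat_numeral ac_simps)
    thus ?thesis using e(2) by (simp only: mult_cancel_left) simp
  qed
  have lim2: "(?xs2 \<longlongrightarrow> 4 + 4 * 0 - 178816 * 0 ^ 2 - 14623627 * 0 ^ 3) (at z0)" by (intro tendsto_intros w)
  have s: "(s \<longlongrightarrow> 0) (at z0)"
  proof -
    have "((\<lambda>z. w z * ?xs2 z) \<longlongrightarrow> 0 * (4 + 4 * 0 - 178816 * 0 ^ 2 - 14623627 * 0 ^ 3)) (at z0)"
      by (intro tendsto_intros w)
    moreover have "eventually (\<lambda>z. w z * ?xs2 z = s z ^ 2) (at z0)"
      using near
    proof eventually_elim
      case (elim z)
      show ?case unfolding xs2[OF elim, symmetric] using pnt(3)[OF elim] by (simp add: w_def)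
    qed
    ultimately have "((\<lambda>z. s z ^ 2) \<longlongrightarrow> 0) (at z0)" using Lim_transform_eventually by fastforce
    hence "((\<lambda>z. norm (s z) ^ 2) \<longlongrightarrow> 0) (at z0)" using tendsto_norm_zero by (fastforce simp: norm_power)
    hence "((\<lambda>z. norm (s z)) \<longlongrightarrow> 0) (at z0)" by simp
    thus ?thesis by (rule tendsto_norm_zero_cancel)
  qed
  let ?f4 = "\<lambda>z. 1 - 1208 * w z - 227671 * w z ^ 2 + 91 / 2 * (s z - w z ^ 2)"
  let ?P = "\<lambda>z. (8 - 384 * w z - 13656232 * w z ^ 2 - 678909344 * w z ^ 3) / 2"
  let ?R = "\<lambda>z. 1015 + 770584 * w z + 163098512 * w z ^ 2 + 29785004488 * w z ^ 3 + 2319185361392 * w z ^ 4 + ?P z * w z"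
  have f4: "F4 (xf z) (yf z) = xf z ^ 2 * ?f4 z" if z: "z \<in> ball z0 r - {z0}" for z
    using pnt(3)[OF z] by (simp add: F4_def s_def w_def field_simps power2_eq_square)
  have f9: "F9 (xf z) (yf z) = xf z ^ 5 * (?P z * s z - w z * ?R z)" if z: "z \<in> ball z0 r - {z0}" for z
  proof -
    define X' where "X' = xf z"
    have nz: "X' \<noteq> 0" using pnt(3)[OF z] by (simp add: X'_def)
    have e: "w z * X' = 1" "s z * X'^2 = 2 * yf z + 1" using nz by (simp_all add: w_def s_def X'_def)
    define W S where "W = w z" and "S = s z"
    have "2 * F9 X' (yf z) = 2 * (X' ^ 5 * ((8 - 384 * W - 13656232 * W ^ 2 - 678909344 * W ^ 3) / 2 * S - W * (1015 + 770584 * W + 163098512 * W ^ 2 + 29785004488 * W ^ 3 + 2319185361392 * W ^ 4 + (8 - 384 * W - 13656232 * W ^ 2 - 678909344 * W ^ 3) / 2 * W)))"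
    proof -
      have *: "(8 - 384 * W - 13656232 * W ^ 2 - 678909344 * W ^ 3) * X'^3 = 8 * X'^3 - 384 * X'^2 - 13656232 * X' - 678909344"
        using e(1) unfolding W_def[symmetric] by Groebner_Basis.algebra
      have **: "(1015 + 770584 * W + 163098512 * W ^ 2 + 29785004488 * W ^ 3 + 2319185361392 * W ^ 4) * X'^4 =
        1015 * X'^4 + 770584 * X'^3 + 163098512 * X'^2 + 29785004488 * X' + 2319185361392"
        using e(1) unfolding W_def[symmetric] by Groebner_Basis.algebra
      define A where "A = (8 - 384 * W - 13656232 * W ^ 2 - 678909344 * W ^ 3)"
      define B where "B = 1015 + 770584 * W + 163098512 * W ^ 2 + 29785004488 * W ^ 3 + 2319185361392 * W ^ 4"
      have "2 * (X'^5 * (A / 2 * S - W * (B + A / 2 * W))) = X'^5 * (A * S - W * (2 * B + A * W))"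
        by (simp add: ring_distribs mult.assoc)
      also have "\<dots> = (A * X'^3) * (S * X'^2) - 2 * (B * X'^4) * (W * X') - (A * X'^3) * (W * X')^2"
        by (simp add: algebra_simps power2_eq_square power3_eq_cube eval_nat_numeral)
      also have "\<dots> = 2 * F9 X' (yf z)"
        unfolding *[folded A_def] **[folded B_def] e[folded S_def W_def] F9_def
        by (simp add: algebra_simps)
      finally show ?thesis unfolding A_def B_def by simp
    qed
    thus ?thesis unfolding X'_def W_def S_def by simp
  qed
  have lf4: "(?f4 \<longlongrightarrow> 1 - 1208 * 0 - 227671 * 0 ^ 2 + 91 / 2 * (0 - 0 ^ 2)) (at z0)" by (intro tendsto_intros w s)
  have lP: "(?P \<longlongrightarrow> (8 - 384 * 0 - 13656232 * 0 ^ 2 - 678909344 * 0 ^ 3) / 2) (at z0)" by (intro tendsto_intros w) simp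
  have lR: "(?R \<longlongrightarrow> 1015 + 770584 * 0 + 163098512 * 0 ^ 2 + 29785004488 * 0 ^ 3 + 2319185361392 * 0 ^ 4 +
      (8 - 384 * 0 - 13656232 * 0 ^ 2 - 678909344 * 0 ^ 3) / 2 * 0) (at z0)" by (intro tendsto_intros w) simp
  \<comment> \<open>Here x K^2 has been expanded with x w = 1 and x s^2 replaced by its polynomial
    in w, so that no unbounded factor is left.\<close>
  let ?G = "\<lambda>z. (?P z * s z - w z * ?R z) * (?P z ^ 2 * ?xs2 z - 2 * ?P z * ?R z * s z + w z * ?R z ^ 2) / ?f4 z ^ 7"
  have lG: "((\<lambda>z. 1 - 343 / 64 * ?G z) \<longlongrightarrow> 1) (at z0)"
  proof -
    have l4: "(?f4 \<longlongrightarrow> 1) (at z0)" using lf4 by simp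
    have "(?G \<longlongrightarrow> (4 * 0 - 0 * 1015) * (4 ^ 2 * 4 - 2 * 4 * 1015 * 0 + 0 * 1015 ^ 2) / 1 ^ 7) (at z0)"
      using lP lR lim2 by (intro tendsto_intros l4 w s) simp_all
    hence "((\<lambda>z. 1 - 343 / 64 * ?G z) \<longlongrightarrow> 1 - 343 / 64 * ((4 * 0 - 0 * 1015) * (4 ^ 2 * 4 - 2 * 4 * 1015 * 0 + 0 * 1015 ^ 2) / 1 ^ 7)) (at z0)"
      by (intro tendsto_diff tendsto_mult tendsto_const)
    thus ?thesis by simp
  qed
  have "eventually (\<lambda>z. ?f4 z \<noteq> 0) (at z0)" using tendsto_imp_eventually_ne[OF lf4] by simp
  with near have "eventually (\<lambda>z. 1 - 343 / 64 * ?G z = tf z) (at z0)"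
  proof eventually_elim
    case (elim z)
    have F4: "F4 (xf z) (yf z) \<noteq> 0" using f4[OF elim(1)] elim(2) pnt(3)[OF elim(1)] by simp
    define X' P R W S f where d: "X' = xf z" "P = ?P z" "R = ?R z" "W = w z" "S = s z" "f = ?f4 z"
    have X0: "X' \<noteq> 0" "W * X' = 1" using pnt(3)[OF elim(1)] by (simp_all add: d w_def)
    have xs: "?xs2 z = X' * S^2" using xs2[OF elim(1)] by (simp add: d)
    have G: "?G z = (P * S - W * R) * (P ^ 2 * (X' * S^2) - 2 * P * R * S + W * R^2) / f ^ 7"
      unfolding xs[unfolded d] d ..
    have "P ^ 2 * (X' * S^2) - 2 * P * R * S + W * R^2 = X' * (P * S - W * R)^2"
      using X0(2) by Groebner_Basis.algebra
    hence G': "?G z = X' * (P * S - W * R)^3 / f^7" unfolding G by (simp add: power3_eq_cube power2_eq_square)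
    have "tf z = 1 - 343 * F9 (xf z) (yf z) ^ 3 / (64 * F4 (xf z) (yf z) ^ 7)"
      using tt_formula[OF pnt(1,2)[OF elim(1)] F4] by (simp add: tf_def)
    also have "\<dots> = 1 - 343 * (X'^5 * (P * S - W * R)) ^ 3 / (64 * (X'^2 * f) ^ 7)"
      unfolding f4[OF elim(1)] f9[OF elim(1)] d ..
    also have "\<dots> = 1 - 343 / 64 * (X' * (P * S - W * R)^3 / f^7)"
    proof -
      define K where "K = P * S - W * R"
      have "(X'^5 * K) ^ 3 = X'^14 * (X' * K^3)" "(X'^2 * f) ^ 7 = X'^14 * f^7" by Groebner_Basis.algebra+
      thus ?thesis unfolding K_def[symmetric] using X0(1) by simp
    qed
    finally show ?case unfolding G' by simp
  qed
  hence lim: "(tf \<longlongrightarrow> 1) (at z0)" by (rule Lim_transform_eventually[OF lG])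
  have "tt z0 \<noteq> P1_inf"
  proof
    assume "tt z0 = P1_inf"
    hence "is_pole tf z0" using P1_holomorphic_pole[OF t_holo z0(1)] by (simp add: tf_def[abs_def])
    thus False using not_tendsto_and_filterlim_at_infinity[OF _ lim] unfolding is_pole_def by simp
  qed
  moreover from this have "tf z0 = 1"
    using analytic_at_imp_isCont[OF tf_analytic[OF z0(1)]] lim tendsto_unique[of "at z0" tf] by (simp add: isCont_def)
  ultimately show ?thesis using P1_value_finite[of "tt z0"] by (simp add: tf_def)
qed

text \<open>Since \<open>G1\<close> is countable, a local deck transformation agrees with one element of \<open>G1\<close> on an
  uncountable set, hence everywhere.\<close>

lemma local_deck_trivial:
  assumes r: "r > 0" "ball z r \<subseteq> H" and \<delta>hol: "\<delta> holomorphic_on ball z r" and fix_z: "\<delta> z = z"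
    and \<delta>: "\<And>w. w \<in> ball z r \<Longrightarrow> \<delta> w \<in> H \<and> tt (\<delta> w) = tt w"
    and triv: "\<And>g w. g \<in> G1 \<Longrightarrow> moebius g z = z \<Longrightarrow> w \<in> H \<Longrightarrow> moebius g w = w"
    and w: "w \<in> ball z r"
  shows "\<delta> w = w"
proof -
  have ex: "\<exists>g\<in>G1. \<delta> w = moebius g w" if w: "w \<in> ball z r" for w
    using tt_eq_iff[of w "\<delta> w"] \<delta>[OF w] w r(2) by auto
  \<comment> \<open>A compact disc, so that an infinite coincidence set accumulates inside the
    domain of holomorphy.\<close>
  define K where "K = cball z (r / 2)"
  have K: "K \<subseteq> ball z r" "compact K" using r(1) by (auto simp: K_def)
  have "\<exists>g\<in>G1. infinite {w \<in> K. \<delta> w = moebius g w}"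
  proof (rule ccontr)
    assume *: "\<not> ?thesis"
    have "countable (\<Union>g\<in>G1. {w \<in> K. \<delta> w = moebius g w})"
      using * by (intro countable_UN[OF G1.count] countable_finite) blast
    moreover have "K \<subseteq> (\<Union>g\<in>G1. {w \<in> K. \<delta> w = moebius g w})" using ex K(1) by blast
    ultimately have "countable K" by (rule countable_subset[rotated])
    thus False using uncountable_cball[of "r / 2" z] r(1) by (simp add: K_def)
  qed
  then obtain h where h: "h \<in> G1" "infinite {w \<in> K. \<delta> w = moebius h w}" by blast
  obtain \<xi> where \<xi>: "\<xi> \<in> K" "\<xi> islimpt {w \<in> K. \<delta> w = moebius h w}"
    using K(2) h(2) unfolding compact_eq_Bolzano_Weierstrass by (metis (no_types, lifting) mem_Collect_eq subsetI)
  have hhol: "(\<lambda>w. \<delta> w - moebius h w) holomorphic_on ball z r"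
    by (intro holomorphic_on_diff \<delta>hol holomorphic_on_subset[OF moebius_holomorphic[OF G1.det_pos[OF h(1)]]] r(2))
  have eq: "\<delta> w = moebius h w" if "w \<in> ball z r" for w
  proof -
    have "\<delta> w - moebius h w = 0"
      by (rule analytic_continuation[OF hhol open_ball connected_ball _ _ \<xi>(2) _ that]) (use K(1) \<xi>(1) in auto)
    thus ?thesis by simp
  qed
  have "moebius h z = z" using eq[of z] fix_z r(1) by simp
  thus ?thesis using triv[OF h(1) _ , of w] eq[OF w] w r(2) by auto
qed

text \<open>If \<open>t\<close> were ramified, it would be invariant under a local rotation about \<open>z\<close>.\<close>

lemma deriv_tf_nonzero:
  assumes z: "z \<in> H" "tt z \<noteq> P1_inf"
    and triv: "\<And>g w. g \<in> G1 \<Longrightarrow> moebius g z = z \<Longrightarrow> w \<in> H \<Longrightarrow> moebius g w = w"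
  shows "deriv tf z \<noteq> 0"
proof
  assume d0: "deriv tf z = 0"
  obtain r0 where r0: "r0 > 0" "\<And>w. w \<noteq> z \<Longrightarrow> dist w z < r0 \<Longrightarrow> tt w \<noteq> P1_inf \<and> w \<in> H"
    using tt_finite_near[OF z(1)] unfolding eventually_at by auto
  have fin: "tt w \<noteq> P1_inf \<and> w \<in> H" if "w \<in> ball z r0" for w
    using r0(2)[of w] that z by (cases "w = z") (auto simp: dist_commute)
  have hol: "tf holomorphic_on ball z r0"
    using tf_analytic fin by (auto intro!: analytic_imp_holomorphic simp: analytic_on_analytic_at[of _ "ball z r0"])
  have "\<exists>n>0. (deriv ^^ n) tf z \<noteq> 0"
  proof (rule ccontr)
    assume *: "\<not> ?thesis"
    have der: "\<And>n. 0 < n \<Longrightarrow> (deriv ^^ n) tf z = 0" using * by blast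
    have const: "tt w = tt z" if "w \<in> ball z r0" for w
    proof -
      have "tf w = tf z"
        by (rule holomorphic_fun_eq_const_on_connected[OF hol open_ball connected_ball der _ that]) (use r0(1) in auto)
      thus ?thesis using P1_value_finite[of "tt w"] P1_value_finite[of "tt z"] fin[OF that] z(2)
        by (simp add: tf_def)
    qed
    have "ball z r0 \<subseteq> H" "z \<in> ball z r0" using fin r0(1) by auto
    from not_locally_one_point(2)[OF open_ball this(2,1), of "tt z"] const show False by blast
  qed
  define n where "n = (LEAST n. 0 < n \<and> (deriv ^^ n) tf z \<noteq> 0)"
  have n: "0 < n" "(deriv ^^ n) tf z \<noteq> 0"
    using LeastI_ex[OF \<open>\<exists>n>0. (deriv ^^ n) tf z \<noteq> 0\<close>[unfolded Bex_def]] unfolding n_def by auto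
  have nmin: "(deriv ^^ i) tf z = 0" if "0 < i" "i < n" for i
    using not_less_Least[of i "\<lambda>n. 0 < n \<and> (deriv ^^ n) tf z \<noteq> 0"] that unfolding n_def by blast
  have "n \<noteq> 1" using n(2) d0 by auto
  hence n2: "n \<ge> 2" using n(1) by simp
  have zb: "z \<in> ball z r0" using r0(1) by simp
  \<comment> \<open>To its first nonvanishing order n, the difference t - t(z) is the n-th power of
    a function k with a simple zero at z.\<close>
  obtain g r where g: "0 < r" "g holomorphic_on ball z r"
    "\<And>w. w \<in> ball z r \<Longrightarrow> tf w - tf z = ((w - z) * g w) ^ n" "\<And>w. w \<in> ball z r \<Longrightarrow> g w \<noteq> 0"
    by (rule holomorphic_factor_order_of_zero_strong[OF hol open_ball zb n]) (erule (1) nmin, rule that)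
  define k where "k = (\<lambda>w. (w - z) * g w)"
  define r1 where "r1 = min r r0"
  have r1: "r1 > 0" "ball z r1 \<subseteq> ball z r" "ball z r1 \<subseteq> ball z r0" using g(1) r0(1) by (auto simp: r1_def)
  have zb1: "z \<in> ball z r1" using r1(1) by simp
  have khol: "k holomorphic_on ball z r1"
    unfolding k_def using holomorphic_on_subset[OF g(2) r1(2)] by (intro holomorphic_intros)
  have dk: "deriv k z \<noteq> 0"
  proof -
    have "(g has_field_derivative deriv g z) (at z)"
      by (rule holomorphic_derivI[OF g(2) open_ball]) (use g(1) in simp)
    hence "(k has_field_derivative ((z - z) * deriv g z + (1 - 0) * g z)) (at z)"
      unfolding k_def by (auto intro!: derivative_eq_intros)
    hence "deriv k z = g z" by (simp add: DERIV_imp_deriv)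
    thus ?thesis using g(4)[of z] g(1) by simp
  qed
  obtain r2 where r2: "r2 > 0" "ball z r2 \<subseteq> ball z r1" "open (k ` ball z r2)" "inj_on k (ball z r2)"
    by (rule has_complex_derivative_locally_invertible[OF khol zb1 open_ball dk]) (rule that)
  have khol2: "k holomorphic_on ball z r2" by (rule holomorphic_on_subset[OF khol r2(2)])
  obtain \<eta> where \<eta>: "\<eta> holomorphic_on k ` ball z r2" "\<And>w. w \<in> ball z r2 \<Longrightarrow> \<eta> (k w) = w"
    by (rule holomorphic_has_inverse[OF khol2 open_ball r2(4)]) (rule that)
  have zb2: "z \<in> ball z r2" using r2(1) by simp
  have kz: "k z = 0" by (simp add: k_def)
  obtain e where e: "e > 0" "ball 0 e \<subseteq> k ` ball z r2"
  proof -
    have "0 \<in> k ` ball z r2" using zb2 kz by (metis imageI)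
    thus ?thesis using that r2(3) by (auto elim: openE)
  qed
  \<comment> \<open>Multiplying the coordinate k by a nontrivial n-th root of unity preserves k^n
    and hence t.\<close>
  define \<zeta> where "\<zeta> = cis (2 * pi / n)"
  have "\<zeta> ^ n = cis (real n * (2 * pi / n))" unfolding \<zeta>_def by (rule Complex.DeMoivre)
  also have "real n * (2 * pi / n) = 2 * pi" using n(1) by simp
  finally have z1: "\<zeta> ^ n = 1" "norm \<zeta> = 1" by (simp_all add: \<zeta>_def)
  have z2: "\<zeta> \<noteq> 1"
  proof
    assume "\<zeta> = 1"
    hence "cos (2 * pi / n) = cos 0" by (simp add: \<zeta>_def complex_eq_iff)
    moreover have "2 * pi / n \<le> pi" "2 * pi / n > 0" using n2 by (simp_all add: field_simps)
    ultimately show False using cos_monotone_0_pi[of 0 "2 * pi / n"] by simp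
  qed
  have "isCont k z" using khol2 zb2 by (meson continuous_on_eq_continuous_at holomorphic_on_imp_continuous_on open_ball)
  then obtain d where d: "d > 0" "\<And>w. dist w z < d \<Longrightarrow> dist (k w) (k z) < e"
    unfolding continuous_at_eps_delta using e(1) by blast
  define r3 where "r3 = min d r2"
  have r3: "r3 > 0" "ball z r3 \<subseteq> ball z r2" using d(1) r2(1) by (auto simp: r3_def)
  have ke: "\<zeta> * k w \<in> ball 0 e" if "w \<in> ball z r3" for w
    using d(2)[of w] that by (simp add: r3_def dist_commute kz z1(2) norm_mult dist_norm)
  define \<delta> where "\<delta> = (\<lambda>w. \<eta> (\<zeta> * k w))"
  have \<delta>: "\<delta> w \<in> ball z r2" "k (\<delta> w) = \<zeta> * k w" if w: "w \<in> ball z r3" for w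
  proof -
    obtain v where v: "v \<in> ball z r2" "\<zeta> * k w = k v" using ke[OF w] e(2) by blast
    have "\<delta> w = v" using \<eta>(2)[OF v(1)] v(2) by (simp add: \<delta>_def)
    thus "\<delta> w \<in> ball z r2" "k (\<delta> w) = \<zeta> * k w" using v by simp_all
  qed
  have \<delta>hol: "\<delta> holomorphic_on ball z r3"
  proof -
    have "(\<lambda>w. \<zeta> * k w) holomorphic_on ball z r3"
      by (intro holomorphic_intros holomorphic_on_subset[OF khol2 r3(2)])
    moreover have "(\<lambda>w. \<zeta> * k w) ` ball z r3 \<subseteq> k ` ball z r2" using ke e(2) by blast
    ultimately have "(\<eta> \<circ> (\<lambda>w. \<zeta> * k w)) holomorphic_on ball z r3"
      by (rule holomorphic_on_compose_gen[OF _ \<eta>(1)])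
    thus ?thesis by (simp add: \<delta>_def o_def)
  qed
  have sub2: "w \<in> ball z r" "w \<in> ball z r0" "tt w \<noteq> P1_inf" "w \<in> H" if "w \<in> ball z r2" for w
    using that r2(2) r1(2,3) fin by blast+
  have "tt (\<delta> w) = tt w" if w: "w \<in> ball z r3" for w
  proof -
    have w2: "w \<in> ball z r2" using w r3(2) by blast
    have gk: "tf v - tf z = k v ^ n" if "v \<in> ball z r2" for v
      using g(3)[OF sub2(1)[OF that]] by (simp add: k_def)
    have "tf (\<delta> w) - tf z = tf w - tf z"
      unfolding gk[OF \<delta>(1)[OF w]] gk[OF w2] \<delta>(2)[OF w] power_mult_distrib z1(1) by simp
    hence "tf (\<delta> w) = tf w" by simp
    thus ?thesis
      using P1_value_finite[OF sub2(3)[OF w2]] P1_value_finite[OF sub2(3)[OF \<delta>(1)[OF w]]] by (simp add: tf_def)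
  qed
  hence inv: "\<delta> w \<in> H \<and> tt (\<delta> w) = tt w" if "w \<in> ball z r3" for w
    using that sub2(4)[OF \<delta>(1)] by blast
  have r3H: "ball z r3 \<subseteq> H" using sub2(4) r3(2) by blast
  have \<delta>z: "\<delta> z = z" using \<eta>(2)[OF zb2] by (simp add: \<delta>_def kz)
  have id: "\<delta> w = w" if "w \<in> ball z r3" for w
    by (rule local_deck_trivial[OF r3(1) r3H \<delta>hol \<delta>z]) (erule inv, erule (2) triv, rule that)
  define w where "w = z + of_real (r3 / 2)"
  have w: "w \<in> ball z r3" "w \<noteq> z" using r3(1) by (simp_all add: w_def dist_norm)
  have "k w = \<zeta> * k w" using \<delta>(2)[OF w(1)] id[OF w(1)] by simp
  hence "k w = 0" using z2 by simp
  moreover have "w \<in> ball z r" using w(1) r3(2) sub2(1) by blast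
  ultimately show False using g(4)[of w] w(2) by (simp add: k_def)
qed

end

section \<open>Stabilizers in the half-plane\<close>

lemma mdenom_mmul:
  assumes "mdet n > 0" "z \<in> upper_half_plane"
  shows "mdenom (mmul m n) z = mdenom m (moebius n z) * mdenom n z"
proof -
  obtain p q r s where m: "m = (p, q, r, s)" by (cases m) auto
  obtain p' q' r' s' where n: "n = (p', q', r', s')" by (cases n) auto
  have "of_real r' * z + of_real s' \<noteq> 0" using mdenom_nonzero[OF assms] by (simp add: n mdenom_def)
  thus ?thesis by (simp add: m n mdenom_def moebius_def mmul_def field_simps)
qed

text \<open>At a fixed point \<open>z\<close> the vector \<open>(z, 1)\<close> is an eigenvector with eigenvalue \<^const>\<open>mdenom\<close>.\<close>

lemma mdenom_fixed_point:
  assumes "mdet m > 0" "z \<in> upper_half_plane" "moebius m z = z"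
  shows "mdenom m z ^ 2 - of_real (mtrace m) * mdenom m z + of_real (mdet m) = 0"
proof -
  obtain p q r s where m: "m = (p, q, r, s)" by (cases m) auto
  have ne: "of_real r * z + of_real s \<noteq> 0" using mdenom_nonzero[OF assms(1,2)] by (simp add: m mdenom_def)
  have "of_real p * z + of_real q = z * (of_real r * z + of_real s)"
    using assms(3) ne by (simp add: m moebius_def nonzero_divide_eq_eq)
  hence "of_real r * (of_real p * z + of_real q) = of_real r * (z * (of_real r * z + of_real s))" by simp
  thus ?thesis by (simp add: m mdenom_def mtrace_def mdet_def algebra_simps power2_eq_square)
qed

text \<open>As z is not real, the real pair (r, s) is determined by r z + s, and the fixed point
  equation then determines (p, q). So the two matrices agree up to sign.\<close>

lemma moebius_fixed_eqI:
  assumes m: "mdet m = 1" "moebius m z = z" and n: "mdet n = 1" "moebius n z = z"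
    and z: "z \<in> upper_half_plane" and eq: "mdenom m z ^ 2 = mdenom n z ^ 2"
  shows "moebius m = moebius n"
proof -
  obtain p q r s where md: "m = (p, q, r, s)" by (cases m) auto
  obtain p' q' r' s' where nd: "n = (p', q', r', s')" by (cases n) auto
  have Im: "Im z \<noteq> 0" using z by (simp add: upper_half_plane_def)
  have fix_eq: "of_real p * z + of_real q = z * (of_real r * z + of_real s)"
    "of_real p' * z + of_real q' = z * (of_real r' * z + of_real s')"
  proof -
    have "of_real r * z + of_real s \<noteq> 0" "of_real r' * z + of_real s' \<noteq> 0"
      using mdenom_nonzero[of m z] mdenom_nonzero[of n z] m n z by (simp_all add: md nd mdenom_def)
    thus "of_real p * z + of_real q = z * (of_real r * z + of_real s)"
      "of_real p' * z + of_real q' = z * (of_real r' * z + of_real s')"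
      using m(2) n(2) by (simp_all add: md nd moebius_def nonzero_divide_eq_eq)
  qed
  have lin: "a = a' \<and> b = b'" if e: "of_real a * z + of_real b = of_real a' * z + of_real b'" for a b a' b' :: real
  proof -
    have "Im (of_real a * z + of_real b) = Im (of_real a' * z + of_real b')" using e by simp
    hence "a = a'" using Im by simp
    thus ?thesis using e by simp
  qed
  define \<epsilon> :: real where "\<epsilon> = (if mdenom m z = mdenom n z then 1 else - 1)"
  have e: "\<epsilon> = 1 \<or> \<epsilon> = - 1" "mdenom m z = of_real \<epsilon> * mdenom n z"
    using eq by (auto simp: \<epsilon>_def power2_eq_iff)
  have rs: "r = \<epsilon> * r' \<and> s = \<epsilon> * s'"
    by (rule lin) (use e(2) in \<open>simp add: md nd mdenom_def algebra_simps\<close>)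
  have "of_real p * z + of_real q = of_real \<epsilon> * (of_real p' * z + of_real q')"
    unfolding fix_eq using rs by (simp add: algebra_simps)
  hence pq: "p = \<epsilon> * p' \<and> q = \<epsilon> * q'" by (intro lin) (simp add: algebra_simps)
  have "(of_real p * w + of_real q) / (of_real r * w + of_real s) =
     (of_real p' * w + of_real q') / (of_real r' * w + of_real s' :: complex)" for w
  proof -
    have "of_real p * w + of_real q = of_real \<epsilon> * (of_real p' * w + of_real q' :: complex)"
      "of_real r * w + of_real s = of_real \<epsilon> * (of_real r' * w + of_real s' :: complex)"
      using rs pq by (simp_all add: algebra_simps)
    thus ?thesis using e(1) by auto
  qed
  thus ?thesis by (simp add: md nd moebius_def fun_eq_iff)
qed

text \<open>Multiplication by an element of D permutes D; comparing the products over D makes its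
  power with exponent \<open>card D\<close> equal to 1. Counting roots of unity then gives
  equality.\<close>

lemma finite_multiplicative_set_roots_unity:
  fixes D :: "complex set"
  assumes "finite D" "D \<noteq> {}" "0 \<notin> D" "\<And>x y. x \<in> D \<Longrightarrow> y \<in> D \<Longrightarrow> x * y \<in> D"
  shows "D = {z. z ^ card D = 1}"
proof -
  have "x ^ card D = 1" if x: "x \<in> D" for x
  proof -
    have x0: "x \<noteq> 0" using x assms(3) by blast
    have inj: "inj_on (\<lambda>y. x * y) D" using x0 by (simp add: inj_on_def)
    have "(\<lambda>y. x * y) ` D \<subseteq> D" using assms(4)[OF x] by blast
    hence im: "(\<lambda>y. x * y) ` D = D" by (rule endo_inj_surj[OF assms(1) _ inj])
    have "prod (\<lambda>y. y) D = prod (\<lambda>y. y) ((\<lambda>y. x * y) ` D)" using im by simp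
    also have "\<dots> = prod (\<lambda>y. x * y) D" by (simp add: prod.reindex[OF inj])
    also have "\<dots> = x ^ card D * prod (\<lambda>y. y) D" by (simp add: prod.distrib)
    finally show ?thesis using assms(1,3) by (simp add: prod_zero_iff)
  qed
  hence "D \<subseteq> {z. z ^ card D = 1}" by blast
  moreover have pos: "card D > 0" using assms(1,2) by (simp add: card_gt_0_iff)
  ultimately show ?thesis
    using finite_roots_unity[of "card D", where ?'a = complex] card_roots_unity_eq[OF pos]
    by (intro card_subset_eq) auto
qed

context shimura
begin

text \<open>The derivative at the fixed point embeds the stabilizer into the nonzero complex
  numbers, and the image consists of all roots of unity of its order. When 3 divides the order, a
  primitive cube root of unity occurs, and an element with this derivative has trace 1 or
  -1.\<close>

lemma order_three_element:
  assumes z0: "z0 \<in> H" and N: "stabilizer_order G0 z0 > 0" "3 dvd stabilizer_order G0 z0"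
  shows "\<exists>h\<in>G0. moebius h z0 = z0 \<and> mtrace h = - 1"
proof -
  define T where "T = {g \<in> G0. moebius g z0 = z0}"
  define e where "e = (\<lambda>F :: complex \<Rightarrow> complex. deriv F z0)"
  have ed: "e (moebius g) = 1 / mdenom g z0 ^ 2" if "g \<in> T" for g
  proof -
    have g: "g \<in> G0" using that by (simp add: T_def)
    show ?thesis
      using moebius_has_field_derivative[OF G0.det_pos[OF g] z0]
      by (simp add: e_def DERIV_imp_deriv G0.det_1[OF g])
  qed
  have S: "{moebius g |g. g \<in> G0 \<and> moebius g z0 = z0} = moebius ` T" by (auto simp: T_def)
  define D where "D = (\<lambda>g. 1 / mdenom g z0 ^ 2) ` T"
  have De: "D = e ` moebius ` T" unfolding D_def image_image using ed by (intro image_cong) simp_all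
  have "inj_on e (moebius ` T)"
  proof (rule inj_onI, clarify)
    fix g h assume gh: "g \<in> T" "h \<in> T" "e (moebius g) = e (moebius h)"
    have "mdenom g z0 ^ 2 = mdenom h z0 ^ 2" using gh(3) unfolding ed[OF gh(1)] ed[OF gh(2)] by simp
    thus "moebius g = moebius h"
      using gh G0.det_1 z0 by (intro moebius_fixed_eqI) (auto simp: T_def)
  qed
  hence cD: "card D = stabilizer_order G0 z0"
    unfolding De stabilizer_order_def S by (rule card_image)
  have mne: "mdenom g z0 \<noteq> 0" if "g \<in> T" for g
    using mdenom_nonzero[OF G0.det_pos z0] that by (simp add: T_def)
  have "D = {z. z ^ card D = 1}"
  proof (rule finite_multiplicative_set_roots_unity)
    show "finite D" by (rule card_ge_0_finite) (use N cD in simp)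
    show "D \<noteq> {}" using N cD by auto
    show "0 \<notin> D" using mne by (auto simp: D_def)
    fix x y assume "x \<in> D" "y \<in> D"
    then obtain g h where gh: "g \<in> T" "x = 1 / mdenom g z0 ^ 2" "h \<in> T" "y = 1 / mdenom h z0 ^ 2"
      by (auto simp: D_def)
    have hp: "mdet h > 0" "moebius h z0 = z0" using gh(3) G0.det_pos by (auto simp: T_def)
    have "moebius (mmul g h) z0 = z0" using moebius_mmul[OF hp(1) z0, of g] hp(2) gh(1) by (simp add: T_def)
    hence "mmul g h \<in> T" using gh G0.mul_in by (simp add: T_def)
    moreover have "x * y = 1 / mdenom (mmul g h) z0 ^ 2"
      using mdenom_mmul[OF hp(1) z0, of g] gh hp(2) by (simp add: power_mult_distrib)
    ultimately show "x * y \<in> D" unfolding D_def by blast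
  qed
  moreover define \<omega> where "\<omega> = cis (2 * pi / 3)"
  have "\<omega> ^ 3 = cis (real 3 * (2 * pi / 3))" unfolding \<omega>_def by (rule Complex.DeMoivre)
  hence w3: "\<omega> ^ 3 = 1" by simp
  have w1: "\<omega> \<noteq> 1"
  proof
    assume "\<omega> = 1"
    hence "Im \<omega> = 0" by simp
    thus False using sin_gt_zero[of "2 * pi / 3"] by (simp add: \<omega>_def)
  qed
  have "(\<omega> - 1) * (\<omega>^2 + \<omega> + 1) = 0" using w3 by (simp add: algebra_simps power2_eq_square power3_eq_cube)
  hence w: "\<omega>^2 + \<omega> + 1 = 0" using w1 by simp
  obtain m where m: "card D = 3 * m" using N(2) unfolding cD by blast
  have "\<omega> ^ card D = 1" unfolding m by (simp add: power_mult w3)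
  ultimately have "\<omega> \<in> D" by blast
  then obtain g where g: "g \<in> T" "\<omega> = 1 / mdenom g z0 ^ 2" by (auto simp: D_def)
  have gG: "g \<in> G0" "moebius g z0 = z0" using g(1) by (auto simp: T_def)
  define l where "l = mdenom g z0"
  have l0: "l \<noteq> 0" using mne[OF g(1)] by (simp add: l_def)
  have "\<omega> * l^2 = 1" using l0 g(2) by (simp add: l_def)
  hence l4: "l^4 + l^2 + 1 = 0" using w by Groebner_Basis.algebra
  have l2: "l^2 - of_real (mtrace g) * l + 1 = 0"
    using mdenom_fixed_point[OF G0.det_pos[OF gG(1)] z0 gG(2)] G0.det_1[OF gG(1)] by (simp add: l_def)
  have "l^2 * (of_real (mtrace g) ^ 2 - 1) = 0" using l4 l2 by Groebner_Basis.algebra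
  hence "of_real (mtrace g ^ 2) = (of_real 1 :: complex)" using l0 by simp
  hence "mtrace g ^ 2 = 1" by (simp only: of_real_eq_iff)
  hence tr: "mtrace g = 1 \<or> mtrace g = - 1" by (simp add: power2_eq_1_iff)
  show ?thesis
  proof (cases "mtrace g = - 1")
    case False
    hence t1: "mtrace g = 1" using tr by simp
    \<comment> \<open>Trace 1 means order 6, and the square of such an element has trace -1.\<close>
    have "mtrace (mmul g g) = mtrace g ^ 2 - 2 * mdet g"
      by (cases g) (simp add: mtrace_def mmul_def mdet_def algebra_simps power2_eq_square)
    hence "mtrace (mmul g g) = - 1" using t1 G0.det_1[OF gG(1)] by simp
    moreover have "moebius (mmul g g) z0 = z0" using moebius_mmul[OF G0.det_pos[OF gG(1)] z0, of g] gG(2) by simp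
    ultimately show ?thesis using G0.mul_in[OF gG(1) gG(1)] by blast
  qed (use gG in blast)
qed

text \<open>A root of the norm of \<open>F9\<close> is the x-coordinate of a zero of
  \<open>F9\<close>. There t = 1, the value at the origin, so the point is a translate of z0 under
  \<open>G1\<close>.\<close>

lemma nine_points_over_one:
  assumes z0: "z0 \<in> H" "pt z0 = E_origin"
  shows "\<exists>gs. (\<forall>i<9::nat. gs i \<in> G1 \<and> pt (moebius (gs i) z0) \<noteq> E_origin \<and>
      F9 (xf (moebius (gs i) z0)) (yf (moebius (gs i) z0)) = 0) \<and>
    inj_on (\<lambda>i. pt (moebius (gs i) z0)) {..<9}"
proof -
  let ?R = "{x. lev F9_norm x = 0}"
  have "finite ?R" by (rule card_ge_0_finite) (simp add: card_F9_norm_roots)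
  then obtain f where f: "bij_betw f {0..<card ?R} ?R" using ex_bij_betw_nat_finite by blast
  have R: "lev F9_norm (f i) = 0" if "i < 9" for i
    using f that unfolding bij_betw_def card_F9_norm_roots by fastforce
  have inj: "inj_on f {..<9}"
    using f unfolding bij_betw_def card_F9_norm_roots by (simp add: lessThan_atLeast0)
  have "\<exists>g. g \<in> G1 \<and> pt (moebius g z0) \<noteq> E_origin \<and> xf (moebius g z0) = f i \<and>
      F9 (xf (moebius g z0)) (yf (moebius g z0)) = 0" if i: "i < 9" for i
  proof -
    let ?y = "y_root (f i)"
    have E: "on_E (f i) ?y" by (rule on_E_y_root)
    have "F9 (f i) ?y = 0 \<or> F9 (f i) (- 1 - ?y) = 0" using F9_norm_eq[OF E] R[OF i] by simp
    then obtain y where y: "on_E (f i) y" "F9 (f i) y = 0" using E on_E_neg[OF E] by blast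
    obtain z where z: "z \<in> H" "pt z = E_affine (f i) y" using pt_surj[of "E_affine (f i) y"] y(1) on_E_E_curve by blast
    have "tt z = P1_fin 1" using tt_formula[OF z F4_F9_no_common_zero[OF y]] y(2) by simp
    hence "tt z0 = tt z" using tt_at_origin[OF z0] by simp
    then obtain g where g: "g \<in> G1" "z = moebius g z0" using tt_eq_iff[OF z0(1) z(1)] by blast
    have "pt z \<noteq> E_origin \<and> xf z = f i \<and> F9 (xf z) (yf z) = 0" using z(2) y(2) by (simp add: xf_def yf_def)
    thus ?thesis using g(1) unfolding g(2) by (intro exI[of _ g]) (rule conjI)
  qed
  then obtain gs where gs: "\<And>i. i < 9 \<Longrightarrow> gs i \<in> G1 \<and> pt (moebius (gs i) z0) \<noteq> E_origin \<and>
      xf (moebius (gs i) z0) = f i \<and> F9 (xf (moebius (gs i) z0)) (yf (moebius (gs i) z0)) = 0" by metis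
  have "inj_on (\<lambda>i. pt (moebius (gs i) z0)) {..<9}"
  proof (rule inj_onI)
    fix i j assume ij: "i \<in> {..<9}" "j \<in> {..<9}" "pt (moebius (gs i) z0) = pt (moebius (gs j) z0)"
    have "f i = f j" using gs[of i] gs[of j] ij by (simp add: xf_def)
    thus "i = j" using inj ij(1,2) by (simp add: inj_on_def)
  qed
  thus ?thesis using gs by blast
qed

text \<open>At a zero of \<open>F9\<close> the function \<open>t - 1\<close> is a unit times a cube, while at the origin it vanishes
  to the order of the stabilizer; both points lie over the same point of the base.\<close>

lemma three_dvd_stabilizer_order:
  assumes z0: "z0 \<in> H" "pt z0 = E_origin" and g: "g \<in> G1" "pt (moebius g z0) \<noteq> E_origin"
    "F9 (xf (moebius g z0)) (yf (moebius g z0)) = 0"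
  shows "stabilizer_order G0 z0 > 0" "3 dvd stabilizer_order G0 z0"
proof -
  let ?b = "moebius g"
  have gp: "mdet g > 0" by (rule G1.det_pos[OF g(1)])
  have z1: "?b z0 \<in> H" by (rule moebius_in_H[OF gp z0(1)])
  obtain r1 where r1: "r1 > 0" "ball (?b z0) r1 \<subseteq> UNIV \<inter> H" "\<And>z. z \<in> ball (?b z0) r1 \<Longrightarrow> pt z \<noteq> E_origin"
    "xf holomorphic_on ball (?b z0) r1" "yf holomorphic_on ball (?b z0) r1"
    by (rule good_ball[OF z1 g(2) open_UNIV UNIV_I]) (rule that)
  define S where "S = H \<inter> ?b -` ball (?b z0) r1"
  have S: "open S" "z0 \<in> S" "S \<subseteq> H" "?b ` S \<subseteq> ball (?b z0) r1"
  proof -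
    have "continuous_on H ?b" by (rule holomorphic_on_imp_continuous_on[OF moebius_holomorphic[OF gp]])
    thus "open S" unfolding S_def by (rule continuous_open_preimage) simp_all
  qed (use z0(1) r1(1) in \<open>auto simp: S_def\<close>)
  have bh: "?b holomorphic_on S" by (rule holomorphic_on_subset[OF moebius_holomorphic[OF gp] S(3)])
  have xh: "(\<lambda>w. xf (?b w)) holomorphic_on S" and yh: "(\<lambda>w. yf (?b w)) holomorphic_on S"
    using holomorphic_on_compose_gen[OF bh r1(4) S(4)] holomorphic_on_compose_gen[OF bh r1(5) S(4)]
    by (simp_all add: o_def)
  define u where "u = (\<lambda>w. F9 (xf (?b w)) (yf (?b w)))"
  define v where "v = (\<lambda>w. F4 (xf (?b w)) (yf (?b w)))"
  have uh: "u holomorphic_on S" unfolding u_def F9_def by (intro holomorphic_intros xh yh)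
  have vh: "v holomorphic_on S" unfolding v_def F4_def by (intro holomorphic_intros xh yh)
  have E1: "on_E (xf (?b z0)) (yf (?b z0))" by (rule pt_affine(2)[OF z1 g(2)])
  have v0: "v z0 \<noteq> 0" unfolding v_def by (rule F4_F9_no_common_zero[OF E1 g(3)])
  have "open (S \<inter> v -` (- {0}))"
    by (rule continuous_open_preimage[OF holomorphic_on_imp_continuous_on[OF vh] S(1)]) (rule open_Compl, rule closed_singleton)
  then obtain r where r: "r > 0" "ball z0 r \<subseteq> S \<inter> v -` (- {0})" using S(2) v0 by (auto elim!: openE)
  have rS: "ball z0 r \<subseteq> S" and rv: "\<And>w. w \<in> ball z0 r \<Longrightarrow> v w \<noteq> 0" using r(2) by auto
  have wH: "w \<in> H" if "w \<in> ball z0 r" for w using that rS S(3) by blast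
  \<comment> \<open>By invariance of t the local expression at the translated point is read off
    around z0 itself, where the zero orders are compared.\<close>
  have val: "tt w = P1_fin (1 - 343 * u w ^ 3 / (64 * v w ^ 7))" if w: "w \<in> ball z0 r" for w
  proof -
    have wS: "w \<in> S" using w rS by blast
    have b: "?b w \<in> H" by (rule moebius_in_H[OF gp wH[OF w]])
    have "pt (?b w) \<noteq> E_origin" using r1(3) S(4) wS by blast
    from tt_formula[OF b pt_affine(1)[OF b this]] rv[OF w]
    show ?thesis using tt_invariant[OF g(1) wH[OF w]] by (simp add: u_def v_def)
  qed
  have zb: "z0 \<in> ball z0 r" using r(1) by simp
  have "\<exists>w\<in>ball z0 r. u w \<noteq> 0"
  proof (rule ccontr)
    assume "\<not> ?thesis"
    hence "\<forall>w\<in>ball z0 r. tt w = P1_fin 1" using val by simp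
    moreover have "ball z0 r \<subseteq> H" using wH by blast
    ultimately show False using not_locally_one_point(2)[OF open_ball zb, of "P1_fin 1"] by blast
  qed
  from zorder_exist_zero[OF holomorphic_on_subset[OF uh rS] open_ball connected_ball zb this]
  obtain n :: int and k r' where k: "n > 0" "r' > 0" "cball z0 r' \<subseteq> ball z0 r" "k holomorphic_on cball z0 r'"
    "\<And>w. w \<in> cball z0 r' \<Longrightarrow> u w = k w * (w - z0) ^ nat n \<and> k w \<noteq> 0"
    using g(3) unfolding u_def[symmetric] by (auto simp: u_def)
  have r': "ball z0 r' \<subseteq> cball z0 r'" "ball z0 r' \<subseteq> ball z0 r" using k(3) by auto
  have zb': "z0 \<in> ball z0 r'" using k(2) by simp
  have ord: "zorder (\<lambda>w. tf w - 1) z0 = 3 * n"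
  proof (rule zorder_eqI[OF open_ball zb'])
    have "k holomorphic_on ball z0 r'" "v holomorphic_on ball z0 r'"
      using holomorphic_on_subset[OF k(4) r'(1)] holomorphic_on_subset[OF vh] rS r'(2) by auto
    thus "(\<lambda>w. - (343 * k w ^ 3 / (64 * v w ^ 7))) holomorphic_on ball z0 r'"
      using rv r'(2) by (intro holomorphic_intros) auto
    show "- (343 * k z0 ^ 3 / (64 * v z0 ^ 7)) \<noteq> 0" using k(5)[of z0] k(2) v0 by simp
    fix w assume w: "w \<in> ball z0 r'" "w \<noteq> z0"
    have "tf w - 1 = - (343 * u w ^ 3 / (64 * v w ^ 7))" using val[of w] w r'(2) by (auto simp: tf_def)
    also have "u w ^ 3 = k w ^ 3 * (w - z0) powi (3 * n)"
    proof -
      have "nat (3 * n) = nat n * 3" "0 \<le> 3 * n" using k(1) by arith+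
      hence "(w - z0) powi (3 * n) = (w - z0) ^ (nat n * 3)" by (simp only: power_int_def if_True)
      thus ?thesis using k(5)[of w] w r'(1) by (simp add: power_mult_distrib power_mult subset_iff)
    qed
    finally show "tf w - 1 = - (343 * k w ^ 3 / (64 * v w ^ 7)) * (w - z0) powi (3 * n)" by simp
  qed
  hence "3 * n = int (stabilizer_order G0 z0)" using origin_iff[OF z0(1)] z0(2) by simp
  thus "stabilizer_order G0 z0 > 0" "3 dvd stabilizer_order G0 z0" using k(1) by presburger+
qed

end

section \<open>The CM point\<close>

lemma sqrt_m11_sq: "sqrt_m11 ^ 2 = - 11"
  by (simp add: sqrt_m11_def power_mult_distrib flip: of_real_power)

lemma K7_sqrt_m11_closed:
  "k \<in> K7 \<Longrightarrow> of_real k \<in> K7_sqrt_m11" "sqrt_m11 \<in> K7_sqrt_m11"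
  "u \<in> K7_sqrt_m11 \<Longrightarrow> v \<in> K7_sqrt_m11 \<Longrightarrow> u + v \<in> K7_sqrt_m11"
  "u \<in> K7_sqrt_m11 \<Longrightarrow> v \<in> K7_sqrt_m11 \<Longrightarrow> u * v \<in> K7_sqrt_m11"
  unfolding K7_sqrt_m11_def
  using generate_field.incl[of _ "of_real ` K7 \<union> {sqrt_m11}" complex_ring]
    generate_field.eng_add[of u complex_ring _ v] generate_field.eng_mult[of u complex_ring _ v]
  by auto

abbreviation cm_unit :: complex where "cm_unit \<equiv> (1 + sqrt_m11) / 2"

lemma cm_unit_sq: "cm_unit * cm_unit = cm_unit - 3"
  using sqrt_m11_sq by (simp add: field_simps power2_eq_square)

lemma cm_unit_linear_unique:
  assumes "of_real c + of_real d * cm_unit = of_real x + of_real y * cm_unit"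
  shows "c = x" "d = y"
proof -
  have s: "Re sqrt_m11 = 0" "Im sqrt_m11 = sqrt 11" by (simp_all add: sqrt_m11_def)
  have "d * (sqrt 11 / 2) = y * (sqrt 11 / 2)" using arg_cong[OF assms, of Im] by (simp add: s)
  thus dy: "d = y" by simp
  thus "c = x" using assms by simp
qed

lemma OK7_m11_form: "u \<in> OK7_m11 \<Longrightarrow> \<exists>x\<in>OK7. \<exists>y\<in>OK7. u = of_real x + of_real y * cm_unit"
  unfolding OK7_m11_def
proof (induction rule: generate_ring.induct)
  case one
  show ?case by (intro bexI[of _ 1] bexI[of _ 0]) (simp_all add: OK7_closed)
next
  case (incl h)
  show ?case
  proof (cases "h = cm_unit")
    case True
    thus ?thesis by (intro bexI[of _ 0] bexI[of _ 1]) (simp_all add: OK7_closed)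
  next
    case False
    hence "h \<in> of_real ` OK7" using incl by simp
    then obtain k where "h = of_real k" "k \<in> OK7" by (rule imageE)
    thus ?thesis by (intro bexI[of _ k] bexI[of _ 0]) (simp_all add: OK7_closed)
  qed
next
  case (a_inv h)
  then obtain x y where *: "x \<in> OK7" "y \<in> OK7" "h = of_real x + of_real y * cm_unit" by blast
  have "a_inv complex_ring h = of_real (- x) + of_real (- y) * cm_unit"
    unfolding *(3) a_inv_ring_of_type_algebra of_real_minus by (simp only: minus_add_distrib minus_mult_left)
  thus ?case using *(1,2) OK7_uminus by (intro bexI[of _ "- x"] bexI[of _ "- y"]) simp_all
next
  case (eng_add u v)
  then obtain x y x' y' where *: "x \<in> OK7" "y \<in> OK7" "u = of_real x + of_real y * cm_unit"
    "x' \<in> OK7" "y' \<in> OK7" "v = of_real x' + of_real y' * cm_unit" by blast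
  have "u + v = of_real (x + x') + of_real (y + y') * cm_unit"
    unfolding *(3,6) of_real_add by (simp only: distrib_right add.assoc add.left_commute)
  thus ?case using * OK7_add by (intro bexI[of _ "x + x'"] bexI[of _ "y + y'"]) simp_all
next
  case (eng_mult u v)
  then obtain x y x' y' where *: "x \<in> OK7" "y \<in> OK7" "u = of_real x + of_real y * cm_unit"
    "x' \<in> OK7" "y' \<in> OK7" "v = of_real x' + of_real y' * cm_unit" by blast
  define w where "w = cm_unit"
  have "w * w = w - 3" using cm_unit_sq unfolding w_def .
  hence "(of_real x + of_real y * w) * (of_real x' + of_real y' * w) =
     of_real (x * x' - 3 * (y * y')) + of_real (x * y' + y * x' + y * y') * w"
    unfolding of_real_add of_real_mult of_real_diff of_real_numeral by Groebner_Basis.algebra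
  hence "u * v = of_real (x * x' - 3 * (y * y')) + of_real (x * y' + y * x' + y * y') * cm_unit"
    unfolding *(3,6) w_def .
  thus ?case using * by (intro bexI[of _ "x * x' - 3 * (y * y')"] bexI[of _ "x * y' + y * x' + y * y'"])
      (simp_all add: OK7_closed)
qed

text \<open>The form c^2 + c d + 3 d^2 is positive definite, so at each real embedding 11 d^2 <= 4.
  All conjugates of the integer d are then less than 1 in absolute value, which forces d =
  0.\<close>

lemma cm_norm_equation:
  assumes "c \<in> OK7" "d \<in> OK7" "c * c + c * d + 3 * (d * d) = 1"
  shows "d = 0" "c = 1 \<or> c = - 1"
proof -
  have bound: "11 * v^2 \<le> 4" if "u * u + u * v + 3 * (v * v) = 1" for u v :: real
  proof -
    have "(2 * u + v)^2 + 11 * v^2 = 4 * (u * u + u * v + 3 * (v * v))"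
      by (simp add: algebra_simps power2_eq_square)
    hence "11 * v^2 = 4 - (2 * u + v)^2" unfolding that by simp
    also have "\<dots> \<le> 4" by simp
    finally show ?thesis .
  qed
  have K: "c \<in> K7" "d \<in> K7" using assms OK7_subset_K7 by auto
  have conj: "conj7 e c * conj7 e c + conj7 e c * conj7 e d + 3 * (conj7 e d * conj7 e d) = 1" if "is_root7 e" for e
  proof -
    have "conj7 e (c * c + c * d + 3 * (d * d)) = 1" unfolding assms(3) by (rule conj7_Rats) simp
    thus ?thesis using K that by (simp add: conj7_add conj7_mult conj7_Rats K7_closed)
  qed
  show d: "d = 0"
    using OK7_conj_bound_imp_0[OF assms(2) bound[OF assms(3)]] bound[OF conj] is_root7_eta23 by blast
  have "c^2 = 1" using assms(3) unfolding d by (simp add: power2_eq_square)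
  thus "c = 1 \<or> c = - 1" by (simp add: power2_eq_1_iff)
qed

lemma fixed_point_form:
  assumes "mdet (p, q, r, s) > 0" "z \<in> upper_half_plane" "moebius (p, q, r, s) z = z"
  shows "q = - r * (cmod z)^2" "s = p - 2 * r * Re z"
proof -
  have "of_real r * z + of_real s \<noteq> 0" using mdenom_nonzero[OF assms(1,2)] by (simp add: mdenom_def)
  hence "of_real p * z + of_real q = z * (of_real r * z + of_real s)"
    using assms(3) by (simp add: moebius_def nonzero_divide_eq_eq)
  hence *: "p * Re z + q = r * (Re z * Re z - Im z * Im z) + s * Re z"
    "p * Im z = r * (2 * (Re z * Im z)) + s * Im z"
    by (simp_all add: complex_eq_iff algebra_simps)
  have "Im z * (s - (p - 2 * r * Re z)) = 0" using *(2) by (simp add: algebra_simps)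
  thus s: "s = p - 2 * r * Re z" using assms(2) by (simp add: upper_half_plane_def)
  show "q = - r * (cmod z)^2" using *(1) unfolding s cmod_power2 by (simp add: algebra_simps power2_eq_square)
qed

text \<open>Matrices fixing z are real combinations of the identity and one further matrix.\<close>

lemma common_fixed_point_commute:
  assumes m: "mdet m > 0" "moebius m z = z" and n: "mdet n > 0" "moebius n z = z" and z: "z \<in> upper_half_plane"
  shows "mmul m n = mmul n m"
proof -
  obtain p q r s where md: "m = (p, q, r, s)" by (cases m) auto
  obtain p' q' r' s' where nd: "n = (p', q', r', s')" by (cases n) auto
  note fm = fixed_point_form[OF m(1)[unfolded md] z m(2)[unfolded md]]
  note fn = fixed_point_form[OF n(1)[unfolded nd] z n(2)[unfolded nd]]
  show ?thesis unfolding md nd fm fn by (simp add: mmul_def algebra_simps)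
qed

section \<open>The element of norm 3 attached to the CM embedding\<close>

context quat_order
begin

lemma rho_moebius_pos: "x \<in> K7_quats \<Longrightarrow> nrd x = 1 \<or> nrd x = 3 \<Longrightarrow> mdet (\<rho> x) > 0"
  by (auto simp: mdet_rho)

text \<open>\<alpha> is the image of (1 + sqrt(-11))/2, which has trace 1 and norm 3. An element of
  \<open>\<Gamma>\<close> fixing z commutes with \<alpha>, so it lies in the image of the CM field;
  since the embedding is optimal, it comes from the CM order, where the only elements of norm 1 are
  1 and -1.\<close>

lemma cm_multiplier:
  assumes emb: "CM_embedding_m11 a b \<O> q" and z: "z \<in> upper_half_plane"
    and fixes_z: "\<And>u. u \<in> K7_sqrt_m11 - {0} \<Longrightarrow> moebius (\<rho> (q u)) z = z"
  shows "\<exists>al\<in>\<O>. nrd al = 3 \<and> fst al = 1 / 2 \<and> moebius (\<rho> al) z = z \<and>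
    (\<forall>g\<in>\<Gamma>. moebius (\<rho> g) z = z \<longrightarrow> g = (1, 0, 0, 0) \<or> g = - (1, 0, 0, 0))"
proof -
  have hom: "q \<in> Ring.ring_hom (complex_ring\<lparr>carrier := K7_sqrt_m11\<rparr>) (quat_alg_K7 a b)"
    and sc: "\<And>k. k \<in> K7 \<Longrightarrow> q (of_real k) = (k, 0, 0, 0)"
    and opt: "{u \<in> K7_sqrt_m11. q u \<in> \<O>} = OK7_m11"
    using emb by (auto simp: CM_embedding_m11_def quat_scalar_def)
  have qK: "q u \<in> K7_quats" if "u \<in> K7_sqrt_m11" for u
    using Ring.ring_hom_closed[OF hom, of u] that by (simp add: quat_algebra_K7_simps)
  have qadd: "q (u + v) = q u + q v" if "u \<in> K7_sqrt_m11" "v \<in> K7_sqrt_m11" for u v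
    using Ring.ring_hom_add[OF hom, of u v] that by (simp add: quat_algebra_K7_simps)
  have qmult: "q (u * v) = q u \<star> q v" if "u \<in> K7_sqrt_m11" "v \<in> K7_sqrt_m11" for u v
    using Ring.ring_hom_mult[OF hom, of u v] that
    by (simp add: quat_algebra_K7_mult[OF ab(1,3)] qK)
  have wO: "cm_unit \<in> OK7_m11"
    unfolding OK7_m11_def by (rule generate_ring.incl) simp
  have wK: "cm_unit \<in> K7_sqrt_m11" using wO opt by blast
  define al where "al = q cm_unit"
  have alO: "al \<in> \<O>" using wO opt unfolding al_def by blast
  have alK: "al \<in> K7_quats" by (rule O_K7[OF alO])
  have m3: "q (- 3) = (- 3, 0, 0, 0)" "- 3 \<in> K7_sqrt_m11"
    using sc[of "- 3"] K7_sqrt_m11_closed(1)[of "- 3"] by (simp_all add: K7_closed)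
  have sq: "al \<star> al = al + (- 3, 0, 0, 0)"
  proof -
    have "q (cm_unit * cm_unit) = q (cm_unit + - 3)" unfolding cm_unit_sq diff_conv_add_uminus ..
    thus ?thesis unfolding al_def qmult[OF wK wK] qadd[OF wK m3(2)] m3(1) .
  qed
  obtain x0 x1 x2 x3 where al: "al = (x0, x1, x2, x3)" by (cases al) auto
  have eqs: "x0 * x0 + a * (x1 * x1) + b * (x2 * x2) - a * b * (x3 * x3) = x0 - 3"
    "2 * x0 * x1 = x1" "2 * x0 * x2 = x2" "2 * x0 * x3 = x3"
    using sq by (simp_all add: al qmul_def algebra_simps)
  \<comment> \<open>X^2 - X + 3 has no real root, so \<alpha> is not a scalar; its scalar part must
    then be 1/2.\<close>
  have "\<not> (x1 = 0 \<and> x2 = 0 \<and> x3 = 0)"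
  proof
    assume "x1 = 0 \<and> x2 = 0 \<and> x3 = 0"
    hence "x0 * x0 = x0 - 3" using eqs(1) by simp
    moreover have "(2 * x0 - 1)^2 = 4 * (x0 * x0) - 4 * x0 + 1" by (simp add: algebra_simps power2_eq_square)
    ultimately have "(2 * x0 - 1)^2 = - 11" by simp
    thus False using zero_le_power2[of "2 * x0 - 1"] by linarith
  qed
  hence nz: "x1 \<noteq> 0 \<or> x2 \<noteq> 0 \<or> x3 \<noteq> 0" by blast
  hence x0: "x0 = 1 / 2" using eqs(2-4) by auto
  have nrd: "nrd al = 3" using eqs(1) by (simp add: al reduced_norm_def x0 power2_eq_square)
  have w0: "cm_unit \<noteq> 0"
  proof
    assume "cm_unit = 0"
    hence "0 * 0 = (0 :: complex) - 3" using cm_unit_sq by (simp only:)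
    thus False by simp
  qed
  have fix_al: "moebius (\<rho> al) z = z" unfolding al_def by (rule fixes_z) (use wK w0 in blast)
  have "g = (1, 0, 0, 0) \<or> g = - (1, 0, 0, 0)" if g: "g \<in> \<Gamma>" "moebius (\<rho> g) z = z" for g
  proof -
    have gO: "g \<in> \<O>" and gK: "g \<in> K7_quats" and gn: "nrd g = 1"
      by (rule Gamma_O[OF g(1)], rule O_K7[OF Gamma_O[OF g(1)]], use g(1) in \<open>simp add: Gamma1_def\<close>)
    have "mmul (\<rho> g) (\<rho> al) = mmul (\<rho> al) (\<rho> g)"
      by (rule common_fixed_point_commute[OF _ g(2) _ fix_al z]) (simp_all add: rho_moebius_pos gK gn alK nrd)
    hence "\<rho> (g \<star> al) = \<rho> (al \<star> g)" by (simp add: rho_mult gK alK)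
    hence comm: "g \<star> al = al \<star> g" by (rule rho_inj[rotated 2]) (simp_all add: qmul_K7 ab gK alK)
    obtain g0 g1 g2 g3 where gd: "g = (g0, g1, g2, g3)" by (cases g) auto
    \<comment> \<open>Commuting means that the pure parts are proportional, which puts g into the
      span of 1 and \<alpha> over the cubic field.\<close>
    have "2 * b * (g3 * x2 - g2 * x3) = 0" "2 * a * (g1 * x3 - g3 * x1) = 0" "2 * (g1 * x2 - g2 * x1) = 0"
      using comm by (simp_all add: gd al qmul_def algebra_simps)
    hence par: "g3 * x2 = g2 * x3" "g1 * x3 = g3 * x1" "g1 * x2 = g2 * x1" using ab by auto
    have mem: "g0 \<in> K7" "g1 \<in> K7" "g2 \<in> K7" "g3 \<in> K7" "x1 \<in> K7" "x2 \<in> K7" "x3 \<in> K7"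
      using gK alK by (simp_all add: gd al K7_quats_def)
    have "\<exists>d\<in>K7. g1 = d * x1 \<and> g2 = d * x2 \<and> g3 = d * x3"
      using nz
    proof (elim disjE)
      assume "x1 \<noteq> 0"
      thus ?thesis using par mem by (intro bexI[of _ "g1 / x1"]) (auto simp: K7_closed field_simps)
    next
      assume "x2 \<noteq> 0"
      thus ?thesis using par mem by (intro bexI[of _ "g2 / x2"]) (auto simp: K7_closed field_simps)
    next
      assume "x3 \<noteq> 0"
      thus ?thesis using par mem by (intro bexI[of _ "g3 / x3"]) (auto simp: K7_closed field_simps)
    qed
    then obtain d where d: "d \<in> K7" "g1 = d * x1" "g2 = d * x2" "g3 = d * x3" by blast
    \<comment> \<open>In g = c + d \<alpha> the scalar part is c + d/2.\<close>
    define c where "c = g0 - d / 2"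
    have c: "c \<in> K7" using mem(1) d(1) by (simp add: c_def K7_closed)
    define u where "u = of_real c + of_real d * cm_unit"
    have "q u = (c, 0, 0, 0) + (d, 0, 0, 0) \<star> al"
      unfolding u_def al_def using c d(1) wK
      by (simp only: qadd qmult sc K7_sqrt_m11_closed)
    also have "\<dots> = g" by (simp add: qmul_scalar al gd d x0 c_def)
    finally have qu: "q u = g" .
    have "u \<in> K7_sqrt_m11" unfolding u_def using c d(1) wK by (intro K7_sqrt_m11_closed)
    hence "u \<in> OK7_m11" using qu gO opt by blast
    then obtain x y where xy: "x \<in> OK7" "y \<in> OK7" "u = of_real x + of_real y * cm_unit" using OK7_m11_form by blast
    have "c = x" "d = y" using cm_unit_linear_unique[of c d x y] xy(3) unfolding u_def by auto
    hence cd: "c \<in> OK7" "d \<in> OK7" using xy by auto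
    have e1: "a * (x1 * x1) + b * (x2 * x2) - a * b * (x3 * x3) = - 11 / 4" using eqs(1) by (simp add: x0)
    have e2: "nrd g = g0 * g0 - d * d * (a * (x1 * x1) + b * (x2 * x2) - a * b * (x3 * x3))"
      by (simp add: gd d reduced_norm_def algebra_simps power2_eq_square)
    have e3: "1 = g0 * g0 - d * d * (- 11 / 4)" using e2 unfolding e1 gn .
    have "c * c + c * d + 3 * (d * d) = g0 * g0 - d * d * (- 11 / 4)" by (simp add: c_def field_simps)
    hence "c * c + c * d + 3 * (d * d) = 1" unfolding e3[symmetric] .
    note * = cm_norm_equation[OF cd this]
    have "g = (c, 0, 0, 0)" using *(1) by (simp add: gd d c_def)
    thus ?thesis using *(2) by auto
  qed
  hence stab: "\<forall>g\<in>\<Gamma>. moebius (\<rho> g) z = z \<longrightarrow> g = (1, 0, 0, 0) \<or> g = - (1, 0, 0, 0)" by blast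
  have f: "fst al = 1 / 2" by (simp add: al x0)
  show ?thesis by (intro bexI[OF _ alO] conjI nrd f fix_al stab)
qed

lemma matrix_group_rho:
  assumes "S \<subseteq> \<Gamma>" "(1, 0, 0, 0) \<in> S" "\<And>g h. g \<in> S \<Longrightarrow> h \<in> S \<Longrightarrow> g \<star> h \<in> S" "\<And>g. g \<in> S \<Longrightarrow> qconj g \<in> S"
  shows "matrix_group (\<rho> ` S)"
  unfolding matrix_group_def
proof (intro conjI ballI)
  have K: "g \<in> K7_quats" "nrd g = 1" if "g \<in> S" for g
  proof -
    have g: "g \<in> \<Gamma>" using that assms(1) by blast
    show "g \<in> K7_quats" by (rule O_K7[OF Gamma_O[OF g]])
    show "nrd g = 1" using g by (simp add: Gamma1_def)
  qed
  have "\<rho> (1, 0, 0, 0) = (1, 0, 0, 1)" using rho_scalar[OF K7_1] by simp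
  thus "(1, 0, 0, 1) \<in> \<rho> ` S" using assms(2) by (metis imageI)
  show "countable (\<rho> ` S)"
  proof -
    have "countable K7_quats" unfolding K7_quats_def by (intro countable_SIGMA countable_K7)
    hence "countable S" by (rule countable_subset[rotated]) (use K(1) in blast)
    thus ?thesis by (rule countable_image)
  qed
  fix m assume "m \<in> \<rho> ` S"
  then obtain g where g: "g \<in> S" "m = \<rho> g" by blast
  show "mdet m = 1" using mdet_rho[OF K(1)[OF g(1)]] K(2)[OF g(1)] g(2) by simp
  obtain p q r s where r: "\<rho> g = (p, q, r, s)" by (cases "\<rho> g") auto
  have "madj m = \<rho> (qconj g)" unfolding g(2) rho_qconj[OF K(1)[OF g(1)] r] r madj_def by simp
  thus "madj m \<in> \<rho> ` S" using assms(4)[OF g(1)] by blast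
  fix n assume "n \<in> \<rho> ` S"
  then obtain h where h: "h \<in> S" "n = \<rho> h" by blast
  have "mmul m n = \<rho> (g \<star> h)" using rho_mult[OF K(1)[OF g(1)] K(1)[OF h(1)]] g(2) h(2) by simp
  thus "mmul m n \<in> \<rho> ` S" using assms(3)[OF g(1) h(1)] by blast
qed

end

text \<open>Twice the derivation \<open>x \<mapsto> Y\<close>, \<open>Y \<mapsto> d'/2\<close> applied to \<open>p(x) + q(x) Y\<close>.\<close>

definition pderivation :: "int list \<times> int list \<Rightarrow> int list \<times> int list" where
  "pderivation u = (ladd (lscale 2 (lmul (lderiv (snd u)) cubic)) (lmul (snd u) (lderiv cubic)), lscale 2 (lderiv (fst u)))"

lemma lev_has_field_derivative: "(lev p has_field_derivative lev (lderiv p) x) (at x)"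
proof -
  have "lev p = poly (Poly (map of_int p))" by (rule ext) (rule lev_eq_poly)
  thus ?thesis using poly_DERIV unfolding lev_lderiv by metis
qed

text \<open>k is the coefficient of the invariant differential dx/Y pulled back to the half-plane:
  x' = k Y and Y' = k times half the derivative of the cubic. Every function on the curve is
  differentiated by the same derivation, up to k.\<close>

lemma pev_has_field_derivative:
  assumes x: "(f has_field_derivative k * Y z) (at z)" and Y: "(Y has_field_derivative k * lev (lderiv cubic) (f z) / 2) (at z)"
    and E: "Y z ^ 2 = lev cubic (f z)"
  shows "((\<lambda>w. pev u (f w) (Y w)) has_field_derivative k / 2 * pev (pderivation u) (f z) (Y z)) (at z)"
proof -
  have l: "((\<lambda>w. lev p (f w)) has_field_derivative lev (lderiv p) (f z) * (k * Y z)) (at z)" for p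
    by (rule DERIV_chain2[OF lev_has_field_derivative x])
  have d1: "((\<lambda>w. lev (fst u) (f w) + lev (snd u) (f w) * Y w) has_field_derivative
      lev (lderiv (fst u)) (f z) * (k * Y z) + (lev (snd u) (f z) * (k * lev (lderiv cubic) (f z) / 2) +
      lev (lderiv (snd u)) (f z) * (k * Y z) * Y z)) (at z)"
    by (intro DERIV_add DERIV_mult' l Y)
  have d2: "lev (lderiv (fst u)) (f z) * (k * Y z) + (lev (snd u) (f z) * (k * lev (lderiv cubic) (f z) / 2) +
      lev (lderiv (snd u)) (f z) * (k * Y z) * Y z) = k / 2 * pev (pderivation u) (f z) (Y z)"
    by (simp add: pev_def pderivation_def lev_hom field_simps flip: E) (simp add: power2_eq_square)
  show ?thesis using d1 unfolding d2 unfolding pev_def[of u] .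
qed

text \<open>The derivative of F9^3 / F4^7 contains the factor 3 F9' F4 - 7 F9 F4', which must
  account for the double zeros of t and has pole order 14 at the origin. It is a constant multiple
  of \<open>G14\<close>.\<close>

lemma derivation_identity:
  "(let m = pmul cubic; z = padd (padd (pscale 3 (m (pderivation F9_pair) F4_pair)) (pscale (- 7) (m (pderivation F4_pair) F9_pair)))
      (pscale (- 8) G14_pair) in lzero (fst z) \<and> lzero (snd z))"
  by code_simp

lemma F4_F9_derivation:
  assumes "on_E x y"
  shows "3 * pev (pderivation F9_pair) x (2 * y + 1) * (2 * F4 x y) - 7 * pev (pderivation F4_pair) x (2 * y + 1) * (2 * F9 x y) = 8 * G14 x y"
proof -
  let ?Y = "2 * y + 1"
  let ?m = "pmul cubic"
  note hom = pev_pmul[OF assms[unfolded on_E_iff]] pev_padd pev_pscale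
  let ?z = "padd (padd (pscale 3 (?m (pderivation F9_pair) F4_pair)) (pscale (- 7) (?m (pderivation F4_pair) F9_pair)))
      (pscale (- 8) G14_pair)"
  have "lzero (fst ?z) \<and> lzero (snd ?z)" using derivation_identity unfolding Let_def .
  hence "pev ?z x ?Y = 0" by (simp only: pev_def lev_lzero mult_zero_left add_0)
  moreover have "pev ?z x ?Y = 3 * (pev (pderivation F9_pair) x ?Y * (2 * F4 x y)) - 7 * (pev (pderivation F4_pair) x ?Y * (2 * F9 x y)) - 8 * G14 x y"
    by (simp only: hom F4_pev F9_pev G14_def of_int_numeral of_int_minus) simp
  ultimately show ?thesis by (simp add: mult.assoc)
qed

lemma t_formula_derivative:
  assumes x: "(f has_field_derivative k * (2 * y z + 1)) (at z)"
    and y: "((\<lambda>w. 2 * y w + 1) has_field_derivative k * lev (lderiv cubic) (f z) / 2) (at z)"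
    and E: "on_E (f z) (y z)" and nz: "F4 (f z) (y z) \<noteq> 0"
  shows "((\<lambda>w. 1 - 343 * F9 (f w) (y w) ^ 3 / (64 * F4 (f w) (y w) ^ 7)) has_field_derivative
    - (343 / 64) * k * (F9 (f z) (y z) ^ 2 / F4 (f z) (y z) ^ 8 * G14 (f z) (y z))) (at z)"
proof -
  let ?Y = "\<lambda>w. 2 * y w + 1"
  define A B where "A = F4 (f z) (y z)" and "B = F9 (f z) (y z)"
  define A' B' where "A' = pev (pderivation F4_pair) (f z) (?Y z)" and "B' = pev (pderivation F9_pair) (f z) (?Y z)"
  have E': "?Y z ^ 2 = lev cubic (f z)" using E by (simp add: on_E_iff)
  have F4e: "F4 x y = pev F4_pair x (2 * y + 1) / 2" and F9e: "F9 x y = pev F9_pair x (2 * y + 1) / 2" for x y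
    using F4_pev[of x y] F9_pev[of x y] by (simp_all add: field_simps)
  have d4: "((\<lambda>w. F4 (f w) (y w)) has_field_derivative k / 4 * A') (at z)"
    using DERIV_cdivide[OF pev_has_field_derivative[where u = F4_pair, OF x y E'], of 2] unfolding F4e A'_def by simp
  have d9: "((\<lambda>w. F9 (f w) (y w)) has_field_derivative k / 4 * B') (at z)"
    using DERIV_cdivide[OF pev_has_field_derivative[where u = F9_pair, OF x y E'], of 2] unfolding F9e B'_def by simp
  have A0: "A \<noteq> 0" using nz by (simp add: A_def)
  have "((\<lambda>w. 1 - 343 * F9 (f w) (y w) ^ 3 / (64 * F4 (f w) (y w) ^ 7)) has_field_derivative
     0 - (343 * (3 * B ^ 2 * (k / 4 * B')) * (64 * A ^ 7) - 343 * B ^ 3 * (64 * (7 * A ^ 6 * (k / 4 * A')))) /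
       ((64 * A ^ 7) * (64 * A ^ 7))) (at z)"
    using A0 unfolding A_def B_def
    by (intro DERIV_diff DERIV_const DERIV_divide DERIV_cmult)
       (auto intro!: derivative_eq_intros d4 d9)
  moreover have "343 * (3 * B ^ 2 * (k / 4 * B')) * (64 * A ^ 7) - 343 * B ^ 3 * (64 * (7 * A ^ 6 * (k / 4 * A'))) =
     343 * 64 * k * A ^ 6 * B ^ 2 * G14 (f z) (y z)"
  proof -
    have "3 * B' * (2 * A) - 7 * A' * (2 * B) = 8 * G14 (f z) (y z)"
      using F4_F9_derivation[OF E] by (simp add: A_def B_def A'_def B'_def)
    hence "2 * (3 * B' * A - 7 * A' * B) = 2 * (4 * G14 (f z) (y z))" by (simp add: algebra_simps)
    hence g: "3 * B' * A - 7 * A' * B = 4 * G14 (f z) (y z)" by (simp only: mult_cancel_left) simp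
    have "343 * (3 * B ^ 2 * (k / 4 * B')) * (64 * A ^ 7) - 343 * B ^ 3 * (64 * (7 * A ^ 6 * (k / 4 * A'))) =
      343 * 64 * (k / 4) * A ^ 6 * B ^ 2 * (3 * B' * A - 7 * A' * B)"
      by (simp add: algebra_simps eval_nat_numeral)
    also have "\<dots> = 343 * 64 * (k / 4) * A ^ 6 * B ^ 2 * (4 * G14 (f z) (y z))" unfolding g ..
    finally show ?thesis by simp
  qed
  moreover have "0 - 343 * 64 * k * A ^ 6 * B ^ 2 * G14 (f z) (y z) / ((64 * A ^ 7) * (64 * A ^ 7)) =
     - (343 / 64) * k * (B ^ 2 / A ^ 8 * G14 (f z) (y z))"
  proof -
    have "A ^ 7 * A ^ 7 = A ^ 6 * A ^ 8" by (simp flip: power_add)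
    hence "(64 * A ^ 7) * (64 * A ^ 7) = 4096 * (A ^ 6 * A ^ 8)" by simp
    moreover have "0 - 343 * 64 * k * p * B ^ 2 * G14 (f z) (y z) / (4096 * (p * q)) =
        - (343 / 64) * k * (B ^ 2 / q * G14 (f z) (y z))" if "p \<noteq> 0" "q \<noteq> 0" for p q :: complex
      using that by (simp add: field_simps)
    ultimately show ?thesis using A0 by (simp only: power_eq_0_iff simp_thms)
  qed
  ultimately show ?thesis by (simp only: A_def B_def)
qed

text \<open>Differentiating Y^2 = cubic gives one relation. Since Y and the derivative of the cubic
  never vanish together, k can be obtained from x' or from Y'.\<close>

lemma tangent_direction:
  assumes x: "(f has_field_derivative f') (at z)" and Y: "(Y has_field_derivative Y') (at z)"
    and E: "eventually (\<lambda>w. Y w ^ 2 = lev cubic (f w)) (nhds z)"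
  obtains k where "f' = k * Y z" "Y' = k * lev (lderiv cubic) (f z) / 2"
proof -
  let ?c = "lev (lderiv cubic) (f z)"
  have "((\<lambda>w. lev cubic (f w)) has_field_derivative ?c * f') (at z)"
    by (rule DERIV_chain2[OF lev_has_field_derivative x])
  moreover have "((\<lambda>w. Y w ^ 2) has_field_derivative 2 * Y z * Y') (at z)"
    using DERIV_power[OF Y, of 2] by (simp add: ac_simps)
  hence "((\<lambda>w. lev cubic (f w)) has_field_derivative 2 * Y z * Y') (at z)"
    using DERIV_cong_ev[OF refl E refl] by blast
  ultimately have eq: "?c * f' = 2 * Y z * Y'" by (rule DERIV_unique)
  show ?thesis
  proof (cases "Y z = 0")
    case True
    have "lev cubic (f z) = 0" using eventually_nhds_x_imp_x[OF E] True by simp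
    hence c: "?c \<noteq> 0" by (rule cubic_simple_roots)
    hence "f' = 0" using eq True by simp
    show ?thesis by (rule that[of "2 * Y' / ?c"]) (use c True \<open>f' = 0\<close> in simp_all)
  next
    case False
    show ?thesis by (rule that[of "f' / Y z"]) (use False eq in \<open>simp_all add: field_simps\<close>)
  qed
qed

text \<open>The two roots of l^2 - l + 3 have product 3, so r = 3/l^2 is the quotient of the other
  root by l, and r + 1/r = (1 - 6)/3 = -5/3.\<close>

lemma cm_multiplier_polynomial:
  fixes l :: complex
  assumes "l^2 - l + 3 = 0"
  shows "3 * (3 / l^2)^2 + 5 * (3 / l^2) + 3 = 0" "3 / l^2 \<noteq> 1"
proof -
  have l0: "l \<noteq> 0" using assms by auto
  have "27 + 15 * l^2 + 3 * l^4 = 0" using assms by Groebner_Basis.algebra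
  moreover have "l^4 * (3 * (3 / l^2)^2 + 5 * (3 / l^2) + 3) = 27 + 15 * l^2 + 3 * l^4"
    using l0 by (simp add: field_simps power2_eq_square eval_nat_numeral)
  ultimately show "3 * (3 / l^2)^2 + 5 * (3 / l^2) + 3 = 0" using l0 by simp
  show "3 / l^2 \<noteq> 1"
  proof
    assume "3 / l^2 = 1"
    hence l2: "l^2 = 3" using l0 by (simp add: field_simps)
    hence "l = 6" using assms by simp
    thus False using l2 by simp
  qed
qed

section \<open>The value of t at the CM point\<close>

context shimura
begin

lemma pt_eq_imp_tt_eq: "z \<in> H \<Longrightarrow> w \<in> H \<Longrightarrow> pt z = pt w \<Longrightarrow> tt z = tt w"
  using pt_eq_iff[of z w] tt_invariant[of _ z] sub by auto

text \<open>A point with t = 1 is equivalent to z0, so a conjugate of h fixes it. Trivial action of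
  that conjugate would make h scalar, which trace -1 and determinant 1 exclude.\<close>

lemma trivial_stabilizer_not_over_one:
  assumes z0: "z0 \<in> H" "pt z0 = E_origin" and h: "h \<in> G0" "moebius h z0 = z0" "mtrace h = - 1"
    and z: "z \<in> H" and triv: "\<And>g w. g \<in> G1 \<Longrightarrow> moebius g z = z \<Longrightarrow> w \<in> H \<Longrightarrow> moebius g w = w"
  shows "tt z \<noteq> P1_fin 1"
proof
  assume "tt z = P1_fin 1"
  hence "tt z0 = tt z" using tt_at_origin[OF z0] by simp
  then obtain k where k: "k \<in> G1" "z = moebius k z0" using tt_eq_iff[OF z0(1) z] by blast
  have h1: "h \<in> G1" using h(1) sub by blast
  have ka: "madj k \<in> G1" by (rule G1.adj_in[OF k(1)])
  note kp = G1.det_pos[OF k(1)] and hp = G1.det_pos[OF h1] and kap = G1.det_pos[OF ka]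
  define m where "m = mmul (mmul k h) (madj k)"
  have mG: "m \<in> G1" unfolding m_def by (intro G1.mul_in k(1) h1 ka)
  have mk: "moebius m (moebius k w) = moebius k (moebius h w)" if "w \<in> H" for w
    using moebius_mmul[OF kap moebius_in_H[OF kp that], of "mmul k h"] moebius_mmul[OF hp that, of k]
      moebius_madj(1)[OF kp that] by (simp add: m_def)
  have "moebius m z = z" using mk[OF z0(1)] k(2) h(2) by simp
  hence "moebius m (moebius k w) = moebius k w" if "w \<in> H" for w
    using triv[OF mG _ moebius_in_H[OF kp that]] by simp
  hence "moebius k (moebius h w) = moebius k w" if "w \<in> H" for w using mk[OF that] that by simp
  hence hw: "moebius h w = w" if "w \<in> H" for w
    using moebius_madj(1)[OF kp that] moebius_madj(1)[OF kp moebius_in_H[OF hp that]] that by metis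
  obtain p q r s where hd: "h = (p, q, r, s)" by (cases h) auto
  \<comment> \<open>A matrix with the two fixed points i and 2i in the half-plane is scalar.\<close>
  have iH: "\<i> \<in> H" "2 * \<i> \<in> H" by (simp_all add: upper_half_plane_def)
  have "mdet (p, q, r, s) > 0" using hp by (simp add: hd)
  note f = fixed_point_form[OF this iH(1) hw[OF iH(1), unfolded hd]]
    fixed_point_form[OF this iH(2) hw[OF iH(2), unfolded hd]]
  have "q = - r" "q = - r * 4" "s = p" using f by (simp_all add: norm_mult)
  hence "q = 0" "r = 0" "s = p" by simp_all
  moreover have "mdet h = 1" by (rule G1.det_1[OF h1])
  ultimately have "p * p = 1" "2 * p = - 1" using h(3) by (simp_all add: hd mdet_def mtrace_def)
  hence "p = - 1 / 2" by simp
  thus False using \<open>p * p = 1\<close> by simp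
qed

text \<open>The formula is available only where \<open>F4\<close> is nonzero. Such points are dense
  near z, so (1 - t) 64 F4^7 = 343 F9^3 extends to z by continuity; a zero of \<open>F4\<close> with
  t finite would be a common zero of \<open>F4\<close> and \<open>F9\<close>.\<close>

lemma F4_nonzero_of_finite:
  assumes z: "z \<in> H" "pt z \<noteq> E_origin" "tt z \<noteq> P1_inf"
  shows "F4 (xf z) (yf z) \<noteq> 0"
proof (rule notI)
  assume F0: "F4 (xf z) (yf z) = 0"
  obtain r where r: "r > 0" "ball z r \<subseteq> UNIV \<inter> H" "\<And>w. w \<in> ball z r \<Longrightarrow> pt w \<noteq> E_origin"
    "xf holomorphic_on ball z r" "yf holomorphic_on ball z r"
    by (rule good_ball[OF z(1,2) open_UNIV UNIV_I]) (rule that)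
  have zb: "z \<in> ball z r" using r(1) by simp
  have rH: "ball z r \<subseteq> H" using r(2) by blast
  let ?F4 = "\<lambda>w. F4 (xf w) (yf w)" and ?F9 = "\<lambda>w. F9 (xf w) (yf w)"
  have h4: "?F4 holomorphic_on ball z r" unfolding F4_def by (intro holomorphic_intros r)
  have h9: "?F9 holomorphic_on ball z r" unfolding F9_def by (intro holomorphic_intros r)
  have "\<exists>w\<in>ball z r. ?F4 w \<noteq> 0"
  proof (rule ccontr)
    assume *: "\<not> ?thesis"
    let ?R = "{x. lev F4_norm x = 0}"
    have "finite {x. poly (Poly (map of_int F4_norm) :: complex poly) x = 0}"
      by (rule poly_roots_finite) (simp add: F4_norm_def)
    hence fin: "finite ?R" by (simp add: lev_eq_poly)
    define A where "A = (\<Union>x\<in>?R. {Q \<in> E_curve. \<exists>y. Q = E_affine x y})"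
    have finA: "finite A" unfolding A_def using fin finite_same_x by blast
    have "pt w \<in> A" if w: "w \<in> ball z r" for w
    proof -
      have wH: "w \<in> H" using w rH by blast
      have "lev F4_norm (xf w) = 0" using F4_norm_eq[OF pt_affine(2)[OF wH r(3)[OF w]]] * w by simp
      thus ?thesis using pt_affine(1)[OF wH r(3)[OF w]] pt_E[OF wH] unfolding A_def by blast
    qed
    thus False using not_locally_finite_points[OF open_ball zb rH finA] by blast
  qed
  then obtain v where v: "v \<in> ball z r" "?F4 v \<noteq> 0" by blast
  have ev: "eventually (\<lambda>w. ?F4 w \<noteq> 0 \<and> w \<in> ball z r) (at z)"
    by (rule non_zero_neighbour_alt[OF h4 open_ball connected_ball zb v])
  have cont: "isCont ?F4 z" "isCont ?F9 z"
    using h4 h9 zb by (meson continuous_on_eq_continuous_at holomorphic_on_imp_continuous_on open_ball)+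
  have ct: "isCont tf z" by (rule analytic_at_imp_isCont[OF tf_analytic[OF z(1,3)]])
  have l1: "((\<lambda>w. (1 - tf w) * (64 * ?F4 w ^ 7)) \<longlongrightarrow> (1 - tf z) * (64 * ?F4 z ^ 7)) (at z)"
    using cont(1) ct unfolding isCont_def by (intro tendsto_intros)
  have l2: "((\<lambda>w. 343 * ?F9 w ^ 3) \<longlongrightarrow> 343 * ?F9 z ^ 3) (at z)"
    using cont(2) unfolding isCont_def by (intro tendsto_intros)
  from ev have "eventually (\<lambda>w. (1 - tf w) * (64 * ?F4 w ^ 7) = 343 * ?F9 w ^ 3) (at z)"
  proof eventually_elim
    case (elim w)
    have wH: "w \<in> H" using elim rH by blast
    have "pt w \<noteq> E_origin" using r(3) elim by blast
    from tt_formula[OF wH pt_affine(1)[OF wH this]] elim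
    show ?case by (simp add: tf_def)
  qed
  from Lim_transform_eventually[OF l1 this] have "(1 - tf z) * (64 * ?F4 z ^ 7) = 343 * ?F9 z ^ 3"
    using l2 tendsto_unique by (meson at_neq_bot)
  hence "?F9 z = 0" using F0 by simp
  thus False using F4_F9_no_common_zero[OF pt_affine(2)[OF z(1,2)]] F0 by blast
qed

text \<open>A and B are the matrices of \<alpha> and \<beta>, and Q = (x, y) is the point of the
  curve below g z. The equation for B g turns t composed with A into t composed with the
  automorphism, in a whole neighbourhood and not only at z.\<close>

lemma cm_value:
  assumes z: "z \<in> H" and A: "mdet A = 3" "mtrace A = 1" "moebius A z = z"
    and g: "g \<in> G1" and D: "D \<in> G1" and B: "mdet B = 3" "mmul B g = mmul D A"
    and eps: "\<epsilon>^2 = 1" and aut: "\<And>w. w \<in> H \<Longrightarrow> pt w \<noteq> E_origin \<Longrightarrow> pt (moebius B w) \<noteq> E_origin \<and>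
      xf (moebius B w) = xf w \<and> 2 * yf (moebius B w) + 1 = \<epsilon> * (2 * yf w + 1)"
    and triv: "\<And>g w. g \<in> G1 \<Longrightarrow> moebius g z = z \<Longrightarrow> w \<in> H \<Longrightarrow> moebius g w = w"
    and z0: "z0 \<in> H" "pt z0 = E_origin" and not1: "tt z \<noteq> P1_fin 1"
  shows "tt z = P1_fin ((7^3 * 43^2 * 127^2 * 139^2 * 307^2 * 659^2 * 11) / (3^3 * 13^7 * 83^7))"
proof -
  have Ap: "mdet A > 0" and Bp: "mdet B > 0" using A B by simp_all
  note gp = G1.det_pos[OF g] and Dp = G1.det_pos[OF D]
  define l where "l = mdenom A z"
  have l: "l^2 - l + 3 = 0"
    using mdenom_fixed_point[OF Ap z A(3)] A(1,2) by (simp add: l_def)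
  define rr where "rr = 3 / l^2"
  note rr = cm_multiplier_polynomial[OF l, folded rr_def]
  have dA: "(moebius A has_field_derivative rr) (at z)"
    using moebius_has_field_derivative[OF Ap z] by (simp add: A(1) rr_def l_def)
  have key: "tt (moebius A w) = tt (moebius B (moebius g w))" if "w \<in> H" for w
    using tt_invariant[OF D moebius_in_H[OF Ap that]] moebius_mmul[OF gp that, of B] moebius_mmul[OF Ap that, of D] B(2)
    by simp
  define z1 where "z1 = moebius g z"
  have z1: "z1 \<in> H" unfolding z1_def by (rule moebius_in_H[OF gp z])
  have tz1: "tt z1 = tt z" unfolding z1_def by (rule tt_invariant[OF g z])
  have pz1: "pt z1 \<noteq> E_origin"
    using tt_at_origin[OF z1] tz1 not1 by auto
  obtain r1 where r1: "r1 > 0" "ball z1 r1 \<subseteq> UNIV \<inter> H" "\<And>w. w \<in> ball z1 r1 \<Longrightarrow> pt w \<noteq> E_origin"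
    "xf holomorphic_on ball z1 r1" "yf holomorphic_on ball z1 r1"
    by (rule good_ball[OF z1 pz1 open_UNIV UNIV_I]) (rule that)
  have cg: "isCont (moebius g) z" by (rule moebius_isCont[OF gp z])
  have "open (H \<inter> moebius g -` ball z1 r1)"
    by (rule continuous_open_preimage[OF holomorphic_on_imp_continuous_on[OF moebius_holomorphic[OF gp]]]) simp_all
  moreover have "z \<in> H \<inter> moebius g -` ball z1 r1" using z r1(1) by (simp add: z1_def)
  ultimately obtain r where r: "r > 0" "ball z r \<subseteq> H \<inter> moebius g -` ball z1 r1" by (auto elim!: openE)
  have wH: "w \<in> H" and wg: "moebius g w \<in> ball z1 r1" if "w \<in> ball z r" for w using r(2) that by auto
  have gH: "moebius g w \<in> H" "pt (moebius g w) \<noteq> E_origin" if "w \<in> ball z r" for w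
    using wg[OF that] r1(2,3) by auto
  have rH: "ball z r \<subseteq> H" using wH by blast
  have zb: "z \<in> ball z r" using r(1) by simp
  have nb: "eventually (\<lambda>w. w \<in> ball z r) (nhds z)" by (rule eventually_nhds_in_open[OF open_ball zb])
  have "\<epsilon> \<noteq> 1"
  proof
    assume e1: "\<epsilon> = 1"
    have inv: "moebius A w \<in> H \<and> tt (moebius A w) = tt w" if w: "w \<in> ball z r" for w
    proof -
      note b = aut[OF gH[OF w]]
      have bH: "moebius B (moebius g w) \<in> H" by (rule moebius_in_H[OF Bp gH(1)[OF w]])
      have "pt (moebius B (moebius g w)) = pt (moebius g w)"
        using pt_affine(1)[OF bH] pt_affine(1)[OF gH[OF w]] b e1 by simp
      hence "tt (moebius B (moebius g w)) = tt (moebius g w)" by (rule pt_eq_imp_tt_eq[OF bH gH(1)[OF w]])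
      thus ?thesis using key[OF wH[OF w]] tt_invariant[OF g wH[OF w]] moebius_in_H[OF Ap wH[OF w]] by simp
    qed
    have id: "moebius A w = w" if "w \<in> ball z r" for w
      by (rule local_deck_trivial[OF r(1) rH holomorphic_on_subset[OF moebius_holomorphic[OF Ap] rH] A(3)])
        (erule inv, erule (2) triv, rule that)
    have ev: "eventually (\<lambda>w. moebius A w = w) (nhds z)" using nb by eventually_elim (rule id)
    have "((\<lambda>w. w) has_field_derivative rr) (at z)" by (rule iffD1[OF DERIV_cong_ev[OF refl ev refl] dA])
    hence "rr = 1" using DERIV_unique[OF _ DERIV_ident] by blast
    thus False using rr(2) by simp
  qed
  hence em: "\<epsilon> = - 1" using eps by (auto simp: power2_eq_1_iff)
  have Bcoord: "pt (moebius B w) = E_affine (xf w) (- 1 - yf w)" if w: "w \<in> H" "pt w \<noteq> E_origin" for w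
  proof -
    note b = aut[OF w]
    have "yf (moebius B w) = - 1 - yf w"
    proof -
      have "2 * yf (moebius B w) + 1 = - (2 * yf w + 1)" using b em by simp
      hence "2 * yf (moebius B w) = 2 * (- 1 - yf w)" by Groebner_Basis.algebra
      thus ?thesis by (simp only: mult_cancel_left) simp
    qed
    thus ?thesis using pt_affine(1)[OF moebius_in_H[OF Bp w(1)]] b by simp
  qed
  define x y where "x = xf z1" and "y = yf z1"
  have E: "on_E x y" using pt_affine(2)[OF z1 pz1] by (simp add: x_def y_def)
  have pB: "pt (moebius B z1) = E_affine x (- 1 - y)" unfolding x_def y_def by (rule Bcoord[OF z1 pz1])
  have BH: "moebius B z1 \<in> H" by (rule moebius_in_H[OF Bp z1])
  have tB: "tt (moebius B z1) = tt z" using key[OF z] A(3) by (simp add: z1_def)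
  \<comment> \<open>If t were infinite, \<open>F4\<close> would vanish at both Q and -Q.\<close>
  have fin: "tt z \<noteq> P1_inf"
  proof
    assume inf: "tt z = P1_inf"
    have "F4 x y = 0" using tt_formula[OF z1 pt_affine(1)[OF z1 pz1]] tz1 inf by (auto simp: x_def y_def)
    moreover have "F4 x (- 1 - y) = 0" using tt_formula[OF BH pB] tB inf by auto
    ultimately show False using F4_zero_neg[OF E] by blast
  qed
  have nz4: "F4 x y \<noteq> 0" using F4_nonzero_of_finite[OF z1 pz1] tz1 fin by (simp add: x_def y_def)
  have pBne: "pt (moebius B z1) \<noteq> E_origin" using pB by simp
  have cB: "xf (moebius B z1) = x" "yf (moebius B z1) = - 1 - y" using pB by (simp_all add: xf_def yf_def)
  have nz4': "F4 x (- 1 - y) \<noteq> 0" using F4_nonzero_of_finite[OF BH pBne] tB fin by (simp add: cB)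
  have v1: "tt z = P1_fin (1 - 343 * F9 x y ^ 3 / (64 * F4 x y ^ 7))"
    using tt_formula[OF z1 pt_affine(1)[OF z1 pz1]] nz4 tz1 by (simp add: x_def y_def)
  have v2: "tt z = P1_fin (1 - 343 * F9 x (- 1 - y) ^ 3 / (64 * F4 x (- 1 - y) ^ 7))"
    using tt_formula[OF BH pB nz4'] tB by simp
  have nz9: "F9 x y \<noteq> 0" "F9 x (- 1 - y) \<noteq> 0"
    using not1 v1 v2 by auto
  have teq: "F9 x y ^ 3 * F4 x (- 1 - y) ^ 7 = F9 x (- 1 - y) ^ 3 * F4 x y ^ 7"
  proof -
    have "343 * F9 x y ^ 3 / (64 * F4 x y ^ 7) = 343 * F9 x (- 1 - y) ^ 3 / (64 * F4 x (- 1 - y) ^ 7)"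
      using v1 unfolding v2 by simp
    hence "343 * F9 x y ^ 3 * (64 * F4 x (- 1 - y) ^ 7) = 343 * F9 x (- 1 - y) ^ 3 * (64 * F4 x y ^ 7)"
      using nz4 nz4' by (subst (asm) frac_eq_eq) simp_all
    thus ?thesis by simp
  qed
  define xg yg where "xg = (\<lambda>w. xf (moebius g w))" and "yg = (\<lambda>w. yf (moebius g w))"
  have gsub: "moebius g ` ball z r \<subseteq> ball z1 r1" using wg by blast
  have gh: "moebius g holomorphic_on ball z r" by (rule holomorphic_on_subset[OF moebius_holomorphic[OF gp] rH])
  have xh: "xg holomorphic_on ball z r" and yh: "yg holomorphic_on ball z r"
    using holomorphic_on_compose_gen[OF gh r1(4) gsub] holomorphic_on_compose_gen[OF gh r1(5) gsub]
    by (simp_all add: o_def xg_def yg_def)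
  have vals: "xg z = x" "yg z = y" by (simp_all add: xg_def yg_def x_def y_def z1_def)
  have dx: "(xg has_field_derivative deriv xg z) (at z)" by (rule holomorphic_derivI[OF xh open_ball zb])
  have dy: "(yg has_field_derivative deriv yg z) (at z)" by (rule holomorphic_derivI[OF yh open_ball zb])
  have dY: "((\<lambda>w. 2 * yg w + 1) has_field_derivative 2 * deriv yg z) (at z)"
    using DERIV_add[OF DERIV_cmult[OF dy, of 2] DERIV_const[of 1]] by simp
  have Eev: "eventually (\<lambda>w. (2 * yg w + 1)^2 = lev cubic (xg w)) (nhds z)"
    using nb
  proof eventually_elim
    case (elim w)
    show ?case using pt_affine(2)[OF gH[OF elim]] by (simp add: on_E_iff xg_def yg_def)
  qed
  obtain k where k: "deriv xg z = k * (2 * yg z + 1)" "2 * deriv yg z = k * lev (lderiv cubic) (xg z) / 2"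
    by (rule tangent_direction[OF dx dY Eev]) (rule that)
  have t1: "((\<lambda>w. 1 - 343 * F9 (xg w) (yg w) ^ 3 / (64 * F4 (xg w) (yg w) ^ 7)) has_field_derivative
    - (343 / 64) * k * (F9 x y ^ 2 / F4 x y ^ 8 * G14 x y)) (at z)"
    using t_formula_derivative[OF dx[unfolded k(1)] dY[unfolded k(2)]] E nz4 by (simp add: vals)
  \<comment> \<open>At -Q the coordinate x is the same and 2y + 1 changes sign, so the invariant
    differential contributes -k instead of k.\<close>
  have dYn: "((\<lambda>w. 2 * (- 1 - yg w) + 1) has_field_derivative - (k * lev (lderiv cubic) (xg z) / 2)) (at z)"
    using DERIV_minus[OF dY[unfolded k(2)]] by (simp add: algebra_simps)
  have dxn: "(xg has_field_derivative (- k) * (2 * (- 1 - yg z) + 1)) (at z)"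
    using dx unfolding k(1) by (simp add: algebra_simps)
  have dYn': "((\<lambda>w. 2 * (- 1 - yg w) + 1) has_field_derivative (- k) * lev (lderiv cubic) (xg z) / 2) (at z)"
    using dYn by simp
  have t2: "((\<lambda>w. 1 - 343 * F9 (xg w) (- 1 - yg w) ^ 3 / (64 * F4 (xg w) (- 1 - yg w) ^ 7)) has_field_derivative
    - (343 / 64) * (- k) * (F9 x (- 1 - y) ^ 2 / F4 x (- 1 - y) ^ 8 * G14 x (- 1 - y))) (at z)"
    using t_formula_derivative[OF dxn dYn'] on_E_neg[OF E] nz4' by (simp add: vals)
  have c4: "isCont (\<lambda>w. F4 (xg w) (yg w)) z" "isCont (\<lambda>w. F4 (xg w) (- 1 - yg w)) z"
    unfolding F4_def by (intro continuous_intros DERIV_isCont[OF dx] DERIV_isCont[OF dy])+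
  have near4: "eventually (\<lambda>w. F4 (xg w) (yg w) \<noteq> 0) (nhds z)"
    unfolding eventually_nhds_conv_at
    by (rule conjI, rule tendsto_imp_eventually_ne[OF c4(1)[unfolded isCont_def]]) (use nz4 vals in simp_all)
  have near4': "eventually (\<lambda>w. F4 (xg w) (- 1 - yg w) \<noteq> 0) (nhds z)"
    unfolding eventually_nhds_conv_at
    by (rule conjI, rule tendsto_imp_eventually_ne[OF c4(2)[unfolded isCont_def]]) (use nz4' vals in simp_all)
  have f1: "eventually (\<lambda>w. tf w = 1 - 343 * F9 (xg w) (yg w) ^ 3 / (64 * F4 (xg w) (yg w) ^ 7)) (nhds z)"
    using nb near4
  proof eventually_elim
    case (elim w)
    from tt_formula[OF gH(1)[OF elim(1)] pt_affine(1)[OF gH[OF elim(1)]]] elim(2)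
    show ?case using tt_invariant[OF g wH[OF elim(1)]] by (simp add: tf_def xg_def yg_def)
  qed
  have f2: "eventually (\<lambda>w. tf (moebius A w) = 1 - 343 * F9 (xg w) (- 1 - yg w) ^ 3 / (64 * F4 (xg w) (- 1 - yg w) ^ 7)) (nhds z)"
    using nb near4'
  proof eventually_elim
    case (elim w)
    from tt_formula[OF moebius_in_H[OF Bp gH(1)[OF elim(1)]] Bcoord[OF gH[OF elim(1)]]] elim(2)
    show ?case using key[OF wH[OF elim(1)]] by (simp add: tf_def xg_def yg_def)
  qed
  have d1: "(tf has_field_derivative - (343 / 64) * k * (F9 x y ^ 2 / F4 x y ^ 8 * G14 x y)) (at z)"
    by (rule iffD2[OF DERIV_cong_ev[OF refl f1 refl] t1])
  have d2: "((\<lambda>w. tf (moebius A w)) has_field_derivative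
    - (343 / 64) * (- k) * (F9 x (- 1 - y) ^ 2 / F4 x (- 1 - y) ^ 8 * G14 x (- 1 - y))) (at z)"
    by (rule iffD2[OF DERIV_cong_ev[OF refl f2 refl] t2])
  \<comment> \<open>A fixes z, so by the chain rule composing with A multiplies the derivative of t
    at z by the multiplier \<open>rr\<close>.\<close>
  have "(tf has_field_derivative - (343 / 64) * k * (F9 x y ^ 2 / F4 x y ^ 8 * G14 x y)) (at (moebius A z))"
    using d1 A(3) by simp
  from DERIV_chain2[OF this dA] d2
  have chain: "- (343 / 64) * k * (F9 x y ^ 2 / F4 x y ^ 8 * G14 x y) * rr =
     - (343 / 64) * (- k) * (F9 x (- 1 - y) ^ 2 / F4 x (- 1 - y) ^ 8 * G14 x (- 1 - y))"
    by (rule DERIV_unique)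
  \<comment> \<open>Nonramification allows k to be cancelled and also supplies the nonvanishing of
    \<open>G14\<close>.\<close>
  have "deriv tf z \<noteq> 0" by (rule deriv_tf_nonzero[OF z fin]) (erule (2) triv)
  hence "- (343 / 64) * k * (F9 x y ^ 2 / F4 x y ^ 8 * G14 x y) \<noteq> 0" using DERIV_imp_deriv[OF d1] by simp
  hence k0: "k \<noteq> 0" and g0: "G14 x y \<noteq> 0" by auto
  define U V where "U = F9 x y ^ 2 / F4 x y ^ 8 * G14 x y" and "V = F9 x (- 1 - y) ^ 2 / F4 x (- 1 - y) ^ 8 * G14 x (- 1 - y)"
  have "- (U * (k * rr)) = V * k" using chain unfolding U_def[symmetric] V_def[symmetric] by (simp add: algebra_simps)
  hence "k * (rr * U + V) = 0" by Groebner_Basis.algebra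
  hence "- V = rr * U" using k0 by (simp add: neg_eq_iff_add_eq_0 add.commute)
  hence "1 - 343 * F9 x y ^ 3 / (64 * F4 x y ^ 7) = (7^3 * 43^2 * 127^2 * 139^2 * 307^2 * 659^2 * 11) / (3^3 * 13^7 * 83^7)"
    unfolding U_def V_def by (rule CM_algebra[OF E rr(1) nz4 nz4' nz9 g0 teq])
  thus ?thesis unfolding v1 by simp
qed

end

context quat_order_mod3
begin

lemma cm_point_value:
  assumes S: "shimura (\<rho> ` \<Gamma>) (\<rho> ` \<Gamma>0) t \<phi>"
    and emb: "CM_embedding_m11 a b \<O> q" and z: "z \<in> upper_half_plane"
    and fixes_z: "\<And>u. u \<in> K7_sqrt_m11 - {0} \<Longrightarrow> moebius (\<rho> (q u)) z = z"
  shows "t (orbit_of (\<rho> ` \<Gamma>) z) =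
    P1_fin ((7^3 * 43^2 * 127^2 * 139^2 * 307^2 * 659^2 * 11) / (3^3 * 13^7 * 83^7))"
proof -
  interpret S: shimura "\<rho> ` \<Gamma>" "\<rho> ` \<Gamma>0" t \<phi> by (rule S)
  have GK: "g \<in> K7_quats" "nrd g = 1" if "g \<in> \<Gamma>" for g
    by (rule O_K7[OF Gamma_O[OF that]]) (use that in \<open>simp add: Gamma1_def\<close>)
  have pos: "mdet (\<rho> g) > 0" if "g \<in> \<Gamma>" for g using rho_moebius_pos GK[OF that] by blast
  have rho1: "\<rho> (1, 0, 0, 0) = (1, 0, 0, 1)" using rho_scalar[OF K7_1] by simp
  obtain z0 where z0: "z0 \<in> upper_half_plane" "S.pt z0 = E_origin"
    using S.pt_surj[of E_origin] by (auto simp: E_curve_def)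
  obtain gs where gs: "\<And>i::nat. i < 9 \<Longrightarrow> gs i \<in> \<rho> ` \<Gamma> \<and> S.pt (moebius (gs i) z0) \<noteq> E_origin \<and>
      F9 (S.xf (moebius (gs i) z0)) (S.yf (moebius (gs i) z0)) = 0"
    and gs_inj: "inj_on (\<lambda>i. S.pt (moebius (gs i) z0)) {..<9}"
    using S.nine_points_over_one[OF z0] by blast
  have g0: "gs 0 \<in> \<rho> ` \<Gamma>" "S.pt (moebius (gs 0) z0) \<noteq> E_origin"
    "F9 (S.xf (moebius (gs 0) z0)) (S.yf (moebius (gs 0) z0)) = 0" using gs[of 0] by auto
  obtain m where m: "m \<in> \<rho> ` \<Gamma>0" "moebius m z0 = z0" "mtrace m = - 1"
    using S.order_three_element[OF z0(1) S.three_dvd_stabilizer_order[OF z0 g0]] by blast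
  obtain h where h: "h \<in> \<Gamma>0" "m = \<rho> h" using m(1) by blast
  have hG: "h \<in> \<Gamma>" by (rule Gamma0_Gamma[OF h(1)])
  note hK = GK[OF hG]
  \<comment> \<open>Cayley-Hamilton for trace -1 and norm 1.\<close>
  have h2: "h \<star> h + h + (1, 0, 0, 0) = 0"
  proof -
    have f: "fst h \<in> K7" using hK(1) by (auto simp: K7_quats_def)
    have "2 * \<sigma> (fst h) = - 1" using mtrace_rho[OF hK(1)] m(3) h(2) by simp
    hence "\<sigma> (2 * fst h + 1) = 0" using f by (simp add: sigma_add sigma_mult K7_closed)
    hence "2 * fst h + 1 = 0" by (rule sigma_eq_0[rotated]) (use f in \<open>simp add: K7_closed\<close>)
    hence f2: "2 * fst h = - 1" by simp
    have "h = (- 1, 0, 0, 0) - qconj h" unfolding qconj_eq f2 by simp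
    hence "h \<star> h = h \<star> ((- 1, 0, 0, 0) - qconj h)" by simp
    also have "\<dots> = h \<star> (- 1, 0, 0, 0) - h \<star> qconj h" by (rule qmul_distrib)
    also have "h \<star> qconj h = (1, 0, 0, 0)" using hK(2) by (simp add: qmul_qconj)
    also have "h \<star> (- 1, 0, 0, 0) = - h" by (cases h) (simp add: qmul_def)
    finally show ?thesis by (simp add: zero_prod_def)
  qed
  note hh = h(1) h2
  define B where "B = \<rho> (beta h)"
  have bK: "beta h \<in> K7_quats" by (rule O_K7[OF beta_O[OF hh]])
  have Bdet: "mdet B = 3" unfolding B_def mdet_rho[OF bK] nrd_beta[OF hh] by simp
  \<comment> \<open>B is twice the matrix of h plus the identity, so it shares the eigenvector (z0,
    1).\<close>
  have Bfix: "moebius B z0 = z0"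
  proof -
    obtain p r s u where r: "\<rho> h = (p, r, s, u)" by (cases "\<rho> h") auto
    have one: "(1, 0, 0, 0) \<in> K7_quats" "2 *\<^sub>R h \<in> K7_quats"
      using hK(1) by (auto simp: K7_quats_def K7_closed)
    have "B = 2 *\<^sub>R \<rho> h + (1, 0, 0, 1)"
      unfolding B_def beta_def rho_add[OF one(2,1)] rho1 using rho_scaleR[OF _ hK(1), of 2] by (simp add: K7_closed)
    hence B: "B = (2 * p + 1, 2 * r, 2 * s, 2 * u + 1)" by (simp add: r)
    have ne: "of_real s * z0 + of_real u \<noteq> 0"
      using mdenom_nonzero[OF pos[OF hG] z0(1)] by (simp add: r mdenom_def)
    have ne2: "of_real (2 * s) * z0 + of_real (2 * u + 1) \<noteq> 0"
      using mdenom_nonzero[of B z0] Bdet z0(1) by (simp add: B mdenom_def)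
    have e: "of_real p * z0 + of_real r = z0 * (of_real s * z0 + of_real u)"
      using m(2) ne unfolding h(2) r by (simp add: moebius_def nonzero_divide_eq_eq)
    have "of_real (2 * p + 1) * z0 + of_real (2 * r) = 2 * (of_real p * z0 + of_real r) + z0" by (simp add: algebra_simps)
    also have "\<dots> = z0 * (of_real (2 * s) * z0 + of_real (2 * u + 1))" unfolding e by (simp add: algebra_simps)
    finally show ?thesis using ne2 unfolding B moebius_def case_prod_conv by (simp add: nonzero_divide_eq_eq)
  qed
  have norm: "\<exists>g'\<in>\<Gamma>0. mmul B (\<rho> g) = mmul (\<rho> g') B \<and> mmul (\<rho> g) B = mmul B (\<rho> g')" if g: "g \<in> \<Gamma>0" for g
  proof -
    obtain g' where g': "g' \<in> \<Gamma>0" "beta h \<star> g = g' \<star> beta h" "g \<star> beta h = beta h \<star> g'"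
      by (rule beta_normalizes[OF hh g]) (rule that)
    have "g \<in> K7_quats" "g' \<in> K7_quats" using GK Gamma0_Gamma g g'(1) by blast+
    thus ?thesis using g' rho_mult[OF bK] rho_mult[OF _ bK] unfolding B_def by metis
  qed
  have n1: "\<exists>g'\<in>\<rho> ` \<Gamma>0. mmul B g = mmul g' B" and n2: "\<exists>g'\<in>\<rho> ` \<Gamma>0. mmul g B = mmul B g'"
    if g: "g \<in> \<rho> ` \<Gamma>0" for g
  proof -
    obtain k where k: "g = \<rho> k" "k \<in> \<Gamma>0" using g by (rule imageE)
    obtain k' where k': "k' \<in> \<Gamma>0" "mmul B (\<rho> k) = mmul (\<rho> k') B" "mmul (\<rho> k) B = mmul B (\<rho> k')"
      using norm[OF k(2)] by blast
    show "\<exists>g'\<in>\<rho> ` \<Gamma>0. mmul B g = mmul g' B"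
      unfolding k(1) by (rule bexI[of _ "\<rho> k'"], rule k'(2), rule imageI, rule k'(1))
    show "\<exists>g'\<in>\<rho> ` \<Gamma>0. mmul g B = mmul B g'"
      unfolding k(1) by (rule bexI[of _ "\<rho> k'"], rule k'(3), rule imageI, rule k'(1))
  qed
  have Bp: "mdet B > 0" using Bdet by simp
  have aut: "\<exists>\<epsilon>. \<epsilon>^2 = 1 \<and> (\<forall>z\<in>upper_half_plane. S.pt z \<noteq> E_origin \<longrightarrow> S.pt (moebius B z) \<noteq> E_origin \<and>
    S.xf (moebius B z) = S.xf z \<and> 2 * S.yf (moebius B z) + 1 = \<epsilon> * (2 * S.yf z + 1))"
    by (rule S.curve_automorphism[OF z0 Bp Bfix]) (erule n1, erule n2)
  then obtain \<epsilon> where eps: "\<epsilon>^2 = 1" and aut: "\<And>w. w \<in> upper_half_plane \<Longrightarrow> S.pt w \<noteq> E_origin \<Longrightarrow>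
      S.pt (moebius B w) \<noteq> E_origin \<and> S.xf (moebius B w) = S.xf w \<and> 2 * S.yf (moebius B w) + 1 = \<epsilon> * (2 * S.yf w + 1)"
    by blast
  have "\<exists>al\<in>\<O>. nrd al = 3 \<and> fst al = 1 / 2 \<and> moebius (\<rho> al) z = z \<and>
    (\<forall>g\<in>\<Gamma>. moebius (\<rho> g) z = z \<longrightarrow> g = (1, 0, 0, 0) \<or> g = - (1, 0, 0, 0))"
    by (rule cm_multiplier[OF emb z]) (rule fixes_z)
  then obtain al where al: "al \<in> \<O>" "nrd al = 3" "fst al = 1 / 2" "moebius (\<rho> al) z = z"
    and stab: "\<And>g. g \<in> \<Gamma> \<Longrightarrow> moebius (\<rho> g) z = z \<Longrightarrow> g = (1, 0, 0, 0) \<or> g = - (1, 0, 0, 0)" by blast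
  have alK: "al \<in> K7_quats" by (rule O_K7[OF al(1)])
  have triv: "moebius g w = w" if g: "g \<in> \<rho> ` \<Gamma>" "moebius g z = z" "w \<in> upper_half_plane" for g w
  proof -
    obtain g' where g': "g' \<in> \<Gamma>" "g = \<rho> g'" using g(1) by blast
    have "g' = (1, 0, 0, 0) \<or> g' = (- 1, 0, 0, 0)" using stab[OF g'(1)] g(2) g'(2) by simp
    moreover have "\<rho> (- 1, 0, 0, 0) = (- 1, 0, 0, - 1)"
      using rho_scalar[of "- 1"] sigma_of_int[of "- 1"] by (simp add: K7_closed)
    ultimately have "g = (1, 0, 0, 1) \<or> g = (- 1, 0, 0, - 1)" using rho1 g'(2) by auto
    thus ?thesis by (auto simp: moebius_def)
  qed
  have not1: "S.tt z \<noteq> P1_fin 1"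
    by (rule S.trivial_stabilizer_not_over_one[OF z0 m z]) (erule (2) triv)
  have ex: "\<forall>i. \<exists>g. i < 9 \<longrightarrow> g \<in> \<Gamma> \<and> gs i = \<rho> g" using gs by blast
  obtain gs' where gs': "\<And>i. i < 9 \<Longrightarrow> gs' i \<in> \<Gamma> \<and> gs i = \<rho> (gs' i)" using choice[OF ex] by blast
  \<comment> \<open>Cosets are labelled by points of the curve over t = 1. The label is invariant on
    the left under \<open>\<Gamma>0\<close> by construction and on the right under h because h fixes
    z0.\<close>
  define f where "f = (\<lambda>x. S.pt (moebius (\<rho> x) z0))"
  have f0: "f (g \<star> x) = f x" if g: "g \<in> \<Gamma>0" and x: "x \<in> \<Gamma>" for g x
  proof -
    have "moebius (\<rho> (g \<star> x)) z0 = moebius (\<rho> g) (moebius (\<rho> x) z0)"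
      unfolding rho_mult[OF GK(1)[OF Gamma0_Gamma[OF g]] GK(1)[OF x]] by (rule moebius_mmul[OF pos[OF x] z0(1)])
    thus ?thesis using S.pt_invariant[of "\<rho> g"] g moebius_in_H[OF pos[OF x] z0(1)] by (simp add: f_def)
  qed
  have fh: "f (x \<star> h) = f x" if x: "x \<in> \<Gamma>" for x
  proof -
    have "moebius (\<rho> (x \<star> h)) z0 = moebius (\<rho> x) (moebius (\<rho> h) z0)"
      unfolding rho_mult[OF GK(1)[OF x] hK(1)] by (rule moebius_mmul[OF pos[OF hG] z0(1)])
    thus ?thesis using m(2) h(2) by (simp add: f_def)
  qed
  have gs1: "gs' i \<in> \<Gamma>" if "i < 9" for i using gs'[OF that] by blast
  have gs2: "f (gs' i) \<noteq> f (1, 0, 0, 0)" if "i < 9" for i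
    using gs[OF that] gs'[OF that] z0(2) by (simp add: f_def rho1)
  have gs3: "inj_on (\<lambda>i. f (gs' i)) {..<9}"
    using gs_inj gs' by (simp add: inj_on_def f_def)
  obtain x d where xd: "x \<in> \<Gamma>" "d \<in> \<Gamma>" "beta h \<star> x = d \<star> al"
    by (rule exists_translate[OF hh, where f = f and gs = gs' and al = al])
      (erule (1) f0, erule fh, erule gs1, erule gs2, rule gs3, rule al(1), rule al(2), rule that)
  have BA: "mmul B (\<rho> x) = mmul (\<rho> d) (\<rho> al)"
    using xd(3) rho_mult[OF bK GK(1)[OF xd(1)]] rho_mult[OF GK(1)[OF xd(2)] alK] by (simp add: B_def)
  have "2 * \<sigma> (1 / 2) = \<sigma> (2 * (1 / 2))" by (subst sigma_mult) (simp_all add: K7_closed)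
  hence tr: "mtrace (\<rho> al) = 1" using mtrace_rho[OF alK] al(3) by simp
  have dt: "mdet (\<rho> al) = 3" using mdet_rho[OF alK] al(2) by simp
  have "\<rho> x \<in> \<rho> ` \<Gamma>" "\<rho> d \<in> \<rho> ` \<Gamma>" using xd by blast+
  have "S.tt z = P1_fin ((7^3 * 43^2 * 127^2 * 139^2 * 307^2 * 659^2 * 11) / (3^3 * 13^7 * 83^7))"
    by (rule S.cm_value[OF z dt tr al(4) \<open>\<rho> x \<in> \<rho> ` \<Gamma>\<close> \<open>\<rho> d \<in> \<rho> ` \<Gamma>\<close> Bdet BA eps])
      (erule (1) aut, erule (2) triv, rule z0(1), rule z0(2), rule not1)
  thus ?thesis unfolding S.tt_def .
qed

end

text \<open>The ordinates come from 455 (2y + 1) = -8 s A with A = -49963095/2048 at this x, that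
  is, 2y + 1 = 109809 s / 256.\<close>

lemma CM_points_on_E:
  assumes "s^2 = - 11"
  defines "y \<equiv> - (1 / 2) + 109809 * s / 512"
  shows "on_E (- (10099 / 64)) y" "F4 (- (10099 / 64)) y \<noteq> 0"
    "1 - 343 * F9 (- (10099 / 64)) y ^ 3 / (64 * F4 (- (10099 / 64)) y ^ 7) =
      (7^3 * 43^2 * 127^2 * 139^2 * 307^2 * 659^2 * 11) / (3^3 * 13^7 * 83^7)"
proof -
  have Y: "2 * y + 1 = 109809 * s / 256" by (simp add: y_def field_simps)
  have "(2 * y + 1)^2 = 109809^2 / 256^2 * s^2" unfolding Y by (simp add: power_divide power_mult_distrib)
  also have "\<dots> = lev cubic (- (10099 / 64))" unfolding assms(1) lev_cubic by (simp add: power2_eq_square power3_eq_cube)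
  finally show "on_E (- (10099 / 64)) y" by (simp add: on_E_iff)
  have x: "- (10099 / 64) = (- 10099 / 64 :: complex)" by simp
  have "lev (fst F4_pair) (- 10099 / 64) = - 49963095 / 2048" by (simp add: F4_pair_def)
  hence "455 * (2 * y + 1) = - 8 * s * lev (fst F4_pair) (- 10099 / 64)" unfolding Y by simp
  note * = CM_value[OF assms(1) x this[folded x]]
  show "F4 (- (10099 / 64)) y \<noteq> 0" by (rule *(1))
  show "1 - 343 * F9 (- (10099 / 64)) y ^ 3 / (64 * F4 (- (10099 / 64)) y ^ 7) =
      (7^3 * 43^2 * 127^2 * 139^2 * 307^2 * 659^2 * 11) / (3^3 * 13^7 * 83^7)" by (rule *(2))
qed

theorem mainTheorem2:
  fixes a b :: real
    and \<sigma> :: "real \<Rightarrow> real"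
    and \<O> :: "(real \<times> real \<times> real \<times> real) set"
    and \<rho> :: "real \<times> real \<times> real \<times> real \<Rightarrow> real \<times> real \<times> real \<times> real"
    and \<iota> :: "(real \<times> real \<times> real \<times> real) set \<Rightarrow> real set \<times> real set \<times> real set \<times> real set"
    and G1 G0 :: "(real \<times> real \<times> real \<times> real) set"
    and t :: "complex set \<Rightarrow> P1"
    and \<phi> :: "complex set \<Rightarrow> E_point"
    and P :: "complex set"
  assumes "a \<in> K7" "a \<noteq> 0" "b \<in> K7" "b \<noteq> 0"
    and "ramified_exactly_off a b \<sigma>"
    and "is_maximal_order a b \<O>"
    and "real_splitting a b \<sigma> \<rho>"
    and "\<iota> \<in> ring_iso (order_ring a b \<O> Quot three_ideal \<O>) (mat2_ring F27)"
    and "G1 = \<rho> ` Gamma1 a b \<O>"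
    and "G0 = \<rho> ` Gamma0_3 a b \<O> \<iota>"
    and "iso_to_P1 G1 t"
    and "elliptic_normalized G1 t"
    and "X0_3_model G1 G0 t \<phi>"
    and "is_CM_point_m11 a b \<O> \<rho> P"
  shows "t P = P1_fin ((7^3 * 43^2 * 127^2 * 139^2 * 307^2 * 659^2 * 11) / (3^3 * 13^7 * 83^7)) \<and>
    (\<forall>\<epsilon>\<in>{1, -1}. \<exists>p\<in>quotient_curve G0.
       \<phi> p = E_affine (- (10099 / 64)) (- (1 / 2) + \<epsilon> * (109809 * sqrt_m11 / 512)) \<and>
       curve_proj G1 p = P)"
proof -
  have sigma: "\<sigma> \<in> Ring.ring_hom K7_ring real_ring" using assms(5) by (simp add: ramified_exactly_off_def)
  have order: "is_order a b \<O>" using assms(6) by (simp add: is_maximal_order_def)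
  interpret quat_order_mod3 a b \<sigma> \<O> \<rho> \<iota>
    by unfold_locales (fact assms sigma order)+
  have g1: "matrix_group G1" unfolding assms(9)
    by (rule matrix_group_rho) (simp_all add: Gamma_1 Gamma_mult Gamma_qconj)
  have g0: "matrix_group G0" unfolding assms(10)
    by (rule matrix_group_rho) (use Gamma0_Gamma Gamma0_1 Gamma0_mult Gamma0_qconj in blast)+
  have sub: "G0 \<subseteq> G1" unfolding assms(9,10) using Gamma0_Gamma by blast
  interpret S: shimura G1 G0 t \<phi>
    by unfold_locales (fact g1 g0 sub assms)+
  obtain q z where q: "CM_embedding_m11 a b \<O> q" and z: "z \<in> upper_half_plane"
    and fz: "\<And>u. u \<in> K7_sqrt_m11 - {0} \<Longrightarrow> moebius (\<rho> (q u)) z = z" and P: "P = orbit_of G1 z"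
    using assms(14) unfolding is_CM_point_m11_def assms(9) by blast
  have "t (orbit_of (\<rho> ` Gamma1 a b \<O>) z) =
      P1_fin ((7^3 * 43^2 * 127^2 * 139^2 * 307^2 * 659^2 * 11) / (3^3 * 13^7 * 83^7))"
    by (rule cm_point_value[OF S.shimura_axioms[unfolded assms(9,10)] q z]) (rule fz)
  hence tP: "t P = P1_fin ((7^3 * 43^2 * 127^2 * 139^2 * 307^2 * 659^2 * 11) / (3^3 * 13^7 * 83^7))"
    unfolding P assms(9) .
  \<comment> \<open>It need not be traced which of the two points is Q: any point of the curve with
    this value of t lies over P, because t separates the orbits of \<open>G1\<close>.\<close>
  have "\<exists>p\<in>quotient_curve G0. \<phi> p = E_affine (- (10099 / 64)) (- (1 / 2) + \<epsilon> * (109809 * sqrt_m11 / 512)) \<and>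
      curve_proj G1 p = P" if e: "\<epsilon> \<in> {1, -1}" for \<epsilon>
  proof -
    have "(\<epsilon> * sqrt_m11)^2 = - 11" using e sqrt_m11_sq by auto
    note c = CM_points_on_E[OF this]
    have y: "- (1 / 2) + 109809 * (\<epsilon> * sqrt_m11) / 512 = - (1 / 2) + \<epsilon> * (109809 * sqrt_m11 / 512)" by simp
    obtain w where w: "w \<in> upper_half_plane"
      "S.pt w = E_affine (- (10099 / 64)) (- (1 / 2) + 109809 * (\<epsilon> * sqrt_m11) / 512)"
      using S.pt_surj c(1) S.on_E_E_curve by blast
    have "S.tt w = S.tt z" using S.tt_formula[OF w c(2)] tP unfolding c(3) P S.tt_def by simp
    then obtain g where g: "g \<in> G1" "z = moebius g w" using S.tt_eq_iff[OF w(1) z] by blast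
    have "curve_proj G1 (orbit_of G0 w) = P"
      using S.curve_proj_orbit[OF w(1)] S.G1.orbit_moebius[OF g(1) w(1)] g(2) P by simp
    moreover have "orbit_of G0 w \<in> quotient_curve G0" using w(1) by (simp add: quotient_curve_def)
    ultimately show ?thesis using w(2) unfolding S.pt_def y by blast
  qed
  thus ?thesis using tP by blast
qed

end
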